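(* Let $\mathfrak g$ be a finite-dimensional strongly unimodular Lie algebra. In non-abelian $BF$ theory on $\mathbb C$ in Lorenz gauge, let $\langle\Phi_1\cdots\Phi_n\rangle$ be a correlator, at pairwise distinct points, of fundamental fields ($a,\bar a,\gamma,\bar\gamma,b,c$) or their derivatives. Then: (1) It is given by finitely many Feynman diagrams $\Gamma$, each a disjoint union of binary rooted trees $\Gamma=\sqcup_{j=1}^pT_j$. (2) The number $N$ of interaction vertices (and thus the order of the correlator in $g$) equals the total $\mathcal{AB}$-charge of the fields $\Phi_i$. (3) The number $p$ of trees equals the number of fields of $\mathcal{AB}$-charge $-1$ among $\{\Phi_i\}$. (4) The contribution of each diagram is given by an integral over $\mathbb C^N$ which is convergent if the field $b$ is always hit by derivatives in $\{\Phi_i\}$. (5) If the bare (underived) field $b$ occurs among the $\Phi_i$, an infrared regularization (e.g. restricting the integration to $|u|<R$) may be necessary; for instance, $\langle\gamma(z_1)\otimes b(z_2)\otimes c(z_3)\rangle$ is given by a multiple of the integral $\int_{\mathbb C}\frac{d^2u}{2\pi}\frac{2\log|u-z_2|+C}{(u-z_1)(\bar u-\bar z_3)}$, which diverges at $u\to\infty$.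
   Context: Strongly unimodular means $\mathrm{tr}_{\mathfrak g}(\mathrm{ad}_{X_1}\cdots \mathrm{ad}_{X_k})=(-1)^k\,\mathrm{tr}_{\mathfrak g}(\mathrm{ad}_{X_k}\cdots \mathrm{ad}_{X_1})$ for all $k\ge 1$, $X_i\in\mathfrak g$. $\langle\cdot,\cdot\rangle$ is the canonical pairing between $\mathfrak g$ and $\mathfrak g^*$. Write $\partial=\partial/\partial z$, $\bar\partial=\partial/\partial\bar z$, and let $d^2u$ be the standard area form on $\mathbb C$. Fundamental fields on $\mathbb C$: $a,\bar a,c$ are $\mathfrak g$-valued, $\gamma,\bar\gamma,b$ are $\mathfrak g^*$-valued; $a,\bar a,\gamma,\bar\gamma$ are even (ghost degree $0$), $b,c$ are odd (ghost degrees $-1$, $+1$). The $\mathcal{AB}$-charge is $+1$ for $\gamma,\bar\gamma,b$, $-1$ for $a,\bar a,c$; it is unchanged by derivatives and additive under products. Free correlators $\langle\cdots\rangle_0$ are given by Wick's lemma (with Koszul signs) from the propagators, valued in $\mathfrak g\otimes\mathfrak g^*\simeq \mathrm{End}(\mathfrak g)$: $\langle c(w)\otimes b(z)\rangle_0=(2\log|w-z|+C)\,\mathbb 1$ ($C$ an undetermined constant), $\langle a(w)\otimes\gamma(z)\rangle_0=\frac{\mathbb 1}{w-z}$, $\langle \bar a(w)\otimes\bar\gamma(z)\rangle_0=\frac{\mathbb 1}{\bar w-\bar z}$, all other propagators being zero; derivatives of fields act by differentiating propagators. The interaction is $V=\langle\gamma-\bar\gamma,[a,\bar a]\rangle+\langle\partial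 b,[\bar a,c]\rangle+\langle\bar\partial b,[a,c]\rangle$, and correlators of the theory at pairwise distinct points $z_i$ are $$\langle\Phi_1(z_1)\cdots\Phi_n(z_n)\rangle=\sum_{N\ge0}\frac1{N!}\Big(\frac{g}{2\pi}\Big)^N\int_{\mathbb C^N}d^2u_1\cdots d^2u_N\,\langle\Phi_1(z_1)\cdots\Phi_n(z_n)V(u_1)\cdots V(u_N)\rangle_0 ,$$ with no Wick contractions inside a single $V(u_i)$; correlators involving higher derivatives of fields are obtained by differentiating the correlators of fields from the list $a,\bar a,\gamma,\bar\gamma,c,b,\partial b,\bar\partial b$ with respect to the positions. The Wick contractions are organized by Feynman graphs with $n$ fixed univalent vertices (the $\Phi_i$) and $N$ trivalent interaction vertices (the $V(u_i)$, integrated over $\mathbb C$). Half-edges decorated by fields of charge $-1$ are oriented towards the vertex, half-edges decorated by fields of charge $+1$ away from it; so each interaction vertex has two incoming and one outgoing half-edge. In a binary rooted tree the leaves are the $\Phi_i$ of charge $+1$ and the root is a $\Phi_i$ of charge $-1$. Contributions of graphs are understood after summation over all admissible decorations of half-edges by fields. *)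

theory Defs
  imports "HOL-Analysis.Analysis" "HOL-Library.Multiset"
begin

section \<open>Strongly unimodular Lie algebras\<close>

locale fin_dim_lie_algebra = finite_dimensional_vector_space smul \<B>
  for smul :: "'k::field \<Rightarrow> 'g::ab_group_add \<Rightarrow> 'g" and \<B> :: "'g set" +
  fixes bracket :: "'g \<Rightarrow> 'g \<Rightarrow> 'g"
  assumes bracket_linear_left: "Vector_Spaces.linear smul smul (\<lambda>x. bracket x y)"
    and bracket_linear_right: "Vector_Spaces.linear smul smul (bracket x)"
    and bracket_alternating: "bracket x x = 0"
    and jacobi: "bracket x (bracket y z) + bracket y (bracket z x) + bracket z (bracket x y) = 0"

definition endo_trace :: "('k::field \<Rightarrow> 'g::ab_group_add \<Rightarrow> 'g) \<Rightarrow> 'g set \<Rightarrow> ('g \<Rightarrow> 'g) \<Rightarrow> 'k" where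
  "endo_trace smul \<B> f = (\<Sum>x\<in>\<B>. module.representation smul \<B> (f x) x)"

definition ad_product :: "('g \<Rightarrow> 'g \<Rightarrow> 'g) \<Rightarrow> 'g list \<Rightarrow> 'g \<Rightarrow> 'g" where
  "ad_product bracket Xs = foldr (\<lambda>X f. bracket X \<circ> f) Xs id"

definition strongly_unimodular ::
  "('k::field \<Rightarrow> 'g::ab_group_add \<Rightarrow> 'g) \<Rightarrow> 'g set \<Rightarrow> ('g \<Rightarrow> 'g \<Rightarrow> 'g) \<Rightarrow> bool" where
  "strongly_unimodular smul \<B> bracket \<longleftrightarrow>
     (\<forall>Xs. Xs \<noteq> [] \<longrightarrow>
        endo_trace smul \<B> (ad_product bracket Xs)
          = (-1) ^ length Xs * endo_trace smul \<B> (ad_product bracket (rev Xs)))"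

text \<open>The ground field is any field embedded in the complex numbers (by \<open>\<iota>\<close>), which covers real
  and complex Lie algebras.\<close>

definition field_embedding :: "('k::field \<Rightarrow> complex) \<Rightarrow> bool" where
  "field_embedding \<iota> \<longleftrightarrow>
     \<iota> 1 = 1 \<and> (\<forall>x y. \<iota> (x + y) = \<iota> x + \<iota> y) \<and> (\<forall>x y. \<iota> (x * y) = \<iota> x * \<iota> y)"

text \<open>\<open>structure_constant \<iota> smul \<B> bracket x y w\<close> is the coefficient of the basis vector \<open>x\<close>
  in the bracket of the basis vectors \<open>y\<close> and \<open>w\<close>.\<close>

definition structure_constant ::
  "('k::field \<Rightarrow> complex) \<Rightarrow> ('k \<Rightarrow> 'g::ab_group_add \<Rightarrow> 'g) \<Rightarrow> 'g set \<Rightarrow> ('g \<Rightarrow> 'g \<Rightarrow> 'g)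
    \<Rightarrow> 'g \<Rightarrow> 'g \<Rightarrow> 'g \<Rightarrow> complex" where
  "structure_constant \<iota> smul \<B> bracket x y w
     = \<iota> (module.representation smul \<B> (bracket y w) x)"


section \<open>Wirtinger derivatives\<close>

definition dz :: "(complex \<Rightarrow> complex) \<Rightarrow> complex \<Rightarrow> complex" where
  "dz f w = (frechet_derivative f (at w) 1 - \<i> * frechet_derivative f (at w) \<i>) / 2"

definition dzbar :: "(complex \<Rightarrow> complex) \<Rightarrow> complex \<Rightarrow> complex" where
  "dzbar f w = (frechet_derivative f (at w) 1 + \<i> * frechet_derivative f (at w) \<i>) / 2"

text \<open>Iterated derivatives of a function of positions; a letter \<open>(False, i)\<close> stands for
  \<open>\<partial>/\<partial>z\<^sub>i\<close> and \<open>(True, i)\<close> for the conjugate derivative, the head of the word acting last.\<close>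

fun iter_deriv :: "(bool \<times> nat) list \<Rightarrow> ((nat \<Rightarrow> complex) \<Rightarrow> complex) \<Rightarrow> (nat \<Rightarrow> complex) \<Rightarrow> complex"
where
  "iter_deriv [] F z = F z"
| "iter_deriv ((bar, i) # ws) F z =
     (if bar then dzbar else dz) (\<lambda>w. iter_deriv ws F (z(i := w))) (z i)"

definition iteratedly_differentiable_on ::
  "(nat \<Rightarrow> complex) set \<Rightarrow> ((nat \<Rightarrow> complex) \<Rightarrow> complex) \<Rightarrow> bool" where
  "iteratedly_differentiable_on S F \<longleftrightarrow>
     (\<forall>ws i. \<forall>z\<in>S. (\<lambda>w. iter_deriv ws F (z(i := w))) differentiable (at (z i)))"


section \<open>Fields, charges and propagators\<close>

text \<open>The fields (with \<open>Fdb\<close>, \<open>Fdbarb\<close> the \<open>z\<close>- and conjugate derivatives of \<open>b\<close>) whose correlators are defined by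
  integrals; all other derived fields are obtained by differentiating with respect to positions.\<close>

datatype bf_field = Fa | Fabar | Fgamma | Fgammabar | Fc | Fb | Fdb | Fdbarb

fun charge :: "bf_field \<Rightarrow> int" where
  "charge Fa = -1" | "charge Fabar = -1" | "charge Fc = -1"
| "charge Fgamma = 1" | "charge Fgammabar = 1"
| "charge Fb = 1" | "charge Fdb = 1" | "charge Fdbarb = 1"

fun ghost_degree :: "bf_field \<Rightarrow> int" where
  "ghost_degree Fa = 0" | "ghost_degree Fabar = 0"
| "ghost_degree Fgamma = 0" | "ghost_degree Fgammabar = 0"
| "ghost_degree Fc = 1"
| "ghost_degree Fb = -1" | "ghost_degree Fdb = -1" | "ghost_degree Fdbarb = -1"

text \<open>\<open>propagator C p q w z\<close> is the coefficient of the identity in the two-point function of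
  \<open>p(w)\<close> and \<open>q(z)\<close>, in this order. \<open>Fdb\<close> and \<open>Fdbarb\<close> differentiate the
  propagator of \<open>c\<close> and \<open>b\<close> in the position of \<open>b\<close> (see \<open>propagator_dz\<close>, \<open>propagator_dzbar\<close>).\<close>

definition propagator :: "complex \<Rightarrow> bf_field \<Rightarrow> bf_field \<Rightarrow> complex \<Rightarrow> complex \<Rightarrow> complex" where
  "propagator C p q w z =
     (case (p, q) of
        (Fc, Fb) \<Rightarrow> of_real (2 * ln (cmod (w - z))) + C
      | (Fc, Fdb) \<Rightarrow> - 1 / (w - z)
      | (Fc, Fdbarb) \<Rightarrow> - 1 / (cnj w - cnj z)
      | (Fb, Fc) \<Rightarrow> - (of_real (2 * ln (cmod (z - w))) + C)
      | (Fdb, Fc) \<Rightarrow> 1 / (z - w)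
      | (Fdbarb, Fc) \<Rightarrow> 1 / (cnj z - cnj w)
      | (Fa, Fgamma) \<Rightarrow> 1 / (w - z)
      | (Fgamma, Fa) \<Rightarrow> 1 / (z - w)
      | (Fabar, Fgammabar) \<Rightarrow> 1 / (cnj w - cnj z)
      | (Fgammabar, Fabar) \<Rightarrow> 1 / (cnj z - cnj w)
      | _ \<Rightarrow> 0)"

lemma propagator_cb_has_derivative:
  assumes "w \<noteq> z"
  shows "((\<lambda>z. propagator C Fc Fb w z) has_derivative
           (\<lambda>h. of_real (2 * (- (h \<bullet> (w - z)) / (cmod (w - z))\<^sup>2)))) (at z)"
proof -
  have "((\<lambda>x. norm (w - x)) has_derivative (\<lambda>h. (- h) \<bullet> sgn (w - z))) (at z)"
  proof (rule has_derivative_compose[where f = "\<lambda>x. w - x" and g = norm, unfolded o_def])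
    show "((-) w has_derivative uminus) (at z)"
      by (auto intro!: derivative_eq_intros)
    show "(norm has_derivative (\<lambda>h. h \<bullet> sgn (w - z))) (at (w - z))"
      using assms by (intro has_derivative_norm) simp
  qed
  then have "((\<lambda>x. ln (cmod (w - x))) has_derivative
          (\<lambda>h. (- h) \<bullet> sgn (w - z) * inverse (cmod (w - z)))) (at z)"
    using assms by (intro has_derivative_ln) auto
  moreover have "(- h) \<bullet> sgn (w - z) * inverse (cmod (w - z)) = - (h \<bullet> (w - z)) / (cmod (w - z))\<^sup>2" for h
    by (simp add: sgn_div_norm divide_inverse power2_eq_square)
  ultimately have "((\<lambda>x. ln (cmod (w - x))) has_derivative
          (\<lambda>h. - (h \<bullet> (w - z)) / (cmod (w - z))\<^sup>2)) (at z)"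
    by simp
  then have "((\<lambda>x. complex_of_real (2 * ln (cmod (w - x))) + C) has_derivative
          (\<lambda>h. of_real (2 * (- (h \<bullet> (w - z)) / (cmod (w - z))\<^sup>2)))) (at z)"
    by (intro has_derivative_add_const has_derivative_of_real has_derivative_mult_right)
  then show ?thesis
    by (simp add: propagator_def)
qed

lemma propagator_dz:
  assumes "w \<noteq> z"
  shows "dz (\<lambda>z. propagator C Fc Fb w z) z = propagator C Fc Fdb w z"
proof -
  have "- 1 / (w - z) = - cnj (w - z) / of_real ((cmod (w - z))\<^sup>2)"
    using complex_div_cnj[of "-1" "w - z"] by (simp only: of_real_power mult_minus1)
  then show ?thesis
    unfolding dz_def frechet_derivative_at[OF propagator_cb_has_derivative[OF assms], symmetric]
    by (simp only: propagator_def prod.case bf_field.case complex_eq_iff inner_complex_def Re_divide_of_real Im_divide_of_real)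
       (simp add: diff_divide_distrib)
qed

lemma propagator_dzbar:
  assumes "w \<noteq> z"
  shows "dzbar (\<lambda>z. propagator C Fc Fb w z) z = propagator C Fc Fdbarb w z"
proof -
  have "- 1 / (cnj w - cnj z) = - (w - z) / of_real ((cmod (w - z))\<^sup>2)"
    using complex_div_cnj[of "-1" "cnj (w - z)"]
    by (simp only: of_real_power mult_minus1 complex_mod_cnj complex_cnj_cnj flip: complex_cnj_diff)
  then show ?thesis
    unfolding dzbar_def frechet_derivative_at[OF propagator_cb_has_derivative[OF assms], symmetric]
    by (simp only: propagator_def prod.case bf_field.case complex_eq_iff inner_complex_def Re_divide_of_real Im_divide_of_real)
       (simp add: diff_divide_distrib)
qed


section \<open>Wick contractions\<close>

text \<open>A fundamental field or a derivative of one is a listed field \<open>p\<close> together with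
  derivative orders \<open>(m, l)\<close> in \<open>z\<close> and its conjugate. Derivatives of \<open>b\<close> are written as
  derivatives of \<open>Fdb\<close> or \<open>Fdbarb\<close>, so that \<open>Fb\<close> always is the underived field; the mixed
  derivative of \<open>b\<close> has two such presentations.\<close>

type_synonym insertion = "bf_field \<times> nat \<times> nat"

definition valid_insertions :: "insertion list \<Rightarrow> bool" where
  "valid_insertions \<Phi> \<longleftrightarrow> (\<forall>m l. (Fb, m, l) \<in> set \<Phi> \<longrightarrow> m = 0 \<and> l = 0)"

definition bare_b_occurs :: "insertion list \<Rightarrow> bool" where
  "bare_b_occurs \<Phi> \<longleftrightarrow> Fb \<in> fst ` set \<Phi>"

definition total_charge :: "insertion list \<Rightarrow> int" where
  "total_charge \<Phi> = (\<Sum>\<phi>\<leftarrow>\<Phi>. charge (fst \<phi>))"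

datatype vertex = Ext nat | Inner nat

datatype half_edge = ExtH nat | IntH nat nat

fun vertex_of :: "half_edge \<Rightarrow> vertex" where
  "vertex_of (ExtH i) = Ext i"
| "vertex_of (IntH j s) = Inner j"

text \<open>Position of a half-edge in the word of fields \<open>\<Phi>\<^sub>1 \<dots> \<Phi>\<^sub>n V(u\<^sub>1) \<dots> V(u\<^sub>N)\<close>.\<close>

fun word_pos :: "nat \<Rightarrow> half_edge \<Rightarrow> nat" where
  "word_pos n (ExtH i) = i"
| "word_pos n (IntH j s) = n + 3 * j + s"

definition half_edges :: "nat \<Rightarrow> nat \<Rightarrow> half_edge set" where
  "half_edges n N = ExtH ` {..<n} \<union> {IntH j s | j s. j < N \<and> s < 3}"

text \<open>Perfect matchings of the half-edges, without contractions inside a single vertex.\<close>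

definition contractions :: "nat \<Rightarrow> nat \<Rightarrow> (half_edge \<times> half_edge) set set" where
  "contractions n N =
     {M. M \<subseteq> half_edges n N \<times> half_edges n N
       \<and> (\<forall>(h, h')\<in>M. word_pos n h < word_pos n h' \<and> vertex_of h \<noteq> vertex_of h')
       \<and> (\<forall>h\<in>half_edges n N. \<exists>!p. p \<in> M \<and> (h = fst p \<or> h = snd p))}"

text \<open>The monomials of the interaction, each with its coefficient and its fields in order. A vertex
  is decorated by a monomial and three basis vectors \<open>[x, y, w]\<close>, the indices of its fields.\<close>

type_synonym 'g vertex_decoration = "(complex \<times> bf_field list) \<times> 'g list"

definition interaction_monomials :: "(complex \<times> bf_field list) set" where
  "interaction_monomials =
     {(1, [Fgamma, Fa, Fabar]), (-1, [Fgammabar, Fa, Fabar]),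
      (1, [Fdb, Fabar, Fc]), (1, [Fdbarb, Fa, Fc])}"

definition vertex_decorations :: "'g set \<Rightarrow> 'g vertex_decoration set" where
  "vertex_decorations \<B> =
     interaction_monomials \<times> {xs. length xs = 3 \<and> set xs \<subseteq> \<B>}"

definition vertex_coeff :: "('g \<Rightarrow> 'g \<Rightarrow> 'g \<Rightarrow> complex) \<Rightarrow> 'g vertex_decoration \<Rightarrow> complex" where
  "vertex_coeff f d = fst (fst d) * f (snd d ! 0) (snd d ! 1) (snd d ! 2)"

fun field_at :: "insertion list \<Rightarrow> (nat \<Rightarrow> 'g vertex_decoration) \<Rightarrow> half_edge \<Rightarrow> bf_field" where
  "field_at \<Phi> \<tau> (ExtH i) = fst (\<Phi> ! i)"
| "field_at \<Phi> \<tau> (IntH j s) = snd (fst (\<tau> j)) ! s"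

fun index_at :: "'g list \<Rightarrow> (nat \<Rightarrow> 'g vertex_decoration) \<Rightarrow> half_edge \<Rightarrow> 'g" where
  "index_at e \<tau> (ExtH i) = e ! i"
| "index_at e \<tau> (IntH j s) = snd (\<tau> j) ! s"

fun point_at :: "(nat \<Rightarrow> complex) \<Rightarrow> (nat \<Rightarrow> complex) \<Rightarrow> half_edge \<Rightarrow> complex" where
  "point_at z u (ExtH i) = z i"
| "point_at z u (IntH j s) = u j"

text \<open>Koszul sign: the parity of the number of crossings between pairs of odd fields (pairs of
  fields of different parity have zero propagator).\<close>

definition koszul_sign :: "nat \<Rightarrow> (half_edge \<Rightarrow> bf_field) \<Rightarrow> (half_edge \<times> half_edge) set \<Rightarrow> complex" where
  "koszul_sign n F M =
     (-1) ^ card {(p, q). p \<in> M \<and> q \<in> M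
        \<and> odd (ghost_degree (F (fst p))) \<and> odd (ghost_degree (F (fst q)))
        \<and> word_pos n (fst p) < word_pos n (fst q)
        \<and> word_pos n (fst q) < word_pos n (snd p)
        \<and> word_pos n (snd p) < word_pos n (snd q)}"

definition contraction_value ::
  "('g \<Rightarrow> 'g \<Rightarrow> 'g \<Rightarrow> complex) \<Rightarrow> complex \<Rightarrow> insertion list \<Rightarrow> 'g list \<Rightarrow> nat
    \<Rightarrow> (nat \<Rightarrow> complex) \<Rightarrow> (nat \<Rightarrow> complex)
    \<Rightarrow> (nat \<Rightarrow> 'g vertex_decoration) \<Rightarrow> (half_edge \<times> half_edge) set \<Rightarrow> complex" where
  "contraction_value f C \<Phi> e N z u \<tau> M =
     (\<Prod>j<N. vertex_coeff f (\<tau> j))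
     * koszul_sign (length \<Phi>) (field_at \<Phi> \<tau>) M
     * (\<Prod>(h, h')\<in>M. if index_at e \<tau> h = index_at e \<tau> h'
          then propagator C (field_at \<Phi> \<tau> h) (field_at \<Phi> \<tau> h') (point_at z u h) (point_at z u h')
          else 0)"

text \<open>Correlators take values in a tensor product of copies of the Lie algebra and its dual. The list
  \<open>e\<close> of basis vectors selects a component: \<open>e ! i\<close> is the index of the \<open>i\<close>-th field, in the basis
  for fields of charge \<open>-1\<close> and in the dual basis for fields of charge \<open>1\<close>. Derivative orders in \<open>\<Phi>\<close> are
  ignored by everything up to \<open>base_correlator\<close>.\<close>

definition free_correlator ::
  "'g set \<Rightarrow> ('g \<Rightarrow> 'g \<Rightarrow> 'g \<Rightarrow> complex) \<Rightarrow> complex \<Rightarrow> insertion list \<Rightarrow> 'g list \<Rightarrow> nat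
    \<Rightarrow> (nat \<Rightarrow> complex) \<Rightarrow> (nat \<Rightarrow> complex) \<Rightarrow> complex" where
  "free_correlator \<B> f C \<Phi> e N z u =
     (\<Sum>\<tau>\<in>(\<Pi>\<^sub>E j\<in>{..<N}. vertex_decorations \<B>).
        \<Sum>M\<in>contractions (length \<Phi>) N. contraction_value f C \<Phi> e N z u \<tau> M)"


section \<open>Feynman graphs\<close>

text \<open>A Feynman graph with labelled vertices is an undirected multigraph, given by the multiset of its
  edges, an edge being the set of its two ends. Labelled interaction vertices are
  accounted for by the factor \<open>1/N!\<close>.\<close>

type_synonym graph = "vertex set multiset"

definition graph_of :: "(half_edge \<times> half_edge) set \<Rightarrow> graph" where
  "graph_of M = image_mset (\<lambda>(h, h'). {vertex_of h, vertex_of h'}) (mset_set M)"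

definition feynman_graphs :: "nat \<Rightarrow> nat \<Rightarrow> graph set" where
  "feynman_graphs n N = graph_of ` contractions n N"

text \<open>The sum over all decorations of the half-edges of a given graph, including orientations.\<close>

definition graph_integrand ::
  "'g set \<Rightarrow> ('g \<Rightarrow> 'g \<Rightarrow> 'g \<Rightarrow> complex) \<Rightarrow> complex \<Rightarrow> insertion list \<Rightarrow> 'g list \<Rightarrow> nat \<Rightarrow> graph
    \<Rightarrow> (nat \<Rightarrow> complex) \<Rightarrow> (nat \<Rightarrow> complex) \<Rightarrow> complex" where
  "graph_integrand \<B> f C \<Phi> e N \<Gamma> z u =
     (\<Sum>\<tau>\<in>(\<Pi>\<^sub>E j\<in>{..<N}. vertex_decorations \<B>).
        \<Sum>M\<in>{M \<in> contractions (length \<Phi>) N. graph_of M = \<Gamma>}. contraction_value f C \<Phi> e N z u \<tau> M)"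

text \<open>Binary trees with leaves labelled by fields and nodes labelled by interaction vertices. A
  rooted tree \<open>(r, t)\<close> has in addition the univalent root \<open>Ext r\<close>, joined to the top of \<open>t\<close>.\<close>

datatype btree = Leaf nat | Node nat btree btree

fun top_vertex :: "btree \<Rightarrow> vertex" where
  "top_vertex (Leaf i) = Ext i"
| "top_vertex (Node j s t) = Inner j"

fun leaves :: "btree \<Rightarrow> nat set" where
  "leaves (Leaf i) = {i}"
| "leaves (Node j s t) = leaves s \<union> leaves t"

fun btree_vertices :: "btree \<Rightarrow> vertex multiset" where
  "btree_vertices (Leaf i) = {#Ext i#}"
| "btree_vertices (Node j s t) = {#Inner j#} + btree_vertices s + btree_vertices t"

fun btree_edges :: "btree \<Rightarrow> graph" where
  "btree_edges (Leaf i) = {#}"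
| "btree_edges (Node j s t) =
     {#{Inner j, top_vertex s}, {Inner j, top_vertex t}#} + btree_edges s + btree_edges t"

fun rooted_vertices :: "nat \<times> btree \<Rightarrow> vertex multiset" where
  "rooted_vertices (r, t) = {#Ext r#} + btree_vertices t"

fun rooted_edges :: "nat \<times> btree \<Rightarrow> graph" where
  "rooted_edges (r, t) = {#{Ext r, top_vertex t}#} + btree_edges t"

text \<open>Comparing vertex multisets makes the trees disjoint, and each of them non-repeating.\<close>

definition disjoint_union_of_rooted_trees :: "insertion list \<Rightarrow> nat \<Rightarrow> graph \<Rightarrow> nat \<Rightarrow> bool" where
  "disjoint_union_of_rooted_trees \<Phi> N \<Gamma> p \<longleftrightarrow>
     (\<exists>Ts. length Ts = p
        \<and> (\<forall>(r, t)\<in>set Ts. charge (fst (\<Phi> ! r)) = -1 \<and> (\<forall>i\<in>leaves t. charge (fst (\<Phi> ! i)) = 1))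
        \<and> (\<Sum>T\<leftarrow>Ts. rooted_vertices T) = mset_set (Ext ` {..<length \<Phi>} \<union> Inner ` {..<N})
        \<and> (\<Sum>T\<leftarrow>Ts. rooted_edges T) = \<Gamma>)"


section \<open>Correlators\<close>

text \<open>Interaction vertices are integrated over \<open>U\<close>, which is the whole plane or, for the infrared
  regularization, a disc.\<close>

definition configurations :: "nat \<Rightarrow> complex set \<Rightarrow> (nat \<Rightarrow> complex) set" where
  "configurations n U = {z. inj_on z {..<n} \<and> z ` {..<n} \<subseteq> U}"

definition vol :: "nat \<Rightarrow> (nat \<Rightarrow> complex) measure" where
  "vol N = (\<Pi>\<^sub>M j\<in>{..<N}. lborel)"

definition domain :: "complex set \<Rightarrow> nat \<Rightarrow> (nat \<Rightarrow> complex) set" where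
  "domain U N = (\<Pi>\<^sub>E j\<in>{..<N}. U)"

definition base_contribution ::
  "'g set \<Rightarrow> ('g \<Rightarrow> 'g \<Rightarrow> 'g \<Rightarrow> complex) \<Rightarrow> complex \<Rightarrow> complex set \<Rightarrow> complex \<Rightarrow> insertion list \<Rightarrow> 'g list
    \<Rightarrow> nat \<Rightarrow> graph \<Rightarrow> (nat \<Rightarrow> complex) \<Rightarrow> complex" where
  "base_contribution \<B> f C U g \<Phi> e N \<Gamma> z =
     1 / fact N * (g / (2 * of_real pi)) ^ N
       * (LINT u:domain U N|vol N. graph_integrand \<B> f C \<Phi> e N \<Gamma> z u)"

definition base_correlator ::
  "'g set \<Rightarrow> ('g \<Rightarrow> 'g \<Rightarrow> 'g \<Rightarrow> complex) \<Rightarrow> complex \<Rightarrow> complex set \<Rightarrow> complex \<Rightarrow> insertion list \<Rightarrow> 'g list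
    \<Rightarrow> (nat \<Rightarrow> complex) \<Rightarrow> complex" where
  "base_correlator \<B> f C U g \<Phi> e z =
     (\<Sum>N. 1 / fact N * (g / (2 * of_real pi)) ^ N
       * (LINT u:domain U N|vol N. free_correlator \<B> f C \<Phi> e N z u))"

definition derivative_word :: "insertion list \<Rightarrow> (bool \<times> nat) list" where
  "derivative_word \<Phi> = concat (map (\<lambda>i. replicate (fst (snd (\<Phi> ! i))) (False, i)
                                     @ replicate (snd (snd (\<Phi> ! i))) (True, i)) [0..<length \<Phi>])"

definition correlator ::
  "'g set \<Rightarrow> ('g \<Rightarrow> 'g \<Rightarrow> 'g \<Rightarrow> complex) \<Rightarrow> complex \<Rightarrow> complex set \<Rightarrow> complex \<Rightarrow> insertion list \<Rightarrow> 'g list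
    \<Rightarrow> (nat \<Rightarrow> complex) \<Rightarrow> complex" where
  "correlator \<B> f C U g \<Phi> e =
     iter_deriv (derivative_word \<Phi>) (base_correlator \<B> f C U g \<Phi> e)"

definition contribution ::
  "'g set \<Rightarrow> ('g \<Rightarrow> 'g \<Rightarrow> 'g \<Rightarrow> complex) \<Rightarrow> complex \<Rightarrow> complex set \<Rightarrow> complex \<Rightarrow> insertion list \<Rightarrow> 'g list
    \<Rightarrow> nat \<Rightarrow> graph \<Rightarrow> (nat \<Rightarrow> complex) \<Rightarrow> complex" where
  "contribution \<B> f C U g \<Phi> e N \<Gamma> =
     iter_deriv (derivative_word \<Phi>) (base_contribution \<B> f C U g \<Phi> e N \<Gamma>)"

text \<open>Tensor components of the correlator of \<open>\<Phi>\<close>.\<close>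

definition tensor_components :: "'g set \<Rightarrow> insertion list \<Rightarrow> 'g list set" where
  "tensor_components \<B> \<Phi> = {e. length e = length \<Phi> \<and> set e \<subseteq> \<B>}"

text \<open>The diagrams whose integrand does not vanish identically after summation over decorations.\<close>

definition contributing_diagrams ::
  "'g set \<Rightarrow> ('g \<Rightarrow> 'g \<Rightarrow> 'g \<Rightarrow> complex) \<Rightarrow> complex \<Rightarrow> insertion list \<Rightarrow> (nat \<times> graph) set" where
  "contributing_diagrams \<B> f C \<Phi> =
     {(N, \<Gamma>). \<Gamma> \<in> feynman_graphs (length \<Phi>) N \<and>
        (\<exists>e\<in>tensor_components \<B> \<Phi>. \<exists>z\<in>configurations (length \<Phi>) UNIV. \<exists>u.
           graph_integrand \<B> f C \<Phi> e N \<Gamma> z u \<noteq> 0)}"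

text \<open>The integral over the whole plane is used when \<open>b\<close> is always derived; in general the
  integral is regularized by restriction to a disc.\<close>

definition admissible_region :: "insertion list \<Rightarrow> complex set \<Rightarrow> bool" where
  "admissible_region \<Phi> U \<longleftrightarrow> (U = UNIV \<and> \<not> bare_b_occurs \<Phi>) \<or> (\<exists>R>0. U = ball 0 R)"

text \<open>The integrand in the example of a divergent correlator.\<close>

definition gamma_b_c_integrand ::
  "complex \<Rightarrow> complex \<Rightarrow> complex \<Rightarrow> complex \<Rightarrow> complex \<Rightarrow> complex" where
  "gamma_b_c_integrand C z1 z2 z3 u =
     (of_real (2 * ln (cmod (u - z2))) + C) / ((u - z1) * (cnj u - cnj z3))"

end

theory Submission
  imports Defs
begin

text \<open>
  In a Wick contraction every half-edge of charge \<open>1\<close> is paired with one of charge \<open>-1\<close>, and every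
  interaction vertex has exactly one half-edge of charge \<open>1\<close>. Counting charges gives \<open>N\<close>, and following
  the outgoing half-edges shows that a graph is a forest of rooted binary trees unless it contains an
  oriented cycle. A cycle carries either only the fields \<open>a\<close>, \<open>\<gamma>\<close> and their conjugates or only ghosts.
  Exchanging the two kinds of fields while reversing the orientation of the cycle preserves the graph
  and, up to signs, the propagators; the structure constants around the cycle turn into the trace of the reversed
  product, which strong unimodularity compares with the original one, and the resulting sign cancels
  against the Koszul sign of the ghost loop up to an overall \<open>-1\<close>. So graphs with cycles do not contribute.

  The integrals of trees converge by integrating out the vertices from the leaves to the root: the
  estimate of one integration has the same form as its two inputs, with slightly worse exponents. A
  bare \<open>b\<close> replaces the factor of an edge by a logarithm, which that factor dominates on bounded regions. For the
  smoothness in the insertion points, the plane is deformed by a diffeomorphism that carries the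
  moving insertion points back to fixed ones, so that only a bounded smooth factor has to be
  differentiated under the integral.\<close>

section \<open>Integrability of tree kernels\<close>

text \<open>The exponents below 1 in the tree estimates are forced: two incoming factors that decay
  like 1/|u|, multiplied by 1/|u - w| and integrated over u, decay only like ln|w| / |w|. At each
  vertex this logarithm is paid for by an arbitrarily small power. Differentiating the integrand
  itself in an insertion point fails, because 1/(u - z) turns into 1/(u - z)^2, which is not
  absolutely integrable. After the deformation a difference of moved points is the difference of the
  fixed points times a factor bounded away from 0, so the singular part no longer depends on z.
  Loops cancel pointwise, before any integration, and inside one unoriented graph. The partners in
  the cancellation orient the cycle in opposite ways, so the cycle has to be singled out by the
  graph alone. This is done by counting edges inside a set of vertices; one minimal such set serves
  all decorations of the graph at once, and all other cycles are left as they are.\<close>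

lemma emeasure_ball_complex:
  "0 \<le> r \<Longrightarrow> emeasure lborel (ball (c::complex) r) = ennreal (pi * r\<^sup>2)"
  by (simp add: emeasure_ball unit_ball_vol_2)

text \<open>Plays the part of polar coordinates: a radial singularity or decay is dominated by a
  step function on dyadic discs, and its integral by a geometric series.\<close>

lemma nn_integral_ball_series:
  fixes c :: "nat \<Rightarrow> real" and r :: "nat \<Rightarrow> real" and F :: "complex \<Rightarrow> ennreal"
  assumes "\<And>k. c k \<ge> 0" "\<And>k. r k \<ge> 0" "summable (\<lambda>k. c k * (pi * (r k)\<^sup>2))"
    and F: "\<And>v. F v \<le> (\<Sum>k. ennreal (c k) * indicator (ball 0 (r k)) v)"
  shows "(\<integral>\<^sup>+v. F v \<partial>lborel) < \<infinity>"
proof -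
  have "(\<integral>\<^sup>+v. F v \<partial>lborel) \<le> (\<integral>\<^sup>+v. (\<Sum>k. ennreal (c k) * indicator (ball (0::complex) (r k)) v) \<partial>lborel)"
    by (rule nn_integral_mono) (rule F)
  also have "\<dots> = (\<Sum>k. \<integral>\<^sup>+v. ennreal (c k) * indicator (ball (0::complex) (r k)) v \<partial>lborel)"
    by (rule nn_integral_suminf) (auto intro!: borel_measurable_times_ennreal borel_measurable_indicator)
  also have "\<dots> = (\<Sum>k. ennreal (c k * (pi * (r k)\<^sup>2)))"
    using assms(1,2) by (simp add: nn_integral_cmult_indicator emeasure_ball_complex ennreal_mult)
  also have "\<dots> < \<infinity>"
    using assms by (subst suminf_ennreal2) auto
  finally show ?thesis .
qed

lemma ennreal_le_suminf: "(f k :: ennreal) \<le> (\<Sum>k. f k)"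
  by (metis ennreal_suminf_lessD not_le order_refl)

lemma dyadic_bounds:
  fixes x :: real assumes "0 < x"
  obtains n :: int where "2 powr n \<le> x" "x < 2 powr (n + 1)"
proof
  have "2 powr \<lfloor>log 2 x\<rfloor> \<le> 2 powr (log 2 x)" by (intro powr_mono) auto
  then show "2 powr \<lfloor>log 2 x\<rfloor> \<le> x" using assms by simp
  have "log 2 x < \<lfloor>log 2 x\<rfloor> + 1" by linarith
  then have "2 powr (log 2 x) < 2 powr (\<lfloor>log 2 x\<rfloor> + 1)" by (intro powr_less_mono) auto
  then show "x < 2 powr (\<lfloor>log 2 x\<rfloor> + 1)" using assms by simp
qed

text \<open>Where |v| is about 2^-k the integrand is at most 2^((k+1) \<sigma>), on a disc of area
  \<pi> 4^-k. The resulting series has ratio 2^(\<sigma> - 2), which is below 1 because \<sigma> <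
  2.\<close>

lemma nn_integral_singular_finite:
  fixes \<sigma> :: real
  assumes "0 \<le> \<sigma>" "\<sigma> < 2"
  shows "(\<integral>\<^sup>+v. ennreal (norm v powr -\<sigma>) * indicator (ball (0::complex) 1) v \<partial>lborel) < \<infinity>"
proof (rule nn_integral_ball_series[where c = "\<lambda>k. 2 powr ((real k + 1) * \<sigma>)" and r = "\<lambda>k. 2 powr - real k"])
  have "(\<lambda>k. 2 powr ((real k + 1) * \<sigma>) * (pi * (2 powr - real k)\<^sup>2)) = (\<lambda>k. (pi * 2 powr \<sigma>) * (2 powr (\<sigma> - 2)) ^ k)"
  proof
    fix k :: nat
    have "2 powr ((real k + 1) * \<sigma>) * (pi * (2 powr - real k)\<^sup>2) = pi * (2 powr ((real k + 1) * \<sigma>) * 2 powr (2 * (- real k)))"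
      by (simp add: powr_power)
    also have "\<dots> = pi * (2 powr \<sigma> * 2 powr ((\<sigma> - 2) * real k))"
      by (simp add: powr_add[symmetric] algebra_simps)
    finally show "2 powr ((real k + 1) * \<sigma>) * (pi * (2 powr - real k)\<^sup>2) = (pi * 2 powr \<sigma>) * (2 powr (\<sigma> - 2)) ^ k"
      by (simp add: powr_power mult.commute)
  qed
  moreover have "2 powr (\<sigma> - 2) < 2 powr 0" using assms by (intro powr_less_mono) auto
  ultimately show "summable (\<lambda>k. 2 powr ((real k + 1) * \<sigma>) * (pi * (2 powr - real k)\<^sup>2))"
    by (auto intro!: summable_mult summable_geometric)
  fix v :: complex
  show "ennreal (norm v powr -\<sigma>) * indicator (ball 0 1) v
      \<le> (\<Sum>k. ennreal (2 powr ((real k + 1) * \<sigma>)) * indicator (ball 0 (2 powr - real k)) v)"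
  proof (cases "v = 0 \<or> norm v \<ge> 1")
    case True then show ?thesis by auto
  next
    case False
    then obtain n :: int where n: "2 powr n \<le> norm v" "norm v < 2 powr (n + 1)"
      using dyadic_bounds[of "norm v"] by auto
    have "2 powr n < 2 powr 0" using n(1) False by simp
    then have "n < 0" by (subst (asm) powr_less_cancel_iff) auto
    \<comment> \<open>The annulus 2^n \<le> |v| < 2^(n+1) lies in the disc of radius 2^-k for -k = n
      + 1; this is a natural number since n < 0.\<close>
    define k where "k = nat (- n - 1)"
    have k: "real_of_int n = - (real k + 1)" using \<open>n < 0\<close> by (simp add: k_def)
    have "norm v powr -\<sigma> \<le> (2 powr n) powr -\<sigma>"
      using n(1) assms by (intro powr_mono2') auto
    also have "(2 powr n) powr -\<sigma> = 2 powr ((real k + 1) * \<sigma>)" by (simp add: powr_powr k algebra_simps)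
    finally have "norm v powr -\<sigma> \<le> 2 powr ((real k + 1) * \<sigma>)" .
    moreover have "v \<in> ball 0 (2 powr - real k)" using n(2) k by simp
    ultimately have "ennreal (norm v powr -\<sigma>) * indicator (ball 0 1) v
      \<le> ennreal (2 powr ((real k + 1) * \<sigma>)) * indicator (ball 0 (2 powr - real k)) v"
      using False by (auto simp: indicator_def)
    also have "\<dots> \<le> (\<Sum>k. ennreal (2 powr ((real k + 1) * \<sigma>)) * indicator (ball 0 (2 powr - real k)) v)"
      by (rule ennreal_le_suminf)
    finally show ?thesis .
  qed
qed auto

text \<open>The same dyadic comparison going outwards, with ratio 2^(2 - \<tau>).\<close>

lemma nn_integral_decay_finite:
  fixes \<tau> :: real
  assumes "2 < \<tau>"
  shows "(\<integral>\<^sup>+v. ennreal (norm v powr -\<tau>) * indicator (- ball (0::complex) 1) v \<partial>lborel) < \<infinity>"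
proof (rule nn_integral_ball_series[where c = "\<lambda>k. 2 powr (- real k * \<tau>)" and r = "\<lambda>k. 2 powr (real k + 1)"])
  have "(\<lambda>k. 2 powr (- real k * \<tau>) * (pi * (2 powr (real k + 1))\<^sup>2)) = (\<lambda>k. (pi * 4) * (2 powr (2 - \<tau>)) ^ k)"
  proof
    fix k :: nat
    have "2 powr (- real k * \<tau>) * (pi * (2 powr (real k + 1))\<^sup>2) = pi * (2 powr (- real k * \<tau>) * 2 powr (2 * (real k + 1)))"
      by (simp add: powr_power)
    also have "\<dots> = pi * (2 powr 2 * 2 powr ((2 - \<tau>) * real k))"
      unfolding powr_add[symmetric] by (simp add: algebra_simps)
    finally show "2 powr (- real k * \<tau>) * (pi * (2 powr (real k + 1))\<^sup>2) = (pi * 4) * (2 powr (2 - \<tau>)) ^ k"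
      by (simp add: powr_power mult.commute)
  qed
  moreover have "2 powr (2 - \<tau>) < 2 powr 0" using assms by (intro powr_less_mono) auto
  ultimately show "summable (\<lambda>k. 2 powr (- real k * \<tau>) * (pi * (2 powr (real k + 1))\<^sup>2))"
    by (auto intro!: summable_mult summable_geometric)
  fix v :: complex
  show "ennreal (norm v powr -\<tau>) * indicator (- ball 0 1) v
      \<le> (\<Sum>k. ennreal (2 powr (- real k * \<tau>)) * indicator (ball 0 (2 powr (real k + 1))) v)"
  proof (cases "norm v < 1")
    case True then show ?thesis by auto
  next
    case False
    then have "0 < norm v" by linarith
    then obtain n :: int where n: "2 powr n \<le> norm v" "norm v < 2 powr (n + 1)"
      using dyadic_bounds[of "norm v"] by blast
    have "2 powr 0 < 2 powr (n + 1)" using n(2) False by simp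
    then have "0 < real_of_int n + 1" by (subst (asm) powr_less_cancel_iff) auto
    then have "0 \<le> n" by linarith
    define k where "k = nat n"
    have k: "real_of_int n = real k" using \<open>0 \<le> n\<close> by (simp add: k_def)
    have "norm v powr -\<tau> \<le> (2 powr n) powr -\<tau>"
      using n(1) assms by (intro powr_mono2') auto
    then have "norm v powr -\<tau> \<le> 2 powr (- real k * \<tau>)" by (simp add: powr_powr k)
    moreover have "v \<in> ball 0 (2 powr (real k + 1))" using n(2) k by simp
    ultimately have "ennreal (norm v powr -\<tau>) * indicator (- ball 0 1) v
      \<le> ennreal (2 powr (- real k * \<tau>)) * indicator (ball 0 (2 powr (real k + 1))) v"
      using False by (auto simp: indicator_def)
    also have "\<dots> \<le> (\<Sum>k. ennreal (2 powr (- real k * \<tau>)) * indicator (ball 0 (2 powr (real k + 1))) v)"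
      by (rule ennreal_le_suminf)
    finally show ?thesis .
  qed
qed auto

text \<open>Models a product of two singularities as seen from the nearer one: the cutoff \<delta>
  removes the second singularity but keeps its decay. So \<sigma> alone decides near 0, and \<sigma>
  + b at infinity.\<close>

lemma nn_integral_power_finite:
  fixes \<sigma> b \<delta> :: real
  assumes "0 \<le> \<sigma>" "\<sigma> < 2" "0 \<le> b" "2 < \<sigma> + b" "0 < \<delta>"
  shows "(\<integral>\<^sup>+v. ennreal (norm (v::complex) powr -\<sigma> * max \<delta> (norm v) powr -b) \<partial>lborel) < \<infinity>"
proof -
  have [measurable]: "ball (0::complex) 1 \<in> sets borel" by simp
  have "(\<integral>\<^sup>+v. ennreal (norm (v::complex) powr -\<sigma> * max \<delta> (norm v) powr -b) \<partial>lborel)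
     \<le> (\<integral>\<^sup>+v. ennreal (\<delta> powr -b) * (ennreal (norm v powr -\<sigma>) * indicator (ball (0::complex) 1) v)
          + ennreal (norm v powr -(\<sigma> + b)) * indicator (- ball (0::complex) 1) v \<partial>lborel)"
  proof (rule nn_integral_mono)
    fix v :: complex
    show "ennreal (norm v powr -\<sigma> * max \<delta> (norm v) powr -b)
      \<le> ennreal (\<delta> powr -b) * (ennreal (norm v powr -\<sigma>) * indicator (ball 0 1) v)
          + ennreal (norm v powr -(\<sigma> + b)) * indicator (- ball 0 1) v"
    proof (cases "norm v < 1")
      case True
      have "max \<delta> (norm v) powr -b \<le> \<delta> powr -b" using assms by (intro powr_mono2') auto
      then show ?thesis using True
        using mult_left_mono[of "max \<delta> (norm v) powr -b" "\<delta> powr -b" "norm v powr -\<sigma>"]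
        by (simp add: ennreal_mult'[symmetric] ennreal_leI mult.commute)
    next
      case False
      then have "max \<delta> (norm v) powr -b \<le> norm v powr -b" using assms by (intro powr_mono2') auto
      then have "norm v powr -\<sigma> * max \<delta> (norm v) powr -b \<le> norm v powr -(\<sigma> + b)"
        using mult_left_mono[of "max \<delta> (norm v) powr -b" "norm v powr -b" "norm v powr -\<sigma>"]
        by (simp add: powr_add[symmetric])
      then show ?thesis using False by (simp add: ennreal_leI)
    qed
  qed
  also have "\<dots> = ennreal (\<delta> powr -b) * (\<integral>\<^sup>+v. ennreal (norm v powr -\<sigma>) * indicator (ball (0::complex) 1) v \<partial>lborel)
      + (\<integral>\<^sup>+v. ennreal (norm v powr -(\<sigma> + b)) * indicator (- ball (0::complex) 1) v \<partial>lborel)"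
    by (subst nn_integral_add, measurable, subst nn_integral_cmult, measurable)
  also have "\<dots> < \<infinity>"
    using nn_integral_singular_finite[of \<sigma>] nn_integral_decay_finite[of "\<sigma> + b"] assms
    by (simp add: ennreal_mult_less_top del: nn_integral_indicator)
  finally show ?thesis .
qed

section \<open>Integrating out one interaction vertex\<close>

lemma nn_integral_lborel_translate:
  fixes f :: "complex \<Rightarrow> ennreal"
  assumes [measurable]: "f \<in> borel_measurable borel"
  shows "(\<integral>\<^sup>+u. f (u - w) \<partial>lborel) = (\<integral>\<^sup>+u. f u \<partial>lborel)"
proof -
  have "(\<integral>\<^sup>+u. f u \<partial>lborel) = (\<integral>\<^sup>+u. f u \<partial>distr lborel borel ((+) (- w)))"
    by (simp add: lborel_distr_plus)
  also have "\<dots> = (\<integral>\<^sup>+u. f (- w + u) \<partial>lborel)"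
    by (subst nn_integral_distr) auto
  finally show ?thesis by simp
qed

text \<open>The bound is uniform in w because the smaller of |u| and |u - w| can take over both
  exponents: the integrand is at most H(u) + H(u - w), and a translate of H has the same integral as
  H.\<close>

lemma nn_integral_two_points:
  fixes s t b \<delta> :: real
  assumes "0 \<le> s" "0 \<le> t" "s + t < 2" "0 \<le> b" "2 < s + t + b" "0 < \<delta>"
  shows "\<exists>K\<ge>0. \<forall>w. (\<integral>\<^sup>+u. ennreal (norm (u::complex) powr -s * max \<delta> (norm u) powr -b * norm (u - w) powr -t) \<partial>lborel) \<le> ennreal K"
proof -
  define H where "H v = norm (v::complex) powr -(s + t) * max \<delta> (norm v) powr -b" for v
  have Hpos: "0 \<le> H v" for v by (simp add: H_def)
  have [measurable]: "H \<in> borel_measurable borel" unfolding H_def by measurable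
  have fin: "(\<integral>\<^sup>+v. ennreal (H v) \<partial>lborel) < \<infinity>"
    unfolding H_def using assms by (intro nn_integral_power_finite) auto
  define K where "K = enn2real (\<integral>\<^sup>+v. ennreal (H v) \<partial>lborel)"
  have K: "(\<integral>\<^sup>+v. ennreal (H v) \<partial>lborel) = ennreal K" "K \<ge> 0"
    using fin by (auto simp: K_def)
  have pw: "norm u powr -s * max \<delta> (norm u) powr -b * norm (u - w) powr -t \<le> H u + H (u - w)" for u w :: complex
  proof (cases "u = 0 \<or> u = w")
    case True then show ?thesis using Hpos[of u] Hpos[of "u - w"] by auto
  next
    case False
    define x y where "x = norm u" and "y = norm (u - w)"
    have xy: "x > 0" "y > 0" using False by (auto simp: x_def y_def)
    have "x powr -s * max \<delta> x powr -b * y powr -t \<le> x powr -(s+t) * max \<delta> x powr -b + y powr -(s+t) * max \<delta> y powr -b"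
    proof (cases "x \<le> y")
      case True
      have "y powr -t \<le> x powr -t" using True xy assms by (intro powr_mono2') auto
      then have "x powr -s * max \<delta> x powr -b * y powr -t \<le> x powr -s * max \<delta> x powr -b * x powr -t"
        by (intro mult_left_mono) auto
      also have "\<dots> = x powr -(s+t) * max \<delta> x powr -b" using xy by (simp add: powr_add[symmetric] mult.commute mult.left_commute)
      finally show ?thesis by (simp add: add_increasing2)
    next
      case False
      have "x powr -s \<le> y powr -s" "max \<delta> x powr -b \<le> max \<delta> y powr -b" using False xy assms by (auto intro!: powr_mono2')
      then have "x powr -s * max \<delta> x powr -b * y powr -t \<le> y powr -s * max \<delta> y powr -b * y powr -t"
        by (intro mult_right_mono mult_mono) auto
      also have "\<dots> = y powr -(s+t) * max \<delta> y powr -b" using xy by (simp add: powr_add[symmetric] mult.commute mult.left_commute)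
      finally show ?thesis by (simp add: add_increasing)
    qed
    then show ?thesis by (simp add: H_def x_def y_def)
  qed
  show ?thesis
  proof (intro exI[of _ "2 * K"] conjI allI)
    fix w :: complex
    have "(\<integral>\<^sup>+u. ennreal (norm u powr -s * max \<delta> (norm u) powr -b * norm (u - w) powr -t) \<partial>lborel)
       \<le> (\<integral>\<^sup>+u. ennreal (H u) + ennreal (H (u - w)) \<partial>lborel)"
      using pw Hpos by (intro nn_integral_mono) (simp add: ennreal_plus[symmetric] ennreal_leI del: ennreal_plus)
    also have "\<dots> = (\<integral>\<^sup>+u. ennreal (H u) \<partial>lborel) + (\<integral>\<^sup>+u. ennreal (H (u - w)) \<partial>lborel)"
      by (rule nn_integral_add) auto
    also have "\<dots> = ennreal (2 * K)"
      using nn_integral_lborel_translate[of "\<lambda>u. ennreal (H u)" w] K by (simp add: ennreal_plus[symmetric] del: ennreal_plus)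
    finally show "(\<integral>\<^sup>+u. ennreal (norm u powr -s * max \<delta> (norm u) powr -b * norm (u - w) powr -t) \<partial>lborel) \<le> ennreal (2 * K)" .
  qed (use K in auto)
qed

text \<open>Lets a power of |w| be absorbed by one of the two other sides of the triangle 0, u, w.
  The factor 2 is a crude bound for 2^c.\<close>

lemma norm_powr_split:
  fixes u w :: complex and c :: real
  assumes "0 < c" "c \<le> 1"
  shows "norm w powr c \<le> 2 * (norm u powr c + norm (u - w) powr c)"
proof -
  define m where "m = max (norm u) (norm (u - w))"
  have "norm w \<le> norm u + norm (u - w)" by (metis norm_triangle_sub norm_minus_commute)
  then have "norm w \<le> 2 * m" by (simp add: m_def)
  then have "norm w powr c \<le> (2 * m) powr c" using assms by (intro powr_mono2) auto
  also have "\<dots> = 2 powr c * m powr c" by (simp add: powr_mult m_def)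
  also have "\<dots> \<le> 2 * m powr c"
    using powr_mono[of c 1 2] assms by (intro mult_right_mono) auto
  also have "m powr c \<le> norm u powr c + norm (u - w) powr c" by (simp add: m_def max_def)
  finally show ?thesis by simp
qed

lemma ennreal_mult_sum:
  "0 \<le> x \<Longrightarrow> 0 \<le> k \<Longrightarrow> 0 \<le> y \<Longrightarrow> 0 \<le> z \<Longrightarrow>
    ennreal (x * (k * (y + z))) = ennreal x * (ennreal k * (ennreal y + ennreal z))"
  by (simp add: ennreal_mult)

text \<open>The decay |w|^-c is bought from the integrand: |w|^c is at most 2 (|u|^c + |u - w|^c),
  and each summand lowers one of the exponents a and 1 by c. The exponents that remain add up to a +
  b + 1 - c, which exceeds 2 exactly when c < a + b - 1; and c > 0 keeps the local exponents below 2
  in total. So \<open>nn_integral_two_points\<close> applies to both summands.\<close>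

lemma nn_integral_one_point_conv:
  fixes a b c \<delta> :: real
  assumes "a \<le> 1" "b \<le> 1" "0 < c" "c < a + b - 1" "0 < \<delta>"
  shows "\<exists>K\<ge>0. \<forall>w. w \<noteq> 0 \<longrightarrow> (\<integral>\<^sup>+u. ennreal (norm (u::complex) powr -a * max \<delta> (norm u) powr -b / norm (u - w)) \<partial>lborel)
           \<le> ennreal (K * norm w powr -c)"
proof -
  obtain K1 where K1: "K1 \<ge> 0" "\<And>w. (\<integral>\<^sup>+u. ennreal (norm (u::complex) powr -(a-c) * max \<delta> (norm u) powr -b * norm (u - w) powr -1) \<partial>lborel) \<le> ennreal K1"
    using nn_integral_two_points[of "a - c" 1 b \<delta>] assms by auto
  obtain K2 where K2: "K2 \<ge> 0" "\<And>w. (\<integral>\<^sup>+u. ennreal (norm (u::complex) powr -a * max \<delta> (norm u) powr -b * norm (u - w) powr -(1-c)) \<partial>lborel) \<le> ennreal K2"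
    using nn_integral_two_points[of a "1-c" b \<delta>] assms by auto
  show ?thesis
  proof (intro exI[of _ "2 * K1 + 2 * K2"] conjI allI impI)
    fix w :: complex assume w: "w \<noteq> 0"
    let ?A = "\<lambda>u. norm u powr -(a-c) * max \<delta> (norm u) powr -b * norm (u - w) powr -1"
    let ?B = "\<lambda>u. norm u powr -a * max \<delta> (norm u) powr -b * norm (u - w) powr -(1-c)"
    have pw: "norm u powr -a * max \<delta> (norm u) powr -b / norm (u - w) \<le> norm w powr -c * (2 * (?A u + ?B u))" for u :: complex
    proof (cases "u = 0 \<or> u = w")
      case True then show ?thesis by auto
    next
      case False
      let ?X = "norm u powr -a * max \<delta> (norm u) powr -b * norm (u - w) powr -1"
      have X: "norm u powr -a * max \<delta> (norm u) powr -b / norm (u - w) = ?X" using False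
        by (simp add: powr_minus_divide)
      have "norm w powr -c * norm w powr c = 1" using w by (simp add: powr_add[symmetric])
      then have "?X = norm w powr -c * (norm w powr c * ?X)" by (simp only: mult.assoc[symmetric] mult_1)
      also have "\<dots> \<le> norm w powr -c * ((2 * (norm u powr c + norm (u - w) powr c)) * ?X)"
        using norm_powr_split[of c w u] assms by (intro mult_left_mono mult_right_mono) auto
      also have "(2 * (norm u powr c + norm (u - w) powr c)) * ?X = 2 * (?A u + ?B u)"
      proof -
        have 1: "norm u powr -(a-c) = norm u powr c * norm u powr -a"
          and 2: "norm (u - w) powr -(1-c) = norm (u - w) powr c * norm (u - w) powr -1"
          using False by (simp_all only: powr_add[symmetric]) simp_all
        show ?thesis unfolding 1 2 by (simp only: ring_distribs mult_ac)
      qed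
      finally show ?thesis unfolding X .
    qed
    have "(\<integral>\<^sup>+u. ennreal (norm u powr -a * max \<delta> (norm u) powr -b / norm (u - w)) \<partial>lborel)
       \<le> (\<integral>\<^sup>+u. ennreal (norm w powr -c) * (ennreal 2 * (ennreal (?A u) + ennreal (?B u))) \<partial>lborel)"
    proof (rule nn_integral_mono)
      fix u :: complex
      have "ennreal (norm u powr -a * max \<delta> (norm u) powr -b / norm (u - w)) \<le> ennreal (norm w powr -c * (2 * (?A u + ?B u)))"
        using pw by (rule ennreal_leI)
      also have "\<dots> = ennreal (norm w powr -c) * (ennreal 2 * (ennreal (?A u) + ennreal (?B u)))"
        by (rule ennreal_mult_sum) auto
      finally show "ennreal (norm u powr -a * max \<delta> (norm u) powr -b / norm (u - w)) \<le> \<dots>" .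
    qed
    also have "\<dots> = ennreal (norm w powr -c) * (ennreal 2 * ((\<integral>\<^sup>+u. ennreal (?A u) \<partial>lborel) + (\<integral>\<^sup>+u. ennreal (?B u) \<partial>lborel)))"
      by (simp add: nn_integral_cmult nn_integral_add del: ennreal_numeral)
    also have "\<dots> \<le> ennreal (norm w powr -c) * (ennreal 2 * (ennreal K1 + ennreal K2))"
      by (intro mult_left_mono add_mono K1 K2) auto
    also have "\<dots> = ennreal ((2 * K1 + 2 * K2) * norm w powr -c)"
      using K1(1) K2(1) by (subst ennreal_mult_sum[symmetric]) (auto simp: algebra_simps)
    finally show "(\<integral>\<^sup>+u. ennreal (norm u powr -a * max \<delta> (norm u) powr -b / norm (u - w)) \<partial>lborel)
           \<le> ennreal ((2 * K1 + 2 * K2) * norm w powr -c)" .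
  qed (use K1 K2 in auto)
qed

text \<open>The distance of u to the farther one of p and q is at least \<delta>, half the distance
  of p and q, and at least the distance to the nearer one. Hence the product of two singularities is
  at most the sum of two terms with one singularity and a cutoff each.\<close>

lemma nn_integral_cherry:
  fixes a b c :: real and p q :: complex
  assumes "a \<le> 1" "b \<le> 1" "0 < c" "c < a + b - 1" "p \<noteq> q"
  shows "\<exists>K\<ge>0. \<forall>w. w \<noteq> p \<longrightarrow> w \<noteq> q \<longrightarrow>
           (\<integral>\<^sup>+u. ennreal (norm (u - p) powr -a * norm (u - q) powr -b / norm (u - w)) \<partial>lborel)
           \<le> ennreal (K * (norm (w - p) powr -c + norm (w - q) powr -c))"
proof -
  define \<delta> where "\<delta> = norm (p - q) / 2"
  have \<delta>: "0 < \<delta>" using assms by (simp add: \<delta>_def)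
  obtain K1 where K1: "K1 \<ge> 0" "\<And>w. w \<noteq> 0 \<Longrightarrow> (\<integral>\<^sup>+u. ennreal (norm (u::complex) powr -a * max \<delta> (norm u) powr -b / norm (u - w)) \<partial>lborel)
           \<le> ennreal (K1 * norm w powr -c)"
    using nn_integral_one_point_conv[of a b c \<delta>] assms \<delta> by auto
  obtain K2 where K2: "K2 \<ge> 0" "\<And>w. w \<noteq> 0 \<Longrightarrow> (\<integral>\<^sup>+u. ennreal (norm (u::complex) powr -b * max \<delta> (norm u) powr -a / norm (u - w)) \<partial>lborel)
           \<le> ennreal (K2 * norm w powr -c)"
    using nn_integral_one_point_conv[of b a c \<delta>] assms \<delta> by auto
  show ?thesis
  proof (intro exI[of _ "max K1 K2"] conjI allI impI)
    fix w :: complex assume w: "w \<noteq> p" "w \<noteq> q"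
    let ?A = "\<lambda>u. norm (u - p) powr -a * max \<delta> (norm (u - p)) powr -b / norm (u - w)"
    let ?B = "\<lambda>u. norm (u - q) powr -b * max \<delta> (norm (u - q)) powr -a / norm (u - w)"
    have pw: "norm (u - p) powr -a * norm (u - q) powr -b / norm (u - w) \<le> ?A u + ?B u" for u
    proof -
      have tri: "2 * \<delta> \<le> norm (u - p) + norm (u - q)"
        unfolding \<delta>_def using norm_triangle_ineq4[of "u - q" "u - p"] by simp
      have nn: "0 \<le> ?A u" "0 \<le> ?B u" by auto
      show ?thesis
      proof (cases "norm (u - p) \<le> norm (u - q)")
        case True
        then have "max \<delta> (norm (u - p)) \<le> norm (u - q)" using tri by auto
        then have "norm (u - q) powr -b \<le> max \<delta> (norm (u - p)) powr -b" using \<delta> assms by (intro powr_mono2') auto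
        then have "norm (u - p) powr -a * norm (u - q) powr -b / norm (u - w) \<le> ?A u"
          by (intro divide_right_mono mult_left_mono) auto
        then show ?thesis using nn(2) by linarith
      next
        case False
        then have "max \<delta> (norm (u - q)) \<le> norm (u - p)" using tri by auto
        then have "norm (u - p) powr -a \<le> max \<delta> (norm (u - q)) powr -a" using \<delta> assms by (intro powr_mono2') auto
        then have "norm (u - q) powr -b * norm (u - p) powr -a / norm (u - w) \<le> ?B u"
          by (intro divide_right_mono mult_left_mono) auto
        moreover have "norm (u - p) powr -a * norm (u - q) powr -b / norm (u - w) = norm (u - q) powr -b * norm (u - p) powr -a / norm (u - w)"
          by (simp add: mult.commute)
        ultimately show ?thesis using nn(1) by linarith
      qed
    qed
    have A: "(\<integral>\<^sup>+u. ennreal (?A u) \<partial>lborel) \<le> ennreal (K1 * norm (w - p) powr -c)"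
    proof -
      have "(\<integral>\<^sup>+u. ennreal (?A u) \<partial>lborel)
        = (\<integral>\<^sup>+u. (\<lambda>v. ennreal (norm v powr -a * max \<delta> (norm v) powr -b / norm (v - (w - p)))) (u - p) \<partial>lborel)"
        by (simp add: algebra_simps)
      also have "\<dots> = (\<integral>\<^sup>+v. ennreal (norm v powr -a * max \<delta> (norm v) powr -b / norm (v - (w - p))) \<partial>lborel)"
        by (rule nn_integral_lborel_translate) measurable
      finally show ?thesis using K1(2)[of "w - p"] w by simp
    qed
    have B: "(\<integral>\<^sup>+u. ennreal (?B u) \<partial>lborel) \<le> ennreal (K2 * norm (w - q) powr -c)"
    proof -
      have "(\<integral>\<^sup>+u. ennreal (?B u) \<partial>lborel)
        = (\<integral>\<^sup>+u. (\<lambda>v. ennreal (norm v powr -b * max \<delta> (norm v) powr -a / norm (v - (w - q)))) (u - q) \<partial>lborel)"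
        by (simp add: algebra_simps)
      also have "\<dots> = (\<integral>\<^sup>+v. ennreal (norm v powr -b * max \<delta> (norm v) powr -a / norm (v - (w - q))) \<partial>lborel)"
        by (rule nn_integral_lborel_translate) measurable
      finally show ?thesis using K2(2)[of "w - q"] w by simp
    qed
    have "(\<integral>\<^sup>+u. ennreal (norm (u - p) powr -a * norm (u - q) powr -b / norm (u - w)) \<partial>lborel)
      \<le> (\<integral>\<^sup>+u. ennreal (?A u) + ennreal (?B u) \<partial>lborel)"
      by (rule nn_integral_mono, subst ennreal_plus[symmetric]) (auto simp del: ennreal_plus intro!: ennreal_leI pw)
    also have "\<dots> = (\<integral>\<^sup>+u. ennreal (?A u) \<partial>lborel) + (\<integral>\<^sup>+u. ennreal (?B u) \<partial>lborel)"
      by (rule nn_integral_add) auto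
    also have "\<dots> \<le> ennreal (K1 * norm (w - p) powr -c) + ennreal (K2 * norm (w - q) powr -c)"
      by (intro add_mono A B)
    also have "\<dots> = ennreal (K1 * norm (w - p) powr -c + K2 * norm (w - q) powr -c)"
      using K1(1) K2(1) by simp
    also have "\<dots> \<le> ennreal (max K1 K2 * (norm (w - p) powr -c + norm (w - q) powr -c))"
      unfolding distrib_left by (intro ennreal_leI add_mono mult_right_mono) auto
    finally show "(\<integral>\<^sup>+u. ennreal (norm (u - p) powr -a * norm (u - q) powr -b / norm (u - w)) \<partial>lborel)
           \<le> ennreal (max K1 K2 * (norm (w - p) powr -c + norm (w - q) powr -c))" .
  qed (use K1 in auto)
qed

section \<open>Kernels of trees and their integrals\<close>

interpretation plane: product_sigma_finite "\<lambda>_::nat. lborel :: complex measure"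
  by standard

definition vertex_pos :: "(nat \<Rightarrow> complex) \<Rightarrow> (nat \<Rightarrow> complex) \<Rightarrow> vertex \<Rightarrow> complex" where
  "vertex_pos z u v = (case v of Ext i \<Rightarrow> z i | Inner j \<Rightarrow> u j)"

lemma vertex_pos_simps [simp]:
  "vertex_pos z u (Ext i) = z i" "vertex_pos z u (Inner j) = u j"
  by (simp_all add: vertex_pos_def)

fun inners :: "btree \<Rightarrow> nat set" where
  "inners (Leaf i) = {}"
| "inners (Node j s t) = insert j (inners s \<union> inners t)"

fun non_repeating :: "btree \<Rightarrow> bool" where
  "non_repeating (Leaf i) = True"
| "non_repeating (Node j s t) = (j \<notin> inners s \<union> inners t \<and> inners s \<inter> inners t = {}
     \<and> leaves s \<inter> leaves t = {} \<and> non_repeating s \<and> non_repeating t)"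

text \<open>The product of the inverse lengths of all edges of the tree, together with the edge that
  joins its top to a point at \<open>w\<close>.\<close>

fun tree_kernel :: "complex \<Rightarrow> (vertex \<Rightarrow> complex) \<Rightarrow> btree \<Rightarrow> real" where
  "tree_kernel w p (Leaf i) = 1 / norm (w - p (Ext i))"
| "tree_kernel w p (Node j s t)
     = 1 / norm (w - p (Inner j)) * (tree_kernel (p (Inner j)) p s * tree_kernel (p (Inner j)) p t)"

lemma finite_inners [simp]: "finite (inners t)" by (induction t) auto
lemma finite_leaves [simp]: "finite (leaves t)" by (induction t) auto
lemma leaves_nonempty [simp]: "leaves t \<noteq> {}" by (induction t) auto

lemma tree_kernel_nonneg: "0 \<le> tree_kernel w p t"
  by (induction t arbitrary: w) auto

lemma tree_kernel_cong:
  "(\<And>j. j \<in> inners t \<Longrightarrow> u j = u' j) \<Longrightarrow> tree_kernel w (vertex_pos z u) t = tree_kernel w (vertex_pos z u') t"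
  by (induction t arbitrary: w) auto

lemma measurable_tree_kernel:
  assumes "w \<in> borel_measurable M" "\<And>j. j \<in> inners t \<Longrightarrow> (\<lambda>x. u x j) \<in> borel_measurable M"
  shows "(\<lambda>x. tree_kernel (w x) (vertex_pos z (u x)) t) \<in> borel_measurable M"
  using assms
proof (induction t arbitrary: w)
  case (Leaf i)
  note [measurable] = Leaf.prems(1)
  show ?case by simp
next
  case (Node j s t)
  note [measurable] = Node.prems(1)
  have [measurable]: "(\<lambda>x. u x j) \<in> borel_measurable M" using Node.prems(2) by simp
  have [measurable]: "(\<lambda>x. tree_kernel (u x j) (vertex_pos z (u x)) s) \<in> borel_measurable M"
    "(\<lambda>x. tree_kernel (u x j) (vertex_pos z (u x)) t) \<in> borel_measurable M"
    using Node.prems(2) by (auto intro!: Node.IH)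
  show ?case by simp
qed

lemma ennreal_mult3: "0 \<le> x \<Longrightarrow> 0 \<le> y \<Longrightarrow> 0 \<le> z \<Longrightarrow> ennreal (x * (y * z)) = ennreal x * (ennreal y * ennreal z)"
  by (simp add: ennreal_mult)

lemma sum_ennreal2:
  "(\<And>i k. i \<in> A \<Longrightarrow> k \<in> B \<Longrightarrow> 0 \<le> f i k) \<Longrightarrow> (\<Sum>i\<in>A. \<Sum>k\<in>B. ennreal (f i k)) = ennreal (\<Sum>i\<in>A. \<Sum>k\<in>B. f i k)"
  by (simp add: sum_nonneg)

text \<open>Tonelli for functions of disjoint groups of coordinates. It separates the two subtrees
  of a node once the position of the node is fixed, and the trees of a forest.\<close>

lemma nn_integral_PiM_mult:
  fixes I J :: "nat set"
  assumes IJ: "I \<inter> J = {}" "finite I" "finite J"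
    and [measurable]: "F \<in> borel_measurable (PiM (I \<union> J) (\<lambda>_. lborel :: complex measure))"
      "G \<in> borel_measurable (PiM (I \<union> J) (\<lambda>_. lborel :: complex measure))"
    and F: "F \<in> borel_measurable (PiM I (\<lambda>_. lborel :: complex measure))"
    and G: "G \<in> borel_measurable (PiM J (\<lambda>_. lborel :: complex measure))"
    and depF: "\<And>x x'. (\<And>i. i \<in> I \<Longrightarrow> x i = x' i) \<Longrightarrow> F x = F x'"
    and depG: "\<And>x x'. (\<And>i. i \<in> J \<Longrightarrow> x i = x' i) \<Longrightarrow> G x = G x'"
  shows "(\<integral>\<^sup>+x. F x * G x \<partial>PiM (I \<union> J) (\<lambda>_. lborel :: complex measure))
     = (\<integral>\<^sup>+x. F x \<partial>PiM I (\<lambda>_. lborel)) * (\<integral>\<^sup>+x. G x \<partial>PiM J (\<lambda>_. lborel) :: ennreal)"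
proof -
  have "(\<integral>\<^sup>+x. F x * G x \<partial>PiM (I \<union> J) (\<lambda>_. lborel :: complex measure))
    = (\<integral>\<^sup>+x. (\<integral>\<^sup>+y. F (merge I J (x, y)) * G (merge I J (x, y)) \<partial>PiM J (\<lambda>_. lborel)) \<partial>PiM I (\<lambda>_. lborel))"
    by (rule plane.product_nn_integral_fold[OF IJ]) measurable
  also have "\<dots> = (\<integral>\<^sup>+x. (\<integral>\<^sup>+y. F x * G y \<partial>PiM J (\<lambda>_. lborel)) \<partial>PiM I (\<lambda>_. lborel))"
  proof -
    have "F (merge I J (x, y)) = F x" for x y by (rule depF) (simp add: merge_def)
    moreover have "G (merge I J (x, y)) = G y" for x y by (rule depG) (use IJ in \<open>auto simp: merge_def\<close>)
    ultimately show ?thesis by simp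
  qed
  also have "\<dots> = (\<integral>\<^sup>+x. F x \<partial>PiM I (\<lambda>_. lborel)) * (\<integral>\<^sup>+x. G x \<partial>PiM J (\<lambda>_. lborel))"
    using F G by (simp add: nn_integral_cmult nn_integral_multc)
  finally show ?thesis .
qed

lemma measurable_coordinate:
  "j \<in> I \<Longrightarrow> (\<lambda>x. x j) \<in> borel_measurable (PiM I (\<lambda>_. lborel :: complex measure))"
  using measurable_component_singleton[of j I "\<lambda>_. lborel :: complex measure"] by simp

lemma measurable_tree_kernel_PiM:
  assumes "inners t \<subseteq> I"
  shows "(\<lambda>x. ennreal (tree_kernel w (vertex_pos z x) t)) \<in> borel_measurable (PiM I (\<lambda>_. lborel :: complex measure))"
  by (rule measurable_compose[OF measurable_tree_kernel measurable_ennreal])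
    (use assms in \<open>auto intro!: measurable_coordinate\<close>)

text \<open>The exponent \<open>c\<close> serves both as the (overestimated) strength of the singularities at the leaves and as
  the (underestimated) decay at infinity; every node lowers it by an arbitrarily small amount below \<open>1\<close>.\<close>

lemma tree_kernel_integral_bound:
  assumes "non_repeating t" "inj_on z (leaves t)" "0 < \<epsilon>" "\<epsilon> \<le> 1/2"
  shows "\<exists>c K. 1 - \<epsilon> < c \<and> c \<le> 1 \<and> K \<ge> 0 \<and> (\<forall>w. w \<notin> z ` leaves t \<longrightarrow>
     (\<integral>\<^sup>+u. ennreal (tree_kernel w (vertex_pos z u) t) \<partial>PiM (inners t) (\<lambda>_. lborel))
       \<le> ennreal (K * (\<Sum>i\<in>leaves t. norm (w - z i) powr -c)))"
  using assms
proof (induction t arbitrary: \<epsilon>)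
  case (Leaf i)
  show ?case
    using Leaf.prems by (intro exI[of _ 1]) (auto simp: powr_minus_divide PiM_empty nn_integral_count_space_finite)
next
  case (Node j s t)
  have e: "0 < \<epsilon>/3" "\<epsilon>/3 \<le> 1/2" using Node.prems by auto
  have nr: "non_repeating s" "non_repeating t" "j \<notin> inners s \<union> inners t" "inners s \<inter> inners t = {}" "leaves s \<inter> leaves t = {}"
    using Node.prems by auto
  have inj: "inj_on z (leaves s)" "inj_on z (leaves t)" using Node.prems(2) by (auto simp: inj_on_Un)
  obtain a Ks where s: "1 - \<epsilon>/3 < a" "a \<le> 1" "Ks \<ge> 0" "\<And>w. w \<notin> z ` leaves s \<Longrightarrow>
     (\<integral>\<^sup>+u. ennreal (tree_kernel w (vertex_pos z u) s) \<partial>PiM (inners s) (\<lambda>_. lborel))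
       \<le> ennreal (Ks * (\<Sum>i\<in>leaves s. norm (w - z i) powr -a))"
    using Node.IH(1)[OF nr(1) inj(1) e] by blast
  obtain b Kt where t: "1 - \<epsilon>/3 < b" "b \<le> 1" "Kt \<ge> 0" "\<And>w. w \<notin> z ` leaves t \<Longrightarrow>
     (\<integral>\<^sup>+u. ennreal (tree_kernel w (vertex_pos z u) t) \<partial>PiM (inners t) (\<lambda>_. lborel))
       \<le> ennreal (Kt * (\<Sum>i\<in>leaves t. norm (w - z i) powr -b))"
    using Node.IH(2)[OF nr(2) inj(2) e] by blast
  \<comment> \<open>Since a and b exceed 1 - \<epsilon>/3, the sum a + b - 1 exceeds 1 -
    2\<epsilon>/3. Giving away another \<epsilon>/6 makes c strictly smaller than a + b - 1 and
    still keeps it above 1 - \<epsilon>.\<close>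
  define c where "c = a + b - 1 - \<epsilon>/6"
  have c: "1 - \<epsilon> < c" "c \<le> 1" "0 < c" "c < a + b - 1" using s(1,2) t(1,2) Node.prems(3,4) by (auto simp: c_def)
  define P where "P i k K \<longleftrightarrow> K \<ge> 0 \<and> (\<forall>w. w \<noteq> z i \<longrightarrow> w \<noteq> z k \<longrightarrow>
           (\<integral>\<^sup>+u. ennreal (norm (u - z i) powr -a * norm (u - z k) powr -b / norm (u - w)) \<partial>lborel)
           \<le> ennreal (K * (norm (w - z i) powr -c + norm (w - z k) powr -c)))" for i k K
  have "\<exists>K. P i k K" if "i \<in> leaves s" "k \<in> leaves t" for i k
  proof -
    have "z i \<noteq> z k" using that Node.prems(2) nr(5) by (auto simp: inj_on_def)
    then show ?thesis unfolding P_def using nn_integral_cherry[of a b c "z i" "z k"] s(2) t(2) c by simp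
  qed
  then obtain K where K: "P i k (K i k)" if "i \<in> leaves s" "k \<in> leaves t" for i k
    by metis
  note K = K[unfolded P_def, THEN conjunct1] K[unfolded P_def, THEN conjunct2, rule_format]
  define K' where "K' = (\<Sum>i\<in>leaves s. \<Sum>k\<in>leaves t. Ks * Kt * (K i k * 2))"
  have K'0: "K' \<ge> 0" unfolding K'_def using K(1) s(3) t(3) by (intro sum_nonneg mult_nonneg_nonneg) auto
  have main: "(\<integral>\<^sup>+u. ennreal (tree_kernel w (vertex_pos z u) (Node j s t)) \<partial>PiM (inners (Node j s t)) (\<lambda>_. lborel))
       \<le> ennreal (K' * (\<Sum>i\<in>leaves (Node j s t). norm (w - z i) powr -c))"
    if w: "w \<notin> z ` leaves (Node j s t)" for w
  proof -
    let ?I = "inners s \<union> inners t"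
    let ?S = "\<Sum>i\<in>leaves (Node j s t). norm (w - z i) powr -c"
    have "(\<integral>\<^sup>+u. ennreal (tree_kernel w (vertex_pos z u) (Node j s t)) \<partial>PiM (inners (Node j s t)) (\<lambda>_. lborel))
      = (\<integral>\<^sup>+y. (\<integral>\<^sup>+x. ennreal (tree_kernel w (vertex_pos z (x(j := y))) (Node j s t)) \<partial>PiM ?I (\<lambda>_. lborel)) \<partial>lborel)"
      unfolding inners.simps using nr(3)
      by (intro plane.product_nn_integral_insert_rev measurable_tree_kernel_PiM) auto
    also have "\<dots> = (\<integral>\<^sup>+y. ennreal (1 / norm (w - y)) *
        ((\<integral>\<^sup>+x. ennreal (tree_kernel y (vertex_pos z x) s) \<partial>PiM (inners s) (\<lambda>_. lborel))
         * (\<integral>\<^sup>+x. ennreal (tree_kernel y (vertex_pos z x) t) \<partial>PiM (inners t) (\<lambda>_. lborel))) \<partial>lborel)"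
    proof (rule nn_integral_cong)
      fix y :: complex
      have eq: "tree_kernel y (vertex_pos z (x(j := y))) s = tree_kernel y (vertex_pos z x) s"
        "tree_kernel y (vertex_pos z (x(j := y))) t = tree_kernel y (vertex_pos z x) t" for x
        using nr(3) by (auto intro!: tree_kernel_cong)
      have "(\<integral>\<^sup>+x. ennreal (tree_kernel w (vertex_pos z (x(j := y))) (Node j s t)) \<partial>PiM ?I (\<lambda>_. lborel))
        = (\<integral>\<^sup>+x. ennreal (1 / norm (w - y)) * (ennreal (tree_kernel y (vertex_pos z x) s) * ennreal (tree_kernel y (vertex_pos z x) t)) \<partial>PiM ?I (\<lambda>_. lborel))"
        by (simp only: tree_kernel.simps vertex_pos_simps fun_upd_same eq ennreal_mult3 tree_kernel_nonneg zero_le_divide_1_iff norm_ge_zero)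
      also have "\<dots> = ennreal (1 / norm (w - y)) * (\<integral>\<^sup>+x. ennreal (tree_kernel y (vertex_pos z x) s) * ennreal (tree_kernel y (vertex_pos z x) t) \<partial>PiM ?I (\<lambda>_. lborel))"
        by (intro nn_integral_cmult borel_measurable_times_ennreal measurable_tree_kernel_PiM) auto
      also have "(\<integral>\<^sup>+x. ennreal (tree_kernel y (vertex_pos z x) s) * ennreal (tree_kernel y (vertex_pos z x) t) \<partial>PiM ?I (\<lambda>_. lborel))
        = (\<integral>\<^sup>+x. ennreal (tree_kernel y (vertex_pos z x) s) \<partial>PiM (inners s) (\<lambda>_. lborel))
         * (\<integral>\<^sup>+x. ennreal (tree_kernel y (vertex_pos z x) t) \<partial>PiM (inners t) (\<lambda>_. lborel))"
        using nr(4)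
        by (intro nn_integral_PiM_mult measurable_tree_kernel_PiM) (auto intro!: arg_cong[where f = ennreal] tree_kernel_cong)
      finally show "(\<integral>\<^sup>+x. ennreal (tree_kernel w (vertex_pos z (x(j := y))) (Node j s t)) \<partial>PiM ?I (\<lambda>_. lborel))
        = ennreal (1 / norm (w - y)) * ((\<integral>\<^sup>+x. ennreal (tree_kernel y (vertex_pos z x) s) \<partial>PiM (inners s) (\<lambda>_. lborel))
         * (\<integral>\<^sup>+x. ennreal (tree_kernel y (vertex_pos z x) t) \<partial>PiM (inners t) (\<lambda>_. lborel)))" .
    qed
    also have "\<dots> \<le> (\<integral>\<^sup>+y. (\<Sum>i\<in>leaves s. \<Sum>k\<in>leaves t. ennreal (Ks * Kt) *
          ennreal (norm (y - z i) powr -a * norm (y - z k) powr -b / norm (y - w))) \<partial>lborel)"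
    proof (rule nn_integral_mono_AE)
      \<comment> \<open>The inductive bounds are available only off the leaves, which are finitely
        many points and hence a null set.\<close>
      have "AE y in lborel. y \<notin> z ` leaves (Node j s t)"
        by (rule AE_not_in) (auto intro!: countable_imp_null_set_lborel countable_finite)
      then show "AE y in lborel. ennreal (1 / norm (w - y)) *
        ((\<integral>\<^sup>+x. ennreal (tree_kernel y (vertex_pos z x) s) \<partial>PiM (inners s) (\<lambda>_. lborel))
         * (\<integral>\<^sup>+x. ennreal (tree_kernel y (vertex_pos z x) t) \<partial>PiM (inners t) (\<lambda>_. lborel)))
         \<le> (\<Sum>i\<in>leaves s. \<Sum>k\<in>leaves t. ennreal (Ks * Kt) *
          ennreal (norm (y - z i) powr -a * norm (y - z k) powr -b / norm (y - w)))"
      proof (rule AE_mp, intro AE_I2 impI)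
        fix y :: complex assume y: "y \<notin> z ` leaves (Node j s t)"
        let ?A = "\<Sum>i\<in>leaves s. norm (y - z i) powr -a" and ?B = "\<Sum>i\<in>leaves t. norm (y - z i) powr -b"
        have "ennreal (1 / norm (w - y)) *
        ((\<integral>\<^sup>+x. ennreal (tree_kernel y (vertex_pos z x) s) \<partial>PiM (inners s) (\<lambda>_. lborel))
         * (\<integral>\<^sup>+x. ennreal (tree_kernel y (vertex_pos z x) t) \<partial>PiM (inners t) (\<lambda>_. lborel)))
         \<le> ennreal (1 / norm (w - y)) * (ennreal (Ks * ?A) * ennreal (Kt * ?B))"
          using y by (intro mult_left_mono mult_mono s t) auto
        also have "\<dots> = ennreal (1 / norm (w - y) * ((Ks * ?A) * (Kt * ?B)))"
          using s(3) t(3) by (intro ennreal_mult3[symmetric] mult_nonneg_nonneg sum_nonneg) auto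
        also have "1 / norm (w - y) * ((Ks * ?A) * (Kt * ?B)) = (\<Sum>i\<in>leaves s. \<Sum>k\<in>leaves t. (Ks * Kt) *
          (norm (y - z i) powr -a * norm (y - z k) powr -b / norm (y - w)))"
        proof -
          have "1 / norm (w - y) * ((Ks * ?A) * (Kt * ?B)) = Ks * Kt / norm (y - w) * (?A * ?B)"
            by (simp add: norm_minus_commute)
          also have "\<dots> = (\<Sum>i\<in>leaves s. \<Sum>k\<in>leaves t. Ks * Kt / norm (y - w) * (norm (y - z i) powr -a * norm (y - z k) powr -b))"
            unfolding sum_product by (simp only: sum_distrib_left)
          finally show ?thesis by (simp add: mult.commute)
        qed
        also have "ennreal \<dots> = (\<Sum>i\<in>leaves s. \<Sum>k\<in>leaves t. ennreal (Ks * Kt *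
          (norm (y - z i) powr -a * norm (y - z k) powr -b / norm (y - w))))"
          using s(3) t(3) by (intro sum_ennreal2[symmetric]) auto
        also have "\<dots> = (\<Sum>i\<in>leaves s. \<Sum>k\<in>leaves t. ennreal (Ks * Kt) *
          ennreal (norm (y - z i) powr -a * norm (y - z k) powr -b / norm (y - w)))"
          using s(3) t(3) by (intro sum.cong refl ennreal_mult) auto
        finally show "ennreal (1 / norm (w - y)) *
        ((\<integral>\<^sup>+x. ennreal (tree_kernel y (vertex_pos z x) s) \<partial>PiM (inners s) (\<lambda>_. lborel))
         * (\<integral>\<^sup>+x. ennreal (tree_kernel y (vertex_pos z x) t) \<partial>PiM (inners t) (\<lambda>_. lborel)))
         \<le> \<dots>" .
      qed
    qed
    also have "\<dots> = (\<Sum>i\<in>leaves s. \<Sum>k\<in>leaves t. ennreal (Ks * Kt) *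
          (\<integral>\<^sup>+y. ennreal (norm (y - z i) powr -a * norm (y - z k) powr -b / norm (y - w)) \<partial>lborel))"
      by (subst nn_integral_sum, measurable, subst nn_integral_sum, measurable, subst nn_integral_cmult, measurable)
    also have "\<dots> \<le> (\<Sum>i\<in>leaves s. \<Sum>k\<in>leaves t. ennreal (Ks * Kt) * ennreal (K i k * (2 * ?S)))"
    proof (intro sum_mono mult_left_mono)
      fix i k assume ik: "i \<in> leaves s" "k \<in> leaves t"
      have le: "norm (w - z l) powr -c \<le> ?S" if "l \<in> leaves (Node j s t)" for l
        using that by (intro member_le_sum[of l _ "\<lambda>i. norm (w - z i) powr -c"]) auto
      have "(\<integral>\<^sup>+y. ennreal (norm (y - z i) powr -a * norm (y - z k) powr -b / norm (y - w)) \<partial>lborel)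
         \<le> ennreal (K i k * (norm (w - z i) powr -c + norm (w - z k) powr -c))"
        using ik w by (intro K) auto
      also have "\<dots> \<le> ennreal (K i k * (2 * ?S))"
        using le[of i] le[of k] ik K(1) by (intro ennreal_leI mult_left_mono) auto
      finally show "(\<integral>\<^sup>+y. ennreal (norm (y - z i) powr -a * norm (y - z k) powr -b / norm (y - w)) \<partial>lborel)
         \<le> ennreal (K i k * (2 * ?S))" .
    qed auto
    also have "\<dots> = (\<Sum>i\<in>leaves s. \<Sum>k\<in>leaves t. ennreal (Ks * Kt * (K i k * 2) * ?S))"
      using s(3) t(3) K(1) by (intro sum.cong refl, subst ennreal_mult[symmetric]) (auto simp: sum_nonneg mult.assoc)
    also have "\<dots> = ennreal (K' * ?S)"
    proof -
      have "0 \<le> Ks * Kt * (K i k * 2) * ?S" if "i \<in> leaves s" "k \<in> leaves t" for i k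
        using s(3) t(3) K(1)[OF that] by (intro mult_nonneg_nonneg sum_nonneg) auto
      then show ?thesis unfolding K'_def sum_distrib_right
        by (intro sum_ennreal2) auto
    qed
    finally show ?thesis .
  qed
  show ?case using c K'0 main by (intro exI[of _ c] exI[of _ K']) auto
qed

text \<open>An edge is the set of its ends, so its length has to be written symmetrically: for a
  pair, the double sum counts the distance twice.\<close>

definition edge_weight :: "(vertex \<Rightarrow> complex) \<Rightarrow> vertex set \<Rightarrow> real" where
  "edge_weight p E = 1 / ((\<Sum>v\<in>E. \<Sum>w\<in>E. norm (p v - p w)) / 2)"

lemma edge_weight_pair [simp]: "edge_weight p {v, w} = 1 / norm (p v - p w)"
  by (cases "v = w") (auto simp: edge_weight_def norm_minus_commute)

lemma edge_weight_rooted_edges: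
  "prod_mset (image_mset (edge_weight p) (rooted_edges (r, t))) = tree_kernel (p (Ext r)) p t"
proof -
  have "prod_mset (image_mset (edge_weight p) (add_mset {v, top_vertex t} (btree_edges t))) = tree_kernel (p v) p t" for v
  proof (induction t arbitrary: v)
    case (Node j s t)
    show ?case by (simp add: Node.IH[of "Inner j", symmetric] mult_ac)
  qed simp
  then show ?thesis by simp
qed

section \<open>From single trees to forests and graphs\<close>

lemma inners_btree_vertices: "j \<in> inners t \<longleftrightarrow> Inner j \<in># btree_vertices t"
  and leaves_btree_vertices: "i \<in> leaves t \<longleftrightarrow> Ext i \<in># btree_vertices t"
  by (induction t) auto

lemma disjoint_of_count_le_1:
  "(\<And>v. count (A + B) v \<le> 1) \<Longrightarrow> v \<in># A \<Longrightarrow> v \<notin># B"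
  by (metis count_union count_greater_eq_one_iff add_le_same_cancel1 le_trans not_one_le_zero add_mono nat_1_add_1 numeral_le_one_iff semiring_norm(69))

lemma non_repeating_of_count:
  "(\<And>v. count (btree_vertices t) v \<le> 1) \<Longrightarrow> non_repeating t"
proof (induction t)
  case (Node j s t)
  let ?A = "{#Inner j#}" and ?S = "btree_vertices s" and ?T = "btree_vertices t"
  have le: "count (?A + (?S + ?T)) v \<le> 1" "count (?S + ?T) v \<le> 1" "count ?S v \<le> 1" "count ?T v \<le> 1" for v
    using Node.prems[of v] by (auto split: if_splits)
  have "Inner j \<notin># ?S + ?T" using disjoint_of_count_le_1[of ?A "?S + ?T"] le by auto
  moreover have "v \<in># ?S \<Longrightarrow> v \<notin># ?T" for v using disjoint_of_count_le_1[of ?S ?T] le by auto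
  ultimately show ?case using Node.IH le(3,4)
    by (auto simp: inners_btree_vertices leaves_btree_vertices)
qed simp

definition forest_kernel :: "(nat \<Rightarrow> complex) \<Rightarrow> (nat \<Rightarrow> complex) \<Rightarrow> (nat \<times> btree) list \<Rightarrow> real" where
  "forest_kernel z u Ts = (\<Prod>(r, t)\<leftarrow>Ts. tree_kernel (z r) (vertex_pos z u) t)"

text \<open>Trees of a forest have disjoint sets of integration variables, so the integral is a
  product over the trees. Each factor is finite because the root of a tree is an insertion point
  different from all its leaves.\<close>

lemma forest_kernel_integral_finite:
  assumes "\<And>v. count (\<Sum>T\<leftarrow>Ts. rooted_vertices T) v \<le> 1"
    and "inj_on z {i. Ext i \<in># (\<Sum>T\<leftarrow>Ts. rooted_vertices T)}"
  shows "(\<integral>\<^sup>+u. ennreal (forest_kernel z u Ts) \<partial>PiM {j. Inner j \<in># (\<Sum>T\<leftarrow>Ts. rooted_vertices T)} (\<lambda>_. lborel)) < \<infinity>"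
  using assms
proof (induction Ts)
  case Nil
  show ?case by (simp add: forest_kernel_def PiM_empty nn_integral_count_space_finite)
next
  case (Cons T Ts)
  obtain r t where T: "T = (r, t)" by (cases T)
  let ?V = "\<Sum>T\<leftarrow>Ts. rooted_vertices T"
  let ?J = "{j. Inner j \<in># ?V}"
  have le: "count (({#Ext r#} + btree_vertices t) + ?V) v \<le> 1" "count ({#Ext r#} + btree_vertices t) v \<le> 1"
    "count (btree_vertices t) v \<le> 1" "count ?V v \<le> 1" for v
    using Cons.prems(1)[of v] by (auto simp: T split: if_splits)
  have dis: "v \<notin># ?V" if "v \<in># {#Ext r#} + btree_vertices t" for v
    using disjoint_of_count_le_1[OF le(1)] that by blast
  have r: "r \<notin> leaves t"
    using disjoint_of_count_le_1[OF le(2), of "Ext r"] by (auto simp: leaves_btree_vertices)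
  have I: "{j. Inner j \<in># (\<Sum>T\<leftarrow>T # Ts. rooted_vertices T)} = inners t \<union> ?J"
    by (auto simp: T inners_btree_vertices)
  have E: "{i. Ext i \<in># (\<Sum>T\<leftarrow>T # Ts. rooted_vertices T)} = insert r (leaves t) \<union> {i. Ext i \<in># ?V}"
    by (auto simp: T leaves_btree_vertices)
  have "finite (Inner ` ?J)" by (rule finite_subset[OF _ finite_set_mset[of ?V]]) blast
  then have finJ: "finite ?J" by (rule finite_imageD) (auto intro: inj_onI)
  have inj: "inj_on z (insert r (leaves t))" "inj_on z {i. Ext i \<in># ?V}"
    using Cons.prems(2) unfolding E by (auto simp: inj_on_Un)
  obtain c K where K: "\<And>w. w \<notin> z ` leaves t \<Longrightarrow>
     (\<integral>\<^sup>+u. ennreal (tree_kernel w (vertex_pos z u) t) \<partial>PiM (inners t) (\<lambda>_. lborel))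
       \<le> ennreal (K * (\<Sum>i\<in>leaves t. norm (w - z i) powr -c))"
    using tree_kernel_integral_bound[of t z "1/2"] non_repeating_of_count[of t] le(3) inj(1) by auto
  have fin1: "(\<integral>\<^sup>+u. ennreal (tree_kernel (z r) (vertex_pos z u) t) \<partial>PiM (inners t) (\<lambda>_. lborel)) < \<infinity>"
    using K[of "z r"] r inj(1) by (auto simp: less_top[symmetric] top_unique)
  have fin2: "(\<integral>\<^sup>+u. ennreal (forest_kernel z u Ts) \<partial>PiM ?J (\<lambda>_. lborel)) < \<infinity>"
    using Cons.IH le(4) inj(2) by blast
  have meas: "(\<lambda>x. ennreal (forest_kernel z x Ts)) \<in> borel_measurable (PiM J (\<lambda>_. lborel))"
    if "?J \<subseteq> J" for J
  proof -
    have "(\<lambda>x. forest_kernel z x Ts) \<in> borel_measurable (PiM J (\<lambda>_. lborel))"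
      if "{j. Inner j \<in># (\<Sum>T\<leftarrow>Ts. rooted_vertices T)} \<subseteq> J" for Ts
      using that
    proof (induction Ts)
      case (Cons T Ts)
      obtain r t where T: "T = (r, t)" by (cases T)
      have "(\<lambda>x. tree_kernel (z r) (vertex_pos z x) t) \<in> borel_measurable (PiM J (\<lambda>_. lborel))"
        using Cons.prems by (intro measurable_tree_kernel)
          (auto simp: T inners_btree_vertices intro!: measurable_coordinate)
      moreover have "(\<lambda>x. forest_kernel z x Ts) \<in> borel_measurable (PiM J (\<lambda>_. lborel))"
        using Cons by auto
      ultimately show ?case unfolding forest_kernel_def by (simp add: T)
    qed (simp add: forest_kernel_def)
    then show ?thesis using that by simp
  qed
  have dep: "forest_kernel z x Ts = forest_kernel z x' Ts" if "\<And>j. j \<in> ?J \<Longrightarrow> x j = x' j" for x x'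
  proof -
    have "tree_kernel (z r) (vertex_pos z x) t = tree_kernel (z r) (vertex_pos z x') t" if "(r, t) \<in> set Ts" for r t
    proof (rule tree_kernel_cong)
      fix j assume "j \<in> inners t"
      then show "x j = x' j" using that
        by (intro \<open>\<And>j. j \<in> ?J \<Longrightarrow> x j = x' j\<close>) (auto simp: inners_btree_vertices intro!: bexI[of _ "(r, t)"])
    qed
    then show ?thesis unfolding forest_kernel_def by (intro arg_cong[where f = prod_list]) auto
  qed
  have "(\<integral>\<^sup>+u. ennreal (forest_kernel z u (T # Ts)) \<partial>PiM (inners t \<union> ?J) (\<lambda>_. lborel))
    = (\<integral>\<^sup>+u. ennreal (tree_kernel (z r) (vertex_pos z u) t) * ennreal (forest_kernel z u Ts) \<partial>PiM (inners t \<union> ?J) (\<lambda>_. lborel))"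
    by (simp add: forest_kernel_def T ennreal_mult'' prod_list_nonneg tree_kernel_nonneg ennreal_mult')
  also have "\<dots> = (\<integral>\<^sup>+u. ennreal (tree_kernel (z r) (vertex_pos z u) t) \<partial>PiM (inners t) (\<lambda>_. lborel))
      * (\<integral>\<^sup>+u. ennreal (forest_kernel z u Ts) \<partial>PiM ?J (\<lambda>_. lborel))"
  proof (rule nn_integral_PiM_mult)
    have "Inner j \<notin># ?V" if "j \<in> inners t" for j
      using that by (intro dis) (simp add: inners_btree_vertices)
    then show "inners t \<inter> ?J = {}" by blast
    show "ennreal (forest_kernel z x Ts) = ennreal (forest_kernel z x' Ts)" if "\<And>i. i \<in> ?J \<Longrightarrow> x i = x' i" for x x'
      using dep[OF that] by simp
    show "ennreal (tree_kernel (z r) (vertex_pos z x) t) = ennreal (tree_kernel (z r) (vertex_pos z x') t)"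
      if "\<And>i. i \<in> inners t \<Longrightarrow> x i = x' i" for x x'
      using tree_kernel_cong[of t x x' "z r" z, OF that] by simp
    show "finite ?J" by (rule finJ)
  qed (auto intro!: measurable_tree_kernel_PiM meas)
  also have "\<dots> < \<infinity>" using fin1 fin2 by (simp add: ennreal_mult_less_top)
  finally show ?case unfolding I .
qed

text \<open>The integrable majorant: it depends only on the graph, so all contractions and
  decorations of a graph share it.\<close>

definition graph_kernel :: "graph \<Rightarrow> (nat \<Rightarrow> complex) \<Rightarrow> (nat \<Rightarrow> complex) \<Rightarrow> real" where
  "graph_kernel \<Gamma> z u = prod_mset (image_mset (edge_weight (vertex_pos z u)) \<Gamma>)"

lemma graph_kernel_forest:
  "graph_kernel (\<Sum>T\<leftarrow>Ts. rooted_edges T) z u = forest_kernel z u Ts"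
proof (induction Ts)
  case (Cons T Ts)
  obtain r t where T: "T = (r, t)" by (cases T)
  have "graph_kernel (\<Sum>T\<leftarrow>T # Ts. rooted_edges T) z u
     = prod_mset (image_mset (edge_weight (vertex_pos z u)) (rooted_edges (r, t))) * graph_kernel (\<Sum>T\<leftarrow>Ts. rooted_edges T) z u"
    by (simp add: graph_kernel_def T)
  then show ?case using Cons unfolding edge_weight_rooted_edges by (simp add: forest_kernel_def T)
qed (simp add: graph_kernel_def forest_kernel_def)

lemma graph_kernel_integral_finite:
  assumes "disjoint_union_of_rooted_trees \<Phi> N \<Gamma> p" "inj_on z {..<length \<Phi>}"
  shows "(\<integral>\<^sup>+u. ennreal (graph_kernel \<Gamma> z u) \<partial>vol N) < \<infinity>"
proof -
  obtain Ts where Ts: "(\<Sum>T\<leftarrow>Ts. rooted_vertices T) = mset_set (Ext ` {..<length \<Phi>} \<union> Inner ` {..<N})"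
    "(\<Sum>T\<leftarrow>Ts. rooted_edges T) = \<Gamma>"
    using assms(1) unfolding disjoint_union_of_rooted_trees_def by blast
  have "{j. Inner j \<in># (\<Sum>T\<leftarrow>Ts. rooted_vertices T)} = {..<N}"
    "{j. Ext j \<in># (\<Sum>T\<leftarrow>Ts. rooted_vertices T)} = {..<length \<Phi>}"
    by (auto simp: Ts(1))
  moreover have "count (\<Sum>T\<leftarrow>Ts. rooted_vertices T) v \<le> 1" for v
    unfolding Ts(1) by (simp add: count_mset_set')
  ultimately show ?thesis
    using forest_kernel_integral_finite[of Ts z] assms(2)
    by (simp add: vol_def Ts(2)[symmetric] graph_kernel_forest)
qed

section \<open>Differentiation of parametric integrals\<close>

definition polydisc :: "nat \<Rightarrow> (nat \<Rightarrow> complex) \<Rightarrow> real \<Rightarrow> (nat \<Rightarrow> complex) set" where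
  "polydisc n z0 \<delta> = {z. \<forall>i<n. norm (z i - z0 i) < \<delta>}"

lemma polydisc_center: "0 < \<delta> \<Longrightarrow> z0 \<in> polydisc n z0 \<delta>"
  by (simp add: polydisc_def)

lemma polydisc_section:
  assumes "z \<in> polydisc n z0 \<delta>"
  shows "open {w. z(i := w) \<in> polydisc n z0 \<delta>}" "convex {w. z(i := w) \<in> polydisc n z0 \<delta>}"
    "z i \<in> {w. z(i := w) \<in> polydisc n z0 \<delta>}"
proof -
  have "{w. z(i := w) \<in> polydisc n z0 \<delta>} = (if i < n then ball (z0 i) \<delta> else UNIV)"
    using assms by (auto simp: polydisc_def dist_norm norm_minus_commute)
  then show "open {w. z(i := w) \<in> polydisc n z0 \<delta>}" "convex {w. z(i := w) \<in> polydisc n z0 \<delta>}"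
    by simp_all
qed (use assms in auto)

text \<open>Bounded amplitudes depending smoothly on the positions \<open>z\<close> in a polydisc, uniformly in the
  integration variable \<open>u\<close>.\<close>

inductive amplitude :: "'a measure \<Rightarrow> 'a set \<Rightarrow> nat \<Rightarrow> (nat \<Rightarrow> complex) \<Rightarrow> real
    \<Rightarrow> ((nat \<Rightarrow> complex) \<Rightarrow> 'a \<Rightarrow> complex) \<Rightarrow> bool"
  for M :: "'a measure" and \<Omega> :: "'a set" and n :: nat and z0 :: "nat \<Rightarrow> complex" and \<delta> :: real where
  amp_const: "a \<in> borel_measurable M \<Longrightarrow> (\<And>u. u \<in> \<Omega> \<Longrightarrow> norm (a u) \<le> K) \<Longrightarrow> amplitude M \<Omega> n z0 \<delta> (\<lambda>z. a)"
| amp_coord: "i < n \<Longrightarrow> amplitude M \<Omega> n z0 \<delta> (\<lambda>z u. z i - z0 i)"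
| amp_add: "amplitude M \<Omega> n z0 \<delta> s \<Longrightarrow> amplitude M \<Omega> n z0 \<delta> t \<Longrightarrow> amplitude M \<Omega> n z0 \<delta> (\<lambda>z u. s z u + t z u)"
| amp_mult: "amplitude M \<Omega> n z0 \<delta> s \<Longrightarrow> amplitude M \<Omega> n z0 \<delta> t \<Longrightarrow> amplitude M \<Omega> n z0 \<delta> (\<lambda>z u. s z u * t z u)"
| amp_cnj: "amplitude M \<Omega> n z0 \<delta> s \<Longrightarrow> amplitude M \<Omega> n z0 \<delta> (\<lambda>z u. cnj (s z u))"
| amp_inverse: "amplitude M \<Omega> n z0 \<delta> s \<Longrightarrow> (\<And>z u. z \<in> polydisc n z0 \<delta> \<Longrightarrow> u \<in> \<Omega> \<Longrightarrow> 1/2 \<le> norm (s z u))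
    \<Longrightarrow> amplitude M \<Omega> n z0 \<delta> (\<lambda>z u. inverse (s z u))"
| amp_ln: "amplitude M \<Omega> n z0 \<delta> s \<Longrightarrow> (\<And>z u. z \<in> polydisc n z0 \<delta> \<Longrightarrow> u \<in> \<Omega> \<Longrightarrow> 1/2 \<le> norm (s z u))
    \<Longrightarrow> amplitude M \<Omega> n z0 \<delta> (\<lambda>z u. of_real (ln (norm (s z u))))"

lemma amp_complex_const: "amplitude M \<Omega> n z0 \<delta> (\<lambda>z u. c)"
  by (rule amp_const[where K = "norm c"]) auto

lemma amp_sum: "finite A \<Longrightarrow> (\<And>i. i \<in> A \<Longrightarrow> amplitude M \<Omega> n z0 \<delta> (s i)) \<Longrightarrow> amplitude M \<Omega> n z0 \<delta> (\<lambda>z u. \<Sum>i\<in>A. s i z u)"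
  by (induction A rule: finite_induct) (auto intro: amp_add amp_complex_const)

lemma amp_prod: "finite A \<Longrightarrow> (\<And>i. i \<in> A \<Longrightarrow> amplitude M \<Omega> n z0 \<delta> (s i)) \<Longrightarrow> amplitude M \<Omega> n z0 \<delta> (\<lambda>z u. \<Prod>i\<in>A. s i z u)"
  by (induction A rule: finite_induct) (auto intro: amp_mult amp_complex_const)

lemma borel_measurable_cnj: "f \<in> borel_measurable M \<Longrightarrow> (\<lambda>x. cnj (f x)) \<in> borel_measurable M"
  by (rule measurable_compose[of f M borel cnj]) (auto intro!: borel_measurable_continuous_onI continuous_intros)

lemma amplitude_measurable: "amplitude M \<Omega> n z0 \<delta> s \<Longrightarrow> s z \<in> borel_measurable M"
  by (induction rule: amplitude.induct) (auto intro: borel_measurable_inverse borel_measurable_cnj)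

lemma amplitude_bounded:
  "amplitude M \<Omega> n z0 \<delta> s \<Longrightarrow> \<exists>K\<ge>0. \<forall>z\<in>polydisc n z0 \<delta>. \<forall>u\<in>\<Omega>. norm (s z u) \<le> K"
proof (induction rule: amplitude.induct)
  case (amp_const a K)
  show ?case by (rule exI[of _ "max 0 K"]) (auto intro: amp_const(2)[THEN order_trans])
next
  case (amp_coord i)
  then show ?case by (intro exI[of _ "max 0 \<delta>"]) (force simp: polydisc_def)
next
  case (amp_add s t)
  then obtain K L where "K \<ge> 0" "L \<ge> 0" "\<forall>z\<in>polydisc n z0 \<delta>. \<forall>u\<in>\<Omega>. norm (s z u) \<le> K" "\<forall>z\<in>polydisc n z0 \<delta>. \<forall>u\<in>\<Omega>. norm (t z u) \<le> L" by blast
  then show ?case by (intro exI[of _ "K + L"]) (auto intro: norm_triangle_mono)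
next
  case (amp_mult s t)
  then obtain K L where "K \<ge> 0" "L \<ge> 0" "\<forall>z\<in>polydisc n z0 \<delta>. \<forall>u\<in>\<Omega>. norm (s z u) \<le> K" "\<forall>z\<in>polydisc n z0 \<delta>. \<forall>u\<in>\<Omega>. norm (t z u) \<le> L" by blast
  then show ?case by (intro exI[of _ "K * L"]) (auto simp: norm_mult intro!: mult_mono)
next
  case (amp_inverse s)
  have "norm (inverse (s z u)) \<le> 2" if "z \<in> polydisc n z0 \<delta>" "u \<in> \<Omega>" for z u
    using amp_inverse(2)[OF that] le_imp_inverse_le[of "1/2" "norm (s z u)"] by (simp add: norm_inverse)
  then show ?case by (intro exI[of _ 2]) auto
next
  case (amp_ln s)
  then obtain K where K: "K \<ge> 0" "\<forall>z\<in>polydisc n z0 \<delta>. \<forall>u\<in>\<Omega>. norm (s z u) \<le> K" by blast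
  have "norm (of_real (ln (norm (s z u))) :: complex) \<le> \<bar>ln (1/2)\<bar> + \<bar>ln K\<bar>" if "z \<in> polydisc n z0 \<delta>" "u \<in> \<Omega>" for z u
  proof -
    have *: "1/2 \<le> norm (s z u)" "norm (s z u) \<le> K" using amp_ln(2)[OF that] K that by auto
    then have "ln (1/2) \<le> ln (norm (s z u))" "ln (norm (s z u)) \<le> ln K" by (subst ln_le_cancel_iff; linarith)+
    then have "\<bar>ln (norm (s z u))\<bar> \<le> \<bar>ln (1/2)\<bar> + \<bar>ln K\<bar>" by linarith
    then show ?thesis by (simp only: norm_of_real)
  qed
  moreover have "0 \<le> \<bar>ln (1/2)\<bar> + \<bar>ln K\<bar>" by (intro add_nonneg_nonneg abs_ge_zero)
  ultimately show ?case by blast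
qed auto

text \<open>The differential of ln|f| is the real part of df/f, written here as half the sum with
  the conjugate so as to fit the form p h + q cnj h.\<close>

lemma has_derivative_ln_norm:
  fixes f :: "complex \<Rightarrow> complex"
  assumes "(f has_derivative f') (at x)" "f x \<noteq> 0"
  shows "((\<lambda>w. complex_of_real (ln (norm (f w)))) has_derivative (\<lambda>h. (f' h / f x + cnj (f' h / f x)) / 2)) (at x)"
proof -
  have "((\<lambda>w. ln (norm (f w))) has_derivative (\<lambda>h. (f' h \<bullet> sgn (f x)) * inverse (norm (f x)))) (at x)"
    using assms by (intro has_derivative_ln has_derivative_compose[OF assms(1) has_derivative_norm, unfolded o_def]) auto
  then have "((\<lambda>w. complex_of_real (ln (norm (f w)))) has_derivative (\<lambda>h. of_real ((f' h \<bullet> sgn (f x)) * inverse (norm (f x))))) (at x)"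
    by (rule has_derivative_of_real)
  moreover have "complex_of_real ((f' h \<bullet> sgn (f x)) * inverse (norm (f x))) = (f' h / f x + cnj (f' h / f x)) / 2" for h
  proof -
    have "f' h / f x + cnj (f' h / f x) = of_real (2 * Re (f' h / f x))"
      by (rule complex_add_cnj)
    moreover have "Re (f' h / f x) = (f' h \<bullet> f x) / (norm (f x))\<^sup>2"
      by (simp add: Re_divide inner_complex_def cmod_power2)
    moreover have "(f' h \<bullet> sgn (f x)) * inverse (norm (f x)) = (f' h \<bullet> f x) / (norm (f x))\<^sup>2"
      by (simp add: sgn_div_norm divide_inverse power2_eq_square)
    ultimately show ?thesis by simp
  qed
  ultimately show ?thesis by (simp only:)
qed

text \<open>\<open>p\<close> and \<open>q\<close> are the Wirtinger derivatives of \<open>s\<close>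
  in the \<open>i\<close>-th position. That they are amplitudes again is what permits
  iteration.\<close>

definition wirtinger_pair :: "'a measure \<Rightarrow> 'a set \<Rightarrow> nat \<Rightarrow> (nat \<Rightarrow> complex) \<Rightarrow> real \<Rightarrow> nat \<Rightarrow> ((nat \<Rightarrow> complex) \<Rightarrow> 'a \<Rightarrow> complex)
    \<Rightarrow> ((nat \<Rightarrow> complex) \<Rightarrow> 'a \<Rightarrow> complex) \<Rightarrow> ((nat \<Rightarrow> complex) \<Rightarrow> 'a \<Rightarrow> complex) \<Rightarrow> bool" where
  "wirtinger_pair M \<Omega> n z0 \<delta> i s p q \<longleftrightarrow> amplitude M \<Omega> n z0 \<delta> p \<and> amplitude M \<Omega> n z0 \<delta> q \<and>
     (\<forall>z\<in>polydisc n z0 \<delta>. \<forall>u\<in>\<Omega>. ((\<lambda>w. s (z(i := w)) u) has_derivative (\<lambda>h. p z u * h + q z u * cnj h)) (at (z i)))"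

lemma wirtinger_pairI:
  assumes "amplitude M \<Omega> n z0 \<delta> p" "amplitude M \<Omega> n z0 \<delta> q"
    "\<And>z u. z \<in> polydisc n z0 \<delta> \<Longrightarrow> u \<in> \<Omega> \<Longrightarrow> ((\<lambda>w. s (z(i := w)) u) has_derivative (\<lambda>h. p z u * h + q z u * cnj h)) (at (z i))"
  shows "\<exists>p q. wirtinger_pair M \<Omega> n z0 \<delta> i s p q"
  unfolding wirtinger_pair_def using assms by (intro exI[of _ p] exI[of _ q]) simp

lemma wirtinger_pairD:
  assumes "wirtinger_pair M \<Omega> n z0 \<delta> i s p q"
  shows "amplitude M \<Omega> n z0 \<delta> p" "amplitude M \<Omega> n z0 \<delta> q"
    "z \<in> polydisc n z0 \<delta> \<Longrightarrow> u \<in> \<Omega> \<Longrightarrow> ((\<lambda>w. s (z(i := w)) u) has_derivative (\<lambda>h. p z u * h + q z u * cnj h)) (at (z i))"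
  using assms unfolding wirtinger_pair_def by simp_all

text \<open>By Wirtinger calculus on each constructor. Conjugation exchanges the two derivatives;
  those of the inverse and of the logarithm contain only the inverse, which stays bounded by the
  lower bound 1/2.\<close>

lemma amplitude_derivative:
  "amplitude M \<Omega> n z0 \<delta> s \<Longrightarrow> \<exists>p q. wirtinger_pair M \<Omega> n z0 \<delta> i s p q"
proof (induction rule: amplitude.induct)
  case (amp_const a K)
  show ?case by (rule wirtinger_pairI[OF amp_complex_const[of _ _ _ _ _ 0] amp_complex_const[of _ _ _ _ _ 0]]) simp
next
  case (amp_coord k)
  show ?case
    by (rule wirtinger_pairI[OF amp_complex_const[of _ _ _ _ _ "if k = i then 1 else 0"] amp_complex_const[of _ _ _ _ _ 0]])
      (auto intro!: derivative_eq_intros)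
next
  case (amp_add s t)
  then obtain p q p' q' where s: "wirtinger_pair M \<Omega> n z0 \<delta> i s p q" and t: "wirtinger_pair M \<Omega> n z0 \<delta> i t p' q'"
    by blast
  note s = wirtinger_pairD[OF s] and t = wirtinger_pairD[OF t]
  show ?case
  proof (rule wirtinger_pairI[OF amplitude.amp_add[OF s(1) t(1)] amplitude.amp_add[OF s(2) t(2)]])
    fix z u assume that: "z \<in> polydisc n z0 \<delta>" "u \<in> \<Omega>"
    show "((\<lambda>w. s (z(i := w)) u + t (z(i := w)) u) has_derivative (\<lambda>h. (p z u + p' z u) * h + (q z u + q' z u) * cnj h)) (at (z i))"
      by (rule has_derivative_eq_rhs[OF has_derivative_add[OF s(3)[OF that] t(3)[OF that]]]) (auto simp: algebra_simps)
  qed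
next
  case (amp_mult s t)
  then obtain p q p' q' where s: "wirtinger_pair M \<Omega> n z0 \<delta> i s p q" and t: "wirtinger_pair M \<Omega> n z0 \<delta> i t p' q'"
    by blast
  note s = wirtinger_pairD[OF s] and t = wirtinger_pairD[OF t]
  show ?case
  proof (rule wirtinger_pairI)
    show "amplitude M \<Omega> n z0 \<delta> (\<lambda>z u. s z u * p' z u + p z u * t z u)"
      "amplitude M \<Omega> n z0 \<delta> (\<lambda>z u. s z u * q' z u + q z u * t z u)"
      by (intro amplitude.amp_add amplitude.amp_mult s(1,2) t(1,2) amp_mult.hyps)+
    fix z u assume that: "z \<in> polydisc n z0 \<delta>" "u \<in> \<Omega>"
    show "((\<lambda>w. s (z(i := w)) u * t (z(i := w)) u) has_derivative
      (\<lambda>h. (s z u * p' z u + p z u * t z u) * h + (s z u * q' z u + q z u * t z u) * cnj h)) (at (z i))"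
      by (rule has_derivative_eq_rhs[OF has_derivative_mult[OF s(3)[OF that] t(3)[OF that]]]) (auto simp: algebra_simps)
  qed
next
  case (amp_cnj s)
  then obtain p q where s: "wirtinger_pair M \<Omega> n z0 \<delta> i s p q"
    by blast
  note s = wirtinger_pairD[OF s]
  show ?case
  proof (rule wirtinger_pairI[OF amplitude.amp_cnj[OF s(2)] amplitude.amp_cnj[OF s(1)]])
    fix z u assume that: "z \<in> polydisc n z0 \<delta>" "u \<in> \<Omega>"
    show "((\<lambda>w. cnj (s (z(i := w)) u)) has_derivative (\<lambda>h. cnj (q z u) * h + cnj (p z u) * cnj h)) (at (z i))"
      by (rule has_derivative_eq_rhs[OF has_derivative_cnj[OF s(3)[OF that]]]) (auto simp: algebra_simps)
  qed
next
  case (amp_inverse s)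
  then obtain p q where s: "wirtinger_pair M \<Omega> n z0 \<delta> i s p q"
    by blast
  note s = wirtinger_pairD[OF s]
  have inv: "amplitude M \<Omega> n z0 \<delta> (\<lambda>z u. inverse (s z u))" using amp_inverse.hyps by (rule amplitude.amp_inverse)
  show ?case
  proof (rule wirtinger_pairI)
    show "amplitude M \<Omega> n z0 \<delta> (\<lambda>z u. - 1 * inverse (s z u) * inverse (s z u) * p z u)"
      "amplitude M \<Omega> n z0 \<delta> (\<lambda>z u. - 1 * inverse (s z u) * inverse (s z u) * q z u)"
      by (intro amplitude.amp_mult s(1,2) inv amp_complex_const)+
    fix z u assume that: "z \<in> polydisc n z0 \<delta>" "u \<in> \<Omega>"
    have "s z u \<noteq> 0" using amp_inverse.hyps(2)[OF that] by auto
    then show "((\<lambda>w. inverse (s (z(i := w)) u)) has_derivative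
      (\<lambda>h. (- 1 * inverse (s z u) * inverse (s z u) * p z u) * h + (- 1 * inverse (s z u) * inverse (s z u) * q z u) * cnj h)) (at (z i))"
      by (intro has_derivative_eq_rhs[OF Deriv.has_derivative_inverse[OF _ s(3)[OF that]]]) (auto simp: algebra_simps)
  qed
next
  case (amp_ln s)
  then obtain p q where s: "wirtinger_pair M \<Omega> n z0 \<delta> i s p q"
    by blast
  note s = wirtinger_pairD[OF s]
  have inv: "amplitude M \<Omega> n z0 \<delta> (\<lambda>z u. inverse (s z u))" using amp_ln.hyps by (rule amplitude.amp_inverse)
  show ?case
  proof (rule wirtinger_pairI)
    show "amplitude M \<Omega> n z0 \<delta> (\<lambda>z u. 1/2 * (p z u * inverse (s z u) + cnj (q z u * inverse (s z u))))"
      "amplitude M \<Omega> n z0 \<delta> (\<lambda>z u. 1/2 * (q z u * inverse (s z u) + cnj (p z u * inverse (s z u))))"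
      by (intro amplitude.amp_mult amplitude.amp_add amplitude.amp_cnj s(1,2) inv amp_complex_const)+
    fix z u assume that: "z \<in> polydisc n z0 \<delta>" "u \<in> \<Omega>"
    have nz: "s z u \<noteq> 0" using amp_ln.hyps(2)[OF that] by auto
    show "((\<lambda>w. complex_of_real (ln (norm (s (z(i := w)) u)))) has_derivative
      (\<lambda>h. (1/2 * (p z u * inverse (s z u) + cnj (q z u * inverse (s z u)))) * h
         + (1/2 * (q z u * inverse (s z u) + cnj (p z u * inverse (s z u)))) * cnj h)) (at (z i))"
      by (rule has_derivative_eq_rhs[OF has_derivative_ln_norm[OF s(3)[OF that]]]) (use nz in \<open>auto simp: field_simps\<close>)
  qed
qed

section \<open>Integrals of a fixed weight times an amplitude\<close>

lemma set_integrable_amplitude: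
  assumes h: "set_integrable M \<Omega> h" and hm: "h \<in> borel_measurable M" and \<Omega>: "\<Omega> \<in> sets M"
    and s: "amplitude M \<Omega> n z0 \<delta> s" and z: "z \<in> polydisc n z0 \<delta>"
  shows "set_integrable M \<Omega> (\<lambda>u. h u * s z u :: complex)"
proof -
  note [measurable] = hm \<Omega> amplitude_measurable[OF s]
  obtain K where K: "K \<ge> 0" "\<forall>z\<in>polydisc n z0 \<delta>. \<forall>u\<in>\<Omega>. norm (s z u) \<le> K" using amplitude_bounded[OF s] by blast
  have "set_integrable M \<Omega> (\<lambda>u. of_real K * h u)" using h by simp
  then show ?thesis
  proof (rule set_integrable_bound)
    show "set_borel_measurable M \<Omega> (\<lambda>u. h u * s z u)" unfolding set_borel_measurable_def by measurable
    show "AE u in M. u \<in> \<Omega> \<longrightarrow> norm (h u * s z u) \<le> norm (of_real K * h u)"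
      using K z by (auto simp: norm_mult mult.commute[of "norm (h _)"] intro!: mult_right_mono)
  qed
qed

text \<open>Dominated convergence for the remainder quotient of s. Bounds for p and q on the whole
  polydisc make s Lipschitz in the \<open>i\<close>-th position uniformly in u, so the quotient is
  at most 2 (Kp + Kq) and a multiple of |h| dominates.\<close>

lemma has_derivative_amplitude_integral:
  fixes h :: "'a \<Rightarrow> complex"
  assumes h: "set_integrable M \<Omega> h" and hm: "h \<in> borel_measurable M" and \<Omega>: "\<Omega> \<in> sets M"
    and amp: "amplitude M \<Omega> n z0 \<delta> s" "amplitude M \<Omega> n z0 \<delta> p" "amplitude M \<Omega> n z0 \<delta> q"
    and der: "\<And>z u. z \<in> polydisc n z0 \<delta> \<Longrightarrow> u \<in> \<Omega> \<Longrightarrow> ((\<lambda>w. s (z(i := w)) u) has_derivative (\<lambda>h. p z u * h + q z u * cnj h)) (at (z i))"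
    and z: "z \<in> polydisc n z0 \<delta>"
  shows "((\<lambda>w. LINT u:\<Omega>|M. h u * s (z(i := w)) u) has_derivative
     (\<lambda>d. (LINT u:\<Omega>|M. h u * p z u) * d + (LINT u:\<Omega>|M. h u * q z u) * cnj d)) (at (z i))"
proof -
  define D where "D = {w. z(i := w) \<in> polydisc n z0 \<delta>}"
  have D: "open D" "convex D" "z i \<in> D" using polydisc_section[OF z, of i] by (auto simp: D_def)
  obtain Kp where Kp: "Kp \<ge> 0" "\<forall>z\<in>polydisc n z0 \<delta>. \<forall>u\<in>\<Omega>. norm (p z u) \<le> Kp" using amplitude_bounded[OF amp(2)] by blast
  obtain Kq where Kq: "Kq \<ge> 0" "\<forall>z\<in>polydisc n z0 \<delta>. \<forall>u\<in>\<Omega>. norm (q z u) \<le> Kq" using amplitude_bounded[OF amp(3)] by blast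
  note int = set_integrable_amplitude[OF h hm \<Omega>]
  have lin: "norm (p z' u * d + q z' u * cnj d) \<le> (Kp + Kq) * norm d" if "z' \<in> polydisc n z0 \<delta>" "u \<in> \<Omega>" for z' u d
  proof -
    have "norm (p z' u * d + q z' u * cnj d) \<le> norm (p z' u) * norm d + norm (q z' u) * norm d"
      by (rule order_trans[OF norm_triangle_ineq]) (simp add: norm_mult)
    also have "\<dots> \<le> Kp * norm d + Kq * norm d" using Kp Kq that by (intro add_mono mult_right_mono) auto
    finally show ?thesis by (simp add: algebra_simps)
  qed
  \<comment> \<open>Mean value inequality on the convex slice of the polydisc.\<close>
  have lip: "norm (s (z(i := w)) u - s z u) \<le> (Kp + Kq) * norm (w - z i)" if w: "w \<in> D" and u: "u \<in> \<Omega>" for w u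
  proof -
    have "norm (s (z(i := w)) u - s (z(i := z i)) u) \<le> (Kp + Kq) * norm (w - z i)"
    proof (rule differentiable_bound[OF D(2), of "\<lambda>w. s (z(i := w)) u" "\<lambda>w d. p (z(i := w)) u * d + q (z(i := w)) u * cnj d"])
      fix w assume "w \<in> D"
      then have zw: "z(i := w) \<in> polydisc n z0 \<delta>" by (simp add: D_def)
      show "((\<lambda>w. s (z(i := w)) u) has_derivative (\<lambda>d. p (z(i := w)) u * d + q (z(i := w)) u * cnj d)) (at w within D)"
        using der[OF zw u] by (simp add: has_derivative_at_withinI)
      show "onorm (\<lambda>d. p (z(i := w)) u * d + q (z(i := w)) u * cnj d) \<le> Kp + Kq"
        using lin[OF zw u] by (rule onorm_le)
    qed (use D w in auto)
    then show ?thesis by simp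
  qed
  let ?F = "\<lambda>w. LINT u:\<Omega>|M. h u * s (z(i := w)) u"
  let ?F' = "\<lambda>d. (LINT u:\<Omega>|M. h u * p z u) * d + (LINT u:\<Omega>|M. h u * q z u) * cnj d"
  define r where "r w u = (s (z(i := w)) u - s z u - (p z u * (w - z i) + q z u * cnj (w - z i))) / of_real (norm (w - z i))" for w u
  have rem: "(?F w - ?F (z i) - ?F' (w - z i)) / of_real (norm (w - z i)) = (LINT u:\<Omega>|M. h u * r w u)" if "w \<in> D" for w
  proof -
    have zw: "z(i := w) \<in> polydisc n z0 \<delta>" using that by (simp add: D_def)
    have "(LINT u:\<Omega>|M. h u * r w u) = (LINT u:\<Omega>|M. ((h u * s (z(i := w)) u - h u * s z u) - (h u * p z u * (w - z i) + h u * q z u * cnj (w - z i))) / of_real (norm (w - z i)))"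
      by (rule set_lebesgue_integral_cong[OF \<Omega>]) (auto simp: r_def algebra_simps)
    also have "\<dots> = (LINT u:\<Omega>|M. (h u * s (z(i := w)) u - h u * s z u) - (h u * p z u * (w - z i) + h u * q z u * cnj (w - z i))) / of_real (norm (w - z i))"
      by (rule set_integral_divide_zero)
    also have "(LINT u:\<Omega>|M. (h u * s (z(i := w)) u - h u * s z u) - (h u * p z u * (w - z i) + h u * q z u * cnj (w - z i))) = ?F w - ?F (z i) - ?F' (w - z i)"
      using int[OF amp(1) zw] int[OF amp(1) z] int[OF amp(2) z] int[OF amp(3) z]
      by (simp add: set_integral_diff set_integral_add)
    finally show ?thesis by simp
  qed
  have lim: "((\<lambda>w. LINT u:\<Omega>|M. h u * r w u) \<longlongrightarrow> 0) (at (z i))"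
    unfolding tendsto_at_iff_sequentially
  proof (intro allI impI)
    fix y :: "nat \<Rightarrow> complex" assume y: "\<forall>k. y k \<in> UNIV - {z i}" "y \<longlonglongrightarrow> z i"
    \<comment> \<open>The bound holds only inside the slice, so an initial part of the sequence is
      cut off.\<close>
    obtain k0 where k0: "\<And>k. k \<ge> k0 \<Longrightarrow> y k \<in> D"
      using topological_tendstoD[OF y(2) D(1) D(3)] by (auto simp: eventually_sequentially)
    have "((\<lambda>k. LINT u:\<Omega>|M. h u * r (y (k + k0)) u) \<longlonglongrightarrow> (LINT u:\<Omega>|M. 0))"
      unfolding set_lebesgue_integral_def
    proof (rule integral_dominated_convergence[where w = "\<lambda>u. indicator \<Omega> u *\<^sub>R (2 * (Kp + Kq) * norm (h u))"])
      note [measurable] = hm \<Omega> amplitude_measurable[OF amp(1)] amplitude_measurable[OF amp(2)] amplitude_measurable[OF amp(3)]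
      show "(\<lambda>u. indicator \<Omega> u *\<^sub>R (h u * r (y (k + k0)) u)) \<in> borel_measurable M" for k
        unfolding r_def by measurable
      show "integrable M (\<lambda>u. indicator \<Omega> u *\<^sub>R (2 * (Kp + Kq) * norm (h u)))"
        using set_integrable_mult_right[of "2 * (Kp + Kq)", OF set_integrable_norm[OF h]] unfolding set_integrable_def .
      have pt: "(\<lambda>k. r (y (k + k0)) u) \<longlonglongrightarrow> 0" if "u \<in> \<Omega>" for u
      proof -
        have "((\<lambda>w. (s (z(i := w)) u - s (z(i := z i)) u - (p z u * (w - z i) + q z u * cnj (w - z i))) /\<^sub>R norm (w - z i)) \<longlongrightarrow> 0) (at (z i))"
          using der[OF z that] unfolding has_derivative_def by (auto simp: netlimit_at)
        then have "((\<lambda>w. r w u) \<longlongrightarrow> 0) (at (z i))"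
          by (simp add: r_def scaleR_conv_of_real divide_inverse mult.commute)
        then have "(\<lambda>k. r (y k) u) \<longlonglongrightarrow> 0"
          using y unfolding tendsto_at_iff_sequentially by (auto simp: o_def)
        then show ?thesis by (rule LIMSEQ_ignore_initial_segment)
      qed
      show "AE u in M. (\<lambda>k. indicator \<Omega> u *\<^sub>R (h u * r (y (k + k0)) u)) \<longlonglongrightarrow> indicator \<Omega> u *\<^sub>R 0"
      proof (intro AE_I2)
        fix u
        show "(\<lambda>k. indicator \<Omega> u *\<^sub>R (h u * r (y (k + k0)) u)) \<longlonglongrightarrow> indicator \<Omega> u *\<^sub>R 0"
          using tendsto_mult[OF tendsto_const[of "h u"] pt[of u]] by (cases "u \<in> \<Omega>") auto
      qed
      show "AE u in M. norm (indicator \<Omega> u *\<^sub>R (h u * r (y (k + k0)) u)) \<le> indicator \<Omega> u *\<^sub>R (2 * (Kp + Kq) * norm (h u))" for k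
      proof (intro AE_I2)
        fix u
        have yD: "y (k + k0) \<in> D" using k0 by simp
        have ne: "norm (y (k + k0) - z i) > 0" using y(1) by simp
        have "norm (r (y (k + k0)) u) \<le> 2 * (Kp + Kq)" if "u \<in> \<Omega>"
        proof -
          have "norm (s (z(i := y (k + k0))) u - s z u - (p z u * (y (k + k0) - z i) + q z u * cnj (y (k + k0) - z i)))
             \<le> (Kp + Kq) * norm (y (k + k0) - z i) + (Kp + Kq) * norm (y (k + k0) - z i)"
            by (rule order_trans[OF norm_triangle_ineq4]) (intro add_mono lip[OF yD that] lin[OF z that])
          also have "\<dots> = (2 * (Kp + Kq)) * norm (y (k + k0) - z i)" by (simp only: mult_2 distrib_right)
          finally show ?thesis by (simp only: r_def norm_divide norm_of_real abs_norm_cancel pos_divide_le_eq[OF ne])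
        qed
        then show "norm (indicator \<Omega> u *\<^sub>R (h u * r (y (k + k0)) u)) \<le> indicator \<Omega> u *\<^sub>R (2 * (Kp + Kq) * norm (h u))"
          by (cases "u \<in> \<Omega>") (auto simp: norm_mult mult.commute[of "norm (h u)"] intro!: mult_right_mono)
      qed
    qed simp
    then have "((\<lambda>k. LINT u:\<Omega>|M. h u * r (y (k + k0)) u) \<longlonglongrightarrow> 0)" by simp
    then show "((\<lambda>w. LINT u:\<Omega>|M. h u * r w u) \<circ> y) \<longlonglongrightarrow> 0"
      unfolding o_def by (rule LIMSEQ_offset)
  qed
  have ev: "eventually (\<lambda>w. w \<in> D) (at (z i))" using D by (auto simp: eventually_at_topological)
  show ?thesis
    unfolding has_derivative_def
  proof (intro conjI)
    show "bounded_linear ?F'"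
      by (intro bounded_linear_add bounded_linear_mult_right bounded_linear_compose[OF bounded_linear_mult_right bounded_linear_cnj])
    have "((\<lambda>w. (?F w - ?F (z i) - ?F' (w - z i)) / of_real (norm (w - z i))) \<longlongrightarrow> 0) (at (z i))"
      using lim by (rule Lim_transform_eventually) (use ev rem in \<open>auto elim!: eventually_mono\<close>)
    then show "((\<lambda>w. (?F w - ?F (Lim (at (z i)) (\<lambda>x. x)) - ?F' (w - Lim (at (z i)) (\<lambda>x. x))) /\<^sub>R norm (w - Lim (at (z i)) (\<lambda>x. x))) \<longlongrightarrow> 0) (at (z i))"
      by (simp add: netlimit_at scaleR_conv_of_real divide_inverse mult.commute)
  qed
qed

lemma dz_dzbar_has_derivative:
  assumes "(f has_derivative (\<lambda>d. P * d + Q * cnj d)) (at w)"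
  shows "dz f w = P" "dzbar f w = Q"
proof -
  have "frechet_derivative f (at w) = (\<lambda>d. P * d + Q * cnj d)"
    using frechet_derivative_at[OF assms] by simp
  then show "dz f w = P" "dzbar f w = Q"
    by (simp_all add: dz_def dzbar_def algebra_simps)
qed

text \<open>Each letter of the word replaces the amplitude by one of its Wirtinger derivatives and
  leaves the integrable weight h alone.\<close>

lemma iter_deriv_amplitude_integral:
  fixes h :: "'a \<Rightarrow> complex"
  assumes h: "set_integrable M \<Omega> h" and hm: "h \<in> borel_measurable M" and \<Omega>: "\<Omega> \<in> sets M"
    and amp: "amplitude M \<Omega> n z0 \<delta> s"
    and F: "\<And>z. z \<in> polydisc n z0 \<delta> \<Longrightarrow> F z = (LINT u:\<Omega>|M. h u * s z u)"
  shows "\<exists>s'. amplitude M \<Omega> n z0 \<delta> s' \<and> (\<forall>z\<in>polydisc n z0 \<delta>. iter_deriv ws F z = (LINT u:\<Omega>|M. h u * s' z u))"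
    and "z \<in> polydisc n z0 \<delta> \<Longrightarrow> (\<lambda>w. iter_deriv ws F (z(i := w))) differentiable (at (z i))"
proof -
  have step: "\<exists>p q. amplitude M \<Omega> n z0 \<delta> p \<and> amplitude M \<Omega> n z0 \<delta> q \<and> (\<forall>z\<in>polydisc n z0 \<delta>.
      ((\<lambda>w. G (z(i := w))) has_derivative (\<lambda>d. (LINT u:\<Omega>|M. h u * p z u) * d + (LINT u:\<Omega>|M. h u * q z u) * cnj d)) (at (z i)))"
    if G: "\<And>z. z \<in> polydisc n z0 \<delta> \<Longrightarrow> G z = (LINT u:\<Omega>|M. h u * s' z u)" and s': "amplitude M \<Omega> n z0 \<delta> s'" for G s' i
  proof -
    obtain p q where pq: "wirtinger_pair M \<Omega> n z0 \<delta> i s' p q"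
      using amplitude_derivative[OF s', of i] by blast
    note pq = wirtinger_pairD[OF pq]
    have "((\<lambda>w. G (z(i := w))) has_derivative (\<lambda>d. (LINT u:\<Omega>|M. h u * p z u) * d + (LINT u:\<Omega>|M. h u * q z u) * cnj d)) (at (z i))"
      if z: "z \<in> polydisc n z0 \<delta>" for z
      by (rule has_derivative_transform_within_open[OF has_derivative_amplitude_integral[OF h hm \<Omega> s' pq z] polydisc_section(1,3)[OF z]])
        (auto simp only: G mem_Collect_eq)
    then show ?thesis using pq by blast
  qed
  have all: "\<exists>s'. amplitude M \<Omega> n z0 \<delta> s' \<and> (\<forall>z\<in>polydisc n z0 \<delta>. iter_deriv ws F z = (LINT u:\<Omega>|M. h u * s' z u))" for ws
  proof (induction ws)
    case Nil then show ?case using amp F by auto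
  next
    case (Cons a ws)
    obtain bar i where a: "a = (bar, i)" by (cases a)
    obtain s' where s': "amplitude M \<Omega> n z0 \<delta> s'" "\<And>z. z\<in>polydisc n z0 \<delta> \<Longrightarrow> iter_deriv ws F z = (LINT u:\<Omega>|M. h u * s' z u)"
      using Cons by blast
    obtain p q where pq: "amplitude M \<Omega> n z0 \<delta> p" "amplitude M \<Omega> n z0 \<delta> q" "\<And>z. z\<in>polydisc n z0 \<delta> \<Longrightarrow>
      ((\<lambda>w. iter_deriv ws F (z(i := w))) has_derivative (\<lambda>d. (LINT u:\<Omega>|M. h u * p z u) * d + (LINT u:\<Omega>|M. h u * q z u) * cnj d)) (at (z i))"
      using step[OF s'(2) s'(1), of i] by blast
    show ?case
      using pq(1,2) dz_dzbar_has_derivative[OF pq(3)] by (cases bar) (auto simp: a)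
  qed
  show "\<exists>s'. amplitude M \<Omega> n z0 \<delta> s' \<and> (\<forall>z\<in>polydisc n z0 \<delta>. iter_deriv ws F z = (LINT u:\<Omega>|M. h u * s' z u))"
    by (rule all)
  assume z: "z \<in> polydisc n z0 \<delta>"
  obtain s' where s': "amplitude M \<Omega> n z0 \<delta> s'" "\<And>z. z\<in>polydisc n z0 \<delta> \<Longrightarrow> iter_deriv ws F z = (LINT u:\<Omega>|M. h u * s' z u)"
    using all[of ws] by blast
  show "(\<lambda>w. iter_deriv ws F (z(i := w))) differentiable (at (z i))"
    using step[OF s'(2) s'(1), of i] z unfolding differentiable_def by blast
qed

section \<open>Change of variables in the plane\<close>

text \<open>The determinant and the change of variables formula are applied on
  \<open>real^2\<close>; \<open>c2v\<close> and \<open>v2c\<close> carry the plane there and back,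
  preserving Lebesgue measure.\<close>

definition c2v :: "complex \<Rightarrow> real^2" where "c2v x = (\<chi> k. if k = 1 then Re x else Im x)"
definition v2c :: "real^2 \<Rightarrow> complex" where "v2c y = Complex (y $ 1) (y $ 2)"

lemma c2v_v2c [simp]: "c2v (v2c y) = y" "v2c (c2v x) = x"
  by (auto simp: c2v_def v2c_def vec_eq_iff forall_2)

lemma linear_c2v: "bounded_linear c2v" and linear_v2c: "bounded_linear v2c"
  by (auto simp: c2v_def v2c_def vec_eq_iff complex_eq_iff linear_conv_bounded_linear[symmetric] intro!: linearI)

lemma measurable_c2v [measurable]: "c2v \<in> borel_measurable borel" and measurable_v2c [measurable]: "v2c \<in> borel_measurable borel"
  by (auto intro!: borel_measurable_continuous_onI linear_continuous_on linear_c2v linear_v2c)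

lemma Basis_real2: "(Basis :: (real^2) set) = {axis 1 1, axis 2 1}"
  by (auto simp: Basis_vec_def UNIV_2)

lemma distr_c2v: "distr lborel borel c2v = lborel"
proof (rule lborel_eqI[symmetric])
  fix l u :: "real^2" assume le: "\<And>b. b \<in> Basis \<Longrightarrow> l \<bullet> b \<le> u \<bullet> b"
  have le': "l $ 1 \<le> u $ 1" "l $ 2 \<le> u $ 2"
    using le[of "axis 1 1"] le[of "axis 2 1"] by (auto simp: Basis_real2 inner_axis)
  have "c2v -` box l u = box (v2c l) (v2c u)"
    by (auto simp: mem_box Basis_real2 Basis_complex_def inner_axis c2v_def v2c_def)
  then have "emeasure (distr lborel borel c2v) (box l u) = emeasure lborel (box (v2c l) (v2c u))"
    by (subst emeasure_distr) auto
  also have "\<dots> = (\<Prod>b\<in>Basis. (u - l) \<bullet> b)"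
    using le' by (subst emeasure_lborel_box) (auto simp: Basis_real2 Basis_complex_def v2c_def inner_axis axis_eq_axis inner_complex_def)
  finally show "emeasure (distr lborel borel c2v) (box l u) = (\<Prod>b\<in>Basis. (u - l) \<bullet> b)" .
qed simp

text \<open>The real-linear map d \<mapsto> A d + E cnj d has determinant |A|^2 - |E|^2. Two
  measures are compared on boxes: the preimage of a box has as its image the box, so the measure of
  the box is the integral of the determinant over the preimage.\<close>

lemma lborel_change_of_variables:
  fixes \<phi> A E :: "complex \<Rightarrow> complex" and J :: "complex \<Rightarrow> real"
  assumes der: "\<And>v. (\<phi> has_derivative (\<lambda>d. A v * d + E v * cnj d)) (at v)"
    and bij: "inj \<phi>" "surj \<phi>"
    and J: "\<And>v. J v = (norm (A v))\<^sup>2 - (norm (E v))\<^sup>2" "\<And>v. 0 \<le> J v"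
    and [measurable]: "J \<in> borel_measurable borel"
  shows "distr (density lborel (\<lambda>v. ennreal (J v))) borel \<phi> = lborel"
proof (rule lborel_eqI[symmetric])
  have cont: "continuous_on UNIV \<phi>"
    by (simp add: continuous_on_eq_continuous_at has_derivative_continuous[OF der])
  then have [measurable]: "\<phi> \<in> borel_measurable borel" by (rule borel_measurable_continuous_onI)
  fix l u :: complex assume le: "\<And>b. b \<in> Basis \<Longrightarrow> l \<bullet> b \<le> u \<bullet> b"
  define g where "g = c2v \<circ> \<phi> \<circ> v2c"
  define g' where "g' y = c2v \<circ> (\<lambda>d. A (v2c y) * d + E (v2c y) * cnj d) \<circ> v2c" for y
  have gder: "(g has_derivative g' y) (at y within S)" for y S
  proof -
    note v2c = bounded_linear_imp_has_derivative[OF linear_v2c, of "at y"]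
    note c2v = bounded_linear_imp_has_derivative[OF linear_c2v, of "at (\<phi> (v2c y))"]
    show ?thesis unfolding g_def g'_def
      by (rule has_derivative_at_withinI[OF diff_chain_at[OF v2c diff_chain_at[OF der c2v]]])
  qed
  define S where "S = g -` (v2c -` box l u)"
  have gmeas [measurable]: "g \<in> borel_measurable borel" unfolding g_def by measurable
  have boxm: "v2c -` box l u \<in> sets borel" using measurable_sets[OF measurable_v2c, of "box l u"] by simp
  have S: "S \<in> sets borel" unfolding S_def using measurable_sets[OF gmeas boxm] by simp
  have surj: "surj g" unfolding g_def using bij(2) by (metis c2v_v2c comp_apply surj_def)
  have inj: "inj g" unfolding g_def
    using inj_on_inverseI[of UNIV v2c c2v] inj_on_inverseI[of UNIV c2v v2c] bij(1) by (intro inj_compose) auto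
  have img: "g ` S = v2c -` box l u" unfolding S_def using surj by (simp add: surj_image_vimage_eq)
  have meas: "emeasure lborel (v2c -` box l u) = (\<Prod>b\<in>Basis. (u - l) \<bullet> b)"
  proof -
    have "emeasure lborel (v2c -` box l u) = emeasure (distr lborel borel c2v) (v2c -` box l u)"
      by (simp add: distr_c2v)
    also have "\<dots> = emeasure lborel (box l u)"
      using boxm by (subst emeasure_distr) (auto simp: vimage_def)
    finally show ?thesis using le by (simp add: emeasure_lborel_box)
  qed
  have nn: "0 \<le> (\<Prod>b\<in>Basis. (u - l) \<bullet> b)" using le by (intro prod_nonneg) (auto simp: inner_diff_left)
  have lm: "g ` S \<in> lmeasurable"
    unfolding img by (rule fmeasurableI) (use boxm meas in \<open>auto simp: emeasure_completion\<close>)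
  have "measure lebesgue (g ` S) = (\<Prod>b\<in>Basis. (u - l) \<bullet> b)"
    unfolding img using meas nn boxm by (simp add: measure_def)
  then have "((\<lambda>x. \<bar>det (matrix (g' x))\<bar>) has_integral (\<Prod>b\<in>Basis. (u - l) \<bullet> b)) S"
    using has_measure_differentiable_image[of S g g'] gder lm S inj by (auto intro: inj_on_subset)
  \<comment> \<open>The columns of the matrix are the values of the derivative at 1 and
    \<i>.\<close>
  moreover have "\<bar>det (matrix (g' y))\<bar> = J (v2c y)" for y
  proof -
    have "v2c (axis 1 1) = 1" "v2c (axis 2 1) = \<i>" by (auto simp: v2c_def axis_def complex_eq_iff)
    moreover have "J (v2c y) = (Re (A (v2c y)))\<^sup>2 + (Im (A (v2c y)))\<^sup>2 - ((Re (E (v2c y)))\<^sup>2 + (Im (E (v2c y)))\<^sup>2)"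
      by (simp add: J(1) cmod_power2)
    ultimately have "det (matrix (g' y)) = J (v2c y)"
      by (simp add: det_2 matrix_def g'_def c2v_def algebra_simps power2_eq_square)
    then show ?thesis using J(2)[of "v2c y"] by simp
  qed
  ultimately have "((\<lambda>y. J (v2c y)) has_integral (\<Prod>b\<in>Basis. (u - l) \<bullet> b)) S" by simp
  then have int: "integral\<^sup>N lborel (\<lambda>y. indicator S y * J (v2c y)) = (\<Prod>b\<in>Basis. (u - l) \<bullet> b)"
    by (intro nn_integral_has_integral_lebesgue) (auto simp: J(2))
  have "emeasure (distr (density lborel (\<lambda>v. ennreal (J v))) borel \<phi>) (box l u)
     = (\<integral>\<^sup>+v. ennreal (J v) * indicator (\<phi> -` box l u) v \<partial>lborel)"
    using measurable_sets_borel[OF \<open>\<phi> \<in> borel_measurable borel\<close>, of "box l u"]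
    by (subst emeasure_distr, simp, simp, subst emeasure_density) auto
  also have "\<dots> = (\<integral>\<^sup>+v. ennreal (J (v2c (c2v v))) * indicator S (c2v v) \<partial>lborel)"
    by (auto simp: S_def g_def indicator_def intro!: nn_integral_cong)
  also have "\<dots> = (\<integral>\<^sup>+y. ennreal (J (v2c y)) * indicator S y \<partial>distr lborel borel c2v)"
    using S by (subst nn_integral_distr) auto
  also have "\<dots> = integral\<^sup>N lborel (\<lambda>y. indicator S y * J (v2c y))"
    unfolding distr_c2v by (intro nn_integral_cong) (auto simp: indicator_def)
  finally show "emeasure (distr (density lborel (\<lambda>v. ennreal (J v))) borel \<phi>) (box l u) = (\<Prod>b\<in>Basis. (u - l) \<bullet> b)"
    using int by simp
qed simp

section \<open>Deformations of the plane moving the insertion points\<close>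

lemma has_derivative_pos_part_square:
  "((\<lambda>t::real. (max 0 t)\<^sup>2) has_real_derivative 2 * max 0 t) (at t)"
proof -
  consider "t > 0" | "t < 0" | "t = 0" by linarith
  then show ?thesis
  proof cases
    case 1
    have "((\<lambda>t::real. t\<^sup>2) has_real_derivative 2 * max 0 t) (at t)" using 1 by (auto intro!: derivative_eq_intros)
    then show ?thesis
      by (rule has_field_derivative_transform_within_open[where S = "{0<..}"]) (use 1 in auto)
  next
    case 2
    have "((\<lambda>t::real. 0) has_real_derivative 2 * max 0 t) (at t)" using 2 by (auto intro!: derivative_eq_intros)
    then show ?thesis
      by (rule has_field_derivative_transform_within_open[where S = "{..<0}"]) (use 2 in auto)
  next
    case 3
    \<comment> \<open>At 0 the difference quotient of the squared positive part is
      \<open>max 0 y\<close> itself.\<close>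
    have "((\<lambda>y. max 0 y) \<longlongrightarrow> 0) (at (0::real))"
      using tendsto_max[OF tendsto_const tendsto_ident_at, of 0 "0::real" UNIV] by simp
    then have "((\<lambda>y::real. ((max 0 y)\<^sup>2 - (max 0 0)\<^sup>2) / (y - 0)) \<longlongrightarrow> 0) (at 0)"
      by (rule Lim_transform_eventually) (auto simp: eventually_at_filter max_def power2_eq_square)
    then show ?thesis using 3 by (simp add: has_field_derivative_iff)
  qed
qed

text \<open>One continuous derivative in v is enough: it enters the Jacobian, while smoothness in
  the insertion points comes from the deformation being affine in them.\<close>

definition bump :: "complex \<Rightarrow> real \<Rightarrow> complex \<Rightarrow> real" where
  "bump c r v = (max 0 (1 - (norm (v - c))\<^sup>2 / r\<^sup>2))\<^sup>2"

text \<open>The holomorphic Wirtinger derivative of the bump. As the bump is real, the other one is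
  its conjugate.\<close>

definition bump_slope :: "complex \<Rightarrow> real \<Rightarrow> complex \<Rightarrow> complex" where
  "bump_slope c r v = of_real (- (2 * max 0 (1 - (norm (v - c))\<^sup>2 / r\<^sup>2)) / r\<^sup>2) * cnj (v - c)"

lemma bump_center [simp]: "bump c r c = 1"
  by (simp add: bump_def)

lemma bump_outside: "0 < r \<Longrightarrow> r \<le> norm (v - c) \<Longrightarrow> bump c r v = 0"
  using power_mono[of r "norm (v - c)" 2] by (simp add: bump_def max_def)

lemma bump_has_derivative:
  "((\<lambda>v. complex_of_real (bump c r v)) has_derivative (\<lambda>d. bump_slope c r v * d + cnj (bump_slope c r v) * cnj d)) (at v)"
proof -
  let ?t = "\<lambda>v. 1 - (norm (v - c))\<^sup>2 / r\<^sup>2"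
  have 1: "(?t has_derivative (\<lambda>d. - (2 * ((v - c) \<bullet> d) / r\<^sup>2))) (at v)"
  proof -
    have "((\<lambda>v. (v - c) \<bullet> (v - c)) has_derivative (\<lambda>d. 2 * ((v - c) \<bullet> d))) (at v)"
      by (auto intro!: derivative_eq_intros simp: inner_commute)
    from has_derivative_diff[OF has_derivative_const[of 1] bounded_linear.has_derivative[OF bounded_linear_divide[of "r\<^sup>2"] this]]
    show ?thesis by (simp add: power2_norm_eq_inner)
  qed
  have "((\<lambda>v. (max 0 (?t v))\<^sup>2) has_derivative (\<lambda>d. - (2 * ((v - c) \<bullet> d) / r\<^sup>2) * (2 * max 0 (?t v)))) (at v)"
    by (rule has_derivative_compose[OF 1 has_derivative_pos_part_square[unfolded has_field_derivative_def], THEN has_derivative_eq_rhs]) auto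
  then have "((\<lambda>v. complex_of_real ((max 0 (?t v))\<^sup>2)) has_derivative (\<lambda>d. complex_of_real (- (2 * ((v - c) \<bullet> d) / r\<^sup>2) * (2 * max 0 (?t v))))) (at v)"
    by (rule has_derivative_of_real)
  moreover have "complex_of_real (- (2 * ((v - c) \<bullet> d) / r\<^sup>2) * (2 * max 0 (?t v))) = bump_slope c r v * d + cnj (bump_slope c r v) * cnj d" for d
  proof -
    have "bump_slope c r v * d + cnj (bump_slope c r v) * cnj d = of_real (2 * Re (bump_slope c r v * d))"
      by (subst complex_add_cnj[symmetric]) simp
    moreover have "Re (bump_slope c r v * d) = (- (2 * max 0 (?t v)) / r\<^sup>2) * ((v - c) \<bullet> d)"
    proof -
      have "Re (complex_of_real a * w) = a * Re w" for a w by simp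
      moreover have "Re (cnj (v - c) * d) = (v - c) \<bullet> d" by (simp add: inner_complex_def algebra_simps)
      ultimately show ?thesis unfolding bump_slope_def mult.assoc by (simp only:)
    qed
    moreover have "- (2 * ((v - c) \<bullet> d) / r\<^sup>2) * (2 * max 0 (?t v)) = 2 * ((- (2 * max 0 (?t v)) / r\<^sup>2) * ((v - c) \<bullet> d))"
      by simp
    ultimately show ?thesis by (simp only:)
  qed
  ultimately show ?thesis unfolding bump_def by (simp only:)
qed

lemma norm_bump_slope:
  assumes "0 < r" shows "norm (bump_slope c r v) \<le> 2 / r"
proof (cases "norm (v - c) < r")
  case True
  have "max 0 (1 - (norm (v - c))\<^sup>2 / r\<^sup>2) \<le> 1" by simp
  then have "2 * max 0 (1 - (norm (v - c))\<^sup>2 / r\<^sup>2) * norm (v - c) \<le> 2 * 1 * r"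
    using True assms by (intro mult_mono) auto
  then have "2 * max 0 (1 - (norm (v - c))\<^sup>2 / r\<^sup>2) * norm (v - c) / r\<^sup>2 \<le> 2 * r / r\<^sup>2"
    using assms by (intro divide_right_mono) auto
  also have "2 * r / r\<^sup>2 = 2 / r" by (simp add: power2_eq_square)
  finally show ?thesis by (simp add: bump_slope_def norm_mult norm_divide norm_power del: complex_cnj_diff)
next
  case False
  then have "1 \<le> (norm (v - c))\<^sup>2 / r\<^sup>2" using power_mono[of r "norm (v - c)" 2] assms by (simp add: pos_le_divide_eq)
  then show ?thesis using assms by (simp add: bump_slope_def max_def)
qed

text \<open>The two Wirtinger derivatives contribute 2/r each.\<close>

lemma bump_lipschitz:
  assumes "0 < r" shows "\<bar>bump c r v - bump c r w\<bar> \<le> 4 / r * norm (v - w)"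
proof -
  have "norm (complex_of_real (bump c r v) - complex_of_real (bump c r w)) \<le> 4 / r * norm (v - w)"
  proof (rule differentiable_bound[of UNIV, OF _ has_derivative_at_withinI[OF bump_has_derivative]])
    fix v
    have "norm (bump_slope c r v * d + cnj (bump_slope c r v) * cnj d) \<le> 4 / r * norm d" for d
    proof -
      have "norm (bump_slope c r v * d + cnj (bump_slope c r v) * cnj d) \<le> norm (bump_slope c r v) * norm d + norm (bump_slope c r v) * norm d"
        by (rule order_trans[OF norm_triangle_ineq]) (simp add: norm_mult)
      also have "\<dots> \<le> 2 / r * norm d + 2 / r * norm d"
        using norm_bump_slope[OF assms] by (intro add_mono mult_right_mono) auto
      finally show ?thesis by simp
    qed
    then show "onorm (\<lambda>d. bump_slope c r v * d + cnj (bump_slope c r v) * cnj d) \<le> 4 / r" by (rule onorm_le)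
  qed auto
  then show ?thesis by (simp flip: of_real_diff)
qed

lemma bump_measurable [measurable]: "bump c r \<in> borel_measurable borel"
  unfolding bump_def by measurable

lemma bump_slope_measurable [measurable]: "bump_slope c r \<in> borel_measurable borel"
  unfolding bump_slope_def by (intro borel_measurable_times borel_measurable_cnj) measurable

text \<open>The bumps of radius \<open>r\<close> may overlap, but each vanishes at the other
  insertion points and outside \<open>U\<close>. So the deformation sends \<open>z0 i\<close> to
  \<open>z i\<close> and fixes the complement of \<open>U\<close>.\<close>

locale deformation =
  fixes n :: nat and z0 :: "nat \<Rightarrow> complex" and r :: real and U :: "complex set"
  assumes r: "0 < r"
    and separated: "\<And>i k. i < n \<Longrightarrow> k < n \<Longrightarrow> i \<noteq> k \<Longrightarrow> r \<le> norm (z0 i - z0 k)"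
    and inside: "\<And>i. i < n \<Longrightarrow> ball (z0 i) r \<subseteq> U"
    and U: "U \<in> sets borel"
begin

text \<open>Small enough that \<open>n\<close> displacements of size \<delta>, each weighted with a
  bump of Lipschitz constant 4/r, add up to a Lipschitz constant of at most 1/2.\<close>

definition "\<delta> = r / (8 * (real n + 1))"

lemma \<delta>_pos: "0 < \<delta>" using r by (simp add: \<delta>_def)

lemma n_\<delta>: "real n * (\<delta> * (4 / r)) \<le> 1 / 2"
  using r by (simp add: \<delta>_def field_simps)

abbreviation "P \<equiv> polydisc n z0 \<delta>"

text \<open>The map is affine in \<open>z\<close> and is the identity for \<open>z = z0\<close>.
  \<open>\<phi>A\<close> and \<open>\<phi>E\<close> are its Wirtinger derivatives in
  \<open>v\<close>, and \<open>\<phi>J\<close> is its Jacobian determinant.\<close>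

definition "\<phi> z v = v + (\<Sum>i<n. complex_of_real (bump (z0 i) r v) * (z i - z0 i))"
definition "\<phi>A z v = 1 + (\<Sum>i<n. bump_slope (z0 i) r v * (z i - z0 i))"
definition "\<phi>E z v = (\<Sum>i<n. cnj (bump_slope (z0 i) r v) * (z i - z0 i))"
definition "\<phi>J z v = (norm (\<phi>A z v))\<^sup>2 - (norm (\<phi>E z v))\<^sup>2"

lemma \<phi>_insertion: "i < n \<Longrightarrow> \<phi> z (z0 i) = z i"
proof -
  assume i: "i < n"
  have "(\<Sum>k<n. complex_of_real (bump (z0 k) r (z0 i)) * (z k - z0 k)) = (\<Sum>k<n. if k = i then z k - z0 k else 0)"
    using separated[OF i] r by (intro sum.cong) (auto simp: bump_outside)
  then show ?thesis using i by (simp add: \<phi>_def)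
qed

lemma \<phi>_outside: "v \<notin> U \<Longrightarrow> \<phi> z v = v"
proof -
  assume v: "v \<notin> U"
  have "bump (z0 k) r v = 0" if "k < n" for k
    using inside[OF that] v r by (intro bump_outside) (auto simp: subset_iff dist_norm norm_minus_commute not_less[symmetric])
  then show ?thesis by (simp add: \<phi>_def)
qed

lemma sum_bound:
  assumes "z \<in> P" "\<And>i. i < n \<Longrightarrow> norm (a i) \<le> c" "0 \<le> c"
  shows "norm (\<Sum>i<n. a i * (z i - z0 i)) \<le> real n * (\<delta> * c)"
proof -
  have "norm (\<Sum>i<n. a i * (z i - z0 i)) \<le> (\<Sum>i<n. \<delta> * c)"
  proof (rule sum_norm_le)
    fix i assume "i \<in> {..<n}"
    then have "norm (a i) * norm (z i - z0 i) \<le> c * \<delta>"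
      using assms by (intro mult_mono) (auto simp: polydisc_def less_imp_le)
    then show "norm (a i * (z i - z0 i)) \<le> \<delta> * c" by (simp add: norm_mult mult.commute)
  qed
  then show ?thesis by simp
qed

text \<open>Makes the deformation a perturbation of the identity by a contraction, from which
  injectivity and surjectivity follow.\<close>

lemma displacement_lipschitz:
  assumes z: "z \<in> P"
  shows "norm ((\<phi> z v - v) - (\<phi> z w - w)) \<le> 1/2 * norm (v - w)"
proof -
  have "(\<phi> z v - v) - (\<phi> z w - w) = (\<Sum>i<n. complex_of_real (bump (z0 i) r v - bump (z0 i) r w) * (z i - z0 i))"
    by (simp add: \<phi>_def sum_subtractf[symmetric] left_diff_distrib)
  also have "norm \<dots> \<le> real n * (\<delta> * (4 / r * norm (v - w)))"
    by (rule sum_bound[OF z]) (use r bump_lipschitz[OF r] in \<open>auto simp del: of_real_diff\<close>)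
  also have "\<dots> = real n * (\<delta> * (4 / r)) * norm (v - w)" by simp
  also have "\<dots> \<le> 1/2 * norm (v - w)" using n_\<delta> by (rule mult_right_mono) simp
  finally show ?thesis .
qed

lemma inj_\<phi>: "z \<in> P \<Longrightarrow> inj (\<phi> z)"
proof (rule injI)
  fix v w assume "z \<in> P" "\<phi> z v = \<phi> z w"
  then have "norm (v - w) \<le> 1/2 * norm (v - w)"
    using displacement_lipschitz[of z v w] by (simp add: norm_minus_commute)
  then show "v = w" by simp
qed

text \<open>A preimage of y is a fixed point of v \<mapsto> y - (\<phi> z v - v), which is a
  contraction.\<close>

lemma surj_\<phi>: "z \<in> P \<Longrightarrow> surj (\<phi> z)"
  unfolding surj_def
proof
  fix y assume z: "z \<in> P"
  have "\<exists>!v. y - (\<phi> z v - v) = v"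
  proof (rule banach_fix_type[of "1/2"])
    show "\<forall>v w. dist (y - (\<phi> z v - v)) (y - (\<phi> z w - w)) \<le> 1/2 * dist v w"
      using displacement_lipschitz[OF z] by (auto simp: dist_norm norm_minus_commute algebra_simps)
  qed auto
  then obtain v where "y - (\<phi> z v - v) = v" by blast
  then have "y = \<phi> z v" by (simp add: algebra_simps)
  then show "\<exists>v. y = \<phi> z v" ..
qed

text \<open>Points outside \<open>U\<close> are fixed; a point of \<open>U\<close> sent to some y
  outside would have the same image as y.\<close>

lemma \<phi>_mem_iff: "z \<in> P \<Longrightarrow> \<phi> z v \<in> U \<longleftrightarrow> v \<in> U"
  by (metis \<phi>_outside injD inj_\<phi>)

lemma \<phi>_has_derivative: "(\<phi> z has_derivative (\<lambda>d. \<phi>A z v * d + \<phi>E z v * cnj d)) (at v)"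
proof -
  have "((\<lambda>v. v + (\<Sum>i<n. complex_of_real (bump (z0 i) r v) * (z i - z0 i))) has_derivative
     (\<lambda>d. d + (\<Sum>i<n. (bump_slope (z0 i) r v * d + cnj (bump_slope (z0 i) r v) * cnj d) * (z i - z0 i)))) (at v)"
    by (intro has_derivative_add has_derivative_ident has_derivative_sum has_derivative_mult_left bump_has_derivative)
  moreover have "d + (\<Sum>i<n. (bump_slope (z0 i) r v * d + cnj (bump_slope (z0 i) r v) * cnj d) * (z i - z0 i))
    = \<phi>A z v * d + \<phi>E z v * cnj d" for d
  proof -
    have "(\<Sum>i<n. (bump_slope (z0 i) r v * d + cnj (bump_slope (z0 i) r v) * cnj d) * (z i - z0 i))
      = (\<Sum>i<n. bump_slope (z0 i) r v * (z i - z0 i)) * d + (\<Sum>i<n. cnj (bump_slope (z0 i) r v) * (z i - z0 i)) * cnj d"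
      unfolding sum_distrib_right sum.distrib[symmetric] by (intro sum.cong) (auto simp: algebra_simps)
    then show ?thesis by (simp add: \<phi>A_def \<phi>E_def distrib_right)
  qed
  ultimately show ?thesis by (simp add: \<phi>_def[abs_def])
qed

text \<open>Both Wirtinger derivatives differ from those of the identity by at most 1/2, so
  |\<phi>E| \<le> 1/2 \<le> |\<phi>A|.\<close>

lemma \<phi>J_nonneg: assumes z: "z \<in> P" shows "0 \<le> \<phi>J z v"
proof -
  have b: "norm (\<Sum>i<n. a i * (z i - z0 i)) \<le> 1/2" if "\<And>i. i < n \<Longrightarrow> norm (a i) \<le> 2 / r" for a
  proof -
    have "norm (\<Sum>i<n. a i * (z i - z0 i)) \<le> real n * (\<delta> * (4 / r))"
      using that r by (intro sum_bound[OF z]) (auto intro: order_trans[where y = "2 / r"] simp: divide_right_mono)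
    then show ?thesis using n_\<delta> by linarith
  qed
  have "norm (\<phi>E z v) \<le> 1/2" unfolding \<phi>E_def by (rule b) (use norm_bump_slope[OF r] in auto)
  moreover have "norm (\<Sum>i<n. bump_slope (z0 i) r v * (z i - z0 i)) \<le> 1/2" by (rule b) (use norm_bump_slope[OF r] in auto)
  then have "1/2 \<le> norm (\<phi>A z v)" unfolding \<phi>A_def
    using norm_triangle_ineq2[of 1 "- (\<Sum>i<n. bump_slope (z0 i) r v * (z i - z0 i))"] by simp
  ultimately show ?thesis by (simp add: \<phi>J_def power_mono)
qed

lemma \<phi>A_measurable [measurable]: "\<phi>A z \<in> borel_measurable borel"
  unfolding \<phi>A_def[abs_def] by measurable

lemma \<phi>E_measurable [measurable]: "\<phi>E z \<in> borel_measurable borel"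
  unfolding \<phi>E_def[abs_def] by (intro borel_measurable_sum borel_measurable_times borel_measurable_cnj) measurable

lemma \<phi>J_measurable [measurable]: "\<phi>J z \<in> borel_measurable borel"
  unfolding \<phi>J_def[abs_def] by measurable

lemma \<phi>_measurable [measurable]: "\<phi> z \<in> borel_measurable borel"
  unfolding \<phi>_def[abs_def] by measurable

section \<open>Deforming all integration variables at once\<close>

definition "\<phi>s N z u = (\<lambda>j\<in>{..<N}. \<phi> z (u j))"
definition "\<phi>Js N z u = (\<Prod>j<N. \<phi>J z (u j))"

lemma coord_measurable: "j < N \<Longrightarrow> (\<lambda>u. u j) \<in> borel_measurable (vol N)"
  unfolding vol_def by (rule measurable_coordinate) simp

lemma \<phi>s_measurable [measurable]: "\<phi>s N z \<in> measurable (vol N) (vol N)"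
proof -
  have "\<phi>s N z \<in> measurable (vol N) (PiM {..<N} (\<lambda>_. lborel))"
    unfolding \<phi>s_def[abs_def]
    by (rule measurable_restrict) (simp add: measurable_compose[OF coord_measurable])
  then show ?thesis by (simp add: vol_def)
qed

lemma \<phi>Js_measurable [measurable]: "\<phi>Js N z \<in> borel_measurable (vol N)"
  unfolding \<phi>Js_def[abs_def]
  by (intro borel_measurable_prod) (simp add: measurable_compose[OF coord_measurable])

text \<open>All variables are moved by the same planar map, so on rectangles the claim is a product
  of one-dimensional (complex) changes of variables.\<close>

lemma vol_deformation:
  assumes z: "z \<in> P"
  shows "distr (density (vol N) (\<lambda>u. ennreal (\<phi>Js N z u))) (vol N) (\<phi>s N z) = vol N"
  unfolding vol_def
proof (rule plane.PiM_eqI)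
  fix B :: "nat \<Rightarrow> complex set" assume B: "\<And>j. j \<in> {..<N} \<Longrightarrow> B j \<in> sets lborel"
  have BE: "Pi\<^sub>E {..<N} B \<in> sets (vol N)" unfolding vol_def using B by (intro sets_PiM_I_finite) auto
  have one: "distr (density lborel (\<lambda>v. ennreal (\<phi>J z v))) borel (\<phi> z) = lborel"
    by (rule lborel_change_of_variables[OF \<phi>_has_derivative inj_\<phi>[OF z] surj_\<phi>[OF z]])
      (auto simp: \<phi>J_def[symmetric] \<phi>J_nonneg[OF z])
  have oneB: "(\<integral>\<^sup>+v. ennreal (\<phi>J z v) * indicator (B j) (\<phi> z v) \<partial>lborel) = emeasure lborel (B j)" if "j < N" for j
  proof -
    have Bj: "B j \<in> sets borel" using B that by simp
    have "emeasure lborel (B j) = emeasure (distr (density lborel (\<lambda>v. ennreal (\<phi>J z v))) borel (\<phi> z)) (B j)" by (simp add: one)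
    also have "\<dots> = (\<integral>\<^sup>+v. ennreal (\<phi>J z v) * indicator (\<phi> z -` B j) v \<partial>lborel)"
      using Bj measurable_sets_borel[OF \<phi>_measurable Bj] by (subst emeasure_distr, simp, simp, subst emeasure_density) auto
    finally show ?thesis by (simp add: indicator_vimage)
  qed
  have "emeasure (distr (density (vol N) (\<lambda>u. ennreal (\<phi>Js N z u))) (vol N) (\<phi>s N z)) (Pi\<^sub>E {..<N} B)
    = emeasure (density (vol N) (\<lambda>u. ennreal (\<phi>Js N z u))) (\<phi>s N z -` (Pi\<^sub>E {..<N} B) \<inter> space (vol N))"
    using BE by (subst emeasure_distr) auto
  also have "\<dots> = (\<integral>\<^sup>+u. ennreal (\<phi>Js N z u) * indicator (\<phi>s N z -` (Pi\<^sub>E {..<N} B) \<inter> space (vol N)) u \<partial>vol N)"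
    using BE by (subst emeasure_density) (auto intro!: measurable_sets[of "\<phi>s N z" "vol N" "vol N"])
  also have "\<dots> = (\<integral>\<^sup>+u. (\<Prod>j<N. ennreal (\<phi>J z (u j)) * indicator (B j) (\<phi> z (u j))) \<partial>vol N)"
  proof (rule nn_integral_cong)
    fix u assume u: "u \<in> space (vol N)"
    have "indicator (\<phi>s N z -` (Pi\<^sub>E {..<N} B) \<inter> space (vol N)) u = (\<Prod>j<N. indicator (B j) (\<phi> z (u j)) :: ennreal)"
    proof (cases "\<forall>j<N. \<phi> z (u j) \<in> B j")
      case True then show ?thesis using u by (simp add: \<phi>s_def)
    next
      case False
      then obtain j where "j < N" "\<phi> z (u j) \<notin> B j" by blast
      moreover from this have "(\<Prod>j<N. indicator (B j) (\<phi> z (u j)) :: ennreal) = 0" by (intro prod_zero bexI[of _ j]) auto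
      ultimately show ?thesis by (auto simp: \<phi>s_def indicator_def)
    qed
    then show "ennreal (\<phi>Js N z u) * indicator (\<phi>s N z -` (Pi\<^sub>E {..<N} B) \<inter> space (vol N)) u
      = (\<Prod>j<N. ennreal (\<phi>J z (u j)) * indicator (B j) (\<phi> z (u j)))"
      by (simp add: \<phi>Js_def prod_ennreal[symmetric] \<phi>J_nonneg[OF z] prod.distrib)
  qed
  also have "\<dots> = (\<Prod>j<N. \<integral>\<^sup>+v. ennreal (\<phi>J z v) * indicator (B j) (\<phi> z v) \<partial>lborel)"
    unfolding vol_def
  proof (rule plane.product_nn_integral_prod)
    fix j assume "j \<in> {..<N}"
    then have "B j \<in> sets borel" using B by simp
    then have "(\<lambda>v. indicator (B j) (\<phi> z v) :: ennreal) \<in> borel_measurable borel"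
      by (intro measurable_compose[OF \<phi>_measurable] borel_measurable_indicator)
    then show "(\<lambda>v. ennreal (\<phi>J z v) * indicator (B j) (\<phi> z v)) \<in> borel_measurable lborel"
      by simp
  qed simp
  also have "\<dots> = (\<Prod>j<N. emeasure lborel (B j))" using oneB by simp
  finally show "emeasure (distr (density (PiM {..<N} (\<lambda>_. lborel)) (\<lambda>u. ennreal (\<phi>Js N z u))) (PiM {..<N} (\<lambda>_. lborel)) (\<phi>s N z)) (Pi\<^sub>E {..<N} B)
    = (\<Prod>j<N. emeasure lborel (B j))" by (simp add: vol_def)
qed (auto simp: vol_def)

lemma domain_sets [measurable]: "domain U N \<in> sets (vol N)"
  unfolding domain_def vol_def using U by (intro sets_PiM_I_finite) auto

lemma integral_deformation:
  fixes f :: "(nat \<Rightarrow> complex) \<Rightarrow> complex"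
  assumes z: "z \<in> P" and [measurable]: "f \<in> borel_measurable (vol N)"
  shows "(LINT u:domain U N|vol N. f u) = (LINT u:domain U N|vol N. of_real (\<phi>Js N z u) * f (\<phi>s N z u))"
proof -
  have "(LINT u:domain U N|vol N. f u) = integral\<^sup>L (distr (density (vol N) (\<lambda>u. ennreal (\<phi>Js N z u))) (vol N) (\<phi>s N z)) (\<lambda>u. indicator (domain U N) u *\<^sub>R f u)"
    by (simp add: vol_deformation[OF z] set_lebesgue_integral_def)
  also have "\<dots> = integral\<^sup>L (density (vol N) (\<lambda>u. ennreal (\<phi>Js N z u))) (\<lambda>u. indicator (domain U N) (\<phi>s N z u) *\<^sub>R f (\<phi>s N z u))"
    by (rule integral_distr) measurable
  also have "\<dots> = integral\<^sup>L (vol N) (\<lambda>u. \<phi>Js N z u *\<^sub>R (indicator (domain U N) (\<phi>s N z u) *\<^sub>R f (\<phi>s N z u)))"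
  proof (rule integral_density)
    show "AE u in vol N. 0 \<le> \<phi>Js N z u" by (simp add: \<phi>Js_def prod_nonneg \<phi>J_nonneg[OF z])
  qed measurable
  also have "\<dots> = integral\<^sup>L (vol N) (\<lambda>u. indicator (domain U N) u *\<^sub>R (of_real (\<phi>Js N z u) * f (\<phi>s N z u)))"
  proof (rule Bochner_Integration.integral_cong[OF refl])
    fix u assume "u \<in> space (vol N)"
    then have "\<phi>s N z u \<in> domain U N \<longleftrightarrow> u \<in> domain U N"
      by (auto simp: \<phi>s_def domain_def vol_def space_PiM PiE_iff \<phi>_mem_iff[OF z])
    then show "\<phi>Js N z u *\<^sub>R (indicator (domain U N) (\<phi>s N z u) *\<^sub>R f (\<phi>s N z u)) = indicator (domain U N) u *\<^sub>R (of_real (\<phi>Js N z u) * f (\<phi>s N z u))"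
      by (simp add: indicator_def scaleR_conv_of_real)
  qed
  finally show ?thesis by (simp add: set_lebesgue_integral_def)
qed

text \<open>The difference quotient of the deformation. At \<open>x = y\<close> the division by zero
  makes it 1, which is harmless since it is multiplied by \<open>x - y\<close>.\<close>

definition "\<phi>Q z x y = 1 + (\<Sum>i<n. complex_of_real (bump (z0 i) r x - bump (z0 i) r y) / (x - y) * (z i - z0 i))"

lemma \<phi>_diff: "\<phi> z x - \<phi> z y = (x - y) * \<phi>Q z x y"
proof (cases "x = y")
  case False
  have "(x - y) * (\<Sum>i<n. complex_of_real (bump (z0 i) r x - bump (z0 i) r y) / (x - y) * (z i - z0 i))
    = (\<Sum>i<n. complex_of_real (bump (z0 i) r x - bump (z0 i) r y) * (z i - z0 i))"
    unfolding sum_distrib_left using False by (intro sum.cong) auto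
  then show ?thesis by (simp add: \<phi>_def \<phi>Q_def distrib_left sum_subtractf left_diff_distrib)
qed (simp add: \<phi>Q_def)

lemma norm_bump_quotient: "norm (complex_of_real (bump (z0 i) r x - bump (z0 i) r y) / (x - y)) \<le> 4 / r"
  using bump_lipschitz[OF r, of "z0 i" x y] r
  by (cases "x = y") (auto simp: norm_divide divide_le_eq simp del: of_real_diff)

lemma norm_\<phi>Q: "z \<in> P \<Longrightarrow> 1/2 \<le> norm (\<phi>Q z x y)"
proof -
  assume z: "z \<in> P"
  have "norm (\<Sum>i<n. complex_of_real (bump (z0 i) r x - bump (z0 i) r y) / (x - y) * (z i - z0 i)) \<le> real n * (\<delta> * (4 / r))"
    using r by (intro sum_bound[OF z norm_bump_quotient]) auto
  also note n_\<delta>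
  finally show ?thesis unfolding \<phi>Q_def
    using norm_triangle_ineq2[of 1 "- (\<Sum>i<n. complex_of_real (bump (z0 i) r x - bump (z0 i) r y) / (x - y) * (z i - z0 i))"] by simp
qed

lemma amp_\<phi>Q:
  assumes [measurable]: "x \<in> borel_measurable M" "y \<in> borel_measurable M"
  shows "amplitude M \<Omega> n z0 \<delta> (\<lambda>z u. \<phi>Q z (x u) (y u))"
  unfolding \<phi>Q_def
proof (intro amp_add amp_complex_const amp_sum amp_mult)
  fix i assume "i \<in> {..<n}"
  show "amplitude M \<Omega> n z0 \<delta> (\<lambda>z u. complex_of_real (bump (z0 i) r (x u) - bump (z0 i) r (y u)) / (x u - y u))"
    by (rule amp_const[where K = "4 / r"]) (measurable, rule norm_bump_quotient)
qed (auto intro: amp_coord)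

text \<open>Squared moduli are rewritten as products with conjugates, which the closure rules for
  amplitudes cover.\<close>

lemma amp_\<phi>Js: "amplitude (vol N) \<Omega> n z0 \<delta> (\<lambda>z u. of_real (\<phi>Js N z u))"
proof -
  have "amplitude (vol N) \<Omega> n z0 \<delta> (\<lambda>z u. \<Prod>j<N. (\<phi>A z (u j) * cnj (\<phi>A z (u j)) + (- 1) * (\<phi>E z (u j) * cnj (\<phi>E z (u j)))))"
  proof (intro amp_prod amp_add amp_mult[of _ _ _ _ _ "\<lambda>z u. \<phi>A z (u _)"] amp_mult[of _ _ _ _ _ "\<lambda>z u. \<phi>E z (u _)"]
      amp_mult[of _ _ _ _ _ "\<lambda>z u. - 1"] amp_cnj amp_complex_const)
    fix j assume "j \<in> {..<N}"
    then have [measurable]: "(\<lambda>u. u j) \<in> borel_measurable (vol N)" by (simp add: coord_measurable)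
    have slope: "amplitude (vol N) \<Omega> n z0 \<delta> (\<lambda>z u. bump_slope (z0 i) r (u j))" for i
      by (rule amp_const[where K = "2 / r"]) (measurable, rule norm_bump_slope[OF r])
    have A: "amplitude (vol N) \<Omega> n z0 \<delta> (\<lambda>z u. \<phi>A z (u j))" unfolding \<phi>A_def
      by (intro amp_add amp_complex_const amp_sum amp_mult slope amp_coord) auto
    have E: "amplitude (vol N) \<Omega> n z0 \<delta> (\<lambda>z u. \<phi>E z (u j))" unfolding \<phi>E_def
      by (intro amp_sum amp_mult amp_cnj slope amp_coord) auto
    show "amplitude (vol N) \<Omega> n z0 \<delta> (\<lambda>z u. \<phi>A z (u j))" by (rule A)
    show "amplitude (vol N) \<Omega> n z0 \<delta> (\<lambda>z u. \<phi>A z (u j))" by (rule A)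
    show "amplitude (vol N) \<Omega> n z0 \<delta> (\<lambda>z u. \<phi>E z (u j))" by (rule E)
    show "amplitude (vol N) \<Omega> n z0 \<delta> (\<lambda>z u. \<phi>E z (u j))" by (rule E)
  qed auto
  moreover have "complex_of_real (\<phi>Js N z u) = (\<Prod>j<N. (\<phi>A z (u j) * cnj (\<phi>A z (u j)) + (- 1) * (\<phi>E z (u j) * cnj (\<phi>E z (u j)))))" for z u
  proof -
    have "(complex_of_real (norm w))\<^sup>2 = w * cnj w" for w using complex_norm_square[of w] by simp
    then show ?thesis by (simp add: \<phi>Js_def \<phi>J_def)
  qed
  ultimately show ?thesis by (simp only:)
qed

end

section \<open>Regularity of contributions\<close>

text \<open>These are the contractions with a logarithm. The interaction contains \<open>b\<close>
  only under a derivative, so one end of such a contraction is always an insertion.\<close>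

definition log_pair :: "bf_field \<Rightarrow> bf_field \<Rightarrow> bool" where
  "log_pair p q \<longleftrightarrow> p = Fc \<and> q = Fb \<or> p = Fb \<and> q = Fc"

lemma propagator_rational:
  assumes "\<not> log_pair p q"
  obtains c where "norm c \<le> 1" "propagator C p q = (\<lambda>w z. c / (w - z))"
    | c where "norm c \<le> 1" "propagator C p q = (\<lambda>w z. c / cnj (w - z))"
proof -
  have flip: "(\<lambda>w z. 1 / (z - w)) = (\<lambda>w z. - 1 / (w - z :: complex))"
    "(\<lambda>w z. 1 / (cnj z - cnj w)) = (\<lambda>w z. - 1 / cnj (w - z))"
    by (auto simp: fun_eq_iff minus_divide_right)
  have "propagator C p q \<in> {\<lambda>w z. 0, \<lambda>w z. 1 / (w - z), \<lambda>w z. -1 / (w - z), \<lambda>w z. 1 / (z - w),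
      \<lambda>w z. 1 / (cnj w - cnj z), \<lambda>w z. -1 / (cnj w - cnj z), \<lambda>w z. 1 / (cnj z - cnj w)}"
    using assms by (cases p; cases q) (simp_all add: propagator_def[abs_def] log_pair_def)
  then consider "propagator C p q = (\<lambda>w z. 0 / (w - z))" | "propagator C p q = (\<lambda>w z. 1 / (w - z))" | "propagator C p q = (\<lambda>w z. -1 / (w - z))"
    | "propagator C p q = (\<lambda>w z. 1 / cnj (w - z))" | "propagator C p q = (\<lambda>w z. -1 / cnj (w - z))"
    unfolding flip by (auto simp only: insert_iff empty_iff complex_cnj_diff div_0)
  then have "\<exists>c. norm c \<le> 1 \<and> (propagator C p q = (\<lambda>w z. c / (w - z)) \<or> propagator C p q = (\<lambda>w z. c / cnj (w - z)))"
  proof cases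
    case 1 then show ?thesis by (intro exI[of _ 0]) (simp only: norm_zero zero_le_one simp_thms)
  next
    case 2 then show ?thesis by (intro exI[of _ 1]) (simp only: norm_one order_refl simp_thms)
  next
    case 3 then show ?thesis by (intro exI[of _ "-1"]) (simp only: norm_minus_cancel norm_one order_refl simp_thms)
  next
    case 4 then show ?thesis by (intro exI[of _ 1]) (simp only: norm_one order_refl simp_thms)
  next
    case 5 then show ?thesis by (intro exI[of _ "-1"]) (simp only: norm_minus_cancel norm_one order_refl simp_thms)
  qed
  then show thesis using that by blast
qed

lemma propagator_log:
  assumes "log_pair p q"
  obtains c where "norm c \<le> 1" "propagator C p q = (\<lambda>w z. c * (of_real (2 * ln (norm (w - z))) + C))"
proof -
  have "propagator C Fc Fb = (\<lambda>w z. 1 * (of_real (2 * ln (norm (w - z))) + C))"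
    "propagator C Fb Fc = (\<lambda>w z. - 1 * (of_real (2 * ln (norm (w - z))) + C))"
    by (auto simp: propagator_def fun_eq_iff norm_minus_commute)
  then show thesis using assms that[of 1] that[of "-1"] by (auto simp: log_pair_def)
qed

lemma measurable_propagator:
  assumes [measurable]: "x \<in> borel_measurable M" "y \<in> borel_measurable M"
  shows "(\<lambda>u. propagator C p q (x u) (y u)) \<in> borel_measurable M"
proof (cases "log_pair p q")
  case True
  then obtain c where "propagator C p q = (\<lambda>w z. c * (of_real (2 * ln (norm (w - z))) + C))"
    using propagator_log by metis
  then show ?thesis by simp
next
  case False
  have [measurable]: "(\<lambda>u. cnj (x u)) \<in> borel_measurable M" "(\<lambda>u. cnj (y u)) \<in> borel_measurable M"
    by (intro borel_measurable_cnj assms)+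
  from propagator_rational[OF False, of C] show ?thesis by cases simp_all
qed

text \<open>The reason why the inverse distance dominates the logarithm on bounded regions. Near 0
  it follows from ln(1/t) \<le> 1/t - 1.\<close>

lemma abs_mult_ln_le:
  fixes t D :: real
  assumes "0 < t" "t \<le> D"
  shows "\<bar>t * ln t\<bar> \<le> 1 + D * \<bar>ln D\<bar>"
proof (cases "t \<le> 1")
  case True
  have "ln (1 / t) \<le> 1 / t - 1" using assms by (intro ln_le_minus_one) auto
  then have "t * (- ln t) \<le> t * (1 / t - 1)" using assms by (intro mult_left_mono) (auto simp: ln_div)
  also have "\<dots> \<le> 1" using assms by (simp add: algebra_simps)
  finally have "- (t * ln t) \<le> 1" by simp
  moreover have "t * ln t \<le> 0" using True assms by (simp add: mult_nonneg_nonpos)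
  moreover have "0 \<le> D * \<bar>ln D\<bar>" using assms by simp
  ultimately show ?thesis by linarith
next
  case False
  then have "0 \<le> ln t" "ln t \<le> ln D" using assms by auto
  then have "t * ln t \<le> D * \<bar>ln D\<bar>" "0 \<le> t * ln t" using assms by (auto intro!: mult_mono)
  then show ?thesis by linarith
qed

section \<open>Factoring propagators into a fixed weight and an amplitude\<close>

context deformation
begin

text \<open>The form required for differentiation under the integral: the weight \<open>h\<close>
  does not see \<open>z\<close>. It will be the product of inverse edge lengths at the fixed
  configuration \<open>z0\<close>.\<close>

definition factors :: "'b measure \<Rightarrow> 'b set \<Rightarrow> ('b \<Rightarrow> complex) \<Rightarrow> ((nat \<Rightarrow> complex) \<Rightarrow> 'b \<Rightarrow> complex) \<Rightarrow> bool" where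
  "factors M \<Omega> h F \<longleftrightarrow> (\<exists>s. amplitude M \<Omega> n z0 \<delta> s \<and> (\<forall>z\<in>P. \<forall>u\<in>\<Omega>. F z u = h u * s z u))"

lemma factors_const: "factors M \<Omega> (\<lambda>_. 1) (\<lambda>z u. c)"
  unfolding factors_def by (intro exI[of _ "\<lambda>z u. c"]) (simp add: amp_complex_const)

lemma factors_mult:
  assumes "factors M \<Omega> h F" "factors M \<Omega> k G"
  shows "factors M \<Omega> (\<lambda>u. h u * k u) (\<lambda>z u. F z u * G z u)"
proof -
  obtain s t where "amplitude M \<Omega> n z0 \<delta> s" "\<forall>z\<in>P. \<forall>u\<in>\<Omega>. F z u = h u * s z u"
    "amplitude M \<Omega> n z0 \<delta> t" "\<forall>z\<in>P. \<forall>u\<in>\<Omega>. G z u = k u * t z u"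
    using assms unfolding factors_def by blast
  then show ?thesis unfolding factors_def by (intro exI[of _ "\<lambda>z u. s z u * t z u"]) (auto intro: amp_mult)
qed

lemma factors_scale: "factors M \<Omega> h F \<Longrightarrow> factors M \<Omega> h (\<lambda>z u. c * F z u)"
  using factors_mult[OF factors_const[of M \<Omega> c]] by simp

lemma factors_prod:
  assumes "finite A" "\<And>a. a \<in> A \<Longrightarrow> factors M \<Omega> (h a) (F a)"
  shows "factors M \<Omega> (\<lambda>u. \<Prod>a\<in>A. h a u) (\<lambda>z u. \<Prod>a\<in>A. F a z u)"
  using assms by (induction A rule: finite_induct) (auto intro: factors_mult factors_const)

lemma factors_sum:
  assumes "finite A" "\<And>a. a \<in> A \<Longrightarrow> factors M \<Omega> h (F a)"
  shows "factors M \<Omega> h (\<lambda>z u. \<Sum>a\<in>A. F a z u)"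
  using assms
proof (induction A rule: finite_induct)
  case empty
  show ?case unfolding factors_def by (intro exI[of _ "\<lambda>z u. 0"]) (simp add: amp_complex_const)
next
  case (insert a A)
  then obtain s t where *: "amplitude M \<Omega> n z0 \<delta> s" "\<forall>z\<in>P. \<forall>u\<in>\<Omega>. F a z u = h u * s z u"
    "amplitude M \<Omega> n z0 \<delta> t" "\<forall>z\<in>P. \<forall>u\<in>\<Omega>. (\<Sum>a\<in>A. F a z u) = h u * t z u"
    unfolding factors_def by (metis insertCI)
  then show ?case unfolding factors_def using insert.hyps
    by (intro exI[of _ "\<lambda>z u. s z u + t z u"]) (auto intro: amp_add simp: distrib_left)
qed

text \<open>By \<open>\<phi>_diff\<close> the amplitude is a phase divided by
  \<open>\<phi>Q\<close>. At coinciding points both sides are 0 by division by zero.\<close>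

lemma factors_rational:
  assumes [measurable]: "x \<in> borel_measurable M" "y \<in> borel_measurable M"
  shows "factors M \<Omega> (\<lambda>u. of_real (1 / norm (x u - y u))) (\<lambda>z u. 1 / (\<phi> z (x u) - \<phi> z (y u)))"
    and "factors M \<Omega> (\<lambda>u. of_real (1 / norm (x u - y u))) (\<lambda>z u. 1 / cnj (\<phi> z (x u) - \<phi> z (y u)))"
proof -
  define s where "s z u = (of_real (norm (x u - y u)) / (x u - y u)) * inverse (\<phi>Q z (x u) (y u))" for z u
  have s: "amplitude M \<Omega> n z0 \<delta> s" unfolding s_def[abs_def]
  proof (intro amp_mult amp_inverse amp_\<phi>Q norm_\<phi>Q assms)
    show "amplitude M \<Omega> n z0 \<delta> (\<lambda>z u. of_real (norm (x u - y u)) / (x u - y u))"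
      by (rule amp_const[where K = 1]) (auto simp: norm_divide divide_le_eq)
  qed
  have eq: "1 / (\<phi> z (x u) - \<phi> z (y u)) = of_real (1 / norm (x u - y u)) * s z u" for z u
    by (cases "x u = y u") (auto simp: \<phi>_diff s_def divide_inverse)
  show "factors M \<Omega> (\<lambda>u. of_real (1 / norm (x u - y u))) (\<lambda>z u. 1 / (\<phi> z (x u) - \<phi> z (y u)))"
    unfolding factors_def using s eq by blast
  have "1 / cnj (\<phi> z (x u) - \<phi> z (y u)) = of_real (1 / norm (x u - y u)) * cnj (s z u)" for z u
    using arg_cong[OF eq[of z u], of cnj] by simp
  then show "factors M \<Omega> (\<lambda>u. of_real (1 / norm (x u - y u))) (\<lambda>z u. 1 / cnj (\<phi> z (x u) - \<phi> z (y u)))"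
    unfolding factors_def using amp_cnj[OF s] by blast
qed

text \<open>The logarithm splits as ln|x - y| + ln|\<phi>Q|. Pulling out the weight 1/|x - y| leaves
  |x - y| times this sum, which is bounded where |x - y| is.\<close>

lemma factors_log:
  assumes [measurable]: "x \<in> borel_measurable M" "y \<in> borel_measurable M"
    and bounds: "\<And>u. u \<in> \<Omega> \<Longrightarrow> x u \<noteq> y u \<and> norm (x u - y u) \<le> D"
  shows "factors M \<Omega> (\<lambda>u. of_real (1 / norm (x u - y u))) (\<lambda>z u. of_real (2 * ln (norm (\<phi> z (x u) - \<phi> z (y u)))) + C)"
proof -
  let ?d = "\<lambda>u. norm (x u - y u)"
  \<comment> \<open>The indicator equals 1 on \<Omega> and makes the coefficient bounded for every
    u.\<close>
  define s where "s z u = (of_real (?d u) * (of_real (2 * ln (?d u)) + C))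
     + (2 * of_real (?d u * indicator {..D} (?d u))) * of_real (ln (norm (\<phi>Q z (x u) (y u))))" for z u
  have a1: "amplitude M \<Omega> n z0 \<delta> (\<lambda>z u. of_real (?d u) * (of_real (2 * ln (?d u)) + C))"
  proof (rule amp_const[where K = "2 * (1 + D * \<bar>ln D\<bar>) + D * norm C"])
      fix u assume "u \<in> \<Omega>"
      then have d: "0 < ?d u" "?d u \<le> D" using bounds by auto
      have "of_real (?d u) * (of_real (2 * ln (?d u)) + C) = of_real (2 * (?d u * ln (?d u))) + of_real (?d u) * C"
        by (simp add: distrib_left)
      also have "norm \<dots> \<le> 2 * \<bar>?d u * ln (?d u)\<bar> + ?d u * norm C"
        by (rule order_trans[OF norm_triangle_ineq]) (simp only: norm_mult norm_of_real, simp add: abs_mult)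
      also have "\<dots> \<le> 2 * (1 + D * \<bar>ln D\<bar>) + D * norm C"
        using abs_mult_ln_le[OF d] d by (intro add_mono mult_left_mono mult_right_mono) auto
      finally show "norm (of_real (?d u) * (of_real (2 * ln (?d u)) + C)) \<le> 2 * (1 + D * \<bar>ln D\<bar>) + D * norm C" .
  qed measurable
  have a2: "amplitude M \<Omega> n z0 \<delta> (\<lambda>z u. 2 * of_real (?d u * indicator {..D} (?d u)))"
    by (rule amp_const[where K = "2 * \<bar>D\<bar>"]) (auto simp: indicator_def norm_mult)
  have a3: "amplitude M \<Omega> n z0 \<delta> (\<lambda>z u. of_real (ln (norm (\<phi>Q z (x u) (y u)))))"
    by (intro amp_ln amp_\<phi>Q norm_\<phi>Q assms)
  have s: "amplitude M \<Omega> n z0 \<delta> s"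
    unfolding s_def[abs_def] by (rule amp_add[OF a1 amp_mult[OF a2 a3]])
  have "of_real (2 * ln (norm (\<phi> z (x u) - \<phi> z (y u)))) + C = of_real (1 / ?d u) * s z u" if "z \<in> P" "u \<in> \<Omega>" for z u
  proof -
    have d: "0 < ?d u" "?d u \<le> D" using bounds that by auto
    have "0 < norm (\<phi>Q z (x u) (y u))" using norm_\<phi>Q[OF that(1), of "x u" "y u"] by linarith
    then have "ln (norm (\<phi> z (x u) - \<phi> z (y u))) = ln (?d u) + ln (norm (\<phi>Q z (x u) (y u)))"
      using d by (simp add: \<phi>_diff norm_mult ln_mult)
    then show ?thesis using d by (simp add: s_def distrib_left)
  qed
  then show ?thesis unfolding factors_def using s by blast
qed

lemma factors_propagator:
  assumes [measurable]: "x \<in> borel_measurable M" "y \<in> borel_measurable M"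
    and bounds: "\<And>u. log_pair p q \<Longrightarrow> u \<in> \<Omega> \<Longrightarrow> x u \<noteq> y u \<and> norm (x u - y u) \<le> D"
  shows "factors M \<Omega> (\<lambda>u. of_real (1 / norm (x u - y u))) (\<lambda>z u. propagator C p q (\<phi> z (x u)) (\<phi> z (y u)))"
proof (cases "log_pair p q")
  case True
  then obtain c where "propagator C p q = (\<lambda>w z. c * (of_real (2 * ln (norm (w - z))) + C))"
    using propagator_log by metis
  then show ?thesis using factors_scale[OF factors_log[OF assms(1,2) bounds[OF True]], where c = c] by simp
next
  case False
  from propagator_rational[OF False, of C] show ?thesis
  proof cases
    case (1 c)
    then show ?thesis using factors_scale[OF factors_rational(1)[OF assms(1,2)], where c = c] by simp
  next
    case (2 c)
    then show ?thesis using factors_scale[OF factors_rational(2)[OF assms(1,2)], where c = c] by simp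
  qed
qed

end

section \<open>Majorants of contractions\<close>

lemma point_at_vertex_pos: "point_at z u h = vertex_pos z u (vertex_of h)"
  by (cases h) auto

lemma finite_half_edges [simp]: "finite (half_edges n N)"
proof -
  have "{IntH j s |j s. j < N \<and> s < 3} = (\<lambda>(j, s). IntH j s) ` ({..<N} \<times> {..<3})" by auto
  then show ?thesis by (simp add: half_edges_def)
qed

lemma contractions_subset: "M \<in> contractions n N \<Longrightarrow> M \<subseteq> half_edges n N \<times> half_edges n N"
  by (simp add: contractions_def)

lemma finite_contraction: "M \<in> contractions n N \<Longrightarrow> finite M"
  by (rule finite_subset[OF contractions_subset]) auto

lemma finite_contractions [simp]: "finite (contractions n N)"
  by (rule finite_subset[of _ "Pow (half_edges n N \<times> half_edges n N)"]) (auto dest: contractions_subset)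

lemma finite_vertex_decorations: "finite \<B> \<Longrightarrow> finite (vertex_decorations \<B>)"
  unfolding vertex_decorations_def interaction_monomials_def
  using finite_lists_length_eq[of \<B> 3] by (auto simp: conj_commute)

lemma graph_kernel_graph_of:
  assumes "finite M"
  shows "graph_kernel (graph_of M) z u = (\<Prod>(h, h')\<in>M. 1 / norm (point_at z u h - point_at z u h'))"
  by (simp add: graph_kernel_def graph_of_def prod_unfold_prod_mset image_mset.compositionality o_def point_at_vertex_pos case_prod_beta)

lemma measurable_point_at:
  "h \<in> half_edges n N \<Longrightarrow> (\<lambda>u. point_at z u h) \<in> borel_measurable (vol N)"
  by (cases h) (auto simp: half_edges_def vol_def intro!: measurable_coordinate)

lemma measurable_contraction_value:
  assumes "M \<in> contractions (length \<Phi>) N"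
  shows "(\<lambda>u. contraction_value f C \<Phi> e N z u \<tau> M) \<in> borel_measurable (vol N)"
proof -
  have "(\<lambda>u. \<Prod>p\<in>M. case p of (h, h') \<Rightarrow> if index_at e \<tau> h = index_at e \<tau> h'
          then propagator C (field_at \<Phi> \<tau> h) (field_at \<Phi> \<tau> h') (point_at z u h) (point_at z u h')
          else 0) \<in> borel_measurable (vol N)"
  proof (rule borel_measurable_prod)
    fix p assume "p \<in> M"
    obtain h h' where p: "p = (h, h')" by (cases p)
    have "h \<in> half_edges (length \<Phi>) N" "h' \<in> half_edges (length \<Phi>) N"
      using contractions_subset[OF assms] \<open>p \<in> M\<close> p by auto
    then show "(\<lambda>u. case p of (h, h') \<Rightarrow> if index_at e \<tau> h = index_at e \<tau> h'
          then propagator C (field_at \<Phi> \<tau> h) (field_at \<Phi> \<tau> h') (point_at z u h) (point_at z u h')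
          else 0) \<in> borel_measurable (vol N)"
      by (cases "index_at e \<tau> h = index_at e \<tau> h'") (simp_all add: p measurable_propagator measurable_point_at)
  qed
  then show ?thesis unfolding contraction_value_def by (intro borel_measurable_times borel_measurable_const)
qed

lemma measurable_graph_integrand:
  "(\<lambda>u. graph_integrand \<B> f C \<Phi> e N \<Gamma> z u) \<in> borel_measurable (vol N)"
  unfolding graph_integrand_def by (intro borel_measurable_sum measurable_contraction_value) auto

lemma measurable_graph_kernel:
  "M \<in> contractions n N \<Longrightarrow> (\<lambda>u. graph_kernel (graph_of M) z u) \<in> borel_measurable (vol N)"
proof -
  assume M: "M \<in> contractions n N"
  have "(\<lambda>u. \<Prod>p\<in>M. 1 / norm (point_at z u (fst p) - point_at z u (snd p))) \<in> borel_measurable (vol N)"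
  proof (rule borel_measurable_prod)
    fix p assume "p \<in> M"
    then have "fst p \<in> half_edges n N" "snd p \<in> half_edges n N" using contractions_subset[OF M] by auto
    note [measurable] = this[THEN measurable_point_at]
    show "(\<lambda>u. 1 / norm (point_at z u (fst p) - point_at z u (snd p))) \<in> borel_measurable (vol N)" by measurable
  qed
  then show ?thesis by (simp add: graph_kernel_graph_of[OF finite_contraction[OF M]] case_prod_beta)
qed

lemma inner_field_not_Fb:
  assumes "\<tau> \<in> (\<Pi>\<^sub>E j\<in>{..<N}. vertex_decorations \<B>)" "j < N" "s < 3"
  shows "field_at \<Phi> \<tau> (IntH j s) \<noteq> Fb"
proof -
  have "fst (\<tau> j) \<in> interaction_monomials" using assms by (auto simp: vertex_decorations_def PiE_iff mem_Times_iff)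
  moreover have "s = 0 \<or> s = 1 \<or> s = 2" using assms(3) by auto
  ultimately show ?thesis by (auto simp: interaction_monomials_def)
qed

lemma AE_vol_ne:
  fixes z0 :: "nat \<Rightarrow> complex" and n N :: nat
  shows "AE u in vol N. \<forall>j<N. \<forall>i<n. u j \<noteq> z0 i"
proof -
  have "AE u in vol N. u j \<noteq> c" if j: "j < N" for j and c :: complex
  proof (rule AE_I')
    let ?S = "\<Pi>\<^sub>E k\<in>{..<N}. if k = j then {c} else UNIV"
    have "emeasure (vol N) ?S = (\<Prod>k<N. emeasure lborel (if k = j then {c} else UNIV))"
      unfolding vol_def by (rule plane.emeasure_PiM) auto
    also have "\<dots> = 0" using j by (intro prod_zero bexI[of _ j]) auto
    finally show "?S \<in> null_sets (vol N)"
      unfolding vol_def by (auto simp: null_sets_def intro!: sets_PiM_I_finite)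
    show "{u \<in> space (vol N). \<not> u j \<noteq> c} \<subseteq> ?S" by (auto simp: vol_def space_PiM PiE_iff extensional_def)
  qed
  then have "AE u in vol N. \<forall>j\<in>{..<N}. \<forall>i\<in>{..<n}. u j \<noteq> z0 i"
    by (intro AE_finite_allI) auto
  then show ?thesis by (rule AE_mp) auto
qed

context deformation
begin

lemma point_deform:
  "h \<in> half_edges n N \<Longrightarrow> point_at z (\<phi>s N z u) h = \<phi> z (point_at z0 u h)"
  by (cases h) (auto simp: half_edges_def \<phi>_insertion \<phi>s_def)

text \<open>Where an interaction vertex meets an insertion, a logarithmic propagator has the value C
  up to sign while the weight is 0, so the factorisation would fail there. These positions form a
  null set. Collisions among interaction vertices can stay, because a logarithm always ends at an
  insertion.\<close>

definition "generic N = {u \<in> domain U N. \<forall>j<N. \<forall>i<n. u j \<noteq> z0 i}"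

lemma generic_sets [measurable]: "generic N \<in> sets (vol N)"
proof -
  have "generic N = domain U N \<inter> (\<Inter>j\<in>{..<N}. \<Inter>i\<in>{..<n}. {u \<in> space (vol N). u j \<noteq> z0 i}) \<inter> space (vol N)"
    using sets.sets_into_space[OF domain_sets] by (auto simp: generic_def)
  moreover have "{u \<in> space (vol N). u j \<noteq> z0 i} \<in> sets (vol N)" if "j < N" for i j
  proof -
    note [measurable] = coord_measurable[OF that]
    show ?thesis by measurable
  qed
  then have "space (vol N) \<inter> (\<Inter>j\<in>{..<N}. \<Inter>i\<in>{..<n}. {u \<in> space (vol N). u j \<noteq> z0 i}) \<in> sets (vol N)"
    by (cases "N = 0"; cases "n = 0") (auto intro!: sets.Int sets.finite_INT)
  ultimately show ?thesis using sets.Int[OF domain_sets] by (simp add: Int_ac)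
qed

lemma set_integral_generic:
  fixes F :: "(nat \<Rightarrow> complex) \<Rightarrow> complex"
  assumes [measurable]: "F \<in> borel_measurable (vol N)"
  shows "(LINT u:domain U N|vol N. F u) = (LINT u:generic N|vol N. F u)"
    and "set_integrable (vol N) (generic N) F \<Longrightarrow> set_integrable (vol N) (domain U N) F"
proof -
  have ae: "AE u in vol N. indicator (domain U N) u *\<^sub>R F u = indicator (generic N) u *\<^sub>R F u"
    using AE_vol_ne[of N n z0] by (rule AE_mp) (auto simp: generic_def indicator_def)
  have m: "(\<lambda>u. indicator (domain U N) u *\<^sub>R F u) \<in> borel_measurable (vol N)"
    "(\<lambda>u. indicator (generic N) u *\<^sub>R F u) \<in> borel_measurable (vol N)"
    by measurable
  show "(LINT u:domain U N|vol N. F u) = (LINT u:generic N|vol N. F u)"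
    unfolding set_lebesgue_integral_def by (rule integral_cong_AE[OF m ae])
  show "set_integrable (vol N) (generic N) F \<Longrightarrow> set_integrable (vol N) (domain U N) F"
    unfolding set_integrable_def using integrable_cong_AE[OF m ae] by simp
qed

text \<open>Edge by edge: each propagator splits off the inverse length of its edge. The weight so
  obtained is the graph kernel, which is common to all contractions with the same graph, so that
  sums over them keep this form.\<close>

lemma factors_contraction_value:
  assumes M: "M \<in> contractions n N" and n: "n = length \<Phi>"
    and \<tau>: "\<tau> \<in> (\<Pi>\<^sub>E j\<in>{..<N}. vertex_decorations \<B>)"
    and bdd: "bounded U \<or> \<not> bare_b_occurs \<Phi>"
  shows "factors (vol N) (generic N) (\<lambda>u. of_real (graph_kernel (graph_of M) z0 u))
     (\<lambda>z u. contraction_value f C \<Phi> e N z (\<phi>s N z u) \<tau> M)"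
proof -
  \<comment> \<open>A logarithm occurs only together with a bare \<open>b\<close>, and then
    \<open>bdd\<close> makes \<open>U\<close> bounded; \<open>D\<close> bounds its diameter.\<close>
  have "\<exists>D. bounded U \<longrightarrow> (\<forall>x\<in>U. \<forall>y\<in>U. norm (x - y) \<le> D)"
    using bounded_two_points[of U] by (auto simp: dist_norm)
  then obtain D where D: "bounded U \<longrightarrow> (\<forall>x\<in>U. \<forall>y\<in>U. norm (x - y) \<le> D)" by blast
  have z0U: "z0 i \<in> U" if "i < n" for i using inside[OF that] r by auto
  have pair: "factors (vol N) (generic N) (\<lambda>u. of_real (1 / norm (point_at z0 u h - point_at z0 u h')))
     (\<lambda>z u. if index_at e \<tau> h = index_at e \<tau> h'
          then propagator C (field_at \<Phi> \<tau> h) (field_at \<Phi> \<tau> h') (point_at z (\<phi>s N z u) h) (point_at z (\<phi>s N z u) h')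
          else 0)" if hM: "(h, h') \<in> M" for h h'
  proof -
    have hh: "h \<in> half_edges n N" "h' \<in> half_edges n N" using hM contractions_subset[OF M] by auto
    have ne: "vertex_of h \<noteq> vertex_of h'" using M hM by (auto simp: contractions_def)
    have bounds: "point_at z0 u h \<noteq> point_at z0 u h' \<and> norm (point_at z0 u h - point_at z0 u h') \<le> D"
      if lp: "log_pair (field_at \<Phi> \<tau> h) (field_at \<Phi> \<tau> h')" and u: "u \<in> generic N" for u
    proof -
      have ext: "bare_b_occurs \<Phi> \<and> (\<exists>i<n. k = ExtH i)" if "k \<in> half_edges n N" "field_at \<Phi> \<tau> k = Fb" for k
      proof (cases k)
        case (ExtH i)
        then have "i < n" using that by (auto simp: half_edges_def)
        then have "Fb \<in> fst ` set \<Phi>" using that ExtH n by (metis field_at.simps(1) image_eqI nth_mem)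
        then show ?thesis using ExtH \<open>i < n\<close> by (auto simp: bare_b_occurs_def)
      next
        case (IntH j s)
        then show ?thesis using that inner_field_not_Fb[OF \<tau>, of j s] by (auto simp: half_edges_def)
      qed
      have "field_at \<Phi> \<tau> h = Fb \<or> field_at \<Phi> \<tau> h' = Fb" using lp by (auto simp: log_pair_def)
      then have bare: "bare_b_occurs \<Phi>" and "(\<exists>i<n. h = ExtH i) \<or> (\<exists>i<n. h' = ExtH i)" using ext hh by auto
      then have bU: "bounded U" using bdd by simp
      have inU: "point_at z0 u k \<in> U" if "k \<in> half_edges n N" for k
        using that u z0U by (cases k) (auto simp: half_edges_def generic_def domain_def)
      have distinct: "point_at z0 u (ExtH i) \<noteq> point_at z0 u k"
        if "i < n" "k \<in> half_edges n N" "vertex_of k \<noteq> Ext i" for i k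
      proof (cases k)
        case (ExtH i')
        then show ?thesis using that separated[of i i'] r by (auto simp: half_edges_def)
      next
        case (IntH j s)
        then have "j < N" using that by (auto simp: half_edges_def)
        then have "u j \<noteq> z0 i" using u that(1) unfolding generic_def by blast
        then show ?thesis using IntH by auto
      qed
      have "point_at z0 u h \<noteq> point_at z0 u h'"
        using \<open>(\<exists>i<n. h = ExtH i) \<or> (\<exists>i<n. h' = ExtH i)\<close> distinct[of _ h'] distinct[of _ h] hh ne by fastforce
      then show ?thesis using D bU inU[OF hh(1)] inU[OF hh(2)] by simp
    qed
    have "factors (vol N) (generic N) (\<lambda>u. of_real (1 / norm (point_at z0 u h - point_at z0 u h')))
      (\<lambda>z u. propagator C (field_at \<Phi> \<tau> h) (field_at \<Phi> \<tau> h') (\<phi> z (point_at z0 u h)) (\<phi> z (point_at z0 u h')))"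
      by (rule factors_propagator[OF hh[THEN measurable_point_at]]) (rule bounds)
    \<comment> \<open>The Kronecker delta of the indices is a constant factor 0 or 1.\<close>
    from factors_scale[OF this, of "if index_at e \<tau> h = index_at e \<tau> h' then 1 else 0"] show ?thesis
      by (cases "index_at e \<tau> h = index_at e \<tau> h'") (simp_all add: point_deform[OF hh(1)] point_deform[OF hh(2)])
  qed
  have "factors (vol N) (generic N) (\<lambda>u. \<Prod>p\<in>M. of_real (1 / norm (point_at z0 u (fst p) - point_at z0 u (snd p))))
    (\<lambda>z u. \<Prod>p\<in>M. if index_at e \<tau> (fst p) = index_at e \<tau> (snd p)
          then propagator C (field_at \<Phi> \<tau> (fst p)) (field_at \<Phi> \<tau> (snd p)) (point_at z (\<phi>s N z u) (fst p)) (point_at z (\<phi>s N z u) (snd p))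
          else 0)"
    by (intro factors_prod finite_contraction[OF M] pair) simp
  from factors_scale[OF this, of "(\<Prod>j<N. vertex_coeff f (\<tau> j)) * koszul_sign (length \<Phi>) (field_at \<Phi> \<tau>) M"]
  show ?thesis
    by (simp add: contraction_value_def case_prod_beta graph_kernel_graph_of[OF finite_contraction[OF M]])
qed

lemma factors_graph_integrand:
  assumes "finite \<B>" and n: "n = length \<Phi>" and bdd: "bounded U \<or> \<not> bare_b_occurs \<Phi>"
  shows "factors (vol N) (generic N) (\<lambda>u. of_real (graph_kernel \<Gamma> z0 u))
     (\<lambda>z u. graph_integrand \<B> f C \<Phi> e N \<Gamma> z (\<phi>s N z u))"
  unfolding graph_integrand_def n[symmetric]
proof (intro factors_sum)
  show "finite (\<Pi>\<^sub>E j\<in>{..<N}. vertex_decorations \<B>)" using finite_vertex_decorations[OF assms(1)] by (intro finite_PiE) auto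
  show "finite {M \<in> contractions n N. graph_of M = \<Gamma>}" by simp
  fix \<tau> M assume "\<tau> \<in> (\<Pi>\<^sub>E j\<in>{..<N}. vertex_decorations \<B>)" "M \<in> {M \<in> contractions n N. graph_of M = \<Gamma>}"
  then show "factors (vol N) (generic N) (\<lambda>u. of_real (graph_kernel \<Gamma> z0 u)) (\<lambda>z u. contraction_value f C \<Phi> e N z (\<phi>s N z u) \<tau> M)"
    using factors_contraction_value[of M N \<Phi> \<tau> \<B>] n bdd by auto
qed

lemma \<phi>s_center: "u \<in> space (vol N) \<Longrightarrow> \<phi>s N z0 u = u" and \<phi>Js_center: "\<phi>Js N z0 u = 1"
  by (auto simp: \<phi>s_def \<phi>_def vol_def space_PiM PiE_iff extensional_def \<phi>Js_def \<phi>J_def \<phi>A_def \<phi>E_def)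

text \<open>At \<open>z0\<close> the deformation is the identity, and the factorisation there gives
  integrability. For nearby \<open>z\<close> the deformed integral has the fixed weight
  \<open>h\<close>, and all dependence on \<open>z\<close> sits in the amplitude.\<close>

lemma regular_contribution:
  assumes \<B>: "finite \<B>" and n: "n = length \<Phi>" and bdd: "bounded U \<or> \<not> bare_b_occurs \<Phi>"
    and \<Gamma>: "\<Gamma> \<in> feynman_graphs n N" "disjoint_union_of_rooted_trees \<Phi> N \<Gamma> p"
  shows "set_integrable (vol N) (domain U N) (graph_integrand \<B> f C \<Phi> e N \<Gamma> z0)"
    and "(\<lambda>w. iter_deriv ws (base_contribution \<B> f C U g \<Phi> e N \<Gamma>) (z0(i := w))) differentiable (at (z0 i))"
proof -
  obtain M where M: "M \<in> contractions n N" "\<Gamma> = graph_of M" using \<Gamma>(1) by (auto simp: feynman_graphs_def)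
  define h where "h u = complex_of_real (graph_kernel \<Gamma> z0 u)" for u
  have hm [measurable]: "h \<in> borel_measurable (vol N)"
    unfolding h_def M(2) using measurable_graph_kernel[OF M(1), of z0] by measurable
  have nonneg: "0 \<le> graph_kernel \<Gamma> z0 u" for u
    unfolding M(2) graph_kernel_graph_of[OF finite_contraction[OF M(1)]] by (intro prod_nonneg) auto
  have inj: "inj_on z0 {..<length \<Phi>}"
    using separated r unfolding inj_on_def n[symmetric] by fastforce
  have "(\<integral>\<^sup>+u. ennreal (norm (h u)) \<partial>vol N) < \<infinity>"
    using graph_kernel_integral_finite[OF \<Gamma>(2) inj] nonneg by (simp add: h_def)
  then have "integrable (vol N) h" by (intro integrableI_bounded) auto
  then have h: "set_integrable (vol N) (generic N) h"
    unfolding set_integrable_def using generic_sets by (intro integrable_mult_indicator)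
  obtain s where s: "amplitude (vol N) (generic N) n z0 \<delta> s"
    "\<And>z u. z \<in> P \<Longrightarrow> u \<in> generic N \<Longrightarrow> graph_integrand \<B> f C \<Phi> e N \<Gamma> z (\<phi>s N z u) = h u * s z u"
    using factors_graph_integrand[OF \<B> n bdd, of N \<Gamma> f C e] unfolding factors_def h_def by blast
  have z0: "z0 \<in> P" using polydisc_center \<delta>_pos by blast
  note [measurable] = measurable_graph_integrand
  have "set_integrable (vol N) (generic N) (\<lambda>u. h u * s z0 u)"
    by (rule set_integrable_amplitude[OF h hm generic_sets s(1) z0])
  moreover have "indicator (generic N) u *\<^sub>R (h u * s z0 u) = indicator (generic N) u *\<^sub>R graph_integrand \<B> f C \<Phi> e N \<Gamma> z0 u" for u
  proof (cases "u \<in> generic N")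
    case True
    then have "u \<in> space (vol N)" using sets.sets_into_space[OF generic_sets[of N]] by blast
    then show ?thesis using s(2)[OF z0 True] \<phi>s_center[of u N] by simp
  qed simp
  ultimately have "set_integrable (vol N) (generic N) (graph_integrand \<B> f C \<Phi> e N \<Gamma> z0)"
    unfolding set_integrable_def by simp
  then show "set_integrable (vol N) (domain U N) (graph_integrand \<B> f C \<Phi> e N \<Gamma> z0)"
    by (intro set_integral_generic(2)) measurable
  let ?c = "1 / fact N * (g / (2 * of_real pi)) ^ N"
  have amp: "amplitude (vol N) (generic N) n z0 \<delta> (\<lambda>z u. ?c * (of_real (\<phi>Js N z u) * s z u))"
    by (intro amp_mult amp_complex_const amp_\<phi>Js s)
  have eq: "base_contribution \<B> f C U g \<Phi> e N \<Gamma> z = (LINT u:generic N|vol N. h u * (?c * (of_real (\<phi>Js N z u) * s z u)))"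
    if z: "z \<in> P" for z
  proof -
    have "(LINT u:domain U N|vol N. graph_integrand \<B> f C \<Phi> e N \<Gamma> z u)
      = (LINT u:domain U N|vol N. of_real (\<phi>Js N z u) * graph_integrand \<B> f C \<Phi> e N \<Gamma> z (\<phi>s N z u))"
      by (rule integral_deformation[OF z]) measurable
    also have "\<dots> = (LINT u:generic N|vol N. of_real (\<phi>Js N z u) * graph_integrand \<B> f C \<Phi> e N \<Gamma> z (\<phi>s N z u))"
      by (rule set_integral_generic(1)) measurable
    finally have "base_contribution \<B> f C U g \<Phi> e N \<Gamma> z
      = (LINT u:generic N|vol N. ?c * (of_real (\<phi>Js N z u) * graph_integrand \<B> f C \<Phi> e N \<Gamma> z (\<phi>s N z u)))"
      unfolding base_contribution_def by (simp only: set_integral_mult_right)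
    also have "\<dots> = (LINT u:generic N|vol N. h u * (?c * (of_real (\<phi>Js N z u) * s z u)))"
      by (rule set_lebesgue_integral_cong[OF generic_sets]) (simp add: s(2)[OF z])
    finally show ?thesis .
  qed
  show "(\<lambda>w. iter_deriv ws (base_contribution \<B> f C U g \<Phi> e N \<Gamma>) (z0(i := w))) differentiable (at (z0 i))"
    by (rule iter_deriv_amplitude_integral(2)[OF h hm generic_sets amp eq z0])
qed

end

lemma deformation_exists:
  assumes "open U" "z \<in> configurations n U"
  obtains r where "deformation n z r U"
proof -
  have z: "inj_on z {..<n}" "\<And>i. i < n \<Longrightarrow> z i \<in> U" using assms(2) by (auto simp: configurations_def)
  have "\<exists>d. i < n \<longrightarrow> 0 < d \<and> ball (z i) d \<subseteq> U" for i
    using assms(1) z(2)[of i] unfolding open_contains_ball by blast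
  then obtain d where "i < n \<longrightarrow> 0 < d i \<and> ball (z i) (d i) \<subseteq> U" for i
    by metis
  then have d: "\<And>i. i < n \<Longrightarrow> 0 < d i" "\<And>i. i < n \<Longrightarrow> ball (z i) (d i) \<subseteq> U" by auto
  \<comment> \<open>The element 1 keeps the set nonempty when there are no insertions.\<close>
  define A where "A = insert 1 (d ` {..<n} \<union> (\<lambda>(i, k). norm (z i - z k)) ` ({(i, k). i < n \<and> k < n \<and> i \<noteq> k}))"
  have "finite {(i, k). i < n \<and> k < n \<and> i \<noteq> k}"
    by (rule finite_subset[of _ "{..<n} \<times> {..<n}"]) auto
  then have fin: "finite A" unfolding A_def by (intro finite.insertI finite_UnI finite_imageI) auto
  have pos: "\<forall>a\<in>A. 0 < a" using d z(1) by (auto simp: A_def inj_on_def)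
  have "deformation n z (Min A) U"
  proof
    show "0 < Min A" using fin pos by (subst Min_gr_iff) (auto simp: A_def)
    show "Min A \<le> norm (z i - z k)" if "i < n" "k < n" "i \<noteq> k" for i k
      using that by (intro Min_le fin) (auto simp: A_def)
    show "ball (z i) (Min A) \<subseteq> U" if "i < n" for i
    proof -
      have "Min A \<le> d i" using that by (intro Min_le fin) (auto simp: A_def)
      then show ?thesis using d(2)[OF that] subset_ball by blast
    qed
    show "U \<in> sets borel" using assms(1) by simp
  qed
  then show thesis by (rule that)
qed

lemma contribution_regular:
  assumes "finite \<B>" "open U" "bounded U \<or> \<not> bare_b_occurs \<Phi>" "z \<in> configurations (length \<Phi>) U"
    and "\<Gamma> \<in> feynman_graphs (length \<Phi>) N" "disjoint_union_of_rooted_trees \<Phi> N \<Gamma> p"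
  shows "set_integrable (vol N) (domain U N) (graph_integrand \<B> f C \<Phi> e N \<Gamma> z)"
    and "(\<lambda>w. iter_deriv ws (base_contribution \<B> f C U g \<Phi> e N \<Gamma>) (z(i := w))) differentiable (at (z i))"
proof -
  obtain r where "deformation (length \<Phi>) z r U" using deformation_exists assms(2,4) by blast
  then interpret deformation "length \<Phi>" z r U .
  show "set_integrable (vol N) (domain U N) (graph_integrand \<B> f C \<Phi> e N \<Gamma> z)"
    "(\<lambda>w. iter_deriv ws (base_contribution \<B> f C U g \<Phi> e N \<Gamma>) (z(i := w))) differentiable (at (z i))"
    using regular_contribution[OF assms(1) refl assms(3,5,6)] by blast+
qed

section \<open>Oriented contractions\<close>

definition partner :: "(half_edge \<times> half_edge) set \<Rightarrow> half_edge \<Rightarrow> half_edge" where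
  "partner M h = (THE h'. (h, h') \<in> M \<or> (h', h) \<in> M)"

lemma partner_ex1:
  assumes "M \<in> contractions n N" "h \<in> half_edges n N"
  shows "\<exists>!h'. (h, h') \<in> M \<or> (h', h) \<in> M"
proof -
  have ne: "\<And>p. p \<in> M \<Longrightarrow> fst p \<noteq> snd p" and ex1: "\<exists>!p. p \<in> M \<and> (h = fst p \<or> h = snd p)"
    using assms by (auto simp: contractions_def)
  obtain p where p: "p \<in> M" "h = fst p \<or> h = snd p" and uniq: "\<And>q. q \<in> M \<Longrightarrow> h = fst q \<or> h = snd q \<Longrightarrow> q = p"
    using ex1 by blast
  obtain a b where ab: "p = (a, b)" by (cases p)
  have hx: "h = a \<and> x = b" if "(h, x) \<in> M" for x using uniq[OF that] ab by simp
  have xh: "h = b \<and> x = a" if "(x, h) \<in> M" for x using uniq[OF that] ab by simp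
  have "a \<noteq> b" using ne[OF p(1)] ab by simp
  have abM: "(a, b) \<in> M" using p(1) ab by simp
  consider "h = a" | "h = b" using p(2) ab by auto
  then show ?thesis
  proof cases
    case 1
    then show ?thesis using abM hx xh \<open>a \<noteq> b\<close> by (intro ex1I[of _ b]) blast+
  next
    case 2
    then show ?thesis using abM hx xh \<open>a \<noteq> b\<close> by (intro ex1I[of _ a]) blast+
  qed
qed

lemma partner_eqI:
  assumes "M \<in> contractions n N" "(h, h') \<in> M \<or> (h', h) \<in> M"
  shows "partner M h = h'"
proof -
  have "h \<in> half_edges n N" using assms contractions_subset by blast
  from partner_ex1[OF assms(1) this] show ?thesis
    unfolding partner_def using assms(2) by (intro the1_equality) auto
qed

lemma partner_mem:
  assumes "M \<in> contractions n N" "h \<in> half_edges n N"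
  shows "(h, partner M h) \<in> M \<or> (partner M h, h) \<in> M" "partner M h \<in> half_edges n N"
    "partner M (partner M h) = h" "vertex_of (partner M h) \<noteq> vertex_of h"
proof -
  show *: "(h, partner M h) \<in> M \<or> (partner M h, h) \<in> M"
    using theI'[OF partner_ex1[OF assms]] by (simp add: partner_def)
  then show "partner M h \<in> half_edges n N" using contractions_subset[OF assms(1)] by blast
  show "partner M (partner M h) = h" using * by (intro partner_eqI[OF assms(1)]) auto
  show "vertex_of (partner M h) \<noteq> vertex_of h" using * assms(1) by (auto simp: contractions_def)
qed

lemma mem_contraction_iff:
  assumes "M \<in> contractions n N"
  shows "(h, h') \<in> M \<longleftrightarrow> h \<in> half_edges n N \<and> h' = partner M h \<and> word_pos n h < word_pos n h'"
proof
  assume "(h, h') \<in> M"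
  then show "h \<in> half_edges n N \<and> h' = partner M h \<and> word_pos n h < word_pos n h'"
    using assms partner_eqI[OF assms, of h h'] by (auto simp: contractions_def)
next
  assume *: "h \<in> half_edges n N \<and> h' = partner M h \<and> word_pos n h < word_pos n h'"
  then have "(h, h') \<in> M \<or> (h', h) \<in> M" using partner_mem[OF assms] by blast
  moreover have "(h', h) \<notin> M" using * assms by (auto simp: contractions_def)
  ultimately show "(h, h') \<in> M" by blast
qed

fun outgoing :: "vertex \<Rightarrow> half_edge" where
  "outgoing (Ext i) = ExtH i"
| "outgoing (Inner j) = IntH j 0"

lemma vertex_of_outgoing [simp]: "vertex_of (outgoing v) = v" by (cases v) auto

lemma sum_half_edges:
  "(\<Sum>h\<in>half_edges n N. g h) = (\<Sum>i<n. g (ExtH i)) + (\<Sum>j<N. g (IntH j 0) + g (IntH j 1) + g (IntH j 2) :: 'a::comm_monoid_add)"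
proof -
  have inner: "{IntH j s | j s. j < N \<and> s < 3} = (\<lambda>(j, s). IntH j s) ` ({..<N} \<times> {..<3})" by auto
  have "(\<Sum>h\<in>half_edges n N. g h) = (\<Sum>h\<in>ExtH ` {..<n}. g h) + (\<Sum>h\<in>{IntH j s | j s. j < N \<and> s < 3}. g h)"
    unfolding half_edges_def by (rule sum.union_disjoint) (auto simp: inner)
  also have "(\<Sum>h\<in>ExtH ` {..<n}. g h) = (\<Sum>i<n. g (ExtH i))" by (subst sum.reindex) (auto simp: inj_on_def)
  also have "(\<Sum>h\<in>{IntH j s | j s. j < N \<and> s < 3}. g h) = (\<Sum>(j, s)\<in>{..<N} \<times> {..<3::nat}. g (IntH j s))"
    unfolding inner by (subst sum.reindex) (auto simp: inj_on_def case_prod_beta)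
  also have "\<dots> = (\<Sum>j<N. \<Sum>s<3::nat. g (IntH j s))" by (simp add: sum.cartesian_product)
  also have "\<dots> = (\<Sum>j<N. g (IntH j 0) + g (IntH j 1) + g (IntH j 2))"
    by (simp add: numeral_3_eq_3 lessThan_Suc add_ac numeral_2_eq_2)
  finally show ?thesis .
qed

lemma sum_mset_add_mset: "(\<Sum>t\<in>#F. add_mset (a t) (b t)) = image_mset a F + (\<Sum>t\<in>#F. b t)"
  by (induction F) auto

text \<open>Only charges decide the shape of the graph, so fields, indices and positions are
  forgotten here.\<close>

locale oriented_contraction =
  fixes n N :: nat and q :: "half_edge \<Rightarrow> int" and M :: "(half_edge \<times> half_edge) set"
  assumes M: "M \<in> contractions n N"
    and q_inner: "\<And>j. j < N \<Longrightarrow> q (IntH j 0) = 1" "\<And>j. j < N \<Longrightarrow> q (IntH j 1) = -1" "\<And>j. j < N \<Longrightarrow> q (IntH j 2) = -1"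
    and q_ext: "\<And>i. i < n \<Longrightarrow> q (ExtH i) = 1 \<or> q (ExtH i) = -1"
    and q_pair: "\<And>h h'. (h, h') \<in> M \<Longrightarrow> q h = - q h'"
begin

abbreviation "H \<equiv> half_edges n N"
abbreviation "p \<equiv> partner M"

lemmas p_mem = partner_mem(2)[OF M] and p_p = partner_mem(3)[OF M] and p_vertex = partner_mem(4)[OF M]

lemma q_partner: "h \<in> H \<Longrightarrow> q (p h) = - q h"
  using partner_mem(1)[OF M, of h] q_pair by fastforce

text \<open>Every edge is the outgoing edge of exactly one vertex in \<open>Outs\<close>, so the
  whole graph is encoded by the function \<open>parent\<close> on this set.\<close>

definition "Outs = {v. (\<exists>i<n. v = Ext i \<and> q (ExtH i) = 1) \<or> (\<exists>j<N. v = Inner j)}"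
definition "Roots = {i. i < n \<and> q (ExtH i) = -1}"
definition "parent v = vertex_of (p (outgoing v))"

lemma finite_Outs [simp]: "finite Outs"
proof -
  have "Outs \<subseteq> Ext ` {..<n} \<union> Inner ` {..<N}" by (auto simp: Outs_def)
  then show ?thesis by (rule finite_subset) auto
qed

lemma finite_Roots [simp]: "finite Roots" by (simp add: Roots_def)

lemma outgoing_mem: "v \<in> Outs \<Longrightarrow> outgoing v \<in> H" "v \<in> Outs \<Longrightarrow> q (outgoing v) = 1"
  by (auto simp: Outs_def half_edges_def q_inner)

lemma positive_half_edge:
  assumes "h \<in> H" "q h = 1" shows "h = outgoing (vertex_of h)" "vertex_of h \<in> Outs"
proof -
  show "h = outgoing (vertex_of h)"
  proof (cases h)
    case (IntH j s)
    then have "j < N" "s < 3" using assms by (auto simp: half_edges_def)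
    then have "s = 0 \<or> s = 1 \<or> s = 2" by auto
    then show ?thesis using IntH assms q_inner[OF \<open>j < N\<close>] by auto
  qed simp
  then show "vertex_of h \<in> Outs"
    using assms by (cases h) (auto simp: Outs_def half_edges_def)
qed

lemma negative_half_edge:
  assumes "h \<in> H" "q h = -1"
  obtains r where "h = ExtH r" "r \<in> Roots" | j where "h = IntH j 1" "j < N" | j where "h = IntH j 2" "j < N"
proof (cases h)
  case (ExtH r)
  then show thesis using assms that(1) by (auto simp: Roots_def half_edges_def)
next
  case (IntH j s)
  then have "j < N" "s < 3" using assms by (auto simp: half_edges_def)
  moreover have "s \<noteq> 0"
  proof
    assume "s = 0"
    then show False using IntH assms q_inner(1)[OF \<open>j < N\<close>] by simp
  qed
  ultimately have "s = 1 \<or> s = 2" by auto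
  then show thesis using IntH that \<open>j < N\<close> by auto
qed

lemma in_half_edge_child:
  assumes "h \<in> H" "q h = -1"
  shows "vertex_of (p h) \<in> Outs" "outgoing (vertex_of (p h)) = p h" "parent (vertex_of (p h)) = vertex_of h"
proof -
  have "p h \<in> H" "q (p h) = 1" using assms p_mem q_partner by auto
  note positive_half_edge[OF this]
  then show "vertex_of (p h) \<in> Outs" "outgoing (vertex_of (p h)) = p h" by simp_all
  then show "parent (vertex_of (p h)) = vertex_of h" using p_p[OF assms(1)] by (simp add: parent_def)
qed

lemma parent_eq_cases:
  assumes "v \<in> Outs"
  shows "(\<exists>r\<in>Roots. parent v = Ext r \<and> v = vertex_of (p (ExtH r)))
    \<or> (\<exists>j<N. parent v = Inner j \<and> (v = vertex_of (p (IntH j 1)) \<or> v = vertex_of (p (IntH j 2))))"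
proof -
  have h: "p (outgoing v) \<in> H" "q (p (outgoing v)) = -1" "p (p (outgoing v)) = outgoing v"
    using outgoing_mem[OF assms] p_mem q_partner p_p by auto
  from h(1,2) show ?thesis
    by (rule negative_half_edge) (use h(3) in \<open>auto simp: parent_def\<close>; metis vertex_of_outgoing)+
qed

definition "child j = vertex_of (p (IntH j 1))"
definition "child' j = vertex_of (p (IntH j 2))"

lemma children:
  assumes "j < N"
  shows "{v \<in> Outs. parent v = Inner j} = {child j, child' j}" "child j \<noteq> child' j"
proof -
  have h: "IntH j 1 \<in> H" "IntH j 2 \<in> H" using assms by (auto simp: half_edges_def)
  have q: "q (IntH j 1) = -1" "q (IntH j 2) = -1" using q_inner assms by auto
  show "{v \<in> Outs. parent v = Inner j} = {child j, child' j}"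
  proof (intro set_eqI iffI)
    fix v assume "v \<in> {v \<in> Outs. parent v = Inner j}"
    then show "v \<in> {child j, child' j}" using parent_eq_cases[of v] by (auto simp: child_def child'_def)
  next
    fix v assume "v \<in> {child j, child' j}"
    then show "v \<in> {v \<in> Outs. parent v = Inner j}"
      using in_half_edge_child[OF h(1) q(1)] in_half_edge_child[OF h(2) q(2)] by (auto simp: child_def child'_def)
  qed
  show "child j \<noteq> child' j"
  proof
    assume eq: "child j = child' j"
    have "p (IntH j 1) = outgoing (child j)" "p (IntH j 2) = outgoing (child' j)"
      by (simp_all only: child_def child'_def in_half_edge_child(2)[OF h(1) q(1)] in_half_edge_child(2)[OF h(2) q(2)])
    then have "p (p (IntH j 1)) = p (p (IntH j 2))" by (simp only: eq)
    then show False unfolding p_p[OF h(1)] p_p[OF h(2)] by simp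
  qed
qed

lemma parent_cases:
  assumes "v \<in> Outs"
  obtains r where "r \<in> Roots" "parent v = Ext r" | j where "j < N" "parent v = Inner j"
  using parent_eq_cases[OF assms] by blast

lemma parent_ne: "v \<in> Outs \<Longrightarrow> parent v \<noteq> v"
  using p_vertex[OF outgoing_mem(1)] by (simp add: parent_def)

lemma roots_bij: "bij_betw parent {v \<in> Outs. parent v \<notin> Inner ` {..<N}} (Ext ` Roots)"
\<comment> \<open>The inverse is only applied to external vertices; its \<open>Inner\<close> branch
  is a dummy.\<close>
proof (intro bij_betwI[where g = "\<lambda>w. vertex_of (p (case w of Ext r \<Rightarrow> ExtH r | Inner j \<Rightarrow> IntH j 0))"])
  show "parent \<in> {v \<in> Outs. parent v \<notin> Inner ` {..<N}} \<rightarrow> Ext ` Roots"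
  proof
    fix v assume "v \<in> {v \<in> Outs. parent v \<notin> Inner ` {..<N}}"
    then show "parent v \<in> Ext ` Roots" by (auto elim: parent_cases)
  qed
  have r: "ExtH r \<in> H" "q (ExtH r) = -1" if "r \<in> Roots" for r using that by (auto simp: Roots_def half_edges_def)
  show "(\<lambda>w. vertex_of (p (case w of Ext r \<Rightarrow> ExtH r | Inner j \<Rightarrow> IntH j 0))) \<in> Ext ` Roots \<rightarrow> {v \<in> Outs. parent v \<notin> Inner ` {..<N}}"
    using in_half_edge_child r by auto
  show "vertex_of (p (case parent v of Ext r \<Rightarrow> ExtH r | Inner j \<Rightarrow> IntH j 0)) = v"
    if "v \<in> {v \<in> Outs. parent v \<notin> Inner ` {..<N}}" for v
    using that parent_eq_cases[of v] by auto
  show "parent (vertex_of (p (case w of Ext r \<Rightarrow> ExtH r | Inner j \<Rightarrow> IntH j 0))) = w" if "w \<in> Ext ` Roots" for w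
    using that in_half_edge_child(3) r by auto
qed

text \<open>The pairing reverses the sign of the charge, so the charges of all half-edges cancel,
  and every interaction vertex contributes 1 - 1 - 1 = -1.\<close>

lemma charge_balance: "(\<Sum>i<n. q (ExtH i)) = int N"
proof -
  have "(\<Sum>h\<in>H. q h) = (\<Sum>h\<in>H. q (p h))"
    by (rule sum.reindex_bij_witness[of _ p p]) (auto simp: p_mem p_p)
  also have "\<dots> = (\<Sum>h\<in>H. - q h)" by (rule sum.cong) (auto simp: q_partner)
  finally have "(\<Sum>h\<in>H. q h) = 0" by (simp add: sum_negf)
  moreover have "(\<Sum>j<N. q (IntH j 0) + q (IntH j 1) + q (IntH j 2)) = (\<Sum>j<N. - 1)"
    using q_inner by (intro sum.cong) auto
  ultimately show ?thesis unfolding sum_half_edges by simp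
qed

text \<open>A contracted pair contains exactly one half-edge of charge 1. \<open>pr\<close> recovers
  the pair from the vertex of this half-edge, ordered as in the word.\<close>

lemma graph_of_eq: "graph_of M = image_mset (\<lambda>v. {v, parent v}) (mset_set Outs)"
proof -
  define pr where "pr v = (if word_pos n (outgoing v) < word_pos n (p (outgoing v)) then (outgoing v, p (outgoing v)) else (p (outgoing v), outgoing v))" for v
  have pr_mem: "pr v \<in> M" if "v \<in> Outs" for v
    using partner_mem(1)[OF M outgoing_mem(1)[OF that]] M by (auto simp: pr_def contractions_def)
  have inj: "inj_on pr Outs"
  proof (rule inj_onI)
    fix v w assume vw: "v \<in> Outs" "w \<in> Outs" "pr v = pr w"
    have "outgoing v \<in> {fst (pr v), snd (pr v)}" "outgoing w \<in> {fst (pr w), snd (pr w)}" by (auto simp: pr_def)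
    moreover have "{fst (pr w), snd (pr w)} = {outgoing w, p (outgoing w)}" by (auto simp: pr_def)
    ultimately have "outgoing v = outgoing w \<or> outgoing v = p (outgoing w)" using vw(3) by auto
    moreover have "outgoing v \<noteq> p (outgoing w)"
      using outgoing_mem[OF vw(1)] outgoing_mem[OF vw(2)] q_partner by (metis equation_minus_iff one_neq_neg_one)
    ultimately show "v = w" using vertex_of_outgoing by metis
  qed
  have "M = pr ` Outs"
  proof (intro set_eqI iffI)
    fix x assume "x \<in> M"
    obtain h h' where x: "x = (h, h')" by (cases x)
    have hM: "(h, h') \<in> M" using \<open>x \<in> M\<close> x by simp
    have hh: "h \<in> H" "h' \<in> H" using contractions_subset[OF M] hM by auto
    have wp: "word_pos n h < word_pos n h'" and h': "h' = p h" "h = p h'"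
      using mem_contraction_iff[OF M] hM partner_eqI[OF M, of h' h] by auto
    have "q h = 1 \<or> q h = -1"
    proof (cases h)
      case (IntH j s)
      then have "j < N" "s < 3" using hh by (auto simp: half_edges_def)
      then have "s = 0 \<or> s = 1 \<or> s = 2" by auto
      then show ?thesis using IntH q_inner[OF \<open>j < N\<close>] by auto
    qed (use hh q_ext in \<open>auto simp: half_edges_def\<close>)
    then show "x \<in> pr ` Outs"
    proof
      assume "q h = 1"
      note pos = positive_half_edge[OF hh(1) this]
      have "pr (vertex_of h) = (h, h')"
        unfolding pr_def pos(1)[symmetric] h'(1)[symmetric] using wp by simp
      then show ?thesis using pos(2) x by (metis imageI)
    next
      assume "q h = -1"
      then have "q h' = 1" using q_pair[OF hM] by simp
      note pos = positive_half_edge[OF hh(2) this]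
      have "pr (vertex_of h') = (h, h')"
        unfolding pr_def pos(1)[symmetric] h'(2)[symmetric] using wp by simp
      then show ?thesis using pos(2) x by (metis imageI)
    qed
  qed (use pr_mem in auto)
  then have "graph_of M = image_mset (\<lambda>(h, h'). {vertex_of h, vertex_of h'}) (image_mset pr (mset_set Outs))"
    by (simp add: graph_of_def image_mset_mset_set[OF inj])
  also have "\<dots> = image_mset (\<lambda>v. {v, parent v}) (mset_set Outs)"
  proof -
    have "(case pr v of (h, h') \<Rightarrow> {vertex_of h, vertex_of h'}) = {v, parent v}" for v
      by (simp add: pr_def parent_def insert_commute)
    then show ?thesis by (simp add: image_mset.compositionality o_def)
  qed
  finally show ?thesis .
qed

text \<open>From a vertex of such a set the parents never lead to a root, so if nonempty it contains
  an oriented cycle.\<close>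

definition "parent_closed Z \<longleftrightarrow> (\<forall>j\<in>Z. parent (Inner j) \<in> Inner ` Z)"

text \<open>Since an edge inside \<open>Z\<close> is the outgoing edge of exactly one vertex of \<open>Z\<close>, being closed under
  \<open>parent\<close> does not depend on the orientation of the graph.\<close>

lemma parent_closed_iff_graph:
  assumes Z: "Z \<subseteq> {..<N}"
  shows "parent_closed Z \<longleftrightarrow> size (filter_mset (\<lambda>E. E \<subseteq> Inner ` Z) (graph_of M)) = card Z"
proof -
  have fin: "finite Z" using Z finite_subset by blast
  have "filter_mset (\<lambda>E. E \<subseteq> Inner ` Z) (graph_of M)
    = image_mset (\<lambda>v. {v, parent v}) (filter_mset (\<lambda>v. {v, parent v} \<subseteq> Inner ` Z) (mset_set Outs))"
    unfolding graph_of_eq by (simp add: filter_mset_image_mset)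
  then have "size (filter_mset (\<lambda>E. E \<subseteq> Inner ` Z) (graph_of M)) = card {v \<in> Outs. {v, parent v} \<subseteq> Inner ` Z}"
    by (simp add: filter_mset_mset_set)
  also have "{v \<in> Outs. {v, parent v} \<subseteq> Inner ` Z} = Inner ` {j \<in> Z. parent (Inner j) \<in> Inner ` Z}"
    using Z by (auto simp: Outs_def)
  also have "card \<dots> = card {j \<in> Z. parent (Inner j) \<in> Inner ` Z}" by (rule card_image) (auto simp: inj_on_def)
  finally have eq: "size (filter_mset (\<lambda>E. E \<subseteq> Inner ` Z) (graph_of M)) = card {j \<in> Z. parent (Inner j) \<in> Inner ` Z}" .
  show ?thesis
  proof
    assume "parent_closed Z"
    then have "{j \<in> Z. parent (Inner j) \<in> Inner ` Z} = Z" by (auto simp: parent_closed_def)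
    then show "size (filter_mset (\<lambda>E. E \<subseteq> Inner ` Z) (graph_of M)) = card Z" using eq by simp
  next
    assume "size (filter_mset (\<lambda>E. E \<subseteq> Inner ` Z) (graph_of M)) = card Z"
    then have "{j \<in> Z. parent (Inner j) \<in> Inner ` Z} = Z" using eq fin by (intro card_subset_eq) auto
    then show "parent_closed Z" by (auto simp: parent_closed_def)
  qed
qed

text \<open>\<open>S\<close> holds the interaction vertices already built into partial trees; leaves
  count as processed from the start.\<close>

definition "processed S = {v \<in> Outs. v \<in> Inner ` S \<or> (\<exists>i. v = Ext i)}"

text \<open>Otherwise every remaining vertex j has a remaining child k(j). As j is the parent of
  k(j), the map k is injective, hence onto the finite set of remaining vertices. So every remaining
  vertex has a remaining parent, and the remaining vertices form a closed set.\<close>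

lemma ready_vertex:
  assumes acyclic: "\<And>Z. Z \<subseteq> {..<N} \<Longrightarrow> Z \<noteq> {} \<Longrightarrow> \<not> parent_closed Z"
    and S: "S \<subset> {..<N}"
  obtains j where "j < N" "j \<notin> S" "child j \<in> processed S" "child' j \<in> processed S"
proof (rule ccontr)
  assume "\<not> thesis"
  then have no: "\<not> (j < N \<and> j \<notin> S \<and> child j \<in> processed S \<and> child' j \<in> processed S)" for j
    using that by blast
  let ?B = "{..<N} - S"
  have "\<exists>k\<in>?B. parent (Inner k) = Inner j" if j: "j \<in> ?B" for j
  proof -
    have "child j \<notin> processed S \<or> child' j \<notin> processed S" using no[of j] j by auto
    moreover have "child j \<in> Outs" "child' j \<in> Outs" "parent (child j) = Inner j" "parent (child' j) = Inner j"
      using children(1)[of j] j by auto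
    ultimately obtain v where "v \<in> Outs" "v \<notin> processed S" "parent v = Inner j" by blast
    then show ?thesis by (auto simp: processed_def Outs_def)
  qed
  then obtain k where k: "\<And>j. j \<in> ?B \<Longrightarrow> k j \<in> ?B" "\<And>j. j \<in> ?B \<Longrightarrow> parent (Inner (k j)) = Inner j" by metis
  have "inj_on k ?B" using k(2) by (metis inj_onI vertex.inject(2))
  then have "k ` ?B = ?B" using k(1) by (intro card_subset_eq) (auto simp: card_image)
  then have img: "i \<in> ?B \<Longrightarrow> \<exists>j\<in>?B. i = k j" for i by blast
  have "parent_closed ?B" unfolding parent_closed_def
  proof
    fix i assume "i \<in> ?B"
    then obtain j where "j \<in> ?B" "i = k j" using img by blast
    then show "parent (Inner i) \<in> Inner ` ?B" using k(2) by simp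
  qed
  then show False using acyclic[of ?B] S by auto
qed

text \<open>Trees are grown from the leaves, one interaction vertex at a time. The invariant says
  that \<open>S\<close> contains with a vertex all interaction vertices among its children, that the
  tops of the trees are the processed vertices whose parent is not yet in \<open>S\<close>, and that
  vertices and edges are used once each.\<close>

lemma partial_forest:
  assumes acyclic: "\<And>Z. Z \<subseteq> {..<N} \<Longrightarrow> Z \<noteq> {} \<Longrightarrow> \<not> parent_closed Z"
  shows "m \<le> N \<Longrightarrow> \<exists>S F. S \<subseteq> {..<N} \<and> card S = m \<and> (\<forall>v\<in>Outs. parent v \<in> Inner ` S \<longrightarrow> v \<in> processed S)
     \<and> image_mset top_vertex F = mset_set {v \<in> processed S. parent v \<notin> Inner ` S}
     \<and> (\<Sum>t\<in>#F. btree_vertices t) = mset_set (processed S)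
     \<and> (\<Sum>t\<in>#F. btree_edges t) = image_mset (\<lambda>v. {v, parent v}) (mset_set {v \<in> processed S. parent v \<in> Inner ` S})
     \<and> (\<forall>t\<in>#F. \<forall>i\<in>leaves t. q (ExtH i) = 1)"
proof (induction m)
  case 0
  let ?I = "{i. i < n \<and> q (ExtH i) = 1}"
  have D: "processed {} = Ext ` ?I" by (auto simp: processed_def Outs_def)
  have inj: "inj_on Ext ?I" "inj_on Leaf ?I" by (auto simp: inj_on_def)
  show ?case
  proof (intro exI[of _ "{}"] exI[of _ "image_mset Leaf (mset_set ?I)"] conjI)
    show "image_mset top_vertex (image_mset Leaf (mset_set ?I)) = mset_set {v \<in> processed {}. parent v \<notin> Inner ` {}}"
      by (simp add: D image_mset.compositionality o_def image_mset_mset_set[OF inj(1)])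
    show "(\<Sum>t\<in>#image_mset Leaf (mset_set ?I). btree_vertices t) = mset_set (processed {})"
      by (simp add: D image_mset.compositionality o_def image_mset_mset_set[OF inj(1), symmetric])
  qed (auto simp: image_mset.compositionality o_def)
next
  case (Suc m)
  then obtain S F where S: "S \<subseteq> {..<N}" "card S = m" "\<And>v. v \<in> Outs \<Longrightarrow> parent v \<in> Inner ` S \<Longrightarrow> v \<in> processed S"
    and F: "image_mset top_vertex F = mset_set {v \<in> processed S. parent v \<notin> Inner ` S}"
      "(\<Sum>t\<in>#F. btree_vertices t) = mset_set (processed S)"
      "(\<Sum>t\<in>#F. btree_edges t) = image_mset (\<lambda>v. {v, parent v}) (mset_set {v \<in> processed S. parent v \<in> Inner ` S})"
      "\<And>t i. t \<in># F \<Longrightarrow> i \<in> leaves t \<Longrightarrow> q (ExtH i) = 1"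
    by auto
  have "S \<subset> {..<N}" using S(1,2) Suc.prems by auto
  then obtain j where j: "j < N" "j \<notin> S" "child j \<in> processed S" "child' j \<in> processed S"
    using ready_vertex[OF acyclic] by blast
  have ch: "child j \<in> Outs" "child' j \<in> Outs" "parent (child j) = Inner j" "parent (child' j) = Inner j" "child j \<noteq> child' j"
    using children[OF j(1)] by auto
  let ?T = "{v \<in> processed S. parent v \<notin> Inner ` S}"
  let ?S = "insert j S"
  have finD: "finite (processed A)" for A unfolding processed_def by simp
  have jO: "Inner j \<in> Outs" using j(1) by (auto simp: Outs_def)
  have jS: "Inner j \<notin> processed S" using j(2) by (auto simp: processed_def)
  \<comment> \<open>The new node is the top of its tree: if its parent were in \<open>S\<close>, it
    would have been processed before, and it is not its own parent.\<close>
  have pj: "parent (Inner j) \<notin> Inner ` ?S"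
    using S(3)[OF jO] jS parent_ne[OF jO] by auto
  have D: "processed ?S = insert (Inner j) (processed S)" using jO by (auto simp: processed_def)
  have "child j \<in> ?T" "child' j \<in> ?T" using j ch by auto
  then have "child j \<in># image_mset top_vertex F" using finD unfolding F(1) by (subst elem_mset_set) auto
  then obtain t where t: "t \<in># F" "top_vertex t = child j" by auto
  define F1 where "F1 = F - {#t#}"
  have F1: "F = add_mset t F1" using t(1) by (simp add: F1_def)
  have T1: "mset_set ?T = add_mset (child j) (mset_set (?T - {child j}))"
    using \<open>child j \<in> ?T\<close> finD by (subst mset_set.remove[of _ "child j"]) auto
  have top1: "image_mset top_vertex F1 = mset_set (?T - {child j})"
    using F(1) unfolding F1 T1 by (simp add: t(2))
  have "child' j \<in># image_mset top_vertex F1" unfolding top1 using \<open>child' j \<in> ?T\<close> ch(5) finD by (subst elem_mset_set) auto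
  then obtain t' where t': "t' \<in># F1" "top_vertex t' = child' j" by auto
  define F2 where "F2 = F1 - {#t'#}"
  have F2: "F1 = add_mset t' F2" using t'(1) by (simp add: F2_def)
  have T2: "mset_set (?T - {child j}) = add_mset (child' j) (mset_set (?T - {child j} - {child' j}))"
    using \<open>child' j \<in> ?T\<close> ch(5) finD by (subst mset_set.remove[of _ "child' j"]) auto
  have top2: "image_mset top_vertex F2 = mset_set (?T - {child j} - {child' j})"
    using top1 unfolding F2 T2 by (simp add: t'(2))
  have FF: "F = add_mset t (add_mset t' F2)" by (simp add: F1 F2)
  have only: "v = child j \<or> v = child' j" if "v \<in> Outs" "parent v = Inner j" for v
    using children(1)[OF j(1)] that by auto
  show ?case
  proof (intro exI[of _ ?S] exI[of _ "add_mset (Node j t t') F2"] conjI)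
    show "?S \<subseteq> {..<N}" using S(1) j(1) by auto
    show "card ?S = Suc m" using S(1,2) j(2) by (simp add: finite_subset[OF S(1)])
    show "\<forall>v\<in>Outs. parent v \<in> Inner ` ?S \<longrightarrow> v \<in> processed ?S"
    proof (intro ballI impI)
      fix v assume v: "v \<in> Outs" "parent v \<in> Inner ` ?S"
      show "v \<in> processed ?S"
      proof (cases "parent v = Inner j")
        case True
        then show ?thesis using only[OF v(1)] j D by auto
      next
        case False
        then show ?thesis using v S(3)[OF v(1)] D by auto
      qed
    qed
    have "{v \<in> processed ?S. parent v \<notin> Inner ` ?S} = insert (Inner j) (?T - {child j} - {child' j})"
    proof (intro set_eqI iffI)
      fix v assume "v \<in> {v \<in> processed ?S. parent v \<notin> Inner ` ?S}"
      then show "v \<in> insert (Inner j) (?T - {child j} - {child' j})" using ch(3,4) by (auto simp: D)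
    next
      fix v assume "v \<in> insert (Inner j) (?T - {child j} - {child' j})"
      then show "v \<in> {v \<in> processed ?S. parent v \<notin> Inner ` ?S}"
        using pj only[of v] unfolding D by (auto simp: processed_def)
    qed
    then show "image_mset top_vertex (add_mset (Node j t t') F2) = mset_set {v \<in> processed ?S. parent v \<notin> Inner ` ?S}"
      using jS finD by (simp add: top2)
    show "(\<Sum>t\<in>#add_mset (Node j t t') F2. btree_vertices t) = mset_set (processed ?S)"
      using F(2) jS finD by (simp add: FF D add.assoc)
    have "{v \<in> processed ?S. parent v \<in> Inner ` ?S} = insert (child j) (insert (child' j) {v \<in> processed S. parent v \<in> Inner ` S})"
    proof (intro set_eqI iffI)
      fix v assume v: "v \<in> {v \<in> processed ?S. parent v \<in> Inner ` ?S}"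
      then show "v \<in> insert (child j) (insert (child' j) {v \<in> processed S. parent v \<in> Inner ` S})"
        using pj only[of v] by (auto simp: D processed_def)
    next
      fix v assume "v \<in> insert (child j) (insert (child' j) {v \<in> processed S. parent v \<in> Inner ` S})"
      then show "v \<in> {v \<in> processed ?S. parent v \<in> Inner ` ?S}" using j ch by (auto simp: D)
    qed
    moreover have "child j \<notin> {v \<in> processed S. parent v \<in> Inner ` S}" "child' j \<notin> {v \<in> processed S. parent v \<in> Inner ` S}"
      using ch j by auto
    ultimately show "(\<Sum>t\<in>#add_mset (Node j t t') F2. btree_edges t)
       = image_mset (\<lambda>v. {v, parent v}) (mset_set {v \<in> processed ?S. parent v \<in> Inner ` ?S})"
      using F(3) ch finD by (simp add: FF t(2) t'(2) insert_commute add.assoc)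
    show "\<forall>t\<in>#add_mset (Node j t t') F2. \<forall>i\<in>leaves t. q (ExtH i) = 1"
      using F(4) by (auto simp: FF)
  qed
qed

text \<open>When all interaction vertices are used, the tops of the trees are the vertices whose
  parent is a root, and \<open>roots_bij\<close> assigns to each tree its own root.\<close>

lemma forest:
  assumes acyclic: "\<And>Z. Z \<subseteq> {..<N} \<Longrightarrow> Z \<noteq> {} \<Longrightarrow> \<not> parent_closed Z"
  shows "\<exists>Ts. (\<forall>(r, t)\<in>set Ts. q (ExtH r) = -1 \<and> (\<forall>i\<in>leaves t. q (ExtH i) = 1))
    \<and> (\<Sum>T\<leftarrow>Ts. rooted_vertices T) = mset_set (Ext ` {..<n} \<union> Inner ` {..<N})
    \<and> (\<Sum>T\<leftarrow>Ts. rooted_edges T) = graph_of M"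
proof -
  obtain S F where S: "S \<subseteq> {..<N}" "card S = N"
    and F: "image_mset top_vertex F = mset_set {v \<in> processed S. parent v \<notin> Inner ` S}"
      "(\<Sum>t\<in>#F. btree_vertices t) = mset_set (processed S)"
      "(\<Sum>t\<in>#F. btree_edges t) = image_mset (\<lambda>v. {v, parent v}) (mset_set {v \<in> processed S. parent v \<in> Inner ` S})"
      "\<And>t i. t \<in># F \<Longrightarrow> i \<in> leaves t \<Longrightarrow> q (ExtH i) = 1"
    using partial_forest[OF acyclic, of N] by auto
  have SN: "S = {..<N}" using S by (intro card_subset_eq) auto
  have D: "processed {..<N} = Outs" by (auto simp: processed_def Outs_def)
  note F = F[unfolded SN D]
  obtain ts where ts: "mset ts = F" using ex_mset by blast
  define root where "root t = (THE r. parent (top_vertex t) = Ext r)" for t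
  let ?T = "{v \<in> Outs. parent v \<notin> Inner ` {..<N}}"
  have root: "parent (top_vertex t) = Ext (root t)" "root t \<in> Roots" if "t \<in># F" for t
  proof -
    have "top_vertex t \<in># image_mset top_vertex F" using that by auto
    then have "top_vertex t \<in> ?T" unfolding F(1) by simp
    then have "parent (top_vertex t) \<in> Ext ` Roots" by (rule bij_betwE[OF roots_bij, rule_format])
    then obtain r where r: "r \<in> Roots" "parent (top_vertex t) = Ext r" by blast
    then have "root t = r" by (simp add: root_def)
    then show "parent (top_vertex t) = Ext (root t)" "root t \<in> Roots" using r by auto
  qed
  have parts: "Ext ` {..<n} \<union> Inner ` {..<N} = Ext ` Roots \<union> Outs" "Ext ` Roots \<inter> Outs = {}"
    using q_ext by (auto simp: Roots_def Outs_def)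
  show ?thesis
  proof (intro exI[of _ "map (\<lambda>t. (root t, t)) ts"] conjI)
    show "\<forall>(r, t)\<in>set (map (\<lambda>t. (root t, t)) ts). q (ExtH r) = -1 \<and> (\<forall>i\<in>leaves t. q (ExtH i) = 1)"
      using root(2) F(4) ts by (auto simp: Roots_def)
    have "(\<Sum>T\<leftarrow>map (\<lambda>t. (root t, t)) ts. rooted_vertices T) = (\<Sum>t\<in>#F. {#Ext (root t)#} + btree_vertices t)"
      unfolding ts[symmetric] by (simp add: o_def sum_mset_sum_list[symmetric] flip: mset_map)
    also have "\<dots> = image_mset (\<lambda>t. Ext (root t)) F + mset_set Outs"
      by (simp add: sum_mset_add_mset F(2))
    also have "image_mset (\<lambda>t. Ext (root t)) F = image_mset parent (image_mset top_vertex F)"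
      using root(1) by (simp add: image_mset.compositionality o_def cong: image_mset_cong)
    also have "\<dots> = mset_set (Ext ` Roots)"
      unfolding F(1) using roots_bij by (simp add: bij_betw_def image_mset_mset_set)
    also have "mset_set (Ext ` Roots) + mset_set Outs = mset_set (Ext ` {..<n} \<union> Inner ` {..<N})"
      unfolding parts(1) using parts(2) by (subst mset_set_Union) auto
    finally show "(\<Sum>T\<leftarrow>map (\<lambda>t. (root t, t)) ts. rooted_vertices T) = mset_set (Ext ` {..<n} \<union> Inner ` {..<N})" .
    have "(\<Sum>T\<leftarrow>map (\<lambda>t. (root t, t)) ts. rooted_edges T) = (\<Sum>t\<in>#F. {#{Ext (root t), top_vertex t}#} + btree_edges t)"
      unfolding ts[symmetric] by (simp add: o_def sum_mset_sum_list[symmetric] flip: mset_map)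
    also have "\<dots> = image_mset (\<lambda>t. {Ext (root t), top_vertex t}) F + image_mset (\<lambda>v. {v, parent v}) (mset_set {v \<in> Outs. parent v \<in> Inner ` {..<N}})"
      by (simp add: sum_mset_add_mset F(3))
    also have "image_mset (\<lambda>t. {Ext (root t), top_vertex t}) F = image_mset (\<lambda>v. {v, parent v}) (image_mset top_vertex F)"
      using root(1) by (simp add: image_mset.compositionality o_def insert_commute cong: image_mset_cong)
    also have "image_mset (\<lambda>v. {v, parent v}) (image_mset top_vertex F) + image_mset (\<lambda>v. {v, parent v}) (mset_set {v \<in> Outs. parent v \<in> Inner ` {..<N}})
      = image_mset (\<lambda>v. {v, parent v}) (mset_set (?T \<union> {v \<in> Outs. parent v \<in> Inner ` {..<N}}))"
      unfolding F(1) by (subst mset_set_Union) auto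
    also have "?T \<union> {v \<in> Outs. parent v \<in> Inner ` {..<N}} = Outs" by auto
    finally show "(\<Sum>T\<leftarrow>map (\<lambda>t. (root t, t)) ts. rooted_edges T) = graph_of M" by (simp add: graph_of_eq)
  qed
qed

end

text \<open>In the multiset of all vertices every tree contains exactly one insertion of charge -1,
  its root.\<close>

lemma rooted_trees_count:
  assumes "disjoint_union_of_rooted_trees \<Phi> N \<Gamma> p"
  shows "p = card {i. i < length \<Phi> \<and> charge (fst (\<Phi> ! i)) = -1}"
proof -
  obtain Ts where len: "length Ts = p"
    and ch: "\<forall>(r, t)\<in>set Ts. charge (fst (\<Phi> ! r)) = -1 \<and> (\<forall>i\<in>leaves t. charge (fst (\<Phi> ! i)) = 1)"
    and vs: "(\<Sum>T\<leftarrow>Ts. rooted_vertices T) = mset_set (Ext ` {..<length \<Phi>} \<union> Inner ` {..<N})"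
    using assms unfolding disjoint_union_of_rooted_trees_def by blast
  define neg where "neg v \<longleftrightarrow> (\<exists>i. v = Ext i \<and> charge (fst (\<Phi> ! i)) = -1)" for v
  have "size (filter_mset neg (\<Sum>T\<leftarrow>Ts. rooted_vertices T)) = length Ts"
    using ch
  proof (induction Ts)
    case (Cons T Ts)
    obtain r t where T: "T = (r, t)" by (cases T)
    have "filter_mset neg (btree_vertices t) = filter_mset (\<lambda>_. False) (btree_vertices t)"
      using Cons.prems by (intro filter_mset_cong) (auto simp: T neg_def leaves_btree_vertices)
    then have "filter_mset neg (btree_vertices t) = {#}" by simp
    moreover have "neg (Ext r)" using Cons.prems by (auto simp: T neg_def)
    ultimately show ?case using Cons by (simp add: T)
  qed simp
  moreover have "{v \<in> Ext ` {..<length \<Phi>} \<union> Inner ` {..<N}. neg v} = Ext ` {i. i < length \<Phi> \<and> charge (fst (\<Phi> ! i)) = -1}"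
    by (auto simp: neg_def)
  moreover have "card (Ext ` {i. i < length \<Phi> \<and> charge (fst (\<Phi> ! i)) = -1}) = card {i. i < length \<Phi> \<and> charge (fst (\<Phi> ! i)) = -1}"
    by (rule card_image) (auto simp: inj_on_def)
  ultimately show ?thesis unfolding len vs by (simp add: filter_mset_mset_set)
qed

section \<open>The sign of a closed loop of chords\<close>

definition order_sign :: "nat \<Rightarrow> nat \<Rightarrow> complex" where
  "order_sign a b = (if a < b then -1 else 1)"

definition chord :: "nat \<Rightarrow> nat \<Rightarrow> nat \<times> nat" where
  "chord x y = (min x y, max x y)"

definition crossing :: "nat \<times> nat \<Rightarrow> nat \<times> nat \<Rightarrow> bool" where
  "crossing p q \<longleftrightarrow> fst p < fst q \<and> fst q < snd p \<and> snd p < snd q"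

lemma order_sign_square [simp]: "order_sign a b * order_sign a b = 1"
  by (simp add: order_sign_def)

lemma order_sign_self [simp]: "order_sign a a = 1"
  by (simp add: order_sign_def)

lemma order_sign_flip: "a \<noteq> b \<Longrightarrow> order_sign b a = - order_sign a b"
  by (auto simp: order_sign_def)

text \<open>Two chords cross when their ends alternate on the line, and the parity of this is the
  product of the four comparisons of an end of one with an end of the other. In this form crossing
  signs become multiplicative.\<close>

lemma crossing_sign_ordered:
  assumes "a < b" "c < d" "a \<noteq> c" "a \<noteq> d" "b \<noteq> c" "b \<noteq> d"
  shows "(if crossing (a, b) (c, d) then -1 else 1) * (if crossing (c, d) (a, b) then -1 else 1)
    = order_sign a c * order_sign a d * order_sign b c * order_sign b d"
proof -
  have eq: "c < a \<longleftrightarrow> \<not> a < c" "c < b \<longleftrightarrow> \<not> b < c" "d < b \<longleftrightarrow> \<not> b < d" "a < d \<or> \<not> a < d"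
    "b < c \<longrightarrow> a < c" "b < d \<longrightarrow> a < d" "a < c \<longrightarrow> a < d" "b < c \<longrightarrow> b < d" "d < a \<longleftrightarrow> \<not> a < d"
    using assms by linarith+
  show ?thesis
    unfolding crossing_def order_sign_def fst_conv snd_conv eq(1-3)
    by (cases "a < c"; cases "a < d"; cases "b < c"; cases "b < d") (use eq(5-9) in simp_all)
qed

text \<open>The four comparisons are symmetric in the two ends of a chord, so it need not be known
  which end comes first.\<close>

lemma crossing_sign:
  assumes "x1 \<noteq> x2" "x1 \<noteq> y2" "y1 \<noteq> x2" "y1 \<noteq> y2" "x1 \<noteq> y1" "x2 \<noteq> y2"
  shows "(if crossing (chord x1 y1) (chord x2 y2) then -1 else 1) * (if crossing (chord x2 y2) (chord x1 y1) then -1 else 1)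
    = order_sign x1 x2 * order_sign x1 y2 * order_sign y1 x2 * order_sign y1 y2"
proof -
  obtain a b where ab: "chord x1 y1 = (a, b)" "a < b" "(a = x1 \<and> b = y1) \<or> (a = y1 \<and> b = x1)"
    using assms(5) by (cases "x1 < y1") (auto simp: chord_def)
  obtain c d where cd: "chord x2 y2 = (c, d)" "c < d" "(c = x2 \<and> d = y2) \<or> (c = y2 \<and> d = x2)"
    using assms(6) by (cases "x2 < y2") (auto simp: chord_def)
  have "order_sign a c * order_sign a d * order_sign b c * order_sign b d
    = order_sign x1 x2 * order_sign x1 y2 * order_sign y1 x2 * order_sign y1 y2"
    using ab(3) cd(3) by (elim disjE conjE) (simp_all only: mult_ac)
  moreover have "a \<noteq> c" "a \<noteq> d" "b \<noteq> c" "b \<noteq> d" using ab(3) cd(3) assms by auto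
  ultimately show ?thesis using crossing_sign_ordered[OF ab(2) cd(2)] unfolding ab(1) cd(1) by simp
qed

lemma prod_square_split:
  "(\<Prod>i<k. \<Prod>j<k. c i j) = (\<Prod>i<k. c i i) * (\<Prod>j<k. \<Prod>i<j. c i j * c j i :: 'a::comm_monoid_mult)"
  for k :: nat
proof (induction k)
  case (Suc k)
  have "(\<Prod>i<Suc k. \<Prod>j<Suc k. c i j) = (\<Prod>i<k. \<Prod>j<k. c i j) * c k k * (\<Prod>i<k. c i k * c k i)"
    by (simp add: prod.distrib mult_ac)
  then show ?case by (simp add: Suc.IH mult_ac)
qed simp

text \<open>Pairs of indices up to k are split into those containing 0 and the shifted rest.
  Together with splitting off the largest index, this compares a triangular product with its
  shift.\<close>

lemma prod_triangle_shift:
  "(\<Prod>j<Suc k. \<Prod>i<j. c i j) = (\<Prod>j<k. \<Prod>i<j. c (Suc i) (Suc j)) * (\<Prod>j<k. c 0 (Suc j) :: 'a::comm_monoid_mult)"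
  for k :: nat
proof (induction k)
  case (Suc k)
  have "(\<Prod>j<Suc (Suc k). \<Prod>i<j. c i j) = (\<Prod>j<Suc k. \<Prod>i<j. c i j) * (\<Prod>i<Suc k. c i (Suc k))"
    by (rule prod.lessThan_Suc)
  also have "(\<Prod>i<Suc k. c i (Suc k)) = c 0 (Suc k) * (\<Prod>i<k. c (Suc i) (Suc k))"
    by (rule prod.lessThan_Suc_shift)
  finally have eq: "(\<Prod>j<Suc (Suc k). \<Prod>i<j. c i j) = (\<Prod>j<Suc k. \<Prod>i<j. c i j) * (c 0 (Suc k) * (\<Prod>i<k. c (Suc i) (Suc k)))" .
  show ?case
    by (rule trans[OF eq]) (unfold Suc.IH prod.lessThan_Suc[of _ k], simp only: mult_ac)
qed simp

lemma prod_cyclic_shift: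
  assumes "v k = (v 0 :: 'b)" "0 < k"
  shows "(\<Prod>j<k. g (v (Suc j))) = (\<Prod>j<k. g (v j) :: 'a::comm_monoid_mult)"
proof -
  obtain m where k: "k = Suc m" using assms(2) by (cases k) auto
  have "(\<Prod>j<Suc m. g (v j)) = g (v 0) * (\<Prod>j<m. g (v (Suc j)))" by (rule prod.lessThan_Suc_shift)
  then show ?thesis using assms(1) by (simp add: k mult.commute)
qed

text \<open>The i-th chord runs from slot 2 of the i-th vertex of the loop to slot 0 of the next
  one. Expanded into comparisons, the sign is E T S G: \<open>T\<close> and \<open>S\<close> compare
  starting points and end points among themselves, \<open>G\<close> compares starting points with
  end points, and \<open>E\<close> collects a -1 for each pair of chords. Reordering the end points
  shows that G = E. And T S is the sign of a cyclic shift of k entries, that is (-1)^(k-1).\<close>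

lemma loop_sign:
  fixes v :: "nat \<Rightarrow> nat" and m k :: nat
  assumes inj: "inj_on v {..<k}" and cyc: "v k = v 0" and k: "0 < k"
  defines "C \<equiv> \<lambda>i. m + 3 * v i + 2" and "D \<equiv> \<lambda>i. m + 3 * v (Suc i)"
  shows "(\<Prod>i<k. \<Prod>j<k. if crossing (chord (C i) (D i)) (chord (C j) (D j)) then -1 else 1)
     * (\<Prod>i<k. order_sign (C i) (D i)) = (-1) ^ (k - 1)"
proof -
  let ?s = "\<lambda>i j. order_sign (v i) (v j)"
  have vne: "v i \<noteq> v j" if "i < j" "j < k" for i j using inj that by (auto simp: inj_on_def)
  have vne': "v (Suc i) \<noteq> v (Suc j)" if "i < j" "j < k" for i j
  proof (cases "Suc j = k")
    case True
    then have "v (Suc i) \<noteq> v 0" using vne[of 0 "Suc i"] that by auto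
    then show ?thesis using True cyc by simp
  next
    case False then show ?thesis using vne[of "Suc i" "Suc j"] that by auto
  qed
  have CD: "C i \<noteq> D j" for i j unfolding C_def D_def by presburger
  have CC: "order_sign (C i) (C j) = ?s i j" and DD: "order_sign (D i) (D j) = ?s (Suc i) (Suc j)" for i j
    by (auto simp: C_def D_def order_sign_def)
  have X: "(if crossing (chord (C i) (D i)) (chord (C j) (D j)) then -1 else 1)
        * (if crossing (chord (C j) (D j)) (chord (C i) (D i)) then -1 else 1)
      = (-1) * (?s i j * ?s (Suc i) (Suc j)) * (order_sign (C i) (D j) * order_sign (C j) (D i))"
    if "i < j" "j < k" for i j
  proof -
    have ne: "C i \<noteq> C j" "D i \<noteq> D j" using vne[OF that] vne'[OF that] by (auto simp: C_def D_def)
    \<comment> \<open>Turning this comparison round costs a sign for each pair i < j; these signs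
      make up \<open>E\<close>.\<close>
    have f: "order_sign (D i) (C j) = - order_sign (C j) (D i)" using order_sign_flip CD by blast
    show ?thesis
      by (subst crossing_sign) (use ne CD[of i j] CD[of j i] CD[of i i] CD[of j j] in \<open>auto simp: CC DD f\<close>)
  qed
  define T where "T = (\<Prod>j<k. \<Prod>i<j. ?s i j)"
  define S where "S = (\<Prod>j<k. \<Prod>i<j. ?s (Suc i) (Suc j))"
  define E where "E = (\<Prod>j<k. \<Prod>i<j. (-1) :: complex)"
  define G where "G = (\<Prod>i<k. \<Prod>j<k. order_sign (C i) (D j))"
  have self: "\<not> crossing p p" for p by (simp add: crossing_def)
  have "(\<Prod>i<k. \<Prod>j<k. if crossing (chord (C i) (D i)) (chord (C j) (D j)) then -1 else 1 :: complex)
     = (\<Prod>j<k. \<Prod>i<j. (-1) * (?s i j * ?s (Suc i) (Suc j)) * (order_sign (C i) (D j) * order_sign (C j) (D i)))"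
  proof -
    have "(\<Prod>i<k. if crossing (chord (C i) (D i)) (chord (C i) (D i)) then -1 else 1 :: complex) = 1"
      by (simp add: self)
    moreover have "(\<Prod>j<k. \<Prod>i<j. (if crossing (chord (C i) (D i)) (chord (C j) (D j)) then -1 else 1)
        * (if crossing (chord (C j) (D j)) (chord (C i) (D i)) then -1 else 1))
      = (\<Prod>j<k. \<Prod>i<j. (-1) * (?s i j * ?s (Suc i) (Suc j)) * (order_sign (C i) (D j) * order_sign (C j) (D i)))"
      by (intro prod.cong refl X) auto
    ultimately show ?thesis by (simp only: prod_square_split mult_1)
  qed
  also have "\<dots> = E * (T * S) * (\<Prod>j<k. \<Prod>i<j. order_sign (C i) (D j) * order_sign (C j) (D i))"
    unfolding E_def T_def S_def by (simp only: prod.distrib)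
  finally have 1: "(\<Prod>i<k. \<Prod>j<k. if crossing (chord (C i) (D i)) (chord (C j) (D j)) then -1 else 1 :: complex)
      * (\<Prod>i<k. order_sign (C i) (D i)) = E * (T * S) * G"
    unfolding G_def prod_square_split by (simp add: mult_ac)
  \<comment> \<open>Since the loop closes, the end points may be listed by the same vertices as the
    starting points. Then a vertex compared with itself gives 1, and two different vertices give -1
    together.\<close>
  have "G = (\<Prod>i<k. \<Prod>j<k. order_sign (C i) (m + 3 * v j))"
    unfolding G_def D_def
    by (rule prod.cong[OF refl]) (rule prod_cyclic_shift[OF cyc k, where g = "\<lambda>w. order_sign _ (m + 3 * w)"])
  also have "\<dots> = (\<Prod>i<k. order_sign (C i) (m + 3 * v i)) * (\<Prod>j<k. \<Prod>i<j. order_sign (C i) (m + 3 * v j) * order_sign (C j) (m + 3 * v i))"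
    by (rule prod_square_split)
  also have "(\<Prod>i<k. order_sign (C i) (m + 3 * v i)) = 1"
    by (rule prod.neutral) (simp add: C_def order_sign_def)
  also have "(\<Prod>j<k. \<Prod>i<j. order_sign (C i) (m + 3 * v j) * order_sign (C j) (m + 3 * v i)) = E"
    unfolding E_def
  proof (intro prod.cong refl)
    fix i j assume "j \<in> {..<k}" "i \<in> {..<j}"
    then have "v i \<noteq> v j" using vne by auto
    then show "order_sign (C i) (m + 3 * v j) * order_sign (C j) (m + 3 * v i) = -1"
      by (cases "v i < v j") (auto simp: C_def order_sign_def)
  qed
  finally have G: "G = E" by simp
  have EE: "E * E = 1" unfolding E_def by (simp add: prod.distrib[symmetric])
  have TT: "T * T = 1" unfolding T_def by (simp add: prod.distrib[symmetric])
  obtain l where l: "k = Suc l" using k by (cases k) auto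
  define R where "R = (\<Prod>j<l. ?s 0 (Suc j))"
  have RR: "R * R = 1" unfolding R_def by (simp add: prod.distrib[symmetric])
  \<comment> \<open>Both sides are the product over all pairs from v 0, ..., v k, once with the last
    and once with the first entry split off.\<close>
  have "T * (\<Prod>i<k. ?s i k) = S * (\<Prod>j<k. ?s 0 (Suc j))"
    using prod_triangle_shift[where k = k and c = ?s] unfolding T_def S_def prod.lessThan_Suc by simp
  moreover have "(\<Prod>j<k. ?s 0 (Suc j)) = R"
    unfolding l prod.lessThan_Suc R_def using cyc l by simp
  moreover have "(\<Prod>i<k. ?s i k) = (-1) ^ l * R"
  proof -
    have "(\<Prod>i<k. ?s i k) = ?s 0 k * (\<Prod>i<l. ?s (Suc i) k)" unfolding l by (rule prod.lessThan_Suc_shift)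
    also have "\<dots> = (\<Prod>i<l. - ?s 0 (Suc i))"
      using cyc l vne[of 0 "Suc _"] by (auto intro!: prod.cong order_sign_flip)
    also have "\<dots> = (-1) ^ l * R" by (simp add: R_def prod_uminus)
    finally show ?thesis .
  qed
  ultimately have "T * ((-1) ^ l * R) = S * R" by simp
  then have "T * ((-1) ^ l * R) * R = S * R * R" by simp
  then have "S = T * (-1) ^ l" using RR by (simp add: mult.assoc)
  then have "T * S = (-1) ^ l" using TT by (simp add: mult.assoc[symmetric])
  then have "E * (T * S) * G = (-1) ^ l" using EE G by (simp add: mult_ac)
  then show ?thesis using 1 l by simp
qed

section \<open>Cyclic sums of structure constants are traces\<close>

text \<open>The matrix entry at (a, b) of the product of the matrices m 0, ..., m (k - 1).\<close>

fun path_sum :: "'a set \<Rightarrow> (nat \<Rightarrow> 'a \<Rightarrow> 'a \<Rightarrow> complex) \<Rightarrow> nat \<Rightarrow> 'a \<Rightarrow> 'a \<Rightarrow> complex" where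
  "path_sum B m 0 a b = (if a = b then 1 else 0)"
| "path_sum B m (Suc k) a b = (\<Sum>c\<in>B. path_sum B m k a c * m k c b)"

lemma sum_PiE_insert:
  assumes "x \<notin> I"
  shows "(\<Sum>y\<in>PiE (insert x I) (\<lambda>_. B). g y) = (\<Sum>y\<in>PiE I (\<lambda>_. B). \<Sum>b\<in>B. g (y(x := b)))"
proof -
  have "(\<Sum>y\<in>PiE (insert x I) (\<lambda>_. B). g y) = (\<Sum>p\<in>B \<times> PiE I (\<lambda>_. B). g ((snd p)(x := fst p)))"
    unfolding PiE_insert_eq using inj_combinator[OF assms, of "\<lambda>_. B"]
    by (subst sum.reindex) (auto simp: case_prod_beta)
  also have "\<dots> = (\<Sum>b\<in>B. \<Sum>y\<in>PiE I (\<lambda>_. B). g (y(x := b)))" by (simp add: sum.cartesian_product case_prod_beta)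
  finally show ?thesis by (simp add: sum.swap[of _ B])
qed

text \<open>The weight \<open>w\<close> on the two ends carries the induction, and afterwards serves
  to close the path to a cycle.\<close>

lemma path_sum_PiE:
  assumes "finite B"
  shows "(\<Sum>y\<in>{..<Suc k} \<rightarrow>\<^sub>E B. (\<Prod>i<k. m i (y i) (y (Suc i))) * w (y 0) (y k)) = (\<Sum>a\<in>B. \<Sum>b\<in>B. path_sum B m k a b * w a b)"
proof (induction k arbitrary: w)
  case 0
  have "(\<Sum>y\<in>{..<Suc 0} \<rightarrow>\<^sub>E B. w (y 0) (y 0)) = (\<Sum>a\<in>B. w a a)"
    using sum_PiE_insert[of 0 "{}" "\<lambda>y. w (y 0) (y 0)" B] by (simp add: lessThan_Suc)
  then show ?case using assms by (simp add: if_distrib[of "\<lambda>x. x * _"] cong: if_cong)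
next
  case (Suc k)
  have "(\<Sum>y\<in>{..<Suc (Suc k)} \<rightarrow>\<^sub>E B. (\<Prod>i<Suc k. m i (y i) (y (Suc i))) * w (y 0) (y (Suc k)))
    = (\<Sum>y\<in>{..<Suc k} \<rightarrow>\<^sub>E B. \<Sum>b\<in>B. (\<Prod>i<Suc k. m i ((y(Suc k := b)) i) ((y(Suc k := b)) (Suc i))) * w ((y(Suc k := b)) 0) b)"
    unfolding lessThan_Suc[of "Suc k"] by (subst sum_PiE_insert) auto
  also have "\<dots> = (\<Sum>y\<in>{..<Suc k} \<rightarrow>\<^sub>E B. (\<Prod>i<k. m i (y i) (y (Suc i))) * (\<Sum>b\<in>B. m k (y k) b * w (y 0) b))"
    by (intro sum.cong refl) (simp add: sum_distrib_left mult.assoc)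
  also have "\<dots> = (\<Sum>a\<in>B. \<Sum>c\<in>B. path_sum B m k a c * (\<Sum>b\<in>B. m k c b * w a b))"
    by (rule Suc.IH)
  also have "\<dots> = (\<Sum>a\<in>B. \<Sum>c\<in>B. \<Sum>b\<in>B. path_sum B m k a c * m k c b * w a b)"
    by (simp add: sum_distrib_left mult.assoc)
  also have "\<dots> = (\<Sum>a\<in>B. \<Sum>b\<in>B. path_sum B m (Suc k) a b * w a b)"
    by (rule sum.cong[OF refl], subst sum.swap) (simp add: sum_distrib_right)
  finally show ?case .
qed

lemma cyclic_sum:
  assumes "finite B"
  shows "(\<Sum>y\<in>{..<Suc k} \<rightarrow>\<^sub>E B. \<Prod>i<Suc k. m i (y i) (y (Suc i mod Suc k))) = (\<Sum>a\<in>B. path_sum B m (Suc k) a a)"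
proof -
  have "(\<Sum>y\<in>{..<Suc k} \<rightarrow>\<^sub>E B. \<Prod>i<Suc k. m i (y i) (y (Suc i mod Suc k)))
    = (\<Sum>y\<in>{..<Suc k} \<rightarrow>\<^sub>E B. (\<Prod>i<k. m i (y i) (y (Suc i))) * m k (y k) (y 0))"
    by (intro sum.cong refl) simp
  also have "\<dots> = (\<Sum>a\<in>B. \<Sum>b\<in>B. path_sum B m k a b * m k b a)"
    by (rule path_sum_PiE[OF assms])
  finally show ?thesis by simp
qed

section \<open>Traces of products of adjoint maps\<close>

locale embedded_lie_algebra = fin_dim_lie_algebra smul \<B> bracket
  for smul :: "'k::field \<Rightarrow> 'g::ab_group_add \<Rightarrow> 'g" and \<B> :: "'g set" and bracket :: "'g \<Rightarrow> 'g \<Rightarrow> 'g" +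
  fixes \<iota> :: "'k \<Rightarrow> complex"
  assumes embedding: "field_embedding \<iota>" and unimodular: "strongly_unimodular smul \<B> bracket"
begin

abbreviation "f \<equiv> structure_constant \<iota> smul \<B> bracket"
abbreviation "rep \<equiv> representation \<B>"

lemma \<iota>_add: "\<iota> (x + y) = \<iota> x + \<iota> y" and \<iota>_mult: "\<iota> (x * y) = \<iota> x * \<iota> y" and \<iota>_1: "\<iota> 1 = 1"
  using embedding by (auto simp: field_embedding_def)

lemma \<iota>_0: "\<iota> 0 = 0" using \<iota>_add[of 0 0] by simp
lemma \<iota>_minus: "\<iota> (- x) = - \<iota> x" using \<iota>_add[of x "- x"] \<iota>_0 by (simp add: eq_neg_iff_add_eq_0 add.commute)
lemma \<iota>_sum: "\<iota> (\<Sum>i\<in>A. h i) = (\<Sum>i\<in>A. \<iota> (h i))"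
  by (induction A rule: infinite_finite_induct) (auto simp: \<iota>_0 \<iota>_add)
lemma \<iota>_sign: "\<iota> ((- 1) ^ n) = (- 1) ^ n"
  by (induction n) (auto simp: \<iota>_1 \<iota>_mult \<iota>_minus)

lemma rep_linear:
  assumes "Vector_Spaces.linear smul smul T"
  shows "rep (T v) a = (\<Sum>c\<in>\<B>. rep v c * rep (T c) a)"
proof -
  interpret T: Vector_Spaces.linear smul smul T by (rule assms)
  have in_span: "x \<in> span \<B>" for x using span_Basis by simp
  have "v = (\<Sum>c\<in>\<B>. smul (rep v c) c)"
    by (rule sum_representation_eq[symmetric]) (auto simp: independent_Basis in_span finite_Basis)
  then have "T v = (\<Sum>c\<in>\<B>. smul (rep v c) (T c))"
    by (metis (no_types, lifting) T.sum T.scale sum.cong)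
  then have "rep (T v) = rep (\<Sum>c\<in>\<B>. smul (rep v c) (T c))" by simp
  also have "\<dots> = (\<lambda>b. \<Sum>c\<in>\<B>. rep (smul (rep v c) (T c)) b)"
    by (rule representation_sum) (auto simp: independent_Basis in_span)
  finally show ?thesis
    by (simp add: representation_scale[OF independent_Basis in_span])
qed

lemma linear_ad_product: "Vector_Spaces.linear smul smul (ad_product bracket Xs)"
proof (induction Xs)
  case Nil
  show ?case unfolding ad_product_def by (simp add: linear_id[unfolded id_def] id_def)
next
  case (Cons X Xs)
  have "ad_product bracket (X # Xs) = bracket X \<circ> ad_product bracket Xs" by (simp add: ad_product_def)
  then show ?case using Vector_Spaces.linear_compose[OF Cons bracket_linear_right] by (simp only:)
qed

lemma bracket_antisym: "bracket x y = - bracket y x"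
proof -
  interpret R: Vector_Spaces.linear smul smul "bracket z" for z by (rule bracket_linear_right)
  interpret L: Vector_Spaces.linear smul smul "\<lambda>x. bracket x z" for z by (rule bracket_linear_left)
  have "bracket (x + y) (x + y) = (bracket x x + bracket x y) + (bracket y x + bracket y y)"
    by (simp only: L.add R.add add_ac)
  then have "bracket x y + bracket y x = 0" by (simp add: bracket_alternating)
  then show ?thesis by (simp add: eq_neg_iff_add_eq_0)
qed

lemma f_antisym: "f x y w = - f x w y"
proof -
  have "rep (bracket y w) x = - rep (bracket w y) x"
    using bracket_antisym[of y w] span_Basis by (simp add: representation_neg[OF independent_Basis])
  then show ?thesis by (simp add: structure_constant_def \<iota>_minus)
qed

lemma rep_basis: "a \<in> \<B> \<Longrightarrow> rep a b = (if a = b then 1 else 0)"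
  using representation_basis[OF independent_Basis] by auto

lemma path_sum_forward:
  assumes "b \<in> \<B>"
  shows "path_sum \<B> (\<lambda>i a b. f a (X i) b) k a b = \<iota> (rep (ad_product bracket (map X [0..<k]) b) a)"
  using assms
proof (induction k arbitrary: b)
  case 0 then show ?case by (auto simp: ad_product_def rep_basis \<iota>_0 \<iota>_1)
next
  case (Suc k)
  have snoc: "ad_product bracket (Xs @ [Y]) = ad_product bracket Xs \<circ> bracket Y" for Xs Y
    by (induction Xs) (auto simp: ad_product_def)
  have "ad_product bracket (map X [0..<Suc k]) b = ad_product bracket (map X [0..<k]) (bracket (X k) b)"
    by (simp add: snoc)
  then show ?case using Suc.IH
    by (simp add: rep_linear[OF linear_ad_product, of _ "bracket (X k) b"] \<iota>_sum \<iota>_mult structure_constant_def mult.commute)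
qed

text \<open>The factors are transposed matrices, which multiply in the opposite order; hence the
  reversed list.\<close>

lemma path_sum_backward:
  assumes "a \<in> \<B>"
  shows "path_sum \<B> (\<lambda>i a b. f b (X i) a) k a b = \<iota> (rep (ad_product bracket (rev (map X [0..<k])) a) b)"
  using assms
proof (induction k arbitrary: b)
  case 0 then show ?case by (auto simp: ad_product_def rep_basis \<iota>_0 \<iota>_1)
next
  case (Suc k)
  have "ad_product bracket (rev (map X [0..<Suc k])) a = bracket (X k) (ad_product bracket (rev (map X [0..<k])) a)"
    by (simp add: ad_product_def)
  then show ?case using Suc
    by (simp add: rep_linear[OF bracket_linear_right, of "X k" "ad_product _ _ _"] \<iota>_sum \<iota>_mult structure_constant_def)
qed

text \<open>Strong unimodularity enters here: the two cyclic sums are the traces of a product of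
  adjoint maps and of the reversed product.\<close>

lemma cyclic_reversal:
  "(\<Sum>y\<in>{..<Suc k} \<rightarrow>\<^sub>E \<B>. \<Prod>i<Suc k. f (y i) (X i) (y (Suc i mod Suc k)))
    = (-1) ^ Suc k * (\<Sum>y\<in>{..<Suc k} \<rightarrow>\<^sub>E \<B>. \<Prod>i<Suc k. f (y (Suc i mod Suc k)) (X i) (y i))"
proof -
  let ?Xs = "map X [0..<Suc k]"
  have "(\<Sum>y\<in>{..<Suc k} \<rightarrow>\<^sub>E \<B>. \<Prod>i<Suc k. f (y i) (X i) (y (Suc i mod Suc k))) = \<iota> (endo_trace smul \<B> (ad_product bracket ?Xs))"
    using cyclic_sum[OF finite_Basis, of "\<lambda>i a b. f a (X i) b" k]
    by (simp only: path_sum_forward endo_trace_def \<iota>_sum cong: sum.cong)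
  moreover have "(\<Sum>y\<in>{..<Suc k} \<rightarrow>\<^sub>E \<B>. \<Prod>i<Suc k. f (y (Suc i mod Suc k)) (X i) (y i)) = \<iota> (endo_trace smul \<B> (ad_product bracket (rev ?Xs)))"
    using cyclic_sum[OF finite_Basis, of "\<lambda>i a b. f b (X i) a" k]
    by (simp only: path_sum_backward endo_trace_def \<iota>_sum cong: sum.cong)
  moreover have "endo_trace smul \<B> (ad_product bracket ?Xs) = (-1) ^ Suc k * endo_trace smul \<B> (ad_product bracket (rev ?Xs))"
    using unimodular[unfolded strongly_unimodular_def, rule_format, of ?Xs] by simp
  ultimately show ?thesis by (simp add: \<iota>_mult \<iota>_sign \<iota>_minus)
qed

text \<open>Carries \<open>cyclic_reversal\<close> over to the vertex set of a loop with its
  predecessor map; \<open>\<nu>\<close> enumerates the loop.\<close>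

lemma cycle_reversal:
  fixes Z :: "nat set" and \<nu> pr :: "nat \<Rightarrow> nat"
  assumes bij: "bij_betw \<nu> {..<k} Z" and k: "0 < k" and pr: "\<And>i. i < k \<Longrightarrow> pr (\<nu> (Suc i mod k)) = \<nu> i"
  shows "(\<Sum>y\<in>Z \<rightarrow>\<^sub>E \<B>. \<Prod>v\<in>Z. f (y (pr v)) (X v) (y v)) = (-1) ^ k * (\<Sum>y\<in>Z \<rightarrow>\<^sub>E \<B>. \<Prod>v\<in>Z. f (y v) (X v) (y (pr v)))"
proof -
  obtain l where l: "k = Suc l" using k by (cases k) auto
  have m: "Suc (x + l) mod Suc l = x" if "x < Suc l" for x using mod_add_self2[of x "Suc l"] that by simp
  have shift: "bij_betw (\<lambda>i. Suc i mod k) {..<k} {..<k}"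
    by (rule bij_betwI[where g = "\<lambda>i. (i + l) mod k"]) (auto simp: l mod_simps m)
  have bij': "bij_betw (\<lambda>i. \<nu> (Suc i mod k)) {..<k} Z"
    using bij_betw_trans[OF shift bij] by (simp add: o_def)
  have prods: "(\<Prod>v\<in>Z. G (y (pr v)) (X v) (y v)) = (\<Prod>i<k. G (y (\<nu> i)) (X (\<nu> (Suc i mod k))) (y (\<nu> (Suc i mod k))))"
    for G :: "'g \<Rightarrow> 'g \<Rightarrow> 'g \<Rightarrow> complex" and y
    by (subst prod.reindex_bij_betw[OF bij', symmetric]) (auto simp: pr intro!: prod.cong)
  have sums: "(\<Sum>y\<in>Z \<rightarrow>\<^sub>E \<B>. h (\<lambda>i\<in>{..<k}. y (\<nu> i))) = (\<Sum>y\<in>{..<k} \<rightarrow>\<^sub>E \<B>. h y)" for h :: "(nat \<Rightarrow> 'g) \<Rightarrow> complex"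
  proof -
    define \<mu> where "\<mu> = inv_into {..<k} \<nu>"
    have \<mu>: "\<And>v. v \<in> Z \<Longrightarrow> \<mu> v < k \<and> \<nu> (\<mu> v) = v" "\<And>i. i < k \<Longrightarrow> \<mu> (\<nu> i) = i" "\<And>i. i < k \<Longrightarrow> \<nu> i \<in> Z"
      using bij unfolding \<mu>_def bij_betw_def by (auto simp: f_inv_into_f inv_into_into[of _ \<nu> "{..<k}", simplified])
    show ?thesis
      by (rule sum.reindex_bij_witness[where i = "\<lambda>y. \<lambda>v\<in>Z. y (\<mu> v)" and j = "\<lambda>y. \<lambda>i\<in>{..<k}. y (\<nu> i)"])
        (auto simp: fun_eq_iff PiE_iff extensional_def \<mu> restrict_def)
  qed
  have "(\<Sum>y\<in>Z \<rightarrow>\<^sub>E \<B>. \<Prod>v\<in>Z. f (y (pr v)) (X v) (y v)) = (\<Sum>y\<in>{..<k} \<rightarrow>\<^sub>E \<B>. \<Prod>i<k. f (y i) (X (\<nu> (Suc i mod k))) (y (Suc i mod k)))"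
    unfolding prods using k by (subst sums[symmetric]) (auto intro!: sum.cong prod.cong)
  also have "\<dots> = (-1) ^ k * (\<Sum>y\<in>{..<k} \<rightarrow>\<^sub>E \<B>. \<Prod>i<k. f (y (Suc i mod k)) (X (\<nu> (Suc i mod k))) (y i))"
    unfolding l by (rule cyclic_reversal)
  also have "(\<Sum>y\<in>{..<k} \<rightarrow>\<^sub>E \<B>. \<Prod>i<k. f (y (Suc i mod k)) (X (\<nu> (Suc i mod k))) (y i)) = (\<Sum>y\<in>Z \<rightarrow>\<^sub>E \<B>. \<Prod>v\<in>Z. f (y v) (X v) (y (pr v)))"
    unfolding prods[where G = "\<lambda>a x b. f b x a"] using k by (subst sums[symmetric]) (auto intro!: sum.cong prod.cong)
  finally show ?thesis .
qed

end

section \<open>Separation of colour and kinematics\<close>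

definition inner_half_edges :: "nat \<Rightarrow> half_edge set" where
  "inner_half_edges N = {IntH j s | j s. j < N \<and> s < 3}"

fun field_of :: "insertion list \<Rightarrow> (nat \<Rightarrow> complex \<times> bf_field list) \<Rightarrow> half_edge \<Rightarrow> bf_field" where
  "field_of \<Phi> \<mu> (ExtH i) = fst (\<Phi> ! i)"
| "field_of \<Phi> \<mu> (IntH j s) = snd (\<mu> j) ! s"

fun index_of :: "'g list \<Rightarrow> (half_edge \<Rightarrow> 'g) \<Rightarrow> half_edge \<Rightarrow> 'g" where
  "index_of e \<xi> (ExtH i) = e ! i"
| "index_of e \<xi> (IntH j s) = \<xi> (IntH j s)"

text \<open>The part of a contraction that sees fields and positions but not the Lie algebra. The
  Kronecker deltas of the propagators become the constraint in \<open>colourings\<close>, and the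
  structure constants go into \<open>colour_factor\<close>.\<close>

definition wick_factor where
  "wick_factor C \<Phi> N z u \<mu> M =
     (\<Prod>j<N. fst (\<mu> j)) * koszul_sign (length \<Phi>) (field_of \<Phi> \<mu>) M
     * (\<Prod>(h, h')\<in>M. propagator C (field_of \<Phi> \<mu> h) (field_of \<Phi> \<mu> h') (point_at z u h) (point_at z u h'))"

definition colourings where
  "colourings \<B> e N M = {\<xi> \<in> inner_half_edges N \<rightarrow>\<^sub>E \<B>. \<forall>(h, h')\<in>M. index_of e \<xi> h = index_of e \<xi> h'}"

definition colour_factor :: "('g \<Rightarrow> 'g \<Rightarrow> 'g \<Rightarrow> complex) \<Rightarrow> 'g set \<Rightarrow> 'g list \<Rightarrow> nat \<Rightarrow> (half_edge \<times> half_edge) set \<Rightarrow> complex" where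
  "colour_factor f \<B> e N M = (\<Sum>\<xi>\<in>colourings \<B> e N M. \<Prod>j<N. f (\<xi> (IntH j 0)) (\<xi> (IntH j (Suc 0))) (\<xi> (IntH j 2)))"

lemma finite_inner_half_edges [simp]: "finite (inner_half_edges N)"
  by (rule finite_subset[OF _ finite_half_edges[of 0 N]]) (auto simp: half_edges_def inner_half_edges_def)

lemma koszul_sign_cong:
  assumes "\<And>p. p \<in> M \<Longrightarrow> F (fst p) = F' (fst p)"
  shows "koszul_sign n F M = koszul_sign n F' M"
  unfolding koszul_sign_def using assms by (intro arg_cong[where f = "\<lambda>A. (-1) ^ card A"]) auto

definition join_decoration :: "nat \<Rightarrow> (nat \<Rightarrow> complex \<times> bf_field list) \<Rightarrow> (half_edge \<Rightarrow> 'g) \<Rightarrow> nat \<Rightarrow> 'g vertex_decoration" where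
  "join_decoration N \<mu> \<xi> = (\<lambda>j\<in>{..<N}. (\<mu> j, [\<xi> (IntH j 0), \<xi> (IntH j (Suc 0)), \<xi> (IntH j 2)]))"

lemma slot_cases: "s < 3 \<Longrightarrow> s = 0 \<or> s = Suc 0 \<or> s = (2::nat)" by auto

lemma sum_decorations_split:
  fixes g :: "(nat \<Rightarrow> 'g vertex_decoration) \<Rightarrow> complex" and \<B> :: "'g set"
  shows "(\<Sum>\<tau>\<in>(\<Pi>\<^sub>E j\<in>{..<N}. vertex_decorations \<B>). g \<tau>)
    = (\<Sum>\<mu>\<in>{..<N} \<rightarrow>\<^sub>E interaction_monomials. \<Sum>\<xi>\<in>inner_half_edges N \<rightarrow>\<^sub>E \<B>. g (join_decoration N \<mu> \<xi>))"
proof -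
  define I where "I = (\<lambda>(\<mu>, \<xi>). join_decoration N \<mu> (\<xi> :: half_edge \<Rightarrow> 'g))"
  define J where "J \<tau> = (\<lambda>j\<in>{..<N}. fst (\<tau> j), \<lambda>h\<in>inner_half_edges N. case h of IntH j s \<Rightarrow> snd (\<tau> j) ! s | ExtH i \<Rightarrow> undefined)"
    for \<tau> :: "nat \<Rightarrow> 'g vertex_decoration"
  have "(\<Sum>\<tau>\<in>(\<Pi>\<^sub>E j\<in>{..<N}. vertex_decorations \<B>). g \<tau>)
    = (\<Sum>p\<in>({..<N} \<rightarrow>\<^sub>E interaction_monomials) \<times> (inner_half_edges N \<rightarrow>\<^sub>E \<B>). g (I p))"
  proof (rule sum.reindex_bij_witness[where i = I and j = J])
    fix \<tau> assume \<tau>: "\<tau> \<in> (\<Pi>\<^sub>E j\<in>{..<N}. vertex_decorations \<B>)"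
    have len: "length (snd (\<tau> j)) = 3" "set (snd (\<tau> j)) \<subseteq> \<B>" "fst (\<tau> j) \<in> interaction_monomials" if "j < N" for j
      using \<tau> that by (auto simp: vertex_decorations_def PiE_iff mem_Times_iff)
    have mem: "IntH j s \<in> inner_half_edges N \<longleftrightarrow> j < N \<and> s < 3" for j s by (auto simp: inner_half_edges_def)
    show "I (J \<tau>) = \<tau>"
    proof
      fix j
      show "I (J \<tau>) j = \<tau> j"
      proof (cases "j < N")
        case True
        then obtain x y w where "snd (\<tau> j) = [x, y, w]" using len(1)[OF True]
          by (auto simp: numeral_3_eq_3 length_Suc_conv)
        then show ?thesis using True by (simp add: I_def J_def join_decoration_def mem prod_eq_iff)
      qed (use \<tau> in \<open>auto simp: I_def J_def join_decoration_def PiE_iff extensional_def\<close>)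
    qed
    then show "g (I (J \<tau>)) = g \<tau>" by simp
    have "snd (\<tau> j) ! s \<in> \<B>" if "j < N" "s < 3" for j s using len[OF that(1)] that(2) nth_mem[of s "snd (\<tau> j)"] by auto
    then show "J \<tau> \<in> ({..<N} \<rightarrow>\<^sub>E interaction_monomials) \<times> (inner_half_edges N \<rightarrow>\<^sub>E \<B>)"
      using len(3) by (auto simp: J_def inner_half_edges_def)
  next
    fix p assume p: "p \<in> ({..<N} \<rightarrow>\<^sub>E interaction_monomials) \<times> (inner_half_edges N \<rightarrow>\<^sub>E \<B>)"
    obtain \<mu> \<xi> where [simp]: "p = (\<mu>, \<xi>)" by (cases p)
    have \<mu>: "\<mu> \<in> {..<N} \<rightarrow>\<^sub>E interaction_monomials" and \<xi>: "\<xi> \<in> inner_half_edges N \<rightarrow>\<^sub>E \<B>" using p by auto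
    have mem: "IntH j s \<in> inner_half_edges N \<longleftrightarrow> j < N \<and> s < 3" for j s by (auto simp: inner_half_edges_def)
    show "J (I p) = p"
    proof -
      have "(\<lambda>j\<in>{..<N}. fst (I p j)) = \<mu>" using \<mu> by (auto simp: I_def join_decoration_def fun_eq_iff PiE_iff extensional_def)
      moreover have "(\<lambda>h\<in>inner_half_edges N. case h of IntH j s \<Rightarrow> snd (I p j) ! s | ExtH i \<Rightarrow> undefined) = \<xi>"
      proof
        fix h
        show "(\<lambda>h\<in>inner_half_edges N. case h of IntH j s \<Rightarrow> snd (I p j) ! s | ExtH i \<Rightarrow> undefined) h = \<xi> h"
        proof (cases "h \<in> inner_half_edges N")
          case True
          then obtain j s where h: "h = IntH j s" "j < N" "s < 3" by (auto simp: inner_half_edges_def)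
          then show ?thesis using True slot_cases[OF h(3)] by (auto simp: I_def join_decoration_def)
        qed (use \<xi> in \<open>auto simp: PiE_iff extensional_def\<close>)
      qed
      ultimately have "J (I p) = (\<mu>, \<xi>)" unfolding J_def by (simp only:)
      then show ?thesis by simp
    qed
    show "I p \<in> (\<Pi>\<^sub>E j\<in>{..<N}. vertex_decorations \<B>)"
      using \<mu> \<xi> by (auto simp: I_def join_decoration_def vertex_decorations_def PiE_iff mem extensional_def)
  qed
  then show ?thesis by (simp add: I_def sum.cartesian_product case_prod_beta)
qed

lemma contraction_value_join:
  assumes M: "M \<in> contractions (length \<Phi>) N"
  shows "contraction_value f C \<Phi> e N z u (join_decoration N \<mu> \<xi>) M
    = wick_factor C \<Phi> N z u \<mu> M * (if \<forall>(h, h')\<in>M. index_of e \<xi> h = index_of e \<xi> h'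
        then \<Prod>j<N. f (\<xi> (IntH j 0)) (\<xi> (IntH j (Suc 0))) (\<xi> (IntH j 2)) else 0)"
proof -
  let ?\<tau> = "join_decoration N \<mu> \<xi>"
  have fld: "field_at \<Phi> ?\<tau> h = field_of \<Phi> \<mu> h" and idx: "index_at e ?\<tau> h = index_of e \<xi> h"
    if "h \<in> half_edges (length \<Phi>) N" for h
    using that slot_cases by (cases h; force simp: half_edges_def join_decoration_def)+
  have sub: "fst p \<in> half_edges (length \<Phi>) N" "snd p \<in> half_edges (length \<Phi>) N" if "p \<in> M" for p
    using contractions_subset[OF M] that by auto
  have "(\<Prod>(h, h')\<in>M. if index_at e ?\<tau> h = index_at e ?\<tau> h'
          then propagator C (field_at \<Phi> ?\<tau> h) (field_at \<Phi> ?\<tau> h') (point_at z u h) (point_at z u h') else 0)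
    = (\<Prod>p\<in>M. if index_of e \<xi> (fst p) = index_of e \<xi> (snd p)
          then propagator C (field_of \<Phi> \<mu> (fst p)) (field_of \<Phi> \<mu> (snd p)) (point_at z u (fst p)) (point_at z u (snd p)) else 0)"
    by (rule prod.cong[OF refl]) (simp add: fld idx sub case_prod_beta)
  also have "\<dots> = (if \<forall>(h, h')\<in>M. index_of e \<xi> h = index_of e \<xi> h'
      then \<Prod>(h, h')\<in>M. propagator C (field_of \<Phi> \<mu> h) (field_of \<Phi> \<mu> h') (point_at z u h) (point_at z u h') else 0)"
  proof (cases "\<forall>(h, h')\<in>M. index_of e \<xi> h = index_of e \<xi> h'")
    case True
    then show ?thesis by (auto simp: case_prod_beta intro!: prod.cong)
  next
    case False
    then obtain a b where "(a, b) \<in> M" "index_of e \<xi> a \<noteq> index_of e \<xi> b" by auto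
    then have "(\<Prod>p\<in>M. if index_of e \<xi> (fst p) = index_of e \<xi> (snd p)
          then propagator C (field_of \<Phi> \<mu> (fst p)) (field_of \<Phi> \<mu> (snd p)) (point_at z u (fst p)) (point_at z u (snd p)) else 0) = 0"
      using finite_contraction[OF M] by (intro prod_zero bexI[of _ "(a, b)"]) auto
    then show ?thesis using False by (simp only: if_False)
  qed
  finally have 1: "(\<Prod>(h, h')\<in>M. if index_at e ?\<tau> h = index_at e ?\<tau> h'
          then propagator C (field_at \<Phi> ?\<tau> h) (field_at \<Phi> ?\<tau> h') (point_at z u h) (point_at z u h') else 0)
    = (if \<forall>(h, h')\<in>M. index_of e \<xi> h = index_of e \<xi> h'
      then \<Prod>(h, h')\<in>M. propagator C (field_of \<Phi> \<mu> h) (field_of \<Phi> \<mu> h') (point_at z u h) (point_at z u h') else 0)" .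
  have 2: "koszul_sign (length \<Phi>) (field_at \<Phi> ?\<tau>) M = koszul_sign (length \<Phi>) (field_of \<Phi> \<mu>) M"
    by (rule koszul_sign_cong) (simp add: fld sub)
  have 3: "(\<Prod>j<N. vertex_coeff f (?\<tau> j)) = (\<Prod>j<N. fst (\<mu> j)) * (\<Prod>j<N. f (\<xi> (IntH j 0)) (\<xi> (IntH j (Suc 0))) (\<xi> (IntH j 2)))"
    unfolding prod.distrib[symmetric] by (rule prod.cong) (auto simp: vertex_coeff_def join_decoration_def)
  show ?thesis unfolding contraction_value_def 1 2 3 wick_factor_def by simp
qed

text \<open>All monomials of the interaction have the same index structure, so the colour factor
  depends on the contraction but not on the choice of monomials.\<close>

lemma sum_decorations:
  assumes "finite \<B>" and M: "M \<in> contractions (length \<Phi>) N"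
  shows "(\<Sum>\<tau>\<in>(\<Pi>\<^sub>E j\<in>{..<N}. vertex_decorations \<B>). contraction_value f C \<Phi> e N z u \<tau> M)
    = (\<Sum>\<mu>\<in>{..<N} \<rightarrow>\<^sub>E interaction_monomials. wick_factor C \<Phi> N z u \<mu> M * colour_factor f \<B> e N M)"
  unfolding sum_decorations_split
proof (rule sum.cong[OF refl])
  fix \<mu>
  have fin: "finite (inner_half_edges N \<rightarrow>\<^sub>E \<B>)" using assms(1) by (intro finite_PiE) auto
  show "(\<Sum>\<xi>\<in>inner_half_edges N \<rightarrow>\<^sub>E \<B>. contraction_value f C \<Phi> e N z u (join_decoration N \<mu> \<xi>) M)
    = wick_factor C \<Phi> N z u \<mu> M * colour_factor f \<B> e N M"
    unfolding contraction_value_join[OF M] sum_distrib_left[symmetric] colour_factor_def colourings_def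
    by (simp only: sum.inter_filter[OF fin])
qed

section \<open>Matched fields\<close>

text \<open>Names a field by the field of charge -1 in its contractions; only fields of one species
  have a nonzero propagator.\<close>

fun species :: "bf_field \<Rightarrow> bf_field" where
  "species Fa = Fa" | "species Fgamma = Fa"
| "species Fabar = Fabar" | "species Fgammabar = Fabar"
| "species Fc = Fc" | "species Fb = Fc" | "species Fdb = Fc" | "species Fdbarb = Fc"

lemma propagator_nonzero:
  "propagator C p q w z \<noteq> 0 \<Longrightarrow> charge p = - charge q \<and> species p = species q"
  by (cases p; cases q) (auto simp: propagator_def)

lemma odd_ghost_degree: "odd (ghost_degree p) \<longleftrightarrow> species p = Fc"
  by (cases p) auto

definition matched :: "(half_edge \<Rightarrow> bf_field) \<Rightarrow> (half_edge \<times> half_edge) set \<Rightarrow> bool" where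
  "matched F M \<longleftrightarrow> (\<forall>(h, h')\<in>M. charge (F h) = - charge (F h') \<and> species (F h) = species (F h'))"

text \<open>Only these decorations contribute, and their charges make each of them an oriented
  contraction.\<close>

definition pairings where
  "pairings \<Phi> N \<Gamma> = {(\<mu>, M). \<mu> \<in> {..<N} \<rightarrow>\<^sub>E interaction_monomials \<and> M \<in> contractions (length \<Phi>) N
     \<and> graph_of M = \<Gamma> \<and> matched (field_of \<Phi> \<mu>) M}"

lemma finite_interaction_monomials [simp]: "finite interaction_monomials"
  by (simp add: interaction_monomials_def)

lemma wick_factor_unmatched:
  assumes "M \<in> contractions (length \<Phi>) N" "\<not> matched (field_of \<Phi> \<mu>) M"
  shows "wick_factor C \<Phi> N z u \<mu> M = 0"
proof -
  have "(\<Prod>(h, h')\<in>M. propagator C (field_of \<Phi> \<mu> h) (field_of \<Phi> \<mu> h') (point_at z u h) (point_at z u h')) = 0"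
    using assms(2) propagator_nonzero finite_contraction[OF assms(1)] unfolding matched_def
    by (intro prod_zero) fastforce+
  then show ?thesis by (simp add: wick_factor_def)
qed

lemma graph_integrand_pairings:
  assumes "finite \<B>"
  shows "graph_integrand \<B> f C \<Phi> e N \<Gamma> z u
    = (\<Sum>(\<mu>, M)\<in>pairings \<Phi> N \<Gamma>. wick_factor C \<Phi> N z u \<mu> M * colour_factor f \<B> e N M)"
proof -
  let ?Ms = "{M \<in> contractions (length \<Phi>) N. graph_of M = \<Gamma>}" and ?\<mu>s = "{..<N} \<rightarrow>\<^sub>E interaction_monomials"
  have fin: "finite ?\<mu>s" by (intro finite_PiE) auto
  have "graph_integrand \<B> f C \<Phi> e N \<Gamma> z u
    = (\<Sum>M\<in>?Ms. \<Sum>\<tau>\<in>(\<Pi>\<^sub>E j\<in>{..<N}. vertex_decorations \<B>). contraction_value f C \<Phi> e N z u \<tau> M)"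
    unfolding graph_integrand_def by (rule sum.swap)
  also have "\<dots> = (\<Sum>M\<in>?Ms. \<Sum>\<mu>\<in>?\<mu>s. wick_factor C \<Phi> N z u \<mu> M * colour_factor f \<B> e N M)"
    by (rule sum.cong[OF refl]) (simp add: sum_decorations[OF assms])
  also have "\<dots> = (\<Sum>(\<mu>, M)\<in>?\<mu>s \<times> ?Ms. wick_factor C \<Phi> N z u \<mu> M * colour_factor f \<B> e N M)"
    by (subst sum.swap) (simp add: sum.cartesian_product)
  also have "\<dots> = (\<Sum>(\<mu>, M)\<in>pairings \<Phi> N \<Gamma>. wick_factor C \<Phi> N z u \<mu> M * colour_factor f \<B> e N M)"
  proof (rule sum.mono_neutral_right)
    show "finite (?\<mu>s \<times> ?Ms)" using fin by simp
    show "pairings \<Phi> N \<Gamma> \<subseteq> ?\<mu>s \<times> ?Ms" unfolding pairings_def by blast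
    show "\<forall>x\<in>?\<mu>s \<times> ?Ms - pairings \<Phi> N \<Gamma>. (case x of (\<mu>, M) \<Rightarrow> wick_factor C \<Phi> N z u \<mu> M * colour_factor f \<B> e N M) = 0"
    proof
      fix x assume x: "x \<in> ?\<mu>s \<times> ?Ms - pairings \<Phi> N \<Gamma>"
      obtain \<mu> M where x_eq: "x = (\<mu>, M)" by (cases x)
      have "M \<in> contractions (length \<Phi>) N" "\<not> matched (field_of \<Phi> \<mu>) M"
        using x unfolding x_eq pairings_def by blast+
      then have "wick_factor C \<Phi> N z u \<mu> M = 0" by (rule wick_factor_unmatched)
      then show "(case x of (\<mu>, M) \<Rightarrow> wick_factor C \<Phi> N z u \<mu> M * colour_factor f \<B> e N M) = 0"
        by (simp only: x_eq prod.case mult_zero_left)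
    qed
  qed
  finally show ?thesis .
qed

lemma charge_cases: "charge p = 1 \<or> charge p = -1" by (cases p) auto

lemma monomial_charges:
  assumes "d \<in> interaction_monomials"
  shows "charge (snd d ! 0) = 1" "charge (snd d ! Suc 0) = -1" "charge (snd d ! 2) = -1"
  using assms by (auto simp: interaction_monomials_def)

lemma oriented_contraction_pairings:
  assumes "(\<mu>, M) \<in> pairings \<Phi> N \<Gamma>"
  shows "oriented_contraction (length \<Phi>) N (\<lambda>h. charge (field_of \<Phi> \<mu> h)) M"
proof
  have \<mu>: "\<mu> j \<in> interaction_monomials" if "j < N" for j using assms that by (auto simp: pairings_def PiE_iff)
  show "M \<in> contractions (length \<Phi>) N" using assms by (simp add: pairings_def)
  fix j assume "j < N"
  then show "charge (field_of \<Phi> \<mu> (IntH j 0)) = 1" "charge (field_of \<Phi> \<mu> (IntH j 1)) = -1" "charge (field_of \<Phi> \<mu> (IntH j 2)) = -1"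
    using monomial_charges[OF \<mu>] by auto
next
  fix h h' assume "(h, h') \<in> M"
  then show "charge (field_of \<Phi> \<mu> h) = - charge (field_of \<Phi> \<mu> h')" using assms by (auto simp: pairings_def matched_def)
qed (rule charge_cases)

section \<open>Closed loops\<close>

abbreviation "boson_a \<equiv> (1, [Fgamma, Fa, Fabar]) :: complex \<times> bf_field list"
abbreviation "boson_abar \<equiv> (-1, [Fgammabar, Fa, Fabar]) :: complex \<times> bf_field list"
abbreviation "ghost_abar \<equiv> (1, [Fdb, Fabar, Fc]) :: complex \<times> bf_field list"
abbreviation "ghost_a \<equiv> (1, [Fdbarb, Fa, Fc]) :: complex \<times> bf_field list"

lemma monomial_cases:
  assumes "d \<in> interaction_monomials"
  obtains "d = boson_a" | "d = boson_abar" | "d = ghost_abar" | "d = ghost_a"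
  using assms by (auto simp: interaction_monomials_def)

definition is_ghost :: "complex \<times> bf_field list \<Rightarrow> bool" where
  "is_ghost d \<longleftrightarrow> d = ghost_abar \<or> d = ghost_a"

text \<open>Refers to the graph alone, so one \<open>Z\<close> can be used for all pairings of that
  graph. Minimality makes \<open>Z\<close> the vertex set of a single oriented cycle in each of
  them.\<close>

definition minimal_closed :: "nat \<Rightarrow> graph \<Rightarrow> nat set \<Rightarrow> bool" where
  "minimal_closed N \<Gamma> Z \<longleftrightarrow> Z \<subseteq> {..<N} \<and> Z \<noteq> {} \<and> size (filter_mset (\<lambda>E. E \<subseteq> Inner ` Z) \<Gamma>) = card Z
     \<and> (\<forall>Y. Y \<subseteq> Z \<longrightarrow> Y \<noteq> {} \<longrightarrow> size (filter_mset (\<lambda>E. E \<subseteq> Inner ` Y) \<Gamma>) = card Y \<longrightarrow> Y = Z)"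

text \<open>The slot by which the loop enters a vertex of \<open>Z\<close>; it is 2 by default when
  no edge from \<open>Z\<close> enters slot 1.\<close>

definition loop_slot :: "nat set \<Rightarrow> (half_edge \<times> half_edge) set \<Rightarrow> nat \<Rightarrow> nat" where
  "loop_slot Z M v = (if \<exists>w\<in>Z. partner M (IntH w 0) = IntH v (Suc 0) then Suc 0 else 2)"

fun label :: "half_edge \<Rightarrow> nat" where
  "label (IntH j s) = j" | "label (ExtH i) = i"

section \<open>The loop as a cycle\<close>

locale loop_config =
  fixes \<Phi> :: "insertion list" and N :: nat and \<Gamma> :: graph and \<mu> :: "nat \<Rightarrow> complex \<times> bf_field list"
    and M :: "(half_edge \<times> half_edge) set" and Z :: "nat set"
  assumes pairing: "(\<mu>, M) \<in> pairings \<Phi> N \<Gamma>" and minimal: "minimal_closed N \<Gamma> Z"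
begin

abbreviation "n \<equiv> length \<Phi>"
abbreviation "F \<equiv> field_of \<Phi> \<mu>"

sublocale oriented_contraction "length \<Phi>" N "\<lambda>h. charge (field_of \<Phi> \<mu> h)" M
  using oriented_contraction_pairings[OF pairing] .

definition "nx v = label (p (IntH v 0))"
definition "pr = inv_into Z nx"
abbreviation "sl \<equiv> loop_slot Z M"

lemma Z: "Z \<subseteq> {..<N}" "Z \<noteq> {}" "finite Z"
  using minimal finite_subset[of Z "{..<N}"] by (auto simp: minimal_closed_def)

lemma Z_lt: "v \<in> Z \<Longrightarrow> v < N" using Z(1) by auto

lemma \<Gamma>: "graph_of M = \<Gamma>" and \<mu>_mem: "v < N \<Longrightarrow> \<mu> v \<in> interaction_monomials" and \<mu>_PiE: "\<mu> \<in> {..<N} \<rightarrow>\<^sub>E interaction_monomials"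
  using pairing by (auto simp: pairings_def PiE_iff)

lemma closed_Z: "parent_closed Z"
  using minimal parent_closed_iff_graph[OF Z(1)] by (simp add: minimal_closed_def \<Gamma>)

lemma closed_subset: "Y \<subseteq> Z \<Longrightarrow> Y \<noteq> {} \<Longrightarrow> parent_closed Y \<Longrightarrow> Y = Z"
  using minimal parent_closed_iff_graph[of Y] Z(1) by (auto simp: minimal_closed_def \<Gamma>)

lemma slots_mem: "v < N \<Longrightarrow> IntH v 0 \<in> H" "v < N \<Longrightarrow> IntH v (Suc 0) \<in> H" "v < N \<Longrightarrow> IntH v 2 \<in> H"
  by (auto simp: half_edges_def)

lemma slot_charges: "v < N \<Longrightarrow> charge (F (IntH v 0)) = 1" "v < N \<Longrightarrow> charge (F (IntH v (Suc 0))) = -1" "v < N \<Longrightarrow> charge (F (IntH v 2)) = -1"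
  using monomial_charges[OF \<mu>_mem] by auto

lemma p_out:
  assumes v: "v \<in> Z"
  shows "nx v \<in> Z" "p (IntH v 0) = IntH (nx v) (Suc 0) \<or> p (IntH v 0) = IntH (nx v) 2"
proof -
  have "parent (Inner v) \<in> Inner ` Z" using closed_Z v by (auto simp: parent_closed_def)
  then obtain w where w: "w \<in> Z" "vertex_of (p (IntH v 0)) = Inner w" by (auto simp: parent_def)
  then obtain s where s: "p (IntH v 0) = IntH w s" by (cases "p (IntH v 0)") auto
  have "p (IntH v 0) \<in> H" using p_mem slots_mem(1)[OF Z_lt[OF v]] by blast
  then have "s < 3" using s by (auto simp: half_edges_def)
  moreover have "s \<noteq> 0"
  proof
    assume "s = 0"
    then show False using q_partner[OF slots_mem(1)[OF Z_lt[OF v]]] slot_charges(1)[OF Z_lt[OF v]] slot_charges(1)[OF Z_lt[OF w(1)]] s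
      by simp
  qed
  moreover have "nx v = w" using s by (simp add: nx_def)
  ultimately show "nx v \<in> Z" "p (IntH v 0) = IntH (nx v) (Suc 0) \<or> p (IntH v 0) = IntH (nx v) 2"
    using w s slot_cases[of s] by auto
qed

lemma parent_nx: "v \<in> Z \<Longrightarrow> parent (Inner v) = Inner (nx v)"
  using p_out(2)[of v] by (auto simp: parent_def)

lemma nx_closed_subset:
  assumes "Y \<subseteq> Z" "Y \<noteq> {}" "\<And>v. v \<in> Y \<Longrightarrow> nx v \<in> Y" shows "Y = Z"
  using assms parent_nx by (intro closed_subset) (auto simp: parent_closed_def subset_iff)

text \<open>The image of \<open>Z\<close> under the successor map is closed under this map as well,
  so minimality makes it all of \<open>Z\<close>. On a finite set the map is then a
  bijection.\<close>

lemma nx_image: "nx ` Z = Z"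
  using Z(2) p_out(1) by (intro nx_closed_subset) auto

lemma nx_inj: "inj_on nx Z"
  using Z(3) nx_image by (intro eq_card_imp_inj_on) auto

lemma nx_bij: "bij_betw nx Z Z"
  using nx_image nx_inj by (simp add: bij_betw_def)

lemma pr: "v \<in> Z \<Longrightarrow> pr v \<in> Z" "v \<in> Z \<Longrightarrow> nx (pr v) = v" "v \<in> Z \<Longrightarrow> pr (nx v) = v"
  using nx_image nx_inj by (auto simp: pr_def f_inv_into_f inv_into_f_f intro: inv_into_into[of _ nx Z, simplified nx_image])

lemma p_out_slot:
  assumes v: "v \<in> Z"
  shows "p (IntH v 0) = IntH (nx v) (sl (nx v))"
proof (cases "p (IntH v 0) = IntH (nx v) (Suc 0)")
  case True
  then have "sl (nx v) = Suc 0" using v by (auto simp: loop_slot_def)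
  then show ?thesis using True by simp
next
  case False
  then have 2: "p (IntH v 0) = IntH (nx v) 2" using p_out(2)[OF v] by blast
  have "\<not> (\<exists>w\<in>Z. p (IntH w 0) = IntH (nx v) (Suc 0))"
  proof
    assume "\<exists>w\<in>Z. p (IntH w 0) = IntH (nx v) (Suc 0)"
    then obtain w where w: "w \<in> Z" "p (IntH w 0) = IntH (nx v) (Suc 0)" by blast
    then have "nx w = nx v" by (simp add: nx_def)
    then have "w = v" using nx_inj w(1) v by (auto dest: inj_onD)
    then show False using w(2) False by simp
  qed
  then have "sl (nx v) = 2" by (simp add: loop_slot_def)
  then show ?thesis using 2 by simp
qed

lemma sl_cases: "sl v = Suc 0 \<or> sl v = 2" by (simp add: loop_slot_def)

lemma p_in_slot: "v \<in> Z \<Longrightarrow> p (IntH v (sl v)) = IntH (pr v) 0"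
  using p_out_slot[of "pr v"] pr[of v] p_p[OF slots_mem(1)[OF Z_lt[of "pr v"]]] by simp

lemma out_species: "v \<in> Z \<Longrightarrow> species (F (IntH v 0)) = species (F (IntH (nx v) (sl (nx v))))"
proof -
  assume v: "v \<in> Z"
  have "(IntH v 0, p (IntH v 0)) \<in> M \<or> (p (IntH v 0), IntH v 0) \<in> M"
    using partner_mem(1)[OF M slots_mem(1)[OF Z_lt[OF v]]] .
  then show ?thesis using pairing p_out_slot[OF v] by (auto simp: pairings_def matched_def)
qed

text \<open>An outgoing derivative of \<open>b\<close> can only contract with \<open>c\<close>, and
  \<open>c\<close> sits in slot 2 of the ghost monomials.\<close>

lemma ghost_propagates:
  assumes v: "v \<in> Z" and g: "is_ghost (\<mu> v)"
  shows "is_ghost (\<mu> (nx v))" "sl (nx v) = 2"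
proof -
  have "species (F (IntH v 0)) = Fc" using g by (auto simp: is_ghost_def)
  then have "species (F (IntH (nx v) (sl (nx v)))) = Fc" using out_species[OF v] by simp
  moreover have "\<mu> (nx v) \<in> interaction_monomials" using p_out(1)[OF v] Z_lt \<mu>_mem by blast
  ultimately show "is_ghost (\<mu> (nx v))" "sl (nx v) = 2"
    using sl_cases[of "nx v"] by (auto elim!: monomial_cases simp: is_ghost_def)
qed

text \<open>The ghost vertices of the loop are closed under the successor map, so by minimality they
  are all of \<open>Z\<close> or none.\<close>

lemma ghost_dichotomy: "(\<forall>v\<in>Z. is_ghost (\<mu> v)) \<or> (\<forall>v\<in>Z. \<not> is_ghost (\<mu> v))"
proof (cases "{v \<in> Z. is_ghost (\<mu> v)} = {}")
  case False
  then have "{v \<in> Z. is_ghost (\<mu> v)} = Z"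
    using ghost_propagates(1) p_out(1) by (intro nx_closed_subset) auto
  then show ?thesis by blast
qed blast

lemma ghost_slot: "\<forall>v\<in>Z. is_ghost (\<mu> v) \<Longrightarrow> v \<in> Z \<Longrightarrow> sl v = 2"
  using ghost_propagates(2)[of "pr v"] pr[of v] by auto

text \<open>\<gamma> contracts with \<open>a\<close> in slot 1 of the next vertex, and its conjugate
  with the conjugate of \<open>a\<close> in slot 2. So the entry slot of the next vertex determines
  the monomial.\<close>

lemma boson_monomial:
  assumes b: "\<forall>v\<in>Z. \<not> is_ghost (\<mu> v)" and v: "v \<in> Z"
  shows "\<mu> v = (if sl (nx v) = Suc 0 then boson_a else boson_abar)"
proof -
  have m: "\<mu> v = boson_a \<or> \<mu> v = boson_abar" if "v \<in> Z" for v
    using \<mu>_mem[OF Z_lt[OF that]] b that by (auto elim!: monomial_cases simp: is_ghost_def)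
  show ?thesis
    using m[OF v] m[OF p_out(1)[OF v]] out_species[OF v] sl_cases[of "nx v"] by auto
qed

definition "loop_half_edges = {IntH v 0 | v. v \<in> Z} \<union> {IntH v (sl v) | v. v \<in> Z}"

lemma loop_half_edges_sub: "h \<in> loop_half_edges \<Longrightarrow> h \<in> H"
proof -
  assume "h \<in> loop_half_edges"
  then obtain v where v: "v \<in> Z" "h = IntH v 0 \<or> h = IntH v (sl v)" by (auto simp: loop_half_edges_def)
  then show ?thesis using slots_mem[OF Z_lt[OF v(1)]] sl_cases[of v] by auto
qed

lemma p_loop: "h \<in> loop_half_edges \<Longrightarrow> p h \<in> loop_half_edges"
  using p_out_slot p_out(1) p_in_slot pr(1) by (auto simp: loop_half_edges_def)

lemma p_loop_iff: "h \<in> H \<Longrightarrow> p h \<in> loop_half_edges \<longleftrightarrow> h \<in> loop_half_edges"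
  using p_loop[of h] p_loop[of "p h"] p_p[of h] by auto

lemma pair_loop_iff: "(h, h') \<in> M \<Longrightarrow> h \<in> loop_half_edges \<longleftrightarrow> h' \<in> loop_half_edges"
  using p_loop_iff[of h] mem_contraction_iff[OF M, of h h'] by auto

lemma loop_pair_cases:
  assumes "(h, h') \<in> M" "h \<in> loop_half_edges"
  obtains v where "v \<in> Z" "h = IntH v 0" "h' = IntH (nx v) (sl (nx v))"
    | v where "v \<in> Z" "h' = IntH v 0" "h = IntH (nx v) (sl (nx v))"
proof -
  have h': "h' = p h" using assms(1) mem_contraction_iff[OF M] by blast
  from assms(2) consider v where "v \<in> Z" "h = IntH v 0" | v where "v \<in> Z" "h = IntH v (sl v)"
    by (auto simp: loop_half_edges_def)
  then show thesis
  proof cases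
    case 1 then show thesis using that(1) p_out_slot h' by auto
  next
    case (2 v)
    then show thesis using that(2)[of "pr v"] p_in_slot[of v] pr[of v] h' by auto
  qed
qed

text \<open>Starting anywhere, the successor map is followed up to the first return. The orbit is
  closed under it, hence all of \<open>Z\<close>.\<close>

lemma cycle_enumeration:
  obtains \<nu> k where "bij_betw \<nu> {..<k} Z" "0 < (k::nat)" "\<And>i. \<nu> (Suc i) = nx (\<nu> i)" "\<nu> k = \<nu> 0"
    "\<And>i. i < k \<Longrightarrow> pr (\<nu> (Suc i mod k)) = \<nu> i"
proof -
  obtain v0 where v0: "v0 \<in> Z" using Z(2) by blast
  define \<nu> where "\<nu> i = (nx ^^ i) v0" for i
  have Suc: "\<nu> (Suc i) = nx (\<nu> i)" for i by (simp add: \<nu>_def)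
  have mem: "\<nu> i \<in> Z" for i by (induction i) (auto simp: Suc p_out(1), simp add: \<nu>_def v0)
  \<comment> \<open>By injectivity any repetition can be pulled back to the starting vertex.\<close>
  have cancel: "\<nu> j = \<nu> 0" if "\<nu> (i + j) = \<nu> i" for i j
    using that
  proof (induction i)
    case (Suc i)
    then have "nx (\<nu> (i + j)) = nx (\<nu> i)" by (simp add: \<open>\<And>i. \<nu> (Suc i) = nx (\<nu> i)\<close>)
    then have "\<nu> (i + j) = \<nu> i" using nx_inj mem by (auto dest: inj_onD)
    then show ?case by (rule Suc.IH)
  qed simp
  have "\<not> inj \<nu>"
  proof
    assume "inj \<nu>"
    then have "infinite (range \<nu>)" by (rule range_inj_infinite)
    then show False using finite_subset[of "range \<nu>" Z] mem Z(3) by blast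
  qed
  then obtain i j where "i < j" "\<nu> i = \<nu> j" unfolding inj_def by (metis linorder_neqE_nat)
  then have ex: "\<exists>j. 0 < j \<and> \<nu> j = \<nu> 0" using cancel[of i "j - i"] by (intro exI[of _ "j - i"]) auto
  define k where "k = (LEAST j. 0 < j \<and> \<nu> j = \<nu> 0)"
  have k: "0 < k" "\<nu> k = \<nu> 0" using LeastI_ex[OF ex] by (auto simp: k_def)
  have least: "k \<le> j" if "0 < j" "\<nu> j = \<nu> 0" for j using that Least_le[of "\<lambda>j. 0 < j \<and> \<nu> j = \<nu> 0" j] by (simp add: k_def)
  have inj: "inj_on \<nu> {..<k}"
  proof (rule linorder_inj_onI')
    fix i j assume ij: "i \<in> {..<k}" "j \<in> {..<k}" "i < j"
    show "\<nu> i \<noteq> \<nu> j"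
    proof
      assume "\<nu> i = \<nu> j"
      then have "\<nu> (j - i) = \<nu> 0" using cancel[of i "j - i"] ij(3) by simp
      then show False using least[of "j - i"] ij by auto
    qed
  qed
  have shift: "\<nu> (Suc i mod k) = \<nu> (Suc i)" if "i < k" for i
    using that k(2) by (cases "Suc i = k") auto
  have img: "\<nu> ` {..<k} = Z"
  proof (rule nx_closed_subset)
    show "\<nu> ` {..<k} \<subseteq> Z" using mem by auto
    show "\<nu> ` {..<k} \<noteq> {}" using k(1) by auto
    fix v assume "v \<in> \<nu> ` {..<k}"
    then obtain i where i: "i < k" "v = \<nu> i" by auto
    then have "nx v = \<nu> (Suc i mod k)" using shift Suc by simp
    then show "nx v \<in> \<nu> ` {..<k}" using k(1) by auto
  qed
  show thesis
  proof (rule that[of \<nu> k])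
    show "bij_betw \<nu> {..<k} Z" using inj img by (simp add: bij_betw_def)
    show "pr (\<nu> (Suc i mod k)) = \<nu> i" if "i < k" for i
      using shift[OF that] Suc pr(3)[OF mem] by simp
  qed (use k Suc in auto)
qed

end

lemma loop_config_if:
  "x \<in> pairings \<Phi> N \<Gamma> \<Longrightarrow> minimal_closed N \<Gamma> Z \<Longrightarrow> loop_config \<Phi> N \<Gamma> (fst x) (snd x) Z"
  by unfold_locales auto

section \<open>Reversal of a loop\<close>

fun relabel :: "nat set \<Rightarrow> (nat \<Rightarrow> nat) \<Rightarrow> half_edge \<Rightarrow> half_edge" where
  "relabel Z s (ExtH i) = ExtH i"
| "relabel Z s (IntH v t) = (if v \<in> Z then IntH v (if t = 0 then 2 else if t = s v then 0 else Suc 0) else IntH v t)"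

text \<open>\<open>3 - s v\<close> is the slot among 1 and 2 other than \<open>s v\<close>, the one
  off the loop.\<close>

fun unrelabel :: "nat set \<Rightarrow> (nat \<Rightarrow> nat) \<Rightarrow> half_edge \<Rightarrow> half_edge" where
  "unrelabel Z s (ExtH i) = ExtH i"
| "unrelabel Z s (IntH v t) = (if v \<in> Z then IntH v (if t = 2 then 0 else if t = 0 then s v else 3 - s v) else IntH v t)"

lemma vertex_of_relabel [simp]: "vertex_of (relabel Z s h) = vertex_of h" "vertex_of (unrelabel Z s h) = vertex_of h"
  by (cases h; simp)+

lemma relabel_inverse:
  assumes "\<And>v. v \<in> Z \<Longrightarrow> s v = Suc 0 \<or> s v = 2" "h \<in> half_edges n N"
  shows "unrelabel Z s (relabel Z s h) = h" "relabel Z s (unrelabel Z s h) = h"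
    "relabel Z s h \<in> half_edges n N" "unrelabel Z s h \<in> half_edges n N"
proof -
  have "unrelabel Z s (relabel Z s h) = h \<and> relabel Z s (unrelabel Z s h) = h \<and> relabel Z s h \<in> half_edges n N \<and> unrelabel Z s h \<in> half_edges n N"
  proof (cases h)
    case (ExtH i) then show ?thesis using assms(2) by auto
  next
    case (IntH v t)
    then have t: "v < N" "t = 0 \<or> t = Suc 0 \<or> t = 2" using assms(2) by (auto simp: half_edges_def)
    show ?thesis
    proof (cases "v \<in> Z")
      case True
      then show ?thesis using IntH t assms(1)[OF True] by (auto simp: half_edges_def)
    next
      case False
      then show ?thesis using IntH assms(2) by auto
    qed
  qed
  then show "unrelabel Z s (relabel Z s h) = h" "relabel Z s (unrelabel Z s h) = h"
    "relabel Z s h \<in> half_edges n N" "unrelabel Z s h \<in> half_edges n N" by auto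
qed

fun vertex_key :: "nat \<Rightarrow> vertex \<Rightarrow> nat" where
  "vertex_key n (Ext i) = i"
| "vertex_key n (Inner j) = n + 3 * j"

text \<open>The slots of a vertex are consecutive in the word, and contracted half-edges belong to
  different vertices. So a permutation of slots inside vertices preserves the order within each
  pair.\<close>

lemma word_pos_less_iff:
  assumes "h \<in> half_edges n N" "h' \<in> half_edges n N" "vertex_of h \<noteq> vertex_of h'"
  shows "word_pos n h < word_pos n h' \<longleftrightarrow> vertex_key n (vertex_of h) < vertex_key n (vertex_of h')"
proof (cases h)
  case (ExtH i)
  then show ?thesis using assms by (cases h') (auto simp: half_edges_def)
next
  case (IntH j s)
  note h = this
  show ?thesis
  proof (cases h')
    case (ExtH i)
    then show ?thesis using assms h by (auto simp: half_edges_def)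
  next
    case (IntH j' s')
    have "j \<noteq> j'" "s < 3" "s' < 3" using assms h IntH by (auto simp: half_edges_def)
    then have "n + 3 * j + s < n + 3 * j' + s' \<longleftrightarrow> j < j'" by (cases "j < j'") auto
    then show ?thesis using h IntH by simp
  qed
qed

text \<open>Both directions of the loop reversal permute half-edges inside vertices and thus carry
  contractions to contractions with the same graph.\<close>

locale slot_permutation =
  fixes n N :: nat and M :: "(half_edge \<times> half_edge) set" and \<theta> \<psi> :: "half_edge \<Rightarrow> half_edge"
  assumes contraction: "M \<in> contractions n N"
    and mem: "\<And>h. h \<in> half_edges n N \<Longrightarrow> \<theta> h \<in> half_edges n N \<and> \<psi> h \<in> half_edges n N"
    and inv: "\<And>h. h \<in> half_edges n N \<Longrightarrow> \<psi> (\<theta> h) = h \<and> \<theta> (\<psi> h) = h"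
    and vertex: "\<And>h. vertex_of (\<theta> h) = vertex_of h"
begin

definition "moved = map_prod \<theta> \<theta> ` M"

lemma half_edges_pair: "p \<in> M \<Longrightarrow> fst p \<in> half_edges n N \<and> snd p \<in> half_edges n N"
  using contractions_subset[OF contraction] by auto

lemma inj_map_prod: "inj_on (map_prod \<theta> \<theta>) M"
  by (rule inj_on_inverseI[of _ "map_prod \<psi> \<psi>"]) (use half_edges_pair inv in \<open>auto simp: prod_eq_iff\<close>)

lemma moved_contraction: "moved \<in> contractions n N"
proof -
  have ord: "word_pos n (fst p) < word_pos n (snd p)" "vertex_of (fst p) \<noteq> vertex_of (snd p)" if "p \<in> M" for p
    using contraction that by (auto simp: contractions_def)
  have ex1: "\<exists>!p. p \<in> M \<and> (h = fst p \<or> h = snd p)" if "h \<in> half_edges n N" for h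
    using contraction that by (auto simp: contractions_def)
  show ?thesis unfolding contractions_def
  proof (intro CollectI conjI ballI)
    show "moved \<subseteq> half_edges n N \<times> half_edges n N" using half_edges_pair mem by (auto simp: moved_def)
    fix x assume "x \<in> moved"
    then obtain p where p: "p \<in> M" "x = (\<theta> (fst p), \<theta> (snd p))" by (auto simp: moved_def)
    have "word_pos n (\<theta> (fst p)) < word_pos n (\<theta> (snd p))"
      using word_pos_less_iff[of "fst p" n N "snd p"] word_pos_less_iff[of "\<theta> (fst p)" n N "\<theta> (snd p)"]
        ord[OF p(1)] half_edges_pair[OF p(1)] mem vertex by simp
    then show "case x of (h, h') \<Rightarrow> word_pos n h < word_pos n h' \<and> vertex_of h \<noteq> vertex_of h'"
      using ord[OF p(1)] vertex p(2) by simp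
  next
    fix h assume h: "h \<in> half_edges n N"
    then obtain p where p: "p \<in> M" "\<psi> h = fst p \<or> \<psi> h = snd p" and uniq: "\<And>q. q \<in> M \<Longrightarrow> \<psi> h = fst q \<or> \<psi> h = snd q \<Longrightarrow> q = p"
      using ex1[of "\<psi> h"] mem by blast
    show "\<exists>!x. x \<in> moved \<and> (h = fst x \<or> h = snd x)"
    proof (rule ex1I[of _ "map_prod \<theta> \<theta> p"])
      show "map_prod \<theta> \<theta> p \<in> moved \<and> (h = fst (map_prod \<theta> \<theta> p) \<or> h = snd (map_prod \<theta> \<theta> p))"
        using p inv[OF h] by (auto simp: moved_def fst_map_prod snd_map_prod)
      fix x assume x: "x \<in> moved \<and> (h = fst x \<or> h = snd x)"
      then obtain q where q: "q \<in> M" "x = map_prod \<theta> \<theta> q" by (auto simp: moved_def)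
      then have "\<psi> h = fst q \<or> \<psi> h = snd q" using x inv half_edges_pair[OF q(1)] by (auto simp: fst_map_prod snd_map_prod)
      then show "x = map_prod \<theta> \<theta> p" using uniq q by simp
    qed
  qed
qed

lemma graph_moved: "graph_of moved = graph_of M"
proof -
  have "graph_of moved = image_mset (\<lambda>(h, h'). {vertex_of h, vertex_of h'}) (image_mset (map_prod \<theta> \<theta>) (mset_set M))"
    by (simp add: graph_of_def moved_def image_mset_mset_set[OF inj_map_prod])
  also have "\<dots> = graph_of M"
    unfolding graph_of_def image_mset.compositionality by (intro image_mset_cong) (auto simp: vertex)
  finally show ?thesis .
qed

lemma partner_moved: "h \<in> half_edges n N \<Longrightarrow> partner moved (\<theta> h) = \<theta> (partner M h)"
  using partner_mem(1)[OF contraction, of h]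
  by (intro partner_eqI[OF moved_contraction]) (auto simp: moved_def intro: rev_image_eqI)

end

text \<open>On a bosonic loop the slot \<open>0\<close> carries \<open>\<gamma>\<close> and the slot \<open>sl v\<close> carries its partner \<open>a\<close>. On the
  ghost loop, \<open>c\<close> in slot \<open>2\<close> takes the place of \<open>\<gamma>\<close> and the derivative of \<open>b\<close> in slot \<open>0\<close> that of \<open>a\<close>,
  so the orientation is reversed, and the remaining field of the vertex moves to slot \<open>1\<close>.\<close>

definition to_ghost where
  "to_ghost N Z x = (\<lambda>j\<in>{..<N}. if j \<in> Z then (if loop_slot Z (snd x) j = Suc 0 then ghost_abar else ghost_a) else fst x j,
     map_prod (relabel Z (loop_slot Z (snd x))) (relabel Z (loop_slot Z (snd x))) ` snd x)"

text \<open>Recovers the entry slot of the bosonic loop from a ghost monomial: slot 1 belongs to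
  \<open>ghost_abar\<close>.\<close>

definition ghost_type where
  "ghost_type (\<mu> :: nat \<Rightarrow> complex \<times> bf_field list) v = (if \<mu> v = ghost_abar then Suc 0 else 2)"

text \<open>A bosonic monomial is determined by the next vertex of the bosonic loop. As the ghost
  loop runs backwards, this is the vertex whose outgoing field contracts with \<open>c\<close> in
  slot 2.\<close>

definition to_boson where
  "to_boson N Z x = (\<lambda>j\<in>{..<N}. if j \<in> Z
        then (if ghost_type (fst x) (label (partner (snd x) (IntH j 2))) = Suc 0 then boson_a else boson_abar) else fst x j,
     map_prod (unrelabel Z (ghost_type (fst x))) (unrelabel Z (ghost_type (fst x))) ` snd x)"

definition boson_pairings where
  "boson_pairings \<Phi> N \<Gamma> Z = {x \<in> pairings \<Phi> N \<Gamma>. \<forall>v\<in>Z. \<not> is_ghost (fst x v)}"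

definition ghost_pairings where
  "ghost_pairings \<Phi> N \<Gamma> Z = {x \<in> pairings \<Phi> N \<Gamma>. \<forall>v\<in>Z. is_ghost (fst x v)}"

section \<open>From a bosonic loop to a ghost loop\<close>

locale boson_loop = loop_config +
  assumes boson: "\<forall>v\<in>Z. \<not> is_ghost (\<mu> v)"
begin

abbreviation "\<theta> \<equiv> relabel Z sl"
text \<open>The field off the loop has to survive: where the loop enters by \<open>a\<close>, this
  field is its conjugate, which calls for \<open>ghost_abar\<close>.\<close>

definition "\<mu>' = (\<lambda>j\<in>{..<N}. if j \<in> Z then (if sl j = Suc 0 then ghost_abar else ghost_a) else \<mu> j)"
abbreviation "F' \<equiv> field_of \<Phi> \<mu>'"

sublocale \<theta>: slot_permutation "length \<Phi>" N M "relabel Z (loop_slot Z M)" "unrelabel Z (loop_slot Z M)"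
  using relabel_inverse[of Z sl] sl_cases by unfold_locales (auto simp: M)

lemma to_ghost_eq: "to_ghost N Z (\<mu>, M) = (\<mu>', \<theta>.moved)"
  unfolding to_ghost_def \<mu>'_def \<theta>.moved_def fst_conv snd_conv by (rule refl)

lemma boson_cases: "v \<in> Z \<Longrightarrow> \<mu> v = boson_a \<or> \<mu> v = boson_abar"
  using boson_monomial[OF boson] by auto

lemma field_off_loop:
  assumes "h \<in> H" "h \<notin> loop_half_edges"
  shows "F' (\<theta> h) = F h"
proof (cases h)
  case (IntH v t)
  then have v: "v < N" "t = 0 \<or> t = Suc 0 \<or> t = 2" using assms(1) by (auto simp: half_edges_def)
  show ?thesis
  proof (cases "v \<in> Z")
    case True
    have "t \<noteq> 0" "t \<noteq> sl v" using assms(2) IntH True by (auto simp: loop_half_edges_def)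
    then show ?thesis using IntH True v sl_cases[of v] boson_cases[OF True] by (auto simp: \<mu>'_def)
  qed (use IntH v in \<open>simp add: \<mu>'_def\<close>)
qed simp

lemma field_loop:
  assumes "v \<in> Z"
  shows "\<theta> (IntH v 0) = IntH v 2" "\<theta> (IntH v (sl v)) = IntH v 0" "F' (IntH v 2) = Fc"
    "F' (IntH v 0) = (if sl v = Suc 0 then Fdb else Fdbarb)"
    "F (IntH v 0) = (if sl (nx v) = Suc 0 then Fgamma else Fgammabar)"
    "F (IntH v (sl v)) = (if sl v = Suc 0 then Fa else Fabar)"
  using assms Z_lt[OF assms] sl_cases[of v] boson_cases[OF assms] boson_monomial[OF boson assms]
  by (auto simp: \<mu>'_def)

lemma to_ghost_mem: "to_ghost N Z (\<mu>, M) \<in> ghost_pairings \<Phi> N \<Gamma> Z"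
proof -
  have "matched F' \<theta>.moved"
    unfolding matched_def
  proof
    fix x assume "x \<in> \<theta>.moved"
    then obtain h h' where x: "x = (\<theta> h, \<theta> h')" "(h, h') \<in> M" by (auto simp: \<theta>.moved_def)
    have hh: "h \<in> H" "h' \<in> H" using contractions_subset[OF M] x(2) by auto
    have "charge (F' (\<theta> h)) = - charge (F' (\<theta> h')) \<and> species (F' (\<theta> h)) = species (F' (\<theta> h'))"
    proof (cases "h \<in> loop_half_edges")
      case True
      from x(2) True show ?thesis
      proof (cases rule: loop_pair_cases)
        case (1 v)
        then show ?thesis using field_loop(1,3)[OF 1(1)] field_loop(2,4)[OF p_out(1)[OF 1(1)]] by simp
      next
        case (2 v)
        then show ?thesis using field_loop(1,3)[OF 2(1)] field_loop(2,4)[OF p_out(1)[OF 2(1)]] by simp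
      qed
    next
      case False
      moreover have "h' \<notin> loop_half_edges" using False pair_loop_iff[OF x(2)] by simp
      ultimately show ?thesis
        using field_off_loop hh x(2) pairing by (auto simp: pairings_def matched_def)
    qed
    then show "case x of (h, h') \<Rightarrow> charge (F' h) = - charge (F' h') \<and> species (F' h) = species (F' h')"
      using x(1) by simp
  qed
  moreover have "\<mu>' \<in> {..<N} \<rightarrow>\<^sub>E interaction_monomials"
    using \<mu>_PiE by (auto simp: \<mu>'_def interaction_monomials_def PiE_iff)
  moreover have "is_ghost (\<mu>' v)" if "v \<in> Z" for v using that Z_lt[OF that] by (simp add: \<mu>'_def is_ghost_def)
  ultimately show ?thesis
    using \<theta>.moved_contraction \<theta>.graph_moved \<Gamma> by (simp add: to_ghost_eq ghost_pairings_def pairings_def)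
qed

lemma to_boson_to_ghost: "to_boson N Z (to_ghost N Z (\<mu>, M)) = (\<mu>, M)"
proof -
  have type: "ghost_type \<mu>' v = sl v" if "v \<in> Z" for v
    using that Z_lt[OF that] sl_cases[of v] by (auto simp: ghost_type_def \<mu>'_def)
  \<comment> \<open>In the reversed configuration slot 2 is the former exit, so its partner still
    points to the old successor.\<close>
  have lab: "label (partner \<theta>.moved (IntH v 2)) = nx v" if "v \<in> Z" for v
    using \<theta>.partner_moved[OF slots_mem(1)[OF Z_lt[OF that]]] field_loop(1)[OF that] p_out_slot[OF that] field_loop(2)[OF p_out(1)[OF that]]
    by simp
  have "unrelabel Z (ghost_type \<mu>') h = unrelabel Z sl h" for h by (cases h) (auto simp: type)
  then have "map_prod (unrelabel Z (ghost_type \<mu>')) (unrelabel Z (ghost_type \<mu>')) ` \<theta>.moved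
    = (\<lambda>p. p) ` M"
    unfolding \<theta>.moved_def image_image
    by (intro image_cong refl) (use \<theta>.half_edges_pair \<theta>.inv in \<open>auto simp: prod_eq_iff map_prod_def case_prod_beta\<close>)
  moreover have "(\<lambda>j\<in>{..<N}. if j \<in> Z then (if ghost_type \<mu>' (label (partner \<theta>.moved (IntH j 2))) = Suc 0 then boson_a else boson_abar) else \<mu>' j) = \<mu>"
  proof
    fix j
    show "(\<lambda>j\<in>{..<N}. if j \<in> Z then (if ghost_type \<mu>' (label (partner \<theta>.moved (IntH j 2))) = Suc 0 then boson_a else boson_abar) else \<mu>' j) j = \<mu> j"
      using boson_monomial[OF boson, of j] lab[of j] type[of "nx j"] p_out(1)[of j] \<mu>_PiE
      by (auto simp: \<mu>'_def PiE_iff extensional_def)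
  qed
  ultimately show ?thesis unfolding to_ghost_eq to_boson_def fst_conv snd_conv by (simp only: image_ident)
qed

end

section \<open>From a ghost loop to a bosonic loop\<close>

locale ghost_loop = loop_config +
  assumes ghost: "\<forall>v\<in>Z. is_ghost (\<mu> v)"
begin

definition "gt = ghost_type \<mu>"

lemma gt_cases: "gt v = Suc 0 \<or> gt v = 2" by (simp add: gt_def ghost_type_def)

lemma sl_2: "v \<in> Z \<Longrightarrow> sl v = 2" using ghost_slot[OF ghost] .

lemma p_2: "v \<in> Z \<Longrightarrow> p (IntH v 2) = IntH (pr v) 0"
  using p_in_slot sl_2 by simp

lemma ghost_monomial: "v \<in> Z \<Longrightarrow> \<mu> v = (if gt v = Suc 0 then ghost_abar else ghost_a)"
  using ghost by (auto simp: is_ghost_def gt_def ghost_type_def)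

abbreviation "\<psi> \<equiv> unrelabel Z gt"
definition "\<mu>' = (\<lambda>j\<in>{..<N}. if j \<in> Z then (if gt (label (p (IntH j 2))) = Suc 0 then boson_a else boson_abar) else \<mu> j)"
abbreviation "F' \<equiv> field_of \<Phi> \<mu>'"

sublocale \<psi>: slot_permutation "length \<Phi>" N M "unrelabel Z gt" "relabel Z gt"
  using relabel_inverse[of Z gt] gt_cases by unfold_locales (auto simp: M)

lemma to_boson_eq: "to_boson N Z (\<mu>, M) = (\<mu>', \<psi>.moved)"
  unfolding to_boson_def \<mu>'_def \<psi>.moved_def unfolding gt_def fst_conv snd_conv by (rule refl)

lemma \<mu>'_Z: "v \<in> Z \<Longrightarrow> \<mu>' v = (if gt (pr v) = Suc 0 then boson_a else boson_abar)"
  using Z_lt by (simp add: \<mu>'_def p_2)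

lemma field_off_loop:
  assumes "h \<in> H" "h \<notin> loop_half_edges"
  shows "F' (\<psi> h) = F h"
proof (cases h)
  case (IntH v t)
  then have v: "v < N" "t = 0 \<or> t = Suc 0 \<or> t = 2" using assms(1) by (auto simp: half_edges_def)
  show ?thesis
  proof (cases "v \<in> Z")
    case True
    have "t \<noteq> 0" "t \<noteq> 2" using assms(2) IntH True sl_2[OF True] by (auto simp: loop_half_edges_def)
    then show ?thesis using IntH True v gt_cases[of v] ghost_monomial[OF True] \<mu>'_Z[OF True] by auto
  qed (use IntH v in \<open>simp add: \<mu>'_def\<close>)
qed simp

lemma field_loop:
  assumes "v \<in> Z"
  shows "\<psi> (IntH v 2) = IntH v 0" "\<psi> (IntH v 0) = IntH v (gt v)"
    "F' (IntH v 0) = (if gt (pr v) = Suc 0 then Fgamma else Fgammabar)"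
    "F' (IntH v (gt v)) = (if gt v = Suc 0 then Fa else Fabar)"
  using assms gt_cases[of v] \<mu>'_Z[OF assms] by auto

lemma to_boson_mem: "to_boson N Z (\<mu>, M) \<in> boson_pairings \<Phi> N \<Gamma> Z"
proof -
  have "matched F' \<psi>.moved"
    unfolding matched_def
  proof
    fix x assume "x \<in> \<psi>.moved"
    then obtain h h' where x: "x = (\<psi> h, \<psi> h')" "(h, h') \<in> M" by (auto simp: \<psi>.moved_def)
    have hh: "h \<in> H" "h' \<in> H" using contractions_subset[OF M] x(2) by auto
    have "charge (F' (\<psi> h)) = - charge (F' (\<psi> h')) \<and> species (F' (\<psi> h)) = species (F' (\<psi> h'))"
    proof (cases "h \<in> loop_half_edges")
      case True
      from x(2) True show ?thesis
      proof (cases rule: loop_pair_cases)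
        case (1 v)
        then show ?thesis
          using field_loop(2,4)[OF 1(1)] field_loop(1,3)[OF p_out(1)[OF 1(1)]] sl_2[OF p_out(1)[OF 1(1)]] pr(3)[OF 1(1)] by simp
      next
        case (2 v)
        then show ?thesis
          using field_loop(2,4)[OF 2(1)] field_loop(1,3)[OF p_out(1)[OF 2(1)]] sl_2[OF p_out(1)[OF 2(1)]] pr(3)[OF 2(1)] by simp
      qed
    next
      case False
      moreover have "h' \<notin> loop_half_edges" using False pair_loop_iff[OF x(2)] by simp
      ultimately show ?thesis
        using field_off_loop hh x(2) pairing by (auto simp: pairings_def matched_def)
    qed
    then show "case x of (h, h') \<Rightarrow> charge (F' h) = - charge (F' h') \<and> species (F' h) = species (F' h')"
      using x(1) by simp
  qed
  moreover have "\<mu>' \<in> {..<N} \<rightarrow>\<^sub>E interaction_monomials"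
    using \<mu>_PiE by (auto simp: \<mu>'_def interaction_monomials_def PiE_iff)
  moreover have "\<not> is_ghost (\<mu>' v)" if "v \<in> Z" for v using that by (simp add: \<mu>'_Z is_ghost_def)
  ultimately show ?thesis
    using \<psi>.moved_contraction \<psi>.graph_moved \<Gamma> by (simp add: to_boson_eq boson_pairings_def pairings_def)
qed

lemma to_ghost_to_boson: "to_ghost N Z (to_boson N Z (\<mu>, M)) = (\<mu>, M)"
proof -
  have out: "partner \<psi>.moved (IntH w 0) = IntH (pr w) (gt (pr w))" if "w \<in> Z" for w
    using \<psi>.partner_moved[OF slots_mem(3)[OF Z_lt[OF that]]] field_loop(1)[OF that] p_2[OF that] field_loop(2)[OF pr(1)[OF that]]
    by simp
  \<comment> \<open>The type of a ghost vertex becomes the entry slot of the bosonic loop, so the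
    first map can read it off again.\<close>
  have slot: "loop_slot Z \<psi>.moved v = gt v" if v: "v \<in> Z" for v
  proof (cases "gt v = Suc 0")
    case True
    then have "partner \<psi>.moved (IntH (nx v) 0) = IntH v (Suc 0)" using out[OF p_out(1)[OF v]] pr(3)[OF v] by simp
    then show ?thesis using True p_out(1)[OF v] by (auto simp: loop_slot_def)
  next
    case False
    then have "\<not> (\<exists>w\<in>Z. partner \<psi>.moved (IntH w 0) = IntH v (Suc 0))" using out by auto
    then show ?thesis using False gt_cases[of v] by (simp add: loop_slot_def)
  qed
  have "relabel Z (loop_slot Z \<psi>.moved) h = relabel Z gt h" for h by (cases h) (auto simp: slot)
  then have "map_prod (relabel Z (loop_slot Z \<psi>.moved)) (relabel Z (loop_slot Z \<psi>.moved)) ` \<psi>.moved = (\<lambda>p. p) ` M"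
    unfolding \<psi>.moved_def image_image
    by (intro image_cong refl) (use \<psi>.half_edges_pair \<psi>.inv in \<open>auto simp: prod_eq_iff map_prod_def case_prod_beta\<close>)
  moreover have "(\<lambda>j\<in>{..<N}. if j \<in> Z then (if loop_slot Z \<psi>.moved j = Suc 0 then ghost_abar else ghost_a) else \<mu>' j) = \<mu>"
  proof
    fix j
    show "(\<lambda>j\<in>{..<N}. if j \<in> Z then (if loop_slot Z \<psi>.moved j = Suc 0 then ghost_abar else ghost_a) else \<mu>' j) j = \<mu> j"
      using ghost_monomial[of j] slot[of j] \<mu>_PiE by (auto simp: \<mu>'_def PiE_iff extensional_def)
  qed
  ultimately show ?thesis unfolding to_boson_eq to_ghost_def fst_conv snd_conv by (simp only: image_ident)
qed

end

section \<open>Cancellation of loops\<close>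

definition word_span :: "nat \<Rightarrow> half_edge \<times> half_edge \<Rightarrow> nat \<times> nat" where
  "word_span n x = (word_pos n (fst x), word_pos n (snd x))"

text \<open>A product over ordered pairs, unlike a cardinality in an exponent, can be split directly
  into loop pairs and the rest.\<close>

lemma koszul_sign_prod:
  assumes "finite M"
  shows "koszul_sign n F M = (\<Prod>x\<in>M. \<Prod>y\<in>M. if species (F (fst x)) = Fc \<and> species (F (fst y)) = Fc
    \<and> crossing (word_span n x) (word_span n y) then -1 else 1)"
proof -
  let ?P = "\<lambda>x y. species (F (fst x)) = Fc \<and> species (F (fst y)) = Fc \<and> crossing (word_span n x) (word_span n y)"
  have "(\<Prod>x\<in>M. \<Prod>y\<in>M. if ?P x y then -1 else 1 :: complex) = (\<Prod>z\<in>M \<times> M. if ?P (fst z) (snd z) then -1 else 1)"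
    by (simp only: prod.cartesian_product case_prod_unfold)
  also have "\<dots> = (\<Prod>z\<in>{z \<in> M \<times> M. ?P (fst z) (snd z)}. -1)"
    using assms by (intro prod.inter_filter[symmetric]) simp
  also have "\<dots> = (-1) ^ card {z \<in> M \<times> M. ?P (fst z) (snd z)}" by (rule prod_constant)
  also have "{z \<in> M \<times> M. ?P (fst z) (snd z)} = {(p, q). p \<in> M \<and> q \<in> M
        \<and> odd (ghost_degree (F (fst p))) \<and> odd (ghost_degree (F (fst q)))
        \<and> word_pos n (fst p) < word_pos n (fst q)
        \<and> word_pos n (fst q) < word_pos n (snd p)
        \<and> word_pos n (snd p) < word_pos n (snd q)}"
    by (auto simp: word_span_def crossing_def odd_ghost_degree)
  finally show ?thesis by (simp only: koszul_sign_def)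
qed

definition pair_propagator where
  "pair_propagator C F z u x = propagator C (F (fst x)) (F (snd x)) (point_at z u (fst x)) (point_at z u (snd x))"

lemma wick_factor_pairs:
  "wick_factor C \<Phi> N z u \<mu> M = (\<Prod>j<N. fst (\<mu> j)) * koszul_sign (length \<Phi>) (field_of \<Phi> \<mu>) M
    * (\<Prod>x\<in>M. pair_propagator C (field_of \<Phi> \<mu>) z u x)"
  by (simp only: wick_factor_def pair_propagator_def case_prod_unfold)

lemma point_at_vertex: "vertex_of h = vertex_of h' \<Longrightarrow> point_at z u h = point_at z u h'"
  by (cases h; cases h') auto

section \<open>Contracted pairs on the loop\<close>

context loop_config
begin

definition "loop_pair v = (if v < nx v then (IntH v 0, IntH (nx v) (sl (nx v))) else (IntH (nx v) (sl (nx v)), IntH v 0))"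
definition "loop_pairs = {x \<in> M. fst x \<in> loop_half_edges}"

lemma nx_ne: assumes v: "v \<in> Z" shows "nx v \<noteq> v"
  using p_vertex[OF slots_mem(1)[OF Z_lt[OF v]]] p_out_slot[OF v] by auto

lemma pair_order: "(h, h') \<in> M \<Longrightarrow> word_pos n h < word_pos n h'"
  using M by (auto simp: contractions_def)

lemma loop_pair_order:
  assumes v: "v \<in> Z"
  shows "(IntH v 0, IntH (nx v) (sl (nx v))) \<in> M \<Longrightarrow> v < nx v"
    "(IntH (nx v) (sl (nx v)), IntH v 0) \<in> M \<Longrightarrow> nx v < v"
  using pair_order[of "IntH v 0" "IntH (nx v) (sl (nx v))"] pair_order[of "IntH (nx v) (sl (nx v))" "IntH v 0"]
    sl_cases[of "nx v"] nx_ne[OF v] by auto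

lemma loop_pair_mem: assumes v: "v \<in> Z" shows "loop_pair v \<in> loop_pairs"
proof -
  have lp: "IntH v 0 \<in> loop_half_edges" "IntH (nx v) (sl (nx v)) \<in> loop_half_edges"
    using v p_out(1)[OF v] by (auto simp: loop_half_edges_def)
  have "(IntH v 0, IntH (nx v) (sl (nx v))) \<in> M \<or> (IntH (nx v) (sl (nx v)), IntH v 0) \<in> M"
    using partner_mem(1)[OF M slots_mem(1)[OF Z_lt[OF v]]] p_out_slot[OF v] by simp
  then show ?thesis
    using loop_pair_order[OF v] lp by (auto simp: loop_pair_def loop_pairs_def)
qed

lemma loop_pair_bij: "bij_betw loop_pair Z loop_pairs"
  unfolding bij_betw_def
proof
  show "inj_on loop_pair Z"
  proof (rule inj_onI)
    fix v w assume "v \<in> Z" "w \<in> Z" "loop_pair v = loop_pair w"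
    moreover have "sl x \<noteq> 0" "0 \<noteq> sl x" for x using sl_cases[of x] by auto
    ultimately show "v = w" by (cases "v < nx v"; cases "w < nx w") (simp_all add: loop_pair_def)
  qed
  show "loop_pair ` Z = loop_pairs"
  proof
    show "loop_pair ` Z \<subseteq> loop_pairs" using loop_pair_mem by blast
    show "loop_pairs \<subseteq> loop_pair ` Z"
    proof
      fix x assume "x \<in> loop_pairs"
      then obtain h h' where x: "x = (h, h')" "(h, h') \<in> M" "h \<in> loop_half_edges"
        by (cases x) (auto simp: loop_pairs_def)
      from x(2,3) show "x \<in> loop_pair ` Z"
      proof (cases rule: loop_pair_cases)
        case (1 v)
        then have "v < nx v" using loop_pair_order(1)[OF 1(1)] x(2) by simp
        then have "x = loop_pair v" using 1 x(1) by (simp add: loop_pair_def)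
        then show ?thesis using 1(1) by blast
      next
        case (2 v)
        then have "nx v < v" using loop_pair_order(2)[OF 2(1)] x(2) by simp
        then have "x = loop_pair v" using 2 x(1) by (simp add: loop_pair_def)
        then show ?thesis using 2(1) by blast
      qed
    qed
  qed
qed

lemma prod_pairs_split: "(\<Prod>x\<in>M. g x) = (\<Prod>x\<in>M - loop_pairs. g x) * (\<Prod>v\<in>Z. g (loop_pair v) :: complex)"
proof -
  have "(\<Prod>x\<in>M. g x) = (\<Prod>x\<in>M - loop_pairs. g x) * (\<Prod>x\<in>loop_pairs. g x)"
    by (rule prod.subset_diff) (auto simp: loop_pairs_def finite_contraction[OF M])
  then show ?thesis by (simp only: prod.reindex_bij_betw[OF loop_pair_bij])
qed

lemma off_loop_pair:
  assumes "x \<in> M - loop_pairs"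
  shows "fst x \<in> H" "snd x \<in> H" "fst x \<notin> loop_half_edges" "snd x \<notin> loop_half_edges" "species (F (snd x)) = species (F (fst x))"
proof -
  obtain h h' where x: "x = (h, h')" by (cases x)
  have hM: "(h, h') \<in> M" "h \<notin> loop_half_edges" using assms x by (auto simp: loop_pairs_def)
  then show "fst x \<in> H" "snd x \<in> H" "fst x \<notin> loop_half_edges" "snd x \<notin> loop_half_edges"
    using pair_loop_iff[OF hM(1)] contractions_subset[OF M] x by auto
  show "species (F (snd x)) = species (F (fst x))" using pairing hM(1) x by (auto simp: pairings_def matched_def)
qed

text \<open>A half-edge at another vertex never lies between two slots of a loop vertex, so it
  compares in the same way with slot 0 and slot 2.\<close>

lemma pos_off_loop:
  assumes "h \<in> H" "vertex_of h \<notin> Inner ` Z" "v \<in> Z"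
  shows "word_pos n h \<noteq> n + 3 * v" "word_pos n h \<noteq> n + 3 * v + 2" "order_sign (word_pos n h) (n + 3 * v + 2) = order_sign (word_pos n h) (n + 3 * v)"
proof -
  have "word_pos n h \<noteq> n + 3 * v \<and> word_pos n h \<noteq> n + 3 * v + 2 \<and> (word_pos n h < n + 3 * v + 2 \<longleftrightarrow> word_pos n h < n + 3 * v)"
  proof (cases h)
    case (ExtH i) then show ?thesis using assms(1) by (auto simp: half_edges_def)
  next
    case (IntH j s)
    then have "s < 3" "j \<noteq> v" using assms by (auto simp: half_edges_def)
    then show ?thesis using IntH by (cases "j < v") auto
  qed
  then show "word_pos n h \<noteq> n + 3 * v" "word_pos n h \<noteq> n + 3 * v + 2" "order_sign (word_pos n h) (n + 3 * v + 2) = order_sign (word_pos n h) (n + 3 * v)"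
    by (auto simp: order_sign_def)
qed

text \<open>The successor map permutes \<open>Z\<close>, so each comparison occurs twice. This is
  why a chord off the loop crosses the closed loop an even number of times.\<close>

lemma prod_order_sign_nx: "(\<Prod>v\<in>Z. order_sign a (n + 3 * v)) * (\<Prod>v\<in>Z. order_sign a (n + 3 * nx v)) = 1"
  unfolding prod.reindex_bij_betw[OF nx_bij, where g = "\<lambda>v. order_sign a (n + 3 * v)"]
  by (simp add: prod.distrib[symmetric])

lemma loop_crossings:
  "(\<Prod>v\<in>Z. \<Prod>w\<in>Z. if crossing (chord (n + 3 * v + 2) (n + 3 * nx v)) (chord (n + 3 * w + 2) (n + 3 * nx w)) then -1 else 1)
    * (\<Prod>v\<in>Z. order_sign (n + 3 * v + 2) (n + 3 * nx v)) = (-1) ^ (card Z - 1)"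
proof -
  obtain \<nu> k where \<nu>: "bij_betw \<nu> {..<k} Z" "0 < (k::nat)" "\<And>i. \<nu> (Suc i) = nx (\<nu> i)" "\<nu> k = \<nu> 0"
    by (rule cycle_enumeration) (rule that)
  have card: "card Z = k" using bij_betw_same_card[OF \<nu>(1)] by simp
  have "inj_on \<nu> {..<k}" using \<nu>(1) by (simp add: bij_betw_def)
  from loop_sign[OF this \<nu>(4,2), of n] show ?thesis
    by (simp only: prod.reindex_bij_betw[OF \<nu>(1), symmetric] \<nu>(3) card)
qed

end

section \<open>Signs of a reversed loop\<close>

context boson_loop
begin

lemma map_loop_pair:
  assumes v: "v \<in> Z"
  shows "map_prod \<theta> \<theta> (loop_pair v) = (if v < nx v then (IntH v 2, IntH (nx v) 0) else (IntH (nx v) 0, IntH v 2))"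
  using field_loop(1)[OF v] field_loop(2)[OF p_out(1)[OF v]] by (simp only: loop_pair_def map_prod_simp if_distrib[of "map_prod \<theta> \<theta>"])

lemma span_loop_pair:
  assumes v: "v \<in> Z"
  shows "word_span n (map_prod \<theta> \<theta> (loop_pair v)) = chord (n + 3 * v + 2) (n + 3 * nx v)"
  unfolding map_loop_pair[OF v] word_span_def chord_def using nx_ne[OF v] by (cases "v < nx v") auto

lemma species_loop_pair:
  assumes v: "v \<in> Z"
  shows "species (F' (fst (map_prod \<theta> \<theta> (loop_pair v)))) = Fc" "species (F (fst (loop_pair v))) \<noteq> Fc"
proof -
  have "F' (IntH v 2) = Fc" "species (F' (IntH (nx v) 0)) = Fc" using field_loop(3)[OF v] field_loop(4)[OF p_out(1)[OF v]] by auto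
  then show "species (F' (fst (map_prod \<theta> \<theta> (loop_pair v)))) = Fc" unfolding map_loop_pair[OF v] by (cases "v < nx v") auto
  have "species (F (IntH v 0)) \<noteq> Fc" "species (F (IntH (nx v) (sl (nx v)))) \<noteq> Fc"
    using field_loop(5)[OF v] field_loop(6)[OF p_out(1)[OF v]] by auto
  then show "species (F (fst (loop_pair v))) \<noteq> Fc" by (simp add: loop_pair_def)
qed

lemma minus_one_divide: "- (1 / (a - b)) = 1 / (b - a :: complex)"
  using minus_divide_right[of 1 "a - b"] by simp

text \<open>The bosonic propagator does not depend on the order of its two fields, while the ghost
  propagator changes sign with it. The sign therefore records which of the two vertices comes first
  in the word.\<close>

lemma propagator_loop:
  assumes v: "v \<in> Z"
  shows "pair_propagator C F' z u (map_prod \<theta> \<theta> (loop_pair v))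
    = - order_sign (n + 3 * v + 2) (n + 3 * nx v) * pair_propagator C F z u (loop_pair v)"
proof -
  let ?w = "nx v"
  note f = field_loop[OF v] field_loop[OF p_out(1)[OF v]]
  show ?thesis
  proof (cases "v < ?w")
    case True
    have 1: "pair_propagator C F' z u (map_prod \<theta> \<theta> (loop_pair v)) = propagator C Fc (if sl ?w = Suc 0 then Fdb else Fdbarb) (u v) (u ?w)"
      unfolding map_loop_pair[OF v] pair_propagator_def using True f by (simp only: if_True fst_conv snd_conv point_at.simps)
    have 2: "pair_propagator C F z u (loop_pair v) = propagator C (if sl ?w = Suc 0 then Fgamma else Fgammabar) (if sl ?w = Suc 0 then Fa else Fabar) (u v) (u ?w)"
      unfolding loop_pair_def pair_propagator_def using True f by (simp only: if_True fst_conv snd_conv point_at.simps)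
    show ?thesis unfolding 1 2
      using True by (auto simp: order_sign_def propagator_def minus_one_divide)
  next
    case False
    have 1: "pair_propagator C F' z u (map_prod \<theta> \<theta> (loop_pair v)) = propagator C (if sl ?w = Suc 0 then Fdb else Fdbarb) Fc (u ?w) (u v)"
      unfolding map_loop_pair[OF v] pair_propagator_def using False f by (simp only: if_False fst_conv snd_conv point_at.simps)
    have 2: "pair_propagator C F z u (loop_pair v) = propagator C (if sl ?w = Suc 0 then Fa else Fabar) (if sl ?w = Suc 0 then Fgamma else Fgammabar) (u ?w) (u v)"
      unfolding loop_pair_def pair_propagator_def using False f by (simp only: if_False fst_conv snd_conv point_at.simps)
    have s: "order_sign (n + 3 * v + 2) (n + 3 * ?w) = 1" using False nx_ne[OF v] by (auto simp: order_sign_def)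
    show ?thesis unfolding 1 2 s
      by (auto simp: propagator_def minus_one_divide)
  qed
qed

lemma propagator_off_loop:
  assumes "x \<in> M - loop_pairs"
  shows "pair_propagator C F' z u (map_prod \<theta> \<theta> x) = pair_propagator C F z u x"
proof -
  note o = off_loop_pair[OF assms]
  have "point_at z u (\<theta> h) = point_at z u h" for h by (rule point_at_vertex) simp
  then show ?thesis
    by (simp only: pair_propagator_def fst_map_prod snd_map_prod field_off_loop[OF o(1,3)] field_off_loop[OF o(2,4)])
qed

text \<open>At a vertex of a bosonic loop the third field is bosonic too, so the ghosts of the
  configuration sit at other vertices and are not moved.\<close>

lemma odd_off_loop:
  assumes "h \<in> H" "species (F h) = Fc"
  shows "vertex_of h \<notin> Inner ` Z" "\<theta> h = h"
proof -
  show *: "vertex_of h \<notin> Inner ` Z"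
  proof
    assume "vertex_of h \<in> Inner ` Z"
    then obtain v t where v: "v \<in> Z" "h = IntH v t" by (cases h) auto
    then have "t < 3" using assms(1) by (auto simp: half_edges_def)
    then show False using boson_cases[OF v(1)] assms(2) v(2) slot_cases[of t] by auto
  qed
  show "\<theta> h = h" using * by (cases h) auto
qed

text \<open>Ghost pairs off the loop keep their crossings, each of them crosses the new ghost loop
  an even number of times, and the crossings of the loop with itself are counted by
  \<open>loop_sign\<close>.\<close>

lemma koszul_reversed:
  "koszul_sign n F' \<theta>.moved * (\<Prod>v\<in>Z. order_sign (n + 3 * v + 2) (n + 3 * nx v)) = (-1) ^ (card Z - 1) * koszul_sign n F M"
proof -
  define c where "c x y = (if species (F (fst x)) = Fc \<and> species (F (fst y)) = Fc
    \<and> crossing (word_span n x) (word_span n y) then -1 else 1 :: complex)" for x y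
  define c' where "c' x y = (if species (F' (fst (map_prod \<theta> \<theta> x))) = Fc \<and> species (F' (fst (map_prod \<theta> \<theta> y))) = Fc
    \<and> crossing (word_span n (map_prod \<theta> \<theta> x)) (word_span n (map_prod \<theta> \<theta> y)) then -1 else 1 :: complex)" for x y
  let ?E = "M - loop_pairs"
  have fin: "finite M" by (rule finite_contraction[OF M])
  have K': "koszul_sign n F' \<theta>.moved = (\<Prod>x\<in>M. \<Prod>y\<in>M. c' x y)"
  proof -
    have "finite \<theta>.moved" using fin by (simp add: \<theta>.moved_def)
    from koszul_sign_prod[OF this] show ?thesis
      unfolding c'_def \<theta>.moved_def prod.reindex[OF \<theta>.inj_map_prod] o_def .
  qed
  have K: "koszul_sign n F M = (\<Prod>x\<in>?E. \<Prod>y\<in>?E. c x y)"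
  proof -
    have "c x (loop_pair v) = 1" "c (loop_pair v) x = 1" if "v \<in> Z" for x v
      using species_loop_pair(2)[OF that] by (auto simp: c_def)
    then have "(\<Prod>x\<in>M. \<Prod>y\<in>M. c x y) = (\<Prod>x\<in>?E. \<Prod>y\<in>?E. c x y)"
      by (simp add: prod_pairs_split)
    then show ?thesis by (simp only: koszul_sign_prod[OF fin] c_def)
  qed
  have spec: "species (F' (fst (map_prod \<theta> \<theta> x))) = species (F (fst x))" if "x \<in> ?E" for x
    using field_off_loop[OF off_loop_pair(1,3)[OF that]] by simp
  have unmoved: "map_prod \<theta> \<theta> x = x" "vertex_of (fst x) \<notin> Inner ` Z" "vertex_of (snd x) \<notin> Inner ` Z"
    if "x \<in> ?E" "species (F (fst x)) = Fc" for x
    using odd_off_loop[of "fst x"] odd_off_loop[of "snd x"] off_loop_pair[OF that(1)] that(2) by (auto simp: prod_eq_iff)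
  have EE: "c' x y = c x y" if "x \<in> ?E" "y \<in> ?E" for x y
    unfolding c'_def c_def spec[OF that(1)] spec[OF that(2)] using unmoved(1)[OF that(1)] unmoved(1)[OF that(2)] by auto
  have cross: "(\<Prod>v\<in>Z. c' x (loop_pair v) * c' (loop_pair v) x) = 1" if x: "x \<in> ?E" for x
  proof (cases "species (F (fst x)) = Fc")
    case False
    then show ?thesis using spec[OF x] by (simp add: c'_def)
  next
    case True
    note fx = unmoved[OF x True]
    let ?a = "word_pos n (fst x)" and ?b = "word_pos n (snd x)"
    have ab: "?a < ?b" using x pair_order[of "fst x" "snd x"] by simp
    have span: "word_span n (map_prod \<theta> \<theta> x) = chord ?a ?b" using ab fx(1) by (simp add: word_span_def chord_def)
    have "c' x (loop_pair v) * c' (loop_pair v) x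
      = (order_sign ?a (n + 3 * v) * order_sign ?a (n + 3 * nx v)) * (order_sign ?b (n + 3 * v) * order_sign ?b (n + 3 * nx v))"
      if v: "v \<in> Z" for v
    proof -
      note w = p_out(1)[OF v]
      note a = pos_off_loop[OF off_loop_pair(1)[OF x] fx(2)] and b = pos_off_loop[OF off_loop_pair(2)[OF x] fx(3)]
      have "n + 3 * v + 2 \<noteq> n + 3 * nx v" by presburger
      then have "c' x (loop_pair v) * c' (loop_pair v) x
        = order_sign ?a (n + 3 * v + 2) * order_sign ?a (n + 3 * nx v) * order_sign ?b (n + 3 * v + 2) * order_sign ?b (n + 3 * nx v)"
        unfolding c'_def spec[OF x] span span_loop_pair[OF v] species_loop_pair(1)[OF v]
        using crossing_sign[of ?a "n + 3 * v + 2" "n + 3 * nx v" ?b] a(2)[OF v] a(1)[OF w] b(2)[OF v] b(1)[OF w] ab True by simp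
      then show ?thesis unfolding a(3)[OF v] b(3)[OF v] by (simp only: mult_ac)
    qed
    then have "(\<Prod>v\<in>Z. c' x (loop_pair v) * c' (loop_pair v) x)
      = (\<Prod>v\<in>Z. (order_sign ?a (n + 3 * v) * order_sign ?a (n + 3 * nx v)) * (order_sign ?b (n + 3 * v) * order_sign ?b (n + 3 * nx v)))"
      by (intro prod.cong refl)
    then show ?thesis by (simp only: prod.distrib prod_order_sign_nx mult_1)
  qed
  have LL: "(\<Prod>v\<in>Z. \<Prod>w\<in>Z. c' (loop_pair v) (loop_pair w))
    = (\<Prod>v\<in>Z. \<Prod>w\<in>Z. if crossing (chord (n + 3 * v + 2) (n + 3 * nx v)) (chord (n + 3 * w + 2) (n + 3 * nx w)) then -1 else 1)"
    by (intro prod.cong refl) (simp only: c'_def span_loop_pair species_loop_pair(1) simp_thms)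
  have "(\<Prod>x\<in>M. \<Prod>y\<in>M. c' x y) = (\<Prod>x\<in>?E. (\<Prod>y\<in>?E. c' x y) * (\<Prod>v\<in>Z. c' x (loop_pair v)))
    * (\<Prod>v\<in>Z. (\<Prod>y\<in>?E. c' (loop_pair v) y) * (\<Prod>w\<in>Z. c' (loop_pair v) (loop_pair w)))"
    by (simp only: prod_pairs_split)
  also have "\<dots> = (\<Prod>x\<in>?E. \<Prod>y\<in>?E. c' x y) * ((\<Prod>x\<in>?E. \<Prod>v\<in>Z. c' x (loop_pair v)) * (\<Prod>v\<in>Z. \<Prod>y\<in>?E. c' (loop_pair v) y))
    * (\<Prod>v\<in>Z. \<Prod>w\<in>Z. c' (loop_pair v) (loop_pair w))"
    by (simp only: prod.distrib mult_ac)
  also have "(\<Prod>v\<in>Z. \<Prod>y\<in>?E. c' (loop_pair v) y) = (\<Prod>y\<in>?E. \<Prod>v\<in>Z. c' (loop_pair v) y)" by (rule prod.swap)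
  also have "(\<Prod>x\<in>?E. \<Prod>v\<in>Z. c' x (loop_pair v)) * (\<Prod>y\<in>?E. \<Prod>v\<in>Z. c' (loop_pair v) y) = 1"
    unfolding prod.distrib[symmetric] by (rule prod.neutral) (use cross in blast)
  also have "(\<Prod>x\<in>?E. \<Prod>y\<in>?E. c' x y) = koszul_sign n F M"
    unfolding K by (intro prod.cong refl EE)
  finally have "koszul_sign n F' \<theta>.moved = koszul_sign n F M * (\<Prod>v\<in>Z. \<Prod>w\<in>Z. c' (loop_pair v) (loop_pair w))"
    unfolding K' by simp
  then show ?thesis using loop_crossings unfolding LL by (simp only: mult_ac)
qed

text \<open>Arises twice, from the coefficient -1 of \<open>boson_abar\<close> and from the
  antisymmetry of the structure constants, and so drops out in the end.\<close>

definition "slot_sign = (\<Prod>v\<in>Z. if sl v = Suc 0 then 1 else -1 :: complex)"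

lemma slot_sign_square: "slot_sign * slot_sign = 1"
  unfolding slot_sign_def prod.distrib[symmetric] by (rule prod.neutral) simp

lemma prod_split_vertices: "(\<Prod>j<N. g j) = (\<Prod>j\<in>{..<N} - Z. g j) * (\<Prod>v\<in>Z. g v :: complex)"
  by (rule prod.subset_diff) (use Z in auto)

lemma coefficients_reversed: "(\<Prod>j<N. fst (\<mu>' j)) = slot_sign * (\<Prod>j<N. fst (\<mu> j))"
proof -
  \<comment> \<open>The coefficient at v is governed by the entry slot of its successor; as the
    successor map is a bijection of \<open>Z\<close>, the product does not change under
    reindexing.\<close>
  have "(\<Prod>v\<in>Z. fst (\<mu> v)) = (\<Prod>v\<in>Z. if sl (nx v) = Suc 0 then 1 else -1)"
    by (rule prod.cong[OF refl]) (simp add: boson_monomial[OF boson])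
  also have "\<dots> = slot_sign"
    unfolding slot_sign_def by (rule prod.reindex_bij_betw[OF nx_bij])
  finally have 1: "(\<Prod>v\<in>Z. fst (\<mu> v)) = slot_sign" .
  have 2: "(\<Prod>v\<in>Z. fst (\<mu>' v)) = 1" by (rule prod.neutral) (use Z_lt in \<open>auto simp: \<mu>'_def\<close>)
  have 3: "(\<Prod>j\<in>{..<N} - Z. fst (\<mu>' j)) = (\<Prod>j\<in>{..<N} - Z. fst (\<mu> j))" by (rule prod.cong) (auto simp: \<mu>'_def)
  show ?thesis unfolding prod_split_vertices 1 2 3 using slot_sign_square by (simp add: mult.left_commute)
qed

text \<open>The order signs of the propagators are absorbed by \<open>koszul_reversed\<close>. Of
  the remaining (-1)^card Z and (-1)^(card Z - 1) a single -1 is left, the usual sign of a closed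
  ghost loop.\<close>

lemma wick_reversed: "wick_factor C \<Phi> N z u \<mu>' \<theta>.moved = - slot_sign * wick_factor C \<Phi> N z u \<mu> M"
proof -
  let ?o = "\<Prod>v\<in>Z. order_sign (n + 3 * v + 2) (n + 3 * nx v)"
  have "(\<Prod>x\<in>\<theta>.moved. pair_propagator C F' z u x) = (\<Prod>x\<in>M. pair_propagator C F' z u (map_prod \<theta> \<theta> x))"
    by (simp only: \<theta>.moved_def prod.reindex[OF \<theta>.inj_map_prod] o_def)
  also have "\<dots> = (\<Prod>x\<in>M - loop_pairs. pair_propagator C F z u x)
      * (\<Prod>v\<in>Z. - order_sign (n + 3 * v + 2) (n + 3 * nx v) * pair_propagator C F z u (loop_pair v))"
    unfolding prod_pairs_split by (intro arg_cong2[where f = "(*)"] prod.cong refl propagator_off_loop propagator_loop)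
  also have "\<dots> = (-1) ^ card Z * ?o * (\<Prod>x\<in>M. pair_propagator C F z u x)"
    unfolding prod_pairs_split prod.distrib prod_uminus by (simp only: mult_ac)
  finally have P: "(\<Prod>x\<in>\<theta>.moved. pair_propagator C F' z u x) = (-1) ^ card Z * ?o * (\<Prod>x\<in>M. pair_propagator C F z u x)" .
  have "card Z \<noteq> 0" using Z by simp
  then have sgn: "(-1) ^ card Z * (-1) ^ (card Z - 1) = (-1 :: complex)" by (cases "card Z") (auto simp: power_mult_distrib[symmetric])
  have "wick_factor C \<Phi> N z u \<mu>' \<theta>.moved
    = slot_sign * (\<Prod>j<N. fst (\<mu> j)) * (-1) ^ card Z * (koszul_sign n F' \<theta>.moved * ?o) * (\<Prod>x\<in>M. pair_propagator C F z u x)"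
    unfolding wick_factor_pairs coefficients_reversed P by (simp only: mult_ac)
  also have "\<dots> = slot_sign * ((-1) ^ card Z * (-1) ^ (card Z - 1)) * wick_factor C \<Phi> N z u \<mu> M"
    unfolding koszul_reversed wick_factor_pairs by (simp only: mult_ac)
  finally show ?thesis unfolding sgn by simp
qed


section \<open>Colour factors of the loop and of its reversal\<close>

lemma inner_sub: "h \<in> inner_half_edges N \<Longrightarrow> h \<in> H"
  by (auto simp: inner_half_edges_def half_edges_def)

lemma index_of_cong:
  assumes "h \<in> H" "h \<in> inner_half_edges N \<Longrightarrow> \<xi> h = \<eta> h"
  shows "index_of e \<xi> h = index_of e \<eta> h"
  using assms by (cases h) (auto simp: half_edges_def inner_half_edges_def)

text \<open>A common form for both orientations: at the vertices of the loop \<open>Q\<close>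
  receives the outgoing, the remaining and the entering index, in this order.\<close>

definition "loop_sum f Q B e = (\<Sum>\<xi>\<in>colourings B e N M.
    (\<Prod>j\<in>{..<N} - Z. f (\<xi> (IntH j 0)) (\<xi> (IntH j (Suc 0))) (\<xi> (IntH j 2)))
    * (\<Prod>v\<in>Z. Q (\<xi> (IntH v 0)) (\<xi> (IntH v (3 - sl v))) (\<xi> (IntH v (sl v)))) :: complex)"

definition "rest_half_edges = inner_half_edges N - loop_half_edges"

lemma rest_mem: "v \<in> Z \<Longrightarrow> IntH v (3 - sl v) \<in> rest_half_edges"
  "j < N \<Longrightarrow> j \<notin> Z \<Longrightarrow> s < 3 \<Longrightarrow> IntH j s \<in> rest_half_edges"
  using sl_cases[of v] Z_lt[of v] by (auto simp: rest_half_edges_def loop_half_edges_def inner_half_edges_def)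

definition "rest_colourings B e = {\<eta> \<in> rest_half_edges \<rightarrow>\<^sub>E B. \<forall>(h, h')\<in>M. h \<notin> loop_half_edges \<longrightarrow> index_of e \<eta> h = index_of e \<eta> h'}"

text \<open>\<open>y v\<close> is the colour of the loop edge leaving v, so the entering slot of v
  carries \<open>y (pr v)\<close>.\<close>

definition "glue \<eta> y = (\<lambda>h\<in>inner_half_edges N. if h \<in> rest_half_edges then \<eta> h
   else case h of IntH v t \<Rightarrow> if t = 0 then y v else y (pr v) | ExtH i \<Rightarrow> undefined)"

lemma glue_simps:
  "h \<in> rest_half_edges \<Longrightarrow> glue \<eta> y h = \<eta> h"
  "v \<in> Z \<Longrightarrow> glue \<eta> y (IntH v 0) = y v"
  "v \<in> Z \<Longrightarrow> glue \<eta> y (IntH v (sl v)) = y (pr v)"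
proof -
  show "h \<in> rest_half_edges \<Longrightarrow> glue \<eta> y h = \<eta> h" by (simp add: glue_def rest_half_edges_def)
  have "IntH v 0 \<in> inner_half_edges N - rest_half_edges" "IntH v (sl v) \<in> inner_half_edges N - rest_half_edges" if "v \<in> Z"
    using that Z_lt[OF that] sl_cases[of v] by (auto simp: rest_half_edges_def loop_half_edges_def inner_half_edges_def)
  then show "v \<in> Z \<Longrightarrow> glue \<eta> y (IntH v 0) = y v" "v \<in> Z \<Longrightarrow> glue \<eta> y (IntH v (sl v)) = y (pr v)"
    using sl_cases[of v] by (auto simp: glue_def)
qed

lemma inner_cases:
  assumes "h \<in> inner_half_edges N"
  obtains "h \<in> rest_half_edges" | v where "v \<in> Z" "h = IntH v 0" | v where "v \<in> Z" "h = IntH v (sl v)"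
  using assms by (auto simp: rest_half_edges_def loop_half_edges_def)

lemma colouring_loop:
  assumes \<xi>: "\<xi> \<in> colourings B e N M" and v: "v \<in> Z"
  shows "\<xi> (IntH v (sl v)) = \<xi> (IntH (pr v) 0)"
proof -
  have "IntH v (sl v) \<in> H" using v by (intro loop_half_edges_sub) (auto simp: loop_half_edges_def)
  from partner_mem(1)[OF M this] have "(IntH v (sl v), IntH (pr v) 0) \<in> M \<or> (IntH (pr v) 0, IntH v (sl v)) \<in> M"
    unfolding p_in_slot[OF v] .
  then show ?thesis using \<xi> by (auto simp: colourings_def)
qed

lemma glue_colouring:
  assumes \<eta>: "\<eta> \<in> rest_colourings B e" and y: "y \<in> Z \<rightarrow>\<^sub>E B"
  shows "glue \<eta> y \<in> colourings B e N M"
proof -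
  have "glue \<eta> y h \<in> B" if h: "h \<in> inner_half_edges N" for h
    using h
  proof (cases rule: inner_cases)
    case 1 then show ?thesis using \<eta> by (auto simp: glue_simps rest_colourings_def)
  next
    case (2 v) then show ?thesis using PiE_mem[OF y 2(1)] by (simp add: glue_simps)
  next
    case (3 v) then show ?thesis using PiE_mem[OF y pr(1)[OF 3(1)]] by (simp add: glue_simps)
  qed
  moreover have "glue \<eta> y \<in> extensional (inner_half_edges N)" by (simp add: glue_def)
  moreover have "index_of e (glue \<eta> y) h = index_of e (glue \<eta> y) h'" if hM: "(h, h') \<in> M" for h h'
  proof (cases "h \<in> loop_half_edges")
    case True
    from hM True show ?thesis
    proof (cases rule: loop_pair_cases)
      case (1 v)
      then show ?thesis using p_out(1)[OF 1(1)] pr(3)[OF 1(1)] by (simp add: glue_simps)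
    next
      case (2 v)
      then show ?thesis using p_out(1)[OF 2(1)] pr(3)[OF 2(1)] by (simp add: glue_simps)
    qed
  next
    case False
    have "h' \<notin> loop_half_edges" using False pair_loop_iff[OF hM] by simp
    moreover have "h \<in> H" "h' \<in> H" using contractions_subset[OF M] hM by auto
    ultimately have "index_of e (glue \<eta> y) h = index_of e \<eta> h" "index_of e (glue \<eta> y) h' = index_of e \<eta> h'"
      using False by (auto intro!: index_of_cong glue_simps(1) simp: rest_half_edges_def)
    moreover have "index_of e \<eta> h = index_of e \<eta> h'" using \<eta> hM False by (auto simp: rest_colourings_def)
    ultimately show ?thesis by simp
  qed
  ultimately show ?thesis by (auto simp: colourings_def PiE_iff)
qed

text \<open>A colouring amounts to one of the half-edges off the loop and an independent colour for
  every edge of the loop. With the former fixed, the inner sum is a cyclic sum of structure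
  constants.\<close>

lemma loop_sum_split:
  fixes f Q :: "'g \<Rightarrow> 'g \<Rightarrow> 'g \<Rightarrow> complex"
  shows "loop_sum f Q B e = (\<Sum>\<eta>\<in>rest_colourings B e.
    (\<Prod>j\<in>{..<N} - Z. f (\<eta> (IntH j 0)) (\<eta> (IntH j (Suc 0))) (\<eta> (IntH j 2)))
    * (\<Sum>y\<in>Z \<rightarrow>\<^sub>E B. \<Prod>v\<in>Z. Q (y v) (\<eta> (IntH v (3 - sl v))) (y (pr v))))"
proof -
  let ?g = "\<lambda>\<eta> y. (\<Prod>j\<in>{..<N} - Z. f (\<eta> (IntH j 0)) (\<eta> (IntH j (Suc 0))) (\<eta> (IntH j 2)))
    * (\<Prod>v\<in>Z. Q (y v) (\<eta> (IntH v (3 - sl v))) (y (pr v)))"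
  have "loop_sum f Q B e = (\<Sum>x\<in>rest_colourings B e \<times> (Z \<rightarrow>\<^sub>E B). ?g (fst x) (snd x))"
    unfolding loop_sum_def
  proof (rule sum.reindex_bij_witness[where i = "\<lambda>x. glue (fst x) (snd x)" and j = "\<lambda>\<xi>. (restrict \<xi> rest_half_edges, \<lambda>v\<in>Z. \<xi> (IntH v 0))"])
    fix \<xi> assume \<xi>: "\<xi> \<in> colourings B e N M"
    let ?y = "\<lambda>v\<in>Z. \<xi> (IntH v 0)" and ?\<eta> = "restrict \<xi> rest_half_edges"
    have PiE: "\<xi> \<in> inner_half_edges N \<rightarrow>\<^sub>E B" using \<xi> by (simp add: colourings_def)
    have "glue ?\<eta> ?y h = \<xi> h" for h
    proof (cases "h \<in> inner_half_edges N")
      case True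
      then show ?thesis
      proof (cases rule: inner_cases)
        case 1 then show ?thesis by (simp add: glue_simps)
      next
        case (2 v) then show ?thesis by (simp add: glue_simps)
      next
        case (3 v) then show ?thesis using colouring_loop[OF \<xi> 3(1)] pr(1)[OF 3(1)] by (simp add: glue_simps)
      qed
    next
      case False
      then show ?thesis using PiE by (auto simp: glue_def PiE_iff extensional_def)
    qed
    then show "glue (fst (?\<eta>, ?y)) (snd (?\<eta>, ?y)) = \<xi>" by (simp add: fun_eq_iff)
    have "index_of e ?\<eta> h = index_of e ?\<eta> h'" if hM: "(h, h') \<in> M" "h \<notin> loop_half_edges" for h h'
    proof -
      have "h' \<notin> loop_half_edges" using hM pair_loop_iff by blast
      moreover have "h \<in> H" "h' \<in> H" using contractions_subset[OF M] hM(1) by auto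
      ultimately have "index_of e ?\<eta> h = index_of e \<xi> h" "index_of e ?\<eta> h' = index_of e \<xi> h'"
        using hM(2) by (auto intro!: index_of_cong simp: rest_half_edges_def)
      moreover have "index_of e \<xi> h = index_of e \<xi> h'" using \<xi> hM(1) by (auto simp: colourings_def)
      ultimately show ?thesis by simp
    qed
    moreover have "?\<eta> \<in> rest_half_edges \<rightarrow>\<^sub>E B" using PiE by (auto simp: rest_half_edges_def)
    moreover have "IntH v 0 \<in> inner_half_edges N" if "v \<in> Z" for v using Z_lt[OF that] by (auto simp: inner_half_edges_def)
    ultimately show "(?\<eta>, ?y) \<in> rest_colourings B e \<times> (Z \<rightarrow>\<^sub>E B)"
      using PiE by (auto simp: rest_colourings_def)
    have "(\<Prod>j\<in>{..<N} - Z. f (?\<eta> (IntH j 0)) (?\<eta> (IntH j (Suc 0))) (?\<eta> (IntH j 2)))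
      = (\<Prod>j\<in>{..<N} - Z. f (\<xi> (IntH j 0)) (\<xi> (IntH j (Suc 0))) (\<xi> (IntH j 2)))"
      by (rule prod.cong) (simp_all add: rest_mem)
    moreover have "(\<Prod>v\<in>Z. Q (?y v) (?\<eta> (IntH v (3 - sl v))) (?y (pr v)))
      = (\<Prod>v\<in>Z. Q (\<xi> (IntH v 0)) (\<xi> (IntH v (3 - sl v))) (\<xi> (IntH v (sl v))))"
      by (rule prod.cong) (simp_all add: rest_mem colouring_loop[OF \<xi>] pr)
    ultimately show "?g (fst (?\<eta>, ?y)) (snd (?\<eta>, ?y))
      = (\<Prod>j\<in>{..<N} - Z. f (\<xi> (IntH j 0)) (\<xi> (IntH j (Suc 0))) (\<xi> (IntH j 2)))
        * (\<Prod>v\<in>Z. Q (\<xi> (IntH v 0)) (\<xi> (IntH v (3 - sl v))) (\<xi> (IntH v (sl v))))"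
      by (simp only: fst_conv snd_conv)
  next
    fix x assume x: "x \<in> rest_colourings B e \<times> (Z \<rightarrow>\<^sub>E B)"
    obtain \<eta> y where x_eq: "x = (\<eta>, y)" by (cases x)
    have \<eta>: "\<eta> \<in> rest_colourings B e" and y: "y \<in> Z \<rightarrow>\<^sub>E B" using x x_eq by auto
    show "glue (fst x) (snd x) \<in> colourings B e N M" using glue_colouring[OF \<eta> y] x_eq by simp
    have "restrict (glue \<eta> y) rest_half_edges h = \<eta> h" for h
      using \<eta> by (cases "h \<in> rest_half_edges") (auto simp: glue_simps rest_colourings_def PiE_iff extensional_def)
    moreover have "(\<lambda>v\<in>Z. glue \<eta> y (IntH v 0)) v = y v" for v
      using y by (cases "v \<in> Z") (auto simp: glue_simps PiE_iff extensional_def)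
    ultimately show "(restrict (glue (fst x) (snd x)) rest_half_edges, \<lambda>v\<in>Z. glue (fst x) (snd x) (IntH v 0)) = x"
      unfolding x_eq fst_conv snd_conv prod.inject by (intro conjI ext)
  qed
  then show ?thesis by (simp only: sum_distrib_left sum.cartesian_product case_prod_unfold)
qed

text \<open>Antisymmetry moves the entering index to the last place where it sits in slot 1. The
  number of such vertices has the parity of (-1)^card Z times \<open>slot_sign\<close>.\<close>

lemma colour_factor_loop_sum:
  fixes f :: "'g \<Rightarrow> 'g \<Rightarrow> 'g \<Rightarrow> complex"
  assumes antisym: "\<And>a b c. f a b c = - f a c b"
  shows "colour_factor f B e N M = (-1) ^ card Z * slot_sign * loop_sum f f B e"
proof -
  have "(\<Prod>v\<in>Z. f (\<xi> (IntH v 0)) (\<xi> (IntH v (Suc 0))) (\<xi> (IntH v 2)))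
    = (\<Prod>v\<in>Z. - (if sl v = Suc 0 then 1 else -1) * f (\<xi> (IntH v 0)) (\<xi> (IntH v (3 - sl v))) (\<xi> (IntH v (sl v))))" for \<xi>
  proof (rule prod.cong[OF refl])
    fix v
    show "f (\<xi> (IntH v 0)) (\<xi> (IntH v (Suc 0))) (\<xi> (IntH v 2))
      = - (if sl v = Suc 0 then 1 else -1) * f (\<xi> (IntH v 0)) (\<xi> (IntH v (3 - sl v))) (\<xi> (IntH v (sl v)))"
    proof (cases "sl v = Suc 0")
      case True
      then show ?thesis using antisym[of "\<xi> (IntH v 0)" "\<xi> (IntH v (Suc 0))" "\<xi> (IntH v 2)"] by simp
    next
      case False
      then have "sl v = 2" using sl_cases[of v] by blast
      then show ?thesis by simp
    qed
  qed
  then have "(\<Prod>j<N. f (\<xi> (IntH j 0)) (\<xi> (IntH j (Suc 0))) (\<xi> (IntH j 2)))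
    = (-1) ^ card Z * slot_sign * ((\<Prod>j\<in>{..<N} - Z. f (\<xi> (IntH j 0)) (\<xi> (IntH j (Suc 0))) (\<xi> (IntH j 2)))
      * (\<Prod>v\<in>Z. f (\<xi> (IntH v 0)) (\<xi> (IntH v (3 - sl v))) (\<xi> (IntH v (sl v)))))" for \<xi>
    unfolding prod_split_vertices by (simp only: prod.distrib prod_uminus slot_sign_def mult_ac)
  then show ?thesis unfolding colour_factor_def loop_sum_def sum_distrib_left by (intro sum.cong refl)
qed

lemma relabel_inner:
  assumes "h \<in> inner_half_edges N"
  shows "\<theta> h \<in> inner_half_edges N \<and> unrelabel Z sl h \<in> inner_half_edges N"
proof -
  obtain v t where h: "h = IntH v t" "v < N" "t < 3" using assms by (auto simp: inner_half_edges_def)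
  have "sl v < 3" "3 - sl v < 3" using sl_cases[of v] by auto
  then show ?thesis using h by (auto simp: inner_half_edges_def)
qed

text \<open>No sign here: after relabelling, the former entry is in slot 0, the remaining index in
  slot 1 and the former exit in slot 2, whatever the entry slot was.\<close>

lemma colour_factor_moved:
  fixes f :: "'g \<Rightarrow> 'g \<Rightarrow> 'g \<Rightarrow> complex"
  shows "colour_factor f B e N \<theta>.moved = loop_sum f (\<lambda>a x b. f b x a) B e"
  unfolding colour_factor_def loop_sum_def
proof (rule sum.reindex_bij_witness[where i = "\<lambda>\<xi>. \<lambda>h\<in>inner_half_edges N. \<xi> (unrelabel Z sl h)" and j = "\<lambda>\<xi>. \<lambda>h\<in>inner_half_edges N. \<xi> (\<theta> h)"])
  note inv = \<theta>.inv[OF inner_sub]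
  have idx: "index_of e (\<lambda>h\<in>inner_half_edges N. \<xi> (\<theta> h)) h = index_of e \<xi> (\<theta> h)" if "h \<in> H" for h and \<xi> :: "half_edge \<Rightarrow> 'g"
    using that by (cases h) (auto simp: half_edges_def inner_half_edges_def)
  fix \<xi> assume \<xi>: "\<xi> \<in> colourings B e N \<theta>.moved"
  let ?\<xi> = "\<lambda>h\<in>inner_half_edges N. \<xi> (\<theta> h)"
  have PiE: "\<xi> \<in> inner_half_edges N \<rightarrow>\<^sub>E B" using \<xi> by (simp add: colourings_def)
  show "(\<lambda>h\<in>inner_half_edges N. ?\<xi> (unrelabel Z sl h)) = \<xi>"
    using PiE inv relabel_inner by (auto simp: fun_eq_iff PiE_iff extensional_def)
  have "index_of e \<xi> (\<theta> h) = index_of e \<xi> (\<theta> h')" if "(h, h') \<in> M" for h h'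
    using \<xi> that by (force simp: colourings_def \<theta>.moved_def)
  moreover have "h \<in> H" "h' \<in> H" if "(h, h') \<in> M" for h h' using contractions_subset[OF M] that by auto
  ultimately show "?\<xi> \<in> colourings B e N M"
    using PiE relabel_inner by (auto simp: colourings_def idx)
  have 1: "(\<Prod>j\<in>{..<N} - Z. f (?\<xi> (IntH j 0)) (?\<xi> (IntH j (Suc 0))) (?\<xi> (IntH j 2)))
    = (\<Prod>j\<in>{..<N} - Z. f (\<xi> (IntH j 0)) (\<xi> (IntH j (Suc 0))) (\<xi> (IntH j 2)))"
    by (rule prod.cong) (auto simp: inner_half_edges_def)
  have 2: "(\<Prod>v\<in>Z. f (?\<xi> (IntH v (sl v))) (?\<xi> (IntH v (3 - sl v))) (?\<xi> (IntH v 0)))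
    = (\<Prod>v\<in>Z. f (\<xi> (IntH v 0)) (\<xi> (IntH v (Suc 0))) (\<xi> (IntH v 2)))"
  proof (rule prod.cong[OF refl])
    fix v assume v: "v \<in> Z"
    show "f (?\<xi> (IntH v (sl v))) (?\<xi> (IntH v (3 - sl v))) (?\<xi> (IntH v 0)) = f (\<xi> (IntH v 0)) (\<xi> (IntH v (Suc 0))) (\<xi> (IntH v 2))"
      using sl_cases[of v] v Z_lt[OF v] by (elim disjE) (simp_all add: inner_half_edges_def)
  qed
  show "(\<Prod>j\<in>{..<N} - Z. f (?\<xi> (IntH j 0)) (?\<xi> (IntH j (Suc 0))) (?\<xi> (IntH j 2)))
      * (\<Prod>v\<in>Z. f (?\<xi> (IntH v (sl v))) (?\<xi> (IntH v (3 - sl v))) (?\<xi> (IntH v 0)))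
    = (\<Prod>j<N. f (\<xi> (IntH j 0)) (\<xi> (IntH j (Suc 0))) (\<xi> (IntH j 2)))"
    unfolding 1 2 prod_split_vertices ..
next
  note inv = \<theta>.inv[OF inner_sub]
  fix \<xi> assume \<xi>: "\<xi> \<in> colourings B e N M"
  let ?\<xi> = "\<lambda>h\<in>inner_half_edges N. \<xi> (unrelabel Z sl h)"
  have PiE: "\<xi> \<in> inner_half_edges N \<rightarrow>\<^sub>E B" using \<xi> by (simp add: colourings_def)
  show "(\<lambda>h\<in>inner_half_edges N. ?\<xi> (\<theta> h)) = \<xi>"
    using PiE inv relabel_inner by (auto simp: fun_eq_iff PiE_iff extensional_def)
  have idx: "index_of e ?\<xi> (\<theta> h) = index_of e \<xi> h" if "h \<in> H" for h
  proof (cases h)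
    case (ExtH i) then show ?thesis by simp
  next
    case (IntH v t)
    then have "h \<in> inner_half_edges N" using that by (auto simp: half_edges_def inner_half_edges_def)
    then have "?\<xi> (\<theta> h) = \<xi> h" using inv relabel_inner by simp
    then show ?thesis using IntH by (cases "v \<in> Z") simp_all
  qed
  have "index_of e \<xi> h = index_of e \<xi> h'" "h \<in> H" "h' \<in> H" if "(h, h') \<in> M" for h h'
    using \<xi> that contractions_subset[OF M] by (auto simp: colourings_def)
  then have "index_of e ?\<xi> h = index_of e ?\<xi> h'" if "(h, h') \<in> \<theta>.moved" for h h'
    using that idx by (auto simp: \<theta>.moved_def)
  then show "?\<xi> \<in> colourings B e N \<theta>.moved"
    using PiE relabel_inner by (auto simp: colourings_def)
qed

end

section \<open>Vanishing of graphs with loops\<close>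

context embedded_lie_algebra
begin

text \<open>The (-1)^k of strong unimodularity meets the (-1)^k of antisymmetry, and
  \<open>slot_sign\<close> occurs twice. What remains is the -1 of the ghost loop.\<close>

lemma loop_reversal:
  assumes "boson_loop \<Phi> N \<Gamma> \<mu> M Z"
  shows "wick_factor C \<Phi> N z u (fst (to_ghost N Z (\<mu>, M))) (snd (to_ghost N Z (\<mu>, M))) * colour_factor f \<B> e N (snd (to_ghost N Z (\<mu>, M)))
    = - (wick_factor C \<Phi> N z u \<mu> M * colour_factor f \<B> e N M)"
proof -
  interpret boson_loop \<Phi> N \<Gamma> \<mu> M Z by (rule assms)
  obtain \<nu> k where \<nu>: "bij_betw \<nu> {..<k} Z" "0 < (k::nat)" "\<And>i. i < k \<Longrightarrow> pr (\<nu> (Suc i mod k)) = \<nu> i"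
    by (rule cycle_enumeration) (rule that)
  have card: "card Z = k" using bij_betw_same_card[OF \<nu>(1)] by simp
  have rev: "loop_sum f (\<lambda>a x b. f b x a) \<B> e = (-1) ^ k * loop_sum f f \<B> e"
    unfolding loop_sum_split sum_distrib_left[of "(-1) ^ k" _ "rest_colourings \<B> e"]
    by (intro sum.cong refl) (simp only: cycle_reversal[OF \<nu>, where X = "\<lambda>v. _ (IntH v (3 - sl v))"] mult_ac)
  have colour: "colour_factor f \<B> e N M = (-1) ^ k * slot_sign * loop_sum f f \<B> e"
    using colour_factor_loop_sum[of f \<B> e] f_antisym unfolding card by blast
  have "colour_factor f \<B> e N \<theta>.moved = (-1) ^ k * loop_sum f f \<B> e"
    unfolding colour_factor_moved rev ..
  also have "\<dots> = slot_sign * slot_sign * ((-1) ^ k * loop_sum f f \<B> e)" unfolding slot_sign_square by simp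
  also have "\<dots> = slot_sign * colour_factor f \<B> e N M" unfolding colour by (simp only: mult_ac)
  finally have "wick_factor C \<Phi> N z u \<mu>' \<theta>.moved * colour_factor f \<B> e N \<theta>.moved
    = - (slot_sign * slot_sign) * (wick_factor C \<Phi> N z u \<mu> M * colour_factor f \<B> e N M)"
    unfolding wick_reversed by (simp only: mult_ac mult_minus_left mult_minus_right)
  then show ?thesis unfolding to_ghost_eq slot_sign_square by simp
qed

lemma minimal_loop_cancels:
  assumes Z: "minimal_closed N \<Gamma> Z"
  shows "graph_integrand \<B> f C \<Phi> e N \<Gamma> z u = 0"
proof -
  define g where "g x = wick_factor C \<Phi> N z u (fst x) (snd x) * colour_factor f \<B> e N (snd x)" for x
  note cfg = loop_config_if[OF _ Z]
  have bl: "boson_loop \<Phi> N \<Gamma> (fst x) (snd x) Z" if "x \<in> boson_pairings \<Phi> N \<Gamma> Z" for x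
    using cfg[of x] that by (auto simp: boson_pairings_def boson_loop_def boson_loop_axioms_def)
  have gl: "ghost_loop \<Phi> N \<Gamma> (fst x) (snd x) Z" if "x \<in> ghost_pairings \<Phi> N \<Gamma> Z" for x
    using cfg[of x] that by (auto simp: ghost_pairings_def ghost_loop_def ghost_loop_axioms_def)
  have split: "pairings \<Phi> N \<Gamma> = boson_pairings \<Phi> N \<Gamma> Z \<union> ghost_pairings \<Phi> N \<Gamma> Z"
    using loop_config.ghost_dichotomy[OF cfg] by (auto simp: boson_pairings_def ghost_pairings_def)
  have disj: "boson_pairings \<Phi> N \<Gamma> Z \<inter> ghost_pairings \<Phi> N \<Gamma> Z = {}"
    using Z by (auto simp: boson_pairings_def ghost_pairings_def minimal_closed_def)
  have fin: "finite (pairings \<Phi> N \<Gamma>)"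
    by (rule finite_subset[of _ "({..<N} \<rightarrow>\<^sub>E interaction_monomials) \<times> contractions (length \<Phi>) N"])
      (auto simp: pairings_def finite_contractions intro!: finite_PiE)
  have "(\<Sum>x\<in>boson_pairings \<Phi> N \<Gamma> Z. g x) = (\<Sum>x\<in>ghost_pairings \<Phi> N \<Gamma> Z. - g x)"
  proof (rule sum.reindex_bij_witness[where i = "to_boson N Z" and j = "to_ghost N Z"])
    fix x assume x: "x \<in> boson_pairings \<Phi> N \<Gamma> Z"
    note b = bl[OF x]
    show "to_boson N Z (to_ghost N Z x) = x" "to_ghost N Z x \<in> ghost_pairings \<Phi> N \<Gamma> Z"
      using boson_loop.to_boson_to_ghost[OF b] boson_loop.to_ghost_mem[OF b] by simp_all
    show "- g (to_ghost N Z x) = g x" using loop_reversal[OF b] by (simp add: g_def)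
  next
    fix x assume x: "x \<in> ghost_pairings \<Phi> N \<Gamma> Z"
    note b = gl[OF x]
    show "to_ghost N Z (to_boson N Z x) = x" "to_boson N Z x \<in> boson_pairings \<Phi> N \<Gamma> Z"
      using ghost_loop.to_ghost_to_boson[OF b] ghost_loop.to_boson_mem[OF b] by simp_all
  qed
  then have "(\<Sum>x\<in>pairings \<Phi> N \<Gamma>. g x) = 0"
    using fin unfolding split by (subst sum.union_disjoint) (auto simp: disj sum_negf)
  then show ?thesis unfolding graph_integrand_pairings[OF finite_Basis] g_def case_prod_unfold .
qed

text \<open>A single contributing pairing orients the graph. If the orientation had a closed set,
  the graph would have a minimal one, and then the sum over all pairings would vanish.\<close>

lemma nonzero_integrand:
  assumes nz: "graph_integrand \<B> f C \<Phi> e N \<Gamma> z u \<noteq> 0"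
  shows "\<exists>p. disjoint_union_of_rooted_trees \<Phi> N \<Gamma> p" "int N = total_charge \<Phi>"
proof -
  have "pairings \<Phi> N \<Gamma> \<noteq> {}"
    using nz unfolding graph_integrand_pairings[OF finite_Basis] by auto
  then obtain \<mu> M where pairing: "(\<mu>, M) \<in> pairings \<Phi> N \<Gamma>" by auto
  interpret oriented_contraction "length \<Phi>" N "\<lambda>h. charge (field_of \<Phi> \<mu> h)" M
    using oriented_contraction_pairings[OF pairing] .
  have \<Gamma>: "graph_of M = \<Gamma>" using pairing by (simp add: pairings_def)
  have acyclic: "\<not> parent_closed Z" if Z: "Z \<subseteq> {..<N}" "Z \<noteq> {}" for Z
  proof
    define P where "P Y \<longleftrightarrow> Y \<subseteq> {..<N} \<and> Y \<noteq> {} \<and> size (filter_mset (\<lambda>E. E \<subseteq> Inner ` Y) \<Gamma>) = card Y" for Y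
    assume "parent_closed Z"
    then have "P Z" using parent_closed_iff_graph[OF Z(1)] Z \<Gamma> by (simp add: P_def)
    \<comment> \<open>Least cardinality among the closed sets implies minimality under
      inclusion.\<close>
    then obtain Y where Y: "P Y" "\<And>X. P X \<Longrightarrow> card Y \<le> card X" using ex_has_least_nat[of P Z card] by blast
    have "finite Y" using Y(1) finite_subset[of Y "{..<N}"] by (auto simp: P_def)
    then have "X = Y" if "P X" "X \<subseteq> Y" for X using card_seteq[OF _ that(2)] Y(2)[OF that(1)] by blast
    then have "minimal_closed N \<Gamma> Y" using Y(1) by (auto simp: minimal_closed_def P_def)
    then show False using minimal_loop_cancels nz by blast
  qed
  from forest[OF acyclic] obtain Ts where
    "\<forall>(r, t)\<in>set Ts. charge (field_of \<Phi> \<mu> (ExtH r)) = -1 \<and> (\<forall>i\<in>leaves t. charge (field_of \<Phi> \<mu> (ExtH i)) = 1)"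
    "(\<Sum>T\<leftarrow>Ts. rooted_vertices T) = mset_set (Ext ` {..<length \<Phi>} \<union> Inner ` {..<N})"
    "(\<Sum>T\<leftarrow>Ts. rooted_edges T) = graph_of M" by blast
  then show "\<exists>p. disjoint_union_of_rooted_trees \<Phi> N \<Gamma> p"
    unfolding disjoint_union_of_rooted_trees_def using \<Gamma> by (intro exI[of _ "length Ts"] exI[of _ Ts]) simp
  show "int N = total_charge \<Phi>"
    using charge_balance by (simp add: total_charge_def sum_list_sum_nth atLeast0LessThan)
qed

lemma contributing:
  assumes "(N, \<Gamma>) \<in> contributing_diagrams \<B> f C \<Phi>"
  shows "\<exists>p. disjoint_union_of_rooted_trees \<Phi> N \<Gamma> p" "int N = total_charge \<Phi>" "\<Gamma> \<in> feynman_graphs (length \<Phi>) N"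
  using assms nonzero_integrand unfolding contributing_diagrams_def by blast+

lemma finite_contributing: "finite (contributing_diagrams \<B> f C \<Phi>)"
proof (rule finite_subset)
  show "contributing_diagrams \<B> f C \<Phi> \<subseteq> {nat (total_charge \<Phi>)} \<times> feynman_graphs (length \<Phi>) (nat (total_charge \<Phi>))"
  proof
    fix x assume "x \<in> contributing_diagrams \<B> f C \<Phi>"
    then obtain N \<Gamma> where x: "x = (N, \<Gamma>)" "(N, \<Gamma>) \<in> contributing_diagrams \<B> f C \<Phi>" by (cases x) auto
    have "N = nat (total_charge \<Phi>)" using contributing(2)[OF x(2)] by simp
    then show "x \<in> {nat (total_charge \<Phi>)} \<times> feynman_graphs (length \<Phi>) (nat (total_charge \<Phi>))"
      using contributing(3)[OF x(2)] x(1) by simp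
  qed
qed (auto simp: feynman_graphs_def finite_contractions)

lemma free_correlator_contributing:
  assumes e: "e \<in> tensor_components \<B> \<Phi>" and z: "z \<in> configurations (length \<Phi>) UNIV"
  shows "free_correlator \<B> f C \<Phi> e N z u
    = (\<Sum>\<Gamma> | (N, \<Gamma>) \<in> contributing_diagrams \<B> f C \<Phi>. graph_integrand \<B> f C \<Phi> e N \<Gamma> z u)"
proof -
  let ?c = "\<lambda>\<tau> M. contraction_value f C \<Phi> e N z u \<tau> M" and ?Cs = "contractions (length \<Phi>) N"
  have "free_correlator \<B> f C \<Phi> e N z u
    = (\<Sum>\<tau>\<in>(\<Pi>\<^sub>E j\<in>{..<N}. vertex_decorations \<B>). \<Sum>\<Gamma>\<in>feynman_graphs (length \<Phi>) N. \<Sum>M\<in>{M \<in> ?Cs. graph_of M = \<Gamma>}. ?c \<tau> M)"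
    unfolding free_correlator_def feynman_graphs_def by (intro sum.cong refl sum.image_gen finite_contractions)
  also have "\<dots> = (\<Sum>\<Gamma>\<in>feynman_graphs (length \<Phi>) N. graph_integrand \<B> f C \<Phi> e N \<Gamma> z u)"
    unfolding graph_integrand_def by (rule sum.swap)
  also have "\<dots> = (\<Sum>\<Gamma> | (N, \<Gamma>) \<in> contributing_diagrams \<B> f C \<Phi>. graph_integrand \<B> f C \<Phi> e N \<Gamma> z u)"
  proof (rule sum.mono_neutral_right)
    show "finite (feynman_graphs (length \<Phi>) N)" by (simp add: feynman_graphs_def finite_contractions)
    show "{\<Gamma>. (N, \<Gamma>) \<in> contributing_diagrams \<B> f C \<Phi>} \<subseteq> feynman_graphs (length \<Phi>) N" using contributing(3) by blast
    show "\<forall>\<Gamma>\<in>feynman_graphs (length \<Phi>) N - {\<Gamma>. (N, \<Gamma>) \<in> contributing_diagrams \<B> f C \<Phi>}. graph_integrand \<B> f C \<Phi> e N \<Gamma> z u = 0"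
      unfolding contributing_diagrams_def using e z by blast
  qed
  finally show ?thesis .
qed

end

section \<open>Correlators as sums of contributions\<close>

lemma dz_dzbar_sum:
  assumes G: "\<And>k. k \<in> K \<Longrightarrow> G k differentiable (at w)"
    and eq: "\<forall>\<^sub>F v in nhds w. F v = (\<Sum>k\<in>K. c k * G k v)"
  shows "dz F w = (\<Sum>k\<in>K. c k * dz (G k) w)" "dzbar F w = (\<Sum>k\<in>K. c k * dzbar (G k) w)"
proof -
  let ?D = "\<lambda>d. \<Sum>k\<in>K. c k * frechet_derivative (G k) (at w) d"
  have "((\<lambda>v. \<Sum>k\<in>K. c k * G k v) has_derivative ?D) (at w)"
    using G by (intro has_derivative_sum has_derivative_mult_right) (simp add: frechet_derivative_works[symmetric])
  then have "(F has_derivative ?D) (at w)"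
  proof (rule has_derivative_transform_eventually)
    show "\<forall>\<^sub>F v in at w. (\<Sum>k\<in>K. c k * G k v) = F v"
      using eq unfolding eventually_at_filter by (rule eventually_mono) simp
    show "(\<Sum>k\<in>K. c k * G k w) = F w" using eventually_nhds_x_imp_x[OF eq] by simp
  qed simp
  then have D: "frechet_derivative F (at w) = ?D" by (rule frechet_derivative_at[symmetric])
  show "dz F w = (\<Sum>k\<in>K. c k * dz (G k) w)" "dzbar F w = (\<Sum>k\<in>K. c k * dzbar (G k) w)"
    unfolding dz_def dzbar_def D sum_distrib_left sum_subtractf[symmetric] sum.distrib[symmetric] sum_divide_distrib
    by (auto intro!: sum.cong simp: algebra_simps)
qed

lemma configurations_coordinate_open:
  assumes "open U" "z \<in> configurations n U"
  shows "\<forall>\<^sub>F w in nhds (z i). z(i := w) \<in> configurations n U"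
proof (cases "i < n")
  case True
  let ?V = "U - z ` ({..<n} - {i})"
  have "open ?V" using assms(1) by (intro open_Diff finite_imp_closed) auto
  moreover have "z i \<in> ?V" using assms(2) True by (auto simp: configurations_def inj_on_def)
  ultimately have "\<forall>\<^sub>F w in nhds (z i). w \<in> ?V" by (rule eventually_nhds_in_open)
  then show ?thesis
  proof (rule eventually_mono)
    fix w assume w: "w \<in> ?V"
    then have "w \<noteq> z j" if "j < n" "j \<noteq> i" for j using that by auto
    moreover have "z j \<noteq> z k" if "j < n" "k < n" "j \<noteq> k" for j k using that assms(2) by (auto simp: configurations_def inj_on_def)
    ultimately have "inj_on (z(i := w)) {..<n}" by (auto simp: inj_on_def fun_upd_def)
    then show "z(i := w) \<in> configurations n U" using assms(2) w by (auto simp: configurations_def)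
  qed
next
  case False
  have "z(i := w) \<in> configurations n U" for w
  proof -
    have "inj_on (z(i := w)) {..<n} = inj_on z {..<n}" by (rule inj_on_cong) (use False in auto)
    then show ?thesis using assms(2) False by (auto simp: configurations_def)
  qed
  then show ?thesis by simp
qed

text \<open>Linearity of derivatives needs differentiable summands at every stage, hence the
  regularity of contributions for all words. An identity on the open set of configurations is
  enough, as it persists near each point.\<close>

lemma iter_deriv_sum:
  assumes G: "\<And>k. k \<in> K \<Longrightarrow> iteratedly_differentiable_on (configurations n U) (G k)"
    and U: "open U" and F: "\<And>z. z \<in> configurations n U \<Longrightarrow> F z = (\<Sum>k\<in>K. c k * G k z)"
    and z: "z \<in> configurations n U"
  shows "iter_deriv ws F z = (\<Sum>k\<in>K. c k * iter_deriv ws (G k) z)"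
  using z
proof (induction ws arbitrary: z)
  case Nil then show ?case by (simp add: F)
next
  case (Cons l ws)
  obtain bar i where l: "l = (bar, i)" by (cases l)
  have "\<forall>\<^sub>F w in nhds (z i). iter_deriv ws F (z(i := w)) = (\<Sum>k\<in>K. c k * iter_deriv ws (G k) (z(i := w)))"
    using configurations_coordinate_open[OF U Cons.prems, of i] by (rule eventually_mono) (rule Cons.IH)
  moreover have "(\<lambda>w. iter_deriv ws (G k) (z(i := w))) differentiable (at (z i))" if "k \<in> K" for k
    using G[OF that] Cons.prems by (auto simp: iteratedly_differentiable_on_def)
  ultimately show ?case
    using dz_dzbar_sum[of K "\<lambda>k w. iter_deriv ws (G k) (z(i := w))" "z i" "\<lambda>w. iter_deriv ws F (z(i := w))" c]
    unfolding l iter_deriv.simps by (cases bar) (simp_all only: if_True if_False)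
qed

lemma configurations_UNIV: "z \<in> configurations n U \<Longrightarrow> z \<in> configurations n UNIV"
  by (auto simp: configurations_def)

lemma base_contribution_power:
  "base_contribution \<B> f C U g \<Phi> e N \<Gamma> z = g ^ N * base_contribution \<B> f C U 1 \<Phi> e N \<Gamma> z"
  by (simp add: base_contribution_def power_divide)

context embedded_lie_algebra
begin

lemma contributing_regular:
  assumes "(N, \<Gamma>) \<in> contributing_diagrams \<B> f C \<Phi>" "open U" "bounded U \<or> \<not> bare_b_occurs \<Phi>"
  shows "z \<in> configurations (length \<Phi>) U \<Longrightarrow> set_integrable (vol N) (domain U N) (graph_integrand \<B> f C \<Phi> e N \<Gamma> z)"
    and "iteratedly_differentiable_on (configurations (length \<Phi>) U) (base_contribution \<B> f C U g \<Phi> e N \<Gamma>)"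
proof -
  obtain p where p: "disjoint_union_of_rooted_trees \<Phi> N \<Gamma> p" using contributing(1)[OF assms(1)] by blast
  note reg = contribution_regular[OF finite_Basis assms(2,3) _ contributing(3)[OF assms(1)] p]
  show "z \<in> configurations (length \<Phi>) U \<Longrightarrow> set_integrable (vol N) (domain U N) (graph_integrand \<B> f C \<Phi> e N \<Gamma> z)"
    by (rule reg(1))
  show "iteratedly_differentiable_on (configurations (length \<Phi>) U) (base_contribution \<B> f C U g \<Phi> e N \<Gamma>)"
    unfolding iteratedly_differentiable_on_def using reg(2) by blast
qed

lemma base_correlator_contributing:
  assumes U: "open U" "bounded U \<or> \<not> bare_b_occurs \<Phi>"
    and e: "e \<in> tensor_components \<B> \<Phi>" and z: "z \<in> configurations (length \<Phi>) U"
  shows "base_correlator \<B> f C U g \<Phi> e z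
    = (\<Sum>(N, \<Gamma>)\<in>contributing_diagrams \<B> f C \<Phi>. base_contribution \<B> f C U g \<Phi> e N \<Gamma> z)"
proof -
  let ?D = "contributing_diagrams \<B> f C \<Phi>"
  let ?D' = "\<lambda>N. {\<Gamma>. (N, \<Gamma>) \<in> ?D}"
  have fin': "finite (?D' N)" for N
    using finite_imageI[OF finite_contributing[of C \<Phi>], of snd] by (rule finite_subset[rotated]) (auto intro: rev_image_eqI)
  have "1 / fact N * (g / (2 * of_real pi)) ^ N * (LINT u:domain U N|vol N. free_correlator \<B> f C \<Phi> e N z u)
    = (\<Sum>\<Gamma>\<in>?D' N. base_contribution \<B> f C U g \<Phi> e N \<Gamma> z)" for N
  proof -
    have "(LINT u:domain U N|vol N. free_correlator \<B> f C \<Phi> e N z u)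
      = (LINT u:domain U N|vol N. (\<Sum>\<Gamma>\<in>?D' N. graph_integrand \<B> f C \<Phi> e N \<Gamma> z u))"
      by (simp only: free_correlator_contributing[OF e configurations_UNIV[OF z]])
    also have "\<dots> = (\<Sum>\<Gamma>\<in>?D' N. LINT u:domain U N|vol N. graph_integrand \<B> f C \<Phi> e N \<Gamma> z u)"
      unfolding set_lebesgue_integral_def scaleR_sum_right
      using contributing_regular(1)[OF _ U z] by (intro Bochner_Integration.integral_sum) (simp add: set_integrable_def)
    finally show ?thesis by (simp only: base_contribution_def sum_distrib_left)
  qed
  then have "base_correlator \<B> f C U g \<Phi> e z = (\<Sum>N. \<Sum>\<Gamma>\<in>?D' N. base_contribution \<B> f C U g \<Phi> e N \<Gamma> z)"
    by (simp only: base_correlator_def)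
  also have "\<dots> = (\<Sum>N\<in>fst ` ?D. \<Sum>\<Gamma>\<in>?D' N. base_contribution \<B> f C U g \<Phi> e N \<Gamma> z)"
  proof (rule suminf_finite)
    show "finite (fst ` ?D)" using finite_contributing by simp
    fix N assume "N \<notin> fst ` ?D"
    then have "?D' N = {}" by force
    then show "(\<Sum>\<Gamma>\<in>?D' N. base_contribution \<B> f C U g \<Phi> e N \<Gamma> z) = 0" by (simp only: sum.empty)
  qed
  also have "\<dots> = (\<Sum>(N, \<Gamma>)\<in>Sigma (fst ` ?D) ?D'. base_contribution \<B> f C U g \<Phi> e N \<Gamma> z)"
    using fin' finite_contributing by (intro sum.Sigma) auto
  also have "Sigma (fst ` ?D) ?D' = ?D" by force
  finally show ?thesis .
qed

lemma correlator_contributing: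
  assumes U: "open U" "bounded U \<or> \<not> bare_b_occurs \<Phi>"
    and e: "e \<in> tensor_components \<B> \<Phi>" and z: "z \<in> configurations (length \<Phi>) U"
  shows "correlator \<B> f C U g \<Phi> e z = (\<Sum>(N, \<Gamma>)\<in>contributing_diagrams \<B> f C \<Phi>. contribution \<B> f C U g \<Phi> e N \<Gamma> z)"
    and "\<exists>\<kappa>. \<forall>g. correlator \<B> f C U g \<Phi> e z = (if total_charge \<Phi> < 0 then 0 else \<kappa> * g ^ nat (total_charge \<Phi>))"
proof -
  let ?D = "contributing_diagrams \<B> f C \<Phi>" and ?w = "derivative_word \<Phi>"
  have reg: "iteratedly_differentiable_on (configurations (length \<Phi>) U) (case x of (N, \<Gamma>) \<Rightarrow> base_contribution \<B> f C U g \<Phi> e N \<Gamma>)"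
    if "x \<in> ?D" for g x
    using contributing_regular(2)[OF _ U] that by (cases x) simp
  have "iter_deriv ?w (base_correlator \<B> f C U g \<Phi> e) z
    = (\<Sum>x\<in>?D. 1 * iter_deriv ?w (case x of (N, \<Gamma>) \<Rightarrow> base_contribution \<B> f C U g \<Phi> e N \<Gamma>) z)"
    by (rule iter_deriv_sum[OF reg U(1) _ z]) (simp_all add: base_correlator_contributing[OF U e] case_prod_unfold)
  then show "correlator \<B> f C U g \<Phi> e z = (\<Sum>(N, \<Gamma>)\<in>?D. contribution \<B> f C U g \<Phi> e N \<Gamma> z)"
    by (simp add: correlator_def contribution_def case_prod_unfold)
  \<comment> \<open>The coefficient of the power of g is the value at g = 1.\<close>
  define \<kappa> where "\<kappa> = (\<Sum>x\<in>?D. iter_deriv ?w (case x of (N, \<Gamma>) \<Rightarrow> base_contribution \<B> f C U 1 \<Phi> e N \<Gamma>) z)"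
  have "correlator \<B> f C U g \<Phi> e z = (if total_charge \<Phi> < 0 then 0 else \<kappa> * g ^ nat (total_charge \<Phi>))" for g
  proof -
    have N: "fst x = nat (total_charge \<Phi>)" "0 \<le> total_charge \<Phi>" if "x \<in> ?D" for x
      using contributing(2)[of "fst x" "snd x" C \<Phi>] that by auto
    have "base_correlator \<B> f C U g \<Phi> e z = (\<Sum>x\<in>?D. g ^ fst x * (case x of (N, \<Gamma>) \<Rightarrow> base_contribution \<B> f C U 1 \<Phi> e N \<Gamma>) z)"
      if "z \<in> configurations (length \<Phi>) U" for z
      unfolding base_correlator_contributing[OF U e that] by (intro sum.cong refl) (simp add: case_prod_unfold base_contribution_power[of \<B> f C U g])
    from iter_deriv_sum[OF reg U(1) this z]
    have "correlator \<B> f C U g \<Phi> e z = (\<Sum>x\<in>?D. g ^ fst x * iter_deriv ?w (case x of (N, \<Gamma>) \<Rightarrow> base_contribution \<B> f C U 1 \<Phi> e N \<Gamma>) z)"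
      by (simp only: correlator_def)
    also have "\<dots> = g ^ nat (total_charge \<Phi>) * \<kappa>"
      unfolding \<kappa>_def sum_distrib_left by (intro sum.cong refl) (simp only: N)
    finally have *: "correlator \<B> f C U g \<Phi> e z = g ^ nat (total_charge \<Phi>) * \<kappa>" .
    \<comment> \<open>For negative total charge \<open>nat\<close> yields the exponent 0, so the sum
      itself has to be seen to be empty.\<close>
    moreover have "\<kappa> = 0" if "total_charge \<Phi> < 0"
    proof -
      have "?D = {}" using N(2) that by fastforce
      then show ?thesis by (simp only: \<kappa>_def sum.empty)
    qed
    ultimately show ?thesis by simp
  qed
  then show "\<exists>\<kappa>. \<forall>g. correlator \<B> f C U g \<Phi> e z = (if total_charge \<Phi> < 0 then 0 else \<kappa> * g ^ nat (total_charge \<Phi>))" by blast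
qed

end

section \<open>The correlator of \<open>\<gamma>\<close>, \<open>b\<close> and \<open>c\<close>\<close>

abbreviation (input) "gbc_fields \<equiv> [(Fgamma, 0, 0), (Fb, 0, 0), (Fc, 0, 0)] :: insertion list"

definition "gbc_pairing = {(ExtH 0, IntH 0 (Suc 0)), (ExtH (Suc 0), IntH 0 2), (ExtH 2, IntH 0 0)}"

lemma half_edges_3_1: "half_edges 3 (Suc 0) = {ExtH 0, ExtH (Suc 0), ExtH 2, IntH 0 0, IntH 0 (Suc 0), IntH 0 2}"
proof -
  have "{IntH j s | j s. j < Suc 0 \<and> s < 3} = IntH 0 ` {..<3}" by auto
  then show ?thesis by (simp add: half_edges_def numeral_3_eq_3 numeral_2_eq_2 lessThan_Suc) blast
qed

lemma gbc_pairing_contraction: "gbc_pairing \<in> contractions 3 (Suc 0)"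
proof -
  have "\<exists>!p. p \<in> gbc_pairing \<and> (h = fst p \<or> h = snd p)" if "h \<in> half_edges 3 (Suc 0)" for h
  proof -
    from that consider "h = ExtH 0 \<or> h = IntH 0 (Suc 0)" | "h = ExtH (Suc 0) \<or> h = IntH 0 2" | "h = ExtH 2 \<or> h = IntH 0 0"
      unfolding half_edges_3_1 by blast
    then show ?thesis
    proof cases
      case 1 then show ?thesis by (intro ex1I[of _ "(ExtH 0, IntH 0 (Suc 0))"]) (auto simp: gbc_pairing_def)
    next
      case 2 then show ?thesis by (intro ex1I[of _ "(ExtH (Suc 0), IntH 0 2)"]) (auto simp: gbc_pairing_def)
    next
      case 3 then show ?thesis by (intro ex1I[of _ "(ExtH 2, IntH 0 0)"]) (auto simp: gbc_pairing_def)
    qed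
  qed
  then show ?thesis unfolding contractions_def
    by (simp add: half_edges_3_1) (simp add: gbc_pairing_def)
qed

lemma contraction_ex1: "M \<in> contractions n N \<Longrightarrow> h \<in> half_edges n N \<Longrightarrow> \<exists>!p. p \<in> M \<and> (h = fst p \<or> h = snd p)"
  by (simp add: contractions_def)

text \<open>Contractions inside the vertex being excluded, its three fields meet the three
  insertions. Here \<gamma> requires \<open>a\<close> and \<open>b\<close> requires
  \<open>c\<close>, and the only monomial with both is \<open>ghost_a\<close>.\<close>

lemma gbc_pairing_unique:
  assumes M: "M \<in> contractions 3 (Suc 0)" and \<mu>: "\<mu> 0 \<in> interaction_monomials" and matched: "matched (field_of gbc_fields \<mu>) M"
  shows "\<mu> 0 = ghost_a" "M = gbc_pairing"
proof -
  let ?F = "field_of gbc_fields \<mu>"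
  have partner: "\<exists>i. (i = 0 \<or> i = Suc 0 \<or> i = 2) \<and> partner M (IntH 0 s) = ExtH i \<and> (ExtH i, IntH 0 s) \<in> M
      \<and> charge (?F (ExtH i)) = - charge (?F (IntH 0 s)) \<and> species (?F (ExtH i)) = species (?F (IntH 0 s))"
    if "s = 0 \<or> s = Suc 0 \<or> s = 2" for s
  proof -
    have s: "IntH 0 s \<in> half_edges 3 (Suc 0)" using that by (auto simp: half_edges_3_1)
    have mem: "partner M (IntH 0 s) \<in> half_edges 3 (Suc 0)" "vertex_of (partner M (IntH 0 s)) \<noteq> Inner 0"
      using partner_mem(2,4)[OF M s] by simp_all
    then obtain i where i: "i = 0 \<or> i = Suc 0 \<or> i = 2" "partner M (IntH 0 s) = ExtH i" unfolding half_edges_3_1 by auto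
    have "(IntH 0 s, ExtH i) \<notin> M" using M i(1) by (auto simp: contractions_def)
    then have "(ExtH i, IntH 0 s) \<in> M" using partner_mem(1)[OF M s] i(2) by simp
    then show ?thesis using i matched by (auto simp: matched_def)
  qed
  obtain i0 where i0: "i0 = 0 \<or> i0 = Suc 0 \<or> i0 = 2" "partner M (IntH 0 0) = ExtH i0" "(ExtH i0, IntH 0 0) \<in> M"
    "charge (?F (ExtH i0)) = - charge (?F (IntH 0 0))" "species (?F (ExtH i0)) = species (?F (IntH 0 0))"
    using partner[of 0] by auto
  obtain i1 where i1: "i1 = 0 \<or> i1 = Suc 0 \<or> i1 = 2" "partner M (IntH 0 (Suc 0)) = ExtH i1" "(ExtH i1, IntH 0 (Suc 0)) \<in> M"
    "charge (?F (ExtH i1)) = - charge (?F (IntH 0 (Suc 0)))" "species (?F (ExtH i1)) = species (?F (IntH 0 (Suc 0)))"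
    using partner[of "Suc 0"] by auto
  obtain i2 where i2: "i2 = 0 \<or> i2 = Suc 0 \<or> i2 = 2" "partner M (IntH 0 2) = ExtH i2" "(ExtH i2, IntH 0 2) \<in> M"
    "charge (?F (ExtH i2)) = - charge (?F (IntH 0 2))" "species (?F (ExtH i2)) = species (?F (IntH 0 2))"
    using partner[of 2] by auto
  have \<mu>0: "\<mu> 0 = ghost_a \<and> i0 = 2 \<and> i1 = 0 \<and> i2 = Suc 0"
    using i0(1,4,5) i1(1,4,5) i2(1,4,5) \<mu> by (auto elim!: monomial_cases)
  then show "\<mu> 0 = ghost_a" by blast
  have sub: "gbc_pairing \<subseteq> M" using \<mu>0 i0(3) i1(3) i2(3) by (simp add: gbc_pairing_def)
  show "M = gbc_pairing"
  proof (rule antisym[OF _ sub], rule subsetI)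
    fix x assume x: "x \<in> M"
    have "fst x \<in> half_edges 3 (Suc 0)" using contractions_subset[OF M] x by auto
    then obtain y where y: "y \<in> gbc_pairing" "fst x = fst y \<or> fst x = snd y"
      using contraction_ex1[OF gbc_pairing_contraction] by blast
    have "x = y" using contraction_ex1[OF M \<open>fst x \<in> half_edges 3 (Suc 0)\<close>] x y sub by blast
    then show "x \<in> gbc_pairing" using y(1) by simp
  qed
qed

lemma gbc_free_correlator:
  assumes B: "finite \<B>" "e1 \<in> \<B>" "e2 \<in> \<B>" "e3 \<in> \<B>"
  shows "free_correlator \<B> f C gbc_fields [e1, e2, e3] (Suc 0) z u
    = - f e3 e1 e2 * gamma_b_c_integrand C (z 0) (z 1) (z 2) (u 0)"
proof -
  let ?\<Phi> = gbc_fields and ?e = "[e1, e2, e3]" and ?\<mu>s = "{..<Suc 0} \<rightarrow>\<^sub>E interaction_monomials"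
  let ?g = "\<lambda>\<mu> M. wick_factor C ?\<Phi> (Suc 0) z u \<mu> M * colour_factor f \<B> ?e (Suc 0) M"
  define \<mu>0 where "\<mu>0 = (\<lambda>j\<in>{..<Suc 0}. ghost_a)"
  have len: "length ?\<Phi> = 3" by simp
  have "free_correlator \<B> f C ?\<Phi> ?e (Suc 0) z u = (\<Sum>M\<in>contractions 3 (Suc 0). \<Sum>\<mu>\<in>?\<mu>s. ?g \<mu> M)"
    unfolding free_correlator_def len
    by (subst sum.swap, intro sum.cong refl sum_decorations B(1)) (simp only: len)
  also have "\<dots> = (\<Sum>x\<in>contractions 3 (Suc 0) \<times> ?\<mu>s. ?g (snd x) (fst x))"
    by (simp only: sum.cartesian_product case_prod_unfold)
  also have "\<dots> = (\<Sum>x\<in>{(gbc_pairing, \<mu>0)}. ?g (snd x) (fst x))"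
  proof (rule sum.mono_neutral_right)
    show "finite (contractions 3 (Suc 0) \<times> ?\<mu>s)" by (auto intro!: finite_PiE)
    show "{(gbc_pairing, \<mu>0)} \<subseteq> contractions 3 (Suc 0) \<times> ?\<mu>s"
      using gbc_pairing_contraction by (simp add: \<mu>0_def interaction_monomials_def)
    show "\<forall>x\<in>contractions 3 (Suc 0) \<times> ?\<mu>s - {(gbc_pairing, \<mu>0)}. ?g (snd x) (fst x) = 0"
    proof
      fix x assume x: "x \<in> contractions 3 (Suc 0) \<times> ?\<mu>s - {(gbc_pairing, \<mu>0)}"
      obtain M \<mu> where x_eq: "x = (M, \<mu>)" by (cases x)
      have M: "M \<in> contractions 3 (Suc 0)" and \<mu>: "\<mu> \<in> ?\<mu>s" "\<mu> 0 \<in> interaction_monomials" using x x_eq by auto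
      have "\<not> matched (field_of ?\<Phi> \<mu>) M"
      proof
        assume "matched (field_of ?\<Phi> \<mu>) M"
        note u = gbc_pairing_unique[OF M \<mu>(2) this]
        have "\<mu> = \<mu>0" using \<mu>(1) u(1) by (auto simp: \<mu>0_def fun_eq_iff PiE_iff extensional_def)
        then show False using u(2) x x_eq by simp
      qed
      then have "wick_factor C ?\<Phi> (Suc 0) z u \<mu> M = 0" by (intro wick_factor_unmatched) (simp only: len M)
      then show "?g (snd x) (fst x) = 0" by (simp add: x_eq)
    qed
  qed
  also have "\<dots> = ?g \<mu>0 gbc_pairing" by simp
  also have "colour_factor f \<B> ?e (Suc 0) gbc_pairing = f e3 e1 e2"
  proof -
    define \<xi> where "\<xi> = (\<lambda>h\<in>inner_half_edges (Suc 0). if h = IntH 0 0 then e3 else if h = IntH 0 (Suc 0) then e1 else e2)"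
    have inner: "inner_half_edges (Suc 0) = {IntH 0 0, IntH 0 (Suc 0), IntH 0 2}"
    proof -
      have "inner_half_edges (Suc 0) = IntH 0 ` {..<3}" by (auto simp: inner_half_edges_def)
      then show ?thesis by (simp add: numeral_3_eq_3 numeral_2_eq_2 lessThan_Suc) blast
    qed
    have "colourings \<B> ?e (Suc 0) gbc_pairing = {\<xi>}"
    proof (intro equalityI subsetI)
      fix \<eta> assume "\<eta> \<in> colourings \<B> ?e (Suc 0) gbc_pairing"
      then show "\<eta> \<in> {\<xi>}"
        by (auto simp: colourings_def gbc_pairing_def \<xi>_def inner fun_eq_iff PiE_iff extensional_def)
    qed (use B in \<open>auto simp: colourings_def gbc_pairing_def \<xi>_def inner\<close>)
    then show ?thesis by (simp add: colour_factor_def \<xi>_def inner)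
  qed
  also have "wick_factor C ?\<Phi> (Suc 0) z u \<mu>0 gbc_pairing = - gamma_b_c_integrand C (z 0) (z 1) (z 2) (u 0)"
  proof -
    \<comment> \<open>The two ghost chords join the positions 1, 5 and 2, 3 of the word; they are
      nested and do not cross.\<close>
    have k: "koszul_sign (length ?\<Phi>) (field_of ?\<Phi> \<mu>0) gbc_pairing = 1"
      by (subst koszul_sign_prod) (auto simp: gbc_pairing_def crossing_def word_span_def intro!: prod.neutral)
    have pr: "(\<Prod>x\<in>gbc_pairing. pair_propagator C (field_of ?\<Phi> \<mu>0) z u x)
      = 1 / (u 0 - z 0) * (- (of_real (2 * ln (cmod (u 0 - z 1))) + C)) * (- (1 / (cnj (z 2) - cnj (u 0))))"
      by (simp add: gbc_pairing_def pair_propagator_def propagator_def \<mu>0_def numeral_2_eq_2)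
    have m: "- (1 / (cnj (z 2) - cnj (u 0))) = 1 / (cnj (u 0) - cnj (z 2))"
      using minus_divide_right[of 1 "cnj (z 2) - cnj (u 0)"] by simp
    have c: "(\<Prod>j<Suc 0. fst (\<mu>0 j)) = 1" by (simp add: \<mu>0_def)
    have eq: "1 * 1 * (1 / A * (- L) * (1 / B)) = - (L / (A * B))" for A B L :: complex by simp
    show ?thesis unfolding wick_factor_pairs gamma_b_c_integrand_def k pr m c by (rule eq)
  qed
  finally show ?thesis by simp
qed

section \<open>The divergent integral\<close>

lemma measurable_gbc [measurable]: "gamma_b_c_integrand C p q r \<in> borel_measurable borel"
  unfolding gamma_b_c_integrand_def using borel_measurable_cnj by measurable

text \<open>On the disc the logarithm is dominated by 1/|u - q|. The product of three inverse
  distances is then the integral of a vertex whose parent is at q.\<close>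

lemma gbc_set_integrable:
  assumes ne: "p \<noteq> q" "p \<noteq> r" "q \<noteq> r"
  shows "set_integrable lborel (ball 0 R) (gamma_b_c_integrand C p q r)"
proof (cases "R > 0")
  case False
  then show ?thesis by (simp add: ball_empty set_integrable_def)
next
  case True
  let ?J = "gamma_b_c_integrand C p q r"
  let ?k = "\<lambda>u. norm (u - p) powr -1 * norm (u - r) powr -1 / norm (u - q)"
  \<comment> \<open>With a = b = 1 any exponent strictly between 0 and 1 is admissible; 1/2 is a
    choice.\<close>
  have "\<exists>K\<ge>0. \<forall>w. w \<noteq> p \<longrightarrow> w \<noteq> r \<longrightarrow>
     (\<integral>\<^sup>+u. ennreal (norm (u - p) powr -1 * norm (u - r) powr -1 / norm (u - w)) \<partial>lborel)
       \<le> ennreal (K * (norm (w - p) powr -(1/2) + norm (w - r) powr -(1/2)))"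
    by (rule nn_integral_cherry) (use ne in auto)
  then obtain K where K: "\<And>w. w \<noteq> p \<Longrightarrow> w \<noteq> r \<Longrightarrow>
     (\<integral>\<^sup>+u. ennreal (norm (u - p) powr -1 * norm (u - r) powr -1 / norm (u - w)) \<partial>lborel)
       \<le> ennreal (K * (norm (w - p) powr -(1/2) + norm (w - r) powr -(1/2)))" by blast
  have "(\<integral>\<^sup>+u. ennreal (?k u) \<partial>lborel) \<le> ennreal (K * (norm (q - p) powr -(1/2) + norm (q - r) powr -(1/2)))"
    by (rule K) (use ne in auto)
  then have fin: "(\<integral>\<^sup>+u. ennreal (?k u) \<partial>lborel) < \<infinity>" by (rule le_less_trans) simp
  have intk: "integrable lborel ?k"
    by (rule integrableI_nonneg) (use fin in auto)
  define D where "D = R + cmod q"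
  define A where "A = 2 * (1 + D * \<bar>ln D\<bar>) + cmod C * D"
  have "AE u in lborel. norm (indicator (ball 0 R) u *\<^sub>R ?J u) \<le> norm (A * ?k u)"
    using AE_lborel_singleton[of q]
  proof eventually_elim
    case (elim u)
    show ?case
    proof (cases "u \<in> ball 0 R")
      case True
      let ?t = "cmod (u - q)"
      have t: "0 < ?t" "?t \<le> D" using elim True norm_triangle_ineq4[of u q] by (auto simp: D_def)
      have "cmod (of_real (2 * ln ?t) + C) * ?t \<le> (2 * \<bar>ln ?t\<bar> + cmod C) * ?t"
        using norm_triangle_ineq[of "complex_of_real (2 * ln ?t)" C] t(1) by (intro mult_right_mono) (auto simp: norm_mult)
      also have "\<dots> = 2 * \<bar>?t * ln ?t\<bar> + cmod C * ?t" using t(1) by (simp add: abs_mult algebra_simps)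
      also have "\<dots> \<le> A" unfolding A_def using abs_mult_ln_le[OF t] t(2) by (intro add_mono mult_left_mono) auto
      finally have A: "cmod (of_real (2 * ln ?t) + C) \<le> A / ?t" using t(1) by (simp add: field_simps)
      have "norm (?J u) = cmod (of_real (2 * ln ?t) + C) * (1 / (cmod (u - p) * cmod (u - r)))"
        using complex_mod_cnj[of "u - r"] by (simp add: gamma_b_c_integrand_def norm_divide norm_mult)
      also have "\<dots> \<le> A / ?t * (1 / (cmod (u - p) * cmod (u - r)))" using A by (rule mult_right_mono) simp
      also have "\<dots> = A * ?k u" by (simp add: powr_minus_divide)
      also have "\<dots> \<le> norm (A * ?k u)" unfolding real_norm_def by (rule abs_ge_self)
      finally show ?thesis using True by simp
    qed simp
  qed
  then show ?thesis unfolding set_integrable_def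
    by (rule Bochner_Integration.integrable_bound[OF integrable_mult_right[OF intk, of A], rotated])
      (intro borel_measurable_scaleR borel_measurable_indicator, auto simp: measurable_gbc)
qed

text \<open>The integrand is (2 ln|u - q| + C) Q(u) / |u|^2 with Q tending to 1. The growing
  logarithm eventually outweighs C and the deviation of Q from 1.\<close>

lemma gbc_asymptotic:
  "\<forall>\<^sub>F u in at_infinity. 1 / (cmod u)\<^sup>2 \<le> Re (gamma_b_c_integrand C p q r u)"
proof -
  define Q where "Q u = u / (u - p) * (cnj u / (cnj u - cnj r))" for u
  have shift: "filterlim (\<lambda>u::complex. u - a) at_infinity at_infinity" for a
    using tendsto_add_filterlim_at_infinity[of "\<lambda>_. - a" "- a" at_infinity "\<lambda>u. u"] filterlim_ident[of "at_infinity :: complex filter"] by simp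
  have quot: "((\<lambda>u. u / (u - a)) \<longlongrightarrow> 1) at_infinity" for a :: complex
  proof -
    have "((\<lambda>u. a / (u - a)) \<longlongrightarrow> 0) at_infinity" by (rule tendsto_divide_0[OF tendsto_const shift])
    then have "((\<lambda>u. 1 + a / (u - a)) \<longlongrightarrow> 1 + 0) at_infinity" by (intro tendsto_add tendsto_const)
    moreover have "\<forall>\<^sub>F u in at_infinity. 1 + a / (u - a) = u / (u - a)"
      using eventually_not_equal_at_infinity[of a] by (rule eventually_mono) (simp add: field_simps)
    ultimately show ?thesis using tendsto_cong[of "\<lambda>u. 1 + a / (u - a)" "\<lambda>u. u / (u - a)" at_infinity 1] by simp
  qed
  have "((\<lambda>u. cnj (u / (u - r))) \<longlongrightarrow> cnj 1) at_infinity" by (intro tendsto_cnj quot)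
  from tendsto_mult[OF quot[of p] this] have Q: "(Q \<longlongrightarrow> 1) at_infinity" by (simp add: Q_def[abs_def])
  have "filterlim (\<lambda>u. ln (cmod (u - q))) at_top at_infinity"
    by (rule filterlim_compose[OF ln_at_top filterlim_at_infinity_imp_norm_at_top[OF shift]])
  \<comment> \<open>The term 2 |C| pays for Re (C Q), since |Q| \<le> 2; and Re Q \<ge> 1/2 lets 2
    ln|u - q| contribute at least ln|u - q|.\<close>
  then have "\<forall>\<^sub>F u in at_infinity. ln (cmod (u - q)) \<ge> 1 + 2 * cmod C" by (simp add: filterlim_at_top)
  moreover have "\<forall>\<^sub>F u in at_infinity. dist (Q u) 1 < 1 / 2" using tendstoD[OF Q, of "1/2"] by simp
  moreover have "\<forall>\<^sub>F u in at_infinity. u \<noteq> (0::complex)" by (rule eventually_not_equal_at_infinity)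
  ultimately show ?thesis
  proof eventually_elim
    case (elim u)
    let ?L = "ln (cmod (u - q))"
    have Qd: "cmod (Q u - 1) < 1 / 2" using elim(2) by (simp add: dist_norm)
    have ReQ: "Re (Q u) \<ge> 1 / 2" using Qd abs_Re_le_cmod[of "Q u - 1"] by simp
    have "cmod (Q u) \<le> 2" using Qd norm_triangle_ineq[of "Q u - 1" 1] by simp
    then have "cmod (C * Q u) \<le> cmod C * 2" by (simp add: norm_mult mult_left_mono)
    then have ReC: "Re (C * Q u) \<ge> - 2 * cmod C" using abs_Re_le_cmod[of "C * Q u"] by linarith
    have L: "?L \<ge> 0" using elim(1) norm_ge_zero[of C] by linarith
    have "u * cnj u \<noteq> 0" using elim(3) by simp
    then have "gamma_b_c_integrand C p q r u = (of_real (2 * ?L) + C) * Q u / (u * cnj u)"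
      by (simp add: gamma_b_c_integrand_def Q_def)
    also have "u * cnj u = of_real ((cmod u)\<^sup>2)" by (rule complex_norm_square[symmetric])
    finally have "Re (gamma_b_c_integrand C p q r u) = Re ((of_real (2 * ?L) + C) * Q u) / (cmod u)\<^sup>2"
      by (simp only: Re_divide_of_real)
    moreover have "Re ((of_real (2 * ?L) + C) * Q u) \<ge> 1"
    proof -
      have "?L * 1 \<le> ?L * (2 * Re (Q u))" using L ReQ by (intro mult_left_mono) auto
      moreover have "Re ((of_real (2 * ?L) + C) * Q u) = ?L * (2 * Re (Q u)) + Re (C * Q u)"
        by (simp add: distrib_right)
      ultimately show ?thesis using ReC elim(1) by linarith
    qed
    ultimately show ?case by (simp add: divide_right_mono)
  qed
qed

text \<open>The real part of the integral gains at least 1 with every doubling of the radius: the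
  annulus has area 3 \<pi> R^2 and the integrand is at least 1/(2R)^2 on it, which gives 3 \<pi> / 4
  > 1. Between the doublings it does not decrease.\<close>

lemma gbc_diverges:
  assumes ne: "p \<noteq> q" "p \<noteq> r" "q \<noteq> r"
  shows "filterlim (\<lambda>R. norm (LINT u:ball 0 R|lborel. gamma_b_c_integrand C p q r u)) at_top at_top"
proof -
  let ?J = "gamma_b_c_integrand C p q r"
  define I where "I R = (LINT u:ball 0 R|lborel. Re (?J u))" for R
  obtain b where b: "\<And>u. b \<le> cmod u \<Longrightarrow> 1 / (cmod u)\<^sup>2 \<le> Re (?J u)"
    using gbc_asymptotic unfolding eventually_at_infinity by blast
  define R0 where "R0 = max b 1"
  have R0: "0 < R0" "b \<le> R0" by (auto simp: R0_def)
  have int: "set_integrable lborel A (\<lambda>u. Re (?J u))" if "A \<subseteq> ball 0 R" "A \<in> sets borel" for A R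
  proof -
    have "set_integrable lborel A ?J" by (rule set_integrable_subset[OF gbc_set_integrable[OF ne]]) (use that in auto)
    from integrable_Re[OF this[unfolded set_integrable_def]] show ?thesis by (simp add: set_integrable_def)
  qed
  have step: "I R' = I R + (LINT u:ball 0 R' - ball 0 R|lborel. Re (?J u))" if "R \<le> R'" for R R'
  proof -
    have "ball 0 R' = ball 0 R \<union> (ball 0 R' - ball 0 R :: complex set)" using that by auto
    then show ?thesis unfolding I_def
      by (subst set_integral_Un[symmetric]) (auto intro!: int[of _ R'] simp: subset_ball[OF that])
  qed
  have mono: "I R \<le> I R'" if "R0 \<le> R" "R \<le> R'" for R R'
  proof -
    have "0 \<le> (LINT u:ball 0 R' - ball 0 R|lborel. Re (?J u))"
      unfolding set_lebesgue_integral_def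
    proof (rule Bochner_Integration.integral_nonneg)
      fix u :: complex
      show "0 \<le> indicator (ball 0 R' - ball 0 R) u *\<^sub>R Re (?J u)"
      proof (cases "u \<in> ball 0 R' - ball 0 R")
        case True
        then have "b \<le> cmod u" using R0 that by auto
        from b[OF this] have "0 \<le> Re (?J u)" by (rule order_trans[rotated]) simp
        then show ?thesis by simp
      qed simp
    qed
    then show ?thesis using step[OF that(2)] by simp
  qed
  have double: "I R + 1 \<le> I (2 * R)" if R: "R0 \<le> R" for R
  proof -
    let ?A = "ball 0 (2 * R) - ball 0 R :: complex set"
    have R_pos: "0 < R" using R R0 by simp
    have sub: "ball 0 R \<subseteq> (ball 0 (2 * R) :: complex set)" using R_pos by (intro subset_ball) simp
    have ball: "measure lborel (ball (0::complex) t) = pi * t\<^sup>2" if "0 < t" for t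
      using that by (simp add: measure_def emeasure_ball_complex)
    have "measure lborel ?A = measure lborel (ball (0::complex) (2 * R)) - measure lborel (ball (0::complex) R)"
      using sub by (intro measure_Diff) (auto simp: emeasure_ball_complex R_pos less_imp_le)
    also have "\<dots> = 3 * pi * R\<^sup>2" using R_pos by (simp add: ball power_mult_distrib)
    finally have m: "measure lborel ?A = 3 * pi * R\<^sup>2" .
    have fin: "emeasure lborel ?A < \<infinity>"
      by (rule le_less_trans[OF emeasure_mono[of ?A "ball 0 (2 * R)"]]) (auto simp: emeasure_ball_complex R_pos less_imp_le)
    have "1 \<le> 3 * pi / 4" using pi_gt3 by simp
    also have "\<dots> = (LINT u:?A|lborel. 1 / (2 * R)\<^sup>2)"
    proof -
      have "(LINT u:?A|lborel. 1 / (2 * R)\<^sup>2) = measure lborel ?A * (1 / (2 * R)\<^sup>2)"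
        unfolding set_lebesgue_integral_def by simp
      also have "\<dots> = 3 * pi / 4" unfolding m using R_pos by (simp add: power_mult_distrib)
      finally show ?thesis by simp
    qed
    also have "\<dots> \<le> (LINT u:?A|lborel. Re (?J u))"
    proof (rule set_integral_mono)
      show "set_integrable lborel ?A (\<lambda>_. 1 / (2 * R)\<^sup>2)" using fin by (simp add: set_integrable_def integrable_indicator_iff)
      show "set_integrable lborel ?A (\<lambda>u. Re (?J u))" by (rule int) auto
      fix u assume u: "u \<in> ?A"
      have "0 < cmod u" using u R_pos by auto
      then have "1 / (2 * R)\<^sup>2 \<le> 1 / (cmod u)\<^sup>2" using u R_pos by (intro divide_left_mono power_mono mult_pos_pos zero_less_power) auto
      also have "\<dots> \<le> Re (?J u)" using u R R0 by (intro b) auto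
      finally show "1 / (2 * R)\<^sup>2 \<le> Re (?J u)" .
    qed
    finally show ?thesis using step[of R "2 * R"] R_pos by simp
  qed
  have dyadic: "I R0 + real k \<le> I (2 ^ k * R0)" for k
  proof (induction k)
    case (Suc k)
    have "R0 * 1 \<le> 2 ^ k * R0" using R0 by (simp add: mult.commute)
    then have "I (2 ^ k * R0) + 1 \<le> I (2 * (2 ^ k * R0))" by (intro double) simp
    then show ?case using Suc by (simp add: mult.assoc)
  qed simp
  have "filterlim I at_top at_top"
    unfolding filterlim_at_top
  proof
    fix B :: real
    obtain k where k: "B - I R0 \<le> real k" using real_arch_simple by blast
    show "\<forall>\<^sub>F R in at_top. B \<le> I R"
      using eventually_ge_at_top[of "2 ^ k * R0"]
    proof (rule eventually_mono)
      fix R assume R: "2 ^ k * R0 \<le> R"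
      have "R0 \<le> 2 ^ k * R0" using R0 by (simp add: mult.commute)
      then have "I (2 ^ k * R0) \<le> I R" using R by (rule mono)
      then show "B \<le> I R" using dyadic[of k] k by linarith
    qed
  qed
  note lim = this
  have le: "I R \<le> norm (LINT u:ball 0 R|lborel. ?J u)" for R
  proof -
    have "I R = Re (LINT u:ball 0 R|lborel. ?J u)"
      using integral_Re[OF gbc_set_integrable[OF ne, of R C, unfolded set_integrable_def]]
      by (simp add: I_def set_lebesgue_integral_def)
    then show ?thesis using complex_Re_le_cmod by simp
  qed
  show ?thesis by (rule filterlim_at_top_mono[OF lim]) (simp add: le)
qed

lemma gbc_not_integrable:
  assumes ne: "p \<noteq> q" "p \<noteq> r" "q \<noteq> r"
  shows "\<not> integrable lborel (gamma_b_c_integrand C p q r)"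
proof
  let ?J = "gamma_b_c_integrand C p q r"
  assume int: "integrable lborel ?J"
  obtain R where R: "(LINT u|lborel. norm (?J u)) + 1 \<le> norm (LINT u:ball 0 R|lborel. ?J u)"
    using gbc_diverges[OF ne, of C] unfolding filterlim_at_top eventually_at_top_linorder by blast
  have "norm (LINT u:ball 0 R|lborel. ?J u) \<le> (LINT u|lborel. norm (?J u))"
    unfolding set_lebesgue_integral_def
  proof (rule Bochner_Integration.integral_norm_bound_integral)
    show "integrable lborel (\<lambda>u. indicator (ball 0 R) u *\<^sub>R ?J u)" using gbc_set_integrable[OF ne] by (simp add: set_integrable_def)
    show "integrable lborel (\<lambda>u. norm (?J u))" using int by simp
  qed (simp add: indicator_def)
  then show False using R by simp
qed

section \<open>Reduction to an integral over one variable\<close>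

lemma vol_1: "vol (Suc 0) = PiM {0} (\<lambda>_. lborel)"
  by (simp add: vol_def lessThan_Suc)

lemma indicator_domain_1:
  "u \<in> space (vol (Suc 0)) \<Longrightarrow> indicator (domain U (Suc 0)) u = indicator U (u 0)"
  by (auto simp: vol_1 space_PiM domain_def lessThan_Suc indicator_def PiE_iff)

lemma integral_domain_1:
  fixes h :: "complex \<Rightarrow> complex"
  assumes [measurable]: "h \<in> borel_measurable borel" "U \<in> sets borel"
  shows "(LINT u:domain U (Suc 0)|vol (Suc 0). h (u 0)) = (LINT u:U|lborel. h u)"
proof -
  have "(LINT u:domain U (Suc 0)|vol (Suc 0). h (u 0)) = (LINT u|vol (Suc 0). indicator U (u 0) *\<^sub>R h (u 0))"
    unfolding set_lebesgue_integral_def by (rule Bochner_Integration.integral_cong) (simp_all add: indicator_domain_1)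
  also have "\<dots> = (LINT u|lborel. indicator U u *\<^sub>R h u)"
    unfolding vol_1 by (rule plane.product_integral_singleton) measurable
  finally show ?thesis by (simp add: set_lebesgue_integral_def)
qed

lemma integrable_domain_1:
  fixes h :: "complex \<Rightarrow> complex"
  assumes [measurable]: "h \<in> borel_measurable borel"
    and int: "set_integrable (vol (Suc 0)) (domain UNIV (Suc 0)) (\<lambda>u. h (u 0))"
  shows "integrable lborel h"
proof -
  have "integrable (vol (Suc 0)) (\<lambda>u. h (u 0))"
    using int unfolding set_integrable_def
    by (subst (asm) Bochner_Integration.integrable_cong[where g = "\<lambda>u. h (u 0)", OF refl]) (simp_all add: indicator_domain_1)
  then have "integrable (distr (PiM {0} (\<lambda>_. lborel)) lborel (\<lambda>u. u (0::nat))) h"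
    unfolding vol_1 by (subst integrable_distr_eq) measurable
  then show ?thesis by (simp only: plane.distr_singleton)
qed

text \<open>The identity for the correlator holds for every Borel region, because both sides are the
  same Bochner integral up to a constant, also where it does not converge.\<close>

lemma (in embedded_lie_algebra) gbc_example:
  assumes e: "e1 \<in> \<B>" "e2 \<in> \<B>" "e3 \<in> \<B>" and z: "z \<in> configurations 3 UNIV"
  shows "let \<Psi> = gbc_fields; J = gamma_b_c_integrand C (z 0) (z 1) (z 2)
       in (\<forall>u. free_correlator \<B> f C \<Psi> [e1, e2, e3] 1 z u = - f e3 e1 e2 * J (u 0))
        \<and> (\<forall>U g. U \<in> sets borel \<longrightarrow>
             correlator \<B> f C U g \<Psi> [e1, e2, e3] z
               = - f e3 e1 e2 * g * (LINT u:U|lborel. J u / (2 * of_real pi)))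
        \<and> (f e3 e1 e2 \<noteq> 0 \<longrightarrow>
             \<not> set_integrable (vol 1) (domain UNIV 1) (free_correlator \<B> f C \<Psi> [e1, e2, e3] 1 z))
        \<and> (\<forall>R>0. set_integrable lborel (ball 0 R) J)
        \<and> \<not> integrable lborel J
        \<and> filterlim (\<lambda>R. norm (LINT u:ball 0 R|lborel. J u)) at_top at_top"
proof -
  let ?e = "[e1, e2, e3]"
  define J where "J = gamma_b_c_integrand C (z 0) (z 1) (z 2)"
  have ne: "z 0 \<noteq> z 1" "z 0 \<noteq> z 2" "z 1 \<noteq> z 2"
    using z inj_on_eq_iff[of z "{..<3}"] by (auto simp: configurations_def)
  have z': "z \<in> configurations (length gbc_fields) UNIV" using z by (simp add: numeral_3_eq_3)
  have e': "?e \<in> tensor_components \<B> gbc_fields" using e by (simp add: tensor_components_def)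
  have [measurable]: "J \<in> borel_measurable borel" unfolding J_def by (rule measurable_gbc)
  have free: "free_correlator \<B> f C gbc_fields ?e (Suc 0) z u = - f e3 e1 e2 * J (u 0)" for u
    unfolding J_def by (rule gbc_free_correlator[OF finite_Basis e])
  \<comment> \<open>The total charge of the three insertions is 1, so the other orders
    vanish.\<close>
  have zero: "free_correlator \<B> f C gbc_fields ?e N z u = 0" if "N \<noteq> Suc 0" for N u
  proof -
    have "{\<Gamma>. (N, \<Gamma>) \<in> contributing_diagrams \<B> f C gbc_fields} = {}"
      using contributing(2)[of N _ C gbc_fields] that by (auto simp: total_charge_def)
    then show ?thesis unfolding free_correlator_contributing[OF e' z'] by (simp only: sum.empty)
  qed
  have corr: "correlator \<B> f C U g gbc_fields ?e z = - f e3 e1 e2 * g * (LINT u:U|lborel. J u / (2 * of_real pi))"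
    if U: "U \<in> sets borel" for U g
  proof -
    let ?t = "\<lambda>N. 1 / fact N * (g / (2 * of_real pi)) ^ N * (LINT u:domain U N|vol N. free_correlator \<B> f C gbc_fields ?e N z u)"
    have "derivative_word gbc_fields = []" by (simp add: derivative_word_def nth_Cons')
    then have "correlator \<B> f C U g gbc_fields ?e z = (\<Sum>N. ?t N)"
      by (simp only: correlator_def iter_deriv.simps base_correlator_def)
    also have "\<dots> = (\<Sum>N\<in>{Suc 0}. ?t N)"
      by (rule suminf_finite) (auto simp: zero set_lebesgue_integral_def)
    also have "\<dots> = g / (2 * of_real pi) * (LINT u:domain U (Suc 0)|vol (Suc 0). - f e3 e1 e2 * J (u 0))"
      by (simp add: free)
    also have "(LINT u:domain U (Suc 0)|vol (Suc 0). - f e3 e1 e2 * J (u 0)) = (LINT u:U|lborel. - f e3 e1 e2 * J u)"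
      by (rule integral_domain_1[where h = "\<lambda>u. - f e3 e1 e2 * J u"]) (use U in measurable)
    also have "(LINT u:U|lborel. - f e3 e1 e2 * J u) = - f e3 e1 e2 * (LINT u:U|lborel. J u)"
      by (rule set_integral_mult_right)
    also have "(LINT u:U|lborel. J u) = 2 * of_real pi * (LINT u:U|lborel. J u / (2 * of_real pi))"
      by simp
    finally show ?thesis by simp
  qed
  have nonint: "\<not> set_integrable (vol (Suc 0)) (domain UNIV (Suc 0)) (free_correlator \<B> f C gbc_fields ?e (Suc 0) z)"
    if f: "f e3 e1 e2 \<noteq> 0"
  proof
    assume "set_integrable (vol (Suc 0)) (domain UNIV (Suc 0)) (free_correlator \<B> f C gbc_fields ?e (Suc 0) z)"
    then have "set_integrable (vol (Suc 0)) (domain UNIV (Suc 0)) (\<lambda>u. - f e3 e1 e2 * J (u 0))"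
      by (simp only: free[abs_def])
    then have "integrable lborel (\<lambda>u. - f e3 e1 e2 * J u)"
      by (rule integrable_domain_1[where h = "\<lambda>u. - f e3 e1 e2 * J u", rotated]) measurable
    from integrable_mult_right[OF this, of "- 1 / f e3 e1 e2"] have "integrable lborel J" using f by simp
    then show False using gbc_not_integrable[OF ne] by (simp add: J_def)
  qed
  show ?thesis
    using free corr nonint gbc_set_integrable[OF ne, of _ C] gbc_not_integrable[OF ne, of C] gbc_diverges[OF ne, of C]
    unfolding Let_def J_def One_nat_def by blast
qed

theorem proposition2p2:
  fixes smul :: "'k::field \<Rightarrow> 'g::ab_group_add \<Rightarrow> 'g" and \<B> :: "'g set"
    and bracket :: "'g \<Rightarrow> 'g \<Rightarrow> 'g" and \<iota> :: "'k \<Rightarrow> complex"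
    and f :: "'g \<Rightarrow> 'g \<Rightarrow> 'g \<Rightarrow> complex" and C :: complex and \<Phi> :: "insertion list"
  assumes lie: "fin_dim_lie_algebra smul \<B> bracket"
    and unimodular: "strongly_unimodular smul \<B> bracket"
    and embedding: "field_embedding \<iota>"
    and f_def: "f = structure_constant \<iota> smul \<B> bracket"
    and insertions: "valid_insertions \<Phi>"
  shows
    "\<comment> \<open>(1)\<close>
     finite (contributing_diagrams \<B> f C \<Phi>) \<and>
     (\<forall>(N, \<Gamma>)\<in>contributing_diagrams \<B> f C \<Phi>. \<exists>p. disjoint_union_of_rooted_trees \<Phi> N \<Gamma> p) \<and>
     (\<forall>e\<in>tensor_components \<B> \<Phi>. \<forall>z\<in>configurations (length \<Phi>) UNIV. \<forall>N u.
       free_correlator \<B> f C \<Phi> e N z u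
         = (\<Sum>\<Gamma> | (N, \<Gamma>) \<in> contributing_diagrams \<B> f C \<Phi>. graph_integrand \<B> f C \<Phi> e N \<Gamma> z u)) \<and>
     (\<forall>U g. admissible_region \<Phi> U \<longrightarrow>
       (\<forall>e\<in>tensor_components \<B> \<Phi>. \<forall>z\<in>configurations (length \<Phi>) U.
         correlator \<B> f C U g \<Phi> e z
           = (\<Sum>(N, \<Gamma>)\<in>contributing_diagrams \<B> f C \<Phi>. contribution \<B> f C U g \<Phi> e N \<Gamma> z))) \<and>
     \<comment> \<open>(2)\<close>
     (\<forall>(N, \<Gamma>)\<in>contributing_diagrams \<B> f C \<Phi>. int N = total_charge \<Phi>) \<and>
     (\<forall>U. admissible_region \<Phi> U \<longrightarrow>
       (\<forall>e\<in>tensor_components \<B> \<Phi>. \<forall>z\<in>configurations (length \<Phi>) U.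
         \<exists>\<kappa>. \<forall>g. correlator \<B> f C U g \<Phi> e z
           = (if total_charge \<Phi> < 0 then 0 else \<kappa> * g ^ nat (total_charge \<Phi>)))) \<and>
     \<comment> \<open>(3)\<close>
     (\<forall>(N, \<Gamma>)\<in>contributing_diagrams \<B> f C \<Phi>. \<forall>p. disjoint_union_of_rooted_trees \<Phi> N \<Gamma> p
       \<longrightarrow> p = card {i. i < length \<Phi> \<and> charge (fst (\<Phi> ! i)) = -1}) \<and>
     \<comment> \<open>(4)\<close>
     (\<not> bare_b_occurs \<Phi> \<longrightarrow>
       (\<forall>(N, \<Gamma>)\<in>contributing_diagrams \<B> f C \<Phi>. \<forall>e\<in>tensor_components \<B> \<Phi>.
         (\<forall>z\<in>configurations (length \<Phi>) UNIV.
            set_integrable (vol N) (domain UNIV N) (graph_integrand \<B> f C \<Phi> e N \<Gamma> z)) \<and>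
         (\<forall>g. iteratedly_differentiable_on (configurations (length \<Phi>) UNIV)
            (base_contribution \<B> f C UNIV g \<Phi> e N \<Gamma>)))) \<and>
     \<comment> \<open>(5), regularization\<close>
     (\<forall>R>0. \<forall>(N, \<Gamma>)\<in>contributing_diagrams \<B> f C \<Phi>. \<forall>e\<in>tensor_components \<B> \<Phi>.
       (\<forall>z\<in>configurations (length \<Phi>) (ball 0 R).
          set_integrable (vol N) (domain (ball 0 R) N) (graph_integrand \<B> f C \<Phi> e N \<Gamma> z)) \<and>
       (\<forall>g. iteratedly_differentiable_on (configurations (length \<Phi>) (ball 0 R))
          (base_contribution \<B> f C (ball 0 R) g \<Phi> e N \<Gamma>))) \<and>
     \<comment> \<open>(5), the example\<close>
     (\<forall>e1\<in>\<B>. \<forall>e2\<in>\<B>. \<forall>e3\<in>\<B>. \<forall>z\<in>configurations 3 UNIV.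
       let \<Psi> = [(Fgamma, 0, 0), (Fb, 0, 0), (Fc, 0, 0)];
           J = gamma_b_c_integrand C (z 0) (z 1) (z 2)
       in (\<forall>u. free_correlator \<B> f C \<Psi> [e1, e2, e3] 1 z u = - f e3 e1 e2 * J (u 0))
        \<and> (\<forall>U g. U \<in> sets borel \<longrightarrow>
             correlator \<B> f C U g \<Psi> [e1, e2, e3] z
               = - f e3 e1 e2 * g * (LINT u:U|lborel. J u / (2 * of_real pi)))
        \<and> (f e3 e1 e2 \<noteq> 0 \<longrightarrow>
             \<not> set_integrable (vol 1) (domain UNIV 1) (free_correlator \<B> f C \<Psi> [e1, e2, e3] 1 z))
        \<and> (\<forall>R>0. set_integrable lborel (ball 0 R) J)
        \<and> \<not> integrable lborel J
        \<and> filterlim (\<lambda>R. norm (LINT u:ball 0 R|lborel. J u)) at_top at_top)"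
proof -
  interpret embedded_lie_algebra smul \<B> bracket \<iota>
    using lie embedding unimodular by (simp add: embedded_lie_algebra_def embedded_lie_algebra_axioms_def)
  have region: "open U" "bounded U \<or> \<not> bare_b_occurs \<Phi>" if "admissible_region \<Phi> U" for U
    using that by (auto simp: admissible_region_def)
  let ?D = "contributing_diagrams \<B> f C \<Phi>"
  note contributing' = contributing[where C = C and \<Phi> = \<Phi>, folded f_def]
    and free = free_correlator_contributing[where C = C and \<Phi> = \<Phi>, folded f_def]
    and correlators = correlator_contributing[where C = C and \<Phi> = \<Phi>, folded f_def]
    and regular = contributing_regular[where C = C and \<Phi> = \<Phi>, folded f_def]
  have 1: "finite ?D" unfolding f_def by (rule finite_contributing)
  have 2: "\<forall>(N, \<Gamma>)\<in>?D. \<exists>p. disjoint_union_of_rooted_trees \<Phi> N \<Gamma> p"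
    using contributing'(1) by auto
  have 3: "\<forall>(N, \<Gamma>)\<in>?D. int N = total_charge \<Phi>"
    using contributing'(2) by auto
  have 4: "\<forall>(N, \<Gamma>)\<in>?D. \<forall>p. disjoint_union_of_rooted_trees \<Phi> N \<Gamma> p
       \<longrightarrow> p = card {i. i < length \<Phi> \<and> charge (fst (\<Phi> ! i)) = -1}"
    using rooted_trees_count by fast
  have regular': "(\<forall>z\<in>configurations (length \<Phi>) U. set_integrable (vol N) (domain U N) (graph_integrand \<B> f C \<Phi> e N \<Gamma> z))
      \<and> (\<forall>g. iteratedly_differentiable_on (configurations (length \<Phi>) U) (base_contribution \<B> f C U g \<Phi> e N \<Gamma>))"
    if "(N, \<Gamma>) \<in> ?D" "open U" "bounded U \<or> \<not> bare_b_occurs \<Phi>" for N \<Gamma> U e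
    using regular[OF that] by blast
  have 5: "\<forall>U g. admissible_region \<Phi> U \<longrightarrow> (\<forall>e\<in>tensor_components \<B> \<Phi>. \<forall>z\<in>configurations (length \<Phi>) U.
         correlator \<B> f C U g \<Phi> e z = (\<Sum>(N, \<Gamma>)\<in>?D. contribution \<B> f C U g \<Phi> e N \<Gamma> z))"
    by (intro allI impI ballI correlators(1) region)
  have 6: "\<forall>U. admissible_region \<Phi> U \<longrightarrow> (\<forall>e\<in>tensor_components \<B> \<Phi>. \<forall>z\<in>configurations (length \<Phi>) U.
         \<exists>\<kappa>. \<forall>g. correlator \<B> f C U g \<Phi> e z
           = (if total_charge \<Phi> < 0 then 0 else \<kappa> * g ^ nat (total_charge \<Phi>)))"
    by (intro allI impI ballI correlators(2) region)
  have 7: "\<not> bare_b_occurs \<Phi> \<longrightarrow> (\<forall>(N, \<Gamma>)\<in>?D. \<forall>e\<in>tensor_components \<B> \<Phi>.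
         (\<forall>z\<in>configurations (length \<Phi>) UNIV. set_integrable (vol N) (domain UNIV N) (graph_integrand \<B> f C \<Phi> e N \<Gamma> z)) \<and>
         (\<forall>g. iteratedly_differentiable_on (configurations (length \<Phi>) UNIV) (base_contribution \<B> f C UNIV g \<Phi> e N \<Gamma>)))"
    by (intro impI ballI case_prodI2) (rule regular', auto)
  have 8: "\<forall>R>0. \<forall>(N, \<Gamma>)\<in>?D. \<forall>e\<in>tensor_components \<B> \<Phi>.
       (\<forall>z\<in>configurations (length \<Phi>) (ball 0 R). set_integrable (vol N) (domain (ball 0 R) N) (graph_integrand \<B> f C \<Phi> e N \<Gamma> z)) \<and>
       (\<forall>g. iteratedly_differentiable_on (configurations (length \<Phi>) (ball 0 R)) (base_contribution \<B> f C (ball 0 R) g \<Phi> e N \<Gamma>))"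
    by (intro allI impI ballI case_prodI2) (rule regular', auto)
  show ?thesis
    by (intro conjI 1 2 3 4 5 6 7 8 ballI allI free gbc_example[folded f_def])
qed

end
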